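(* Let $G=(\Lambda,E)$ be a finite connected undirected graph without self-loops, endowed with edge weights $W_{ij}=W_{ji}>0$ for $\{i,j\}\in E$, and set $W_{ij}=0$ if $\{i,j\}\notin E$ (in particular $W_{ii}=0$). Partition $\Lambda=I\cup J$, $I\cap J=\emptyset$, with $|J|\ge 2$, and let $\rho\in J$. Let $(X,T)$ be the vrjp in exchangeable time scale on $\Lambda$ started at $\rho$ with weights $W$. For $\beta_I\in\mathbb{R}^I$ define the $J\times J$ matrices $$W^J(\beta_I):=W_{JJ}+W_{JI}([H^W_\beta]_{II})^{-1}W_{IJ},\qquad W^{J\neq}(\beta_I):=\big(W^J_{ij}(\beta_I)1_{\{i\neq j\}}\big)_{i,j\in J},$$ and define $\widehat W\in\mathbb{R}^{(I\cup\{\rho\})\times(I\cup\{\rho\})}$ by $\widehat W_{ij}=W_{ij}$ for $i,j\in I$, $\widehat W_{i\rho}=\widehat W_{\rho i}=\sum_{k\in J}W_{ik}$ for $i\in I$, and $\widehat W_{\rho\rho}=0$. Then the restrictions $(X^J,T^J)$ and $(X^{J\neq},T^{J\neq})$ are mixtures of vrjps in exchangeable time scale on $J$ with random weights $W^J(\beta_I)$ and $W^{J\neq}(\beta_I)$ respectively, where $\beta_I$ is the restriction to $I$ of a random vector $\beta_{I\cup\{\rho\}}$ with law $\nu^{\widehat W}_{I\cup\{\rho\}}$. Precisely, for every measurable $A\subseteq J^{\mathbb{N}_0}\times(0,\infty)^{\mathbb{N}_0}$, $$P_\rho^{W,\Lambda}((X^{J\neq},T^{J\neq})\in A)=\int_{\mathbb{R}^{I\cup\{\rho\}}}P_\rho^{W^{J\neq}(\beta_I),J}((X,T)\in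 A)\,\nu^{\widehat W}_{I\cup\{\rho\}}(d\beta_{I\cup\{\rho\}})=\int_{\mathbb{R}^\Lambda}P_\rho^{W^{J\neq}(\beta_I),J}((X,T)\in A)\,\nu^W_\Lambda(d\beta_\Lambda),$$ and the same identities hold with $(X^{J\neq},T^{J\neq})$ and $W^{J\neq}(\beta_I)$ replaced by $(X^J,T^J)$ and $W^J(\beta_I)$. (On the left-hand side $(X,T)$ is the canonical process on $\Lambda^{\mathbb{N}_0}\times(0,\infty)^{\mathbb{N}_0}$, on the right-hand side the canonical process on $J^{\mathbb{N}_0}\times(0,\infty)^{\mathbb{N}_0}$.)
   Context: Encoding of jump processes: a continuous-time jump process on a vertex set $\Lambda$ is encoded by $(X_n,T_n)_{n\in\mathbb{N}_0}$, where $X_n\in\Lambda$ is the $n$-th position visited and $T_n>0$ is the waiting time before the jump from $X_n$ to $X_{n+1}$; $X_{n+1}=X_n$ ("self-loop") is allowed. Vrjp: for a finite (or locally finite) vertex set $\Lambda$ and a symmetric matrix $W=(W_{ij})_{i,j\in\Lambda}$ of nonnegative weights, the vertex-reinforced jump process $(Y_t)_{t\ge0}$ started at $\rho$ jumps, conditionally on its past and on $Y_t=i$, to $j\neq i$ at rate $W_{ij}L_j(t)$, where $L_j(t)=1+\int_0^t1_{\{Y_s=j\}}ds$. The vrjp in exchangeable time scale is $Z_t=Y_{D^{-1}(t)}$ with $D(t)=\sum_{i\in\Lambda}(L_i(t)^2-1)$. $P^{W,\Lambda}_\rho$ denotes the law of $(X_n,T_n)_{n}$ obtained from $Z$ (built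 from the off-diagonal entries of $W$), augmented by self-loops as follows: for each vertex $i$ an independent Poisson process of intensity $\frac12W_{ii}$ is attached, and whenever the particle is at $i$ and this clock rings a self-loop $i\to i$ is inserted. A "mixture of vrjps with random weights $W'$" means the law obtained by first sampling $W'$ and then running the vrjp with weights $W'$. Restriction and self-loop removal: given $(X_n,T_n)_n$, let $\sigma_0=0$, $\sigma_n=\inf\{l>\sigma_{n-1}:X_l\neq X_{\sigma_{n-1}}\}$, and $(X^{\neq}_n,T^{\neq}_n):=(X_{\sigma_n},\sum_{l=\sigma_n}^{\sigma_{n+1}-1}T_l)$. For $\emptyset\neq J\subseteq\Lambda$ let $\tau_0=0$, $\tau_n=\inf\{l>\tau_{n-1}:X_l\in J\}$ and $(X^J_n,T^J_n):=(X_{\tau_n},T_{\tau_n})$. $(X^{J\neq},T^{J\neq})$ denotes first restricting to $J$ then removing self-loops. Notation: for a vector $v$ and matrix $A$, $v_I$ and $A_{IJ}$ denote restrictions to index sets. For $\beta\in\mathbb{R}^\Lambda$, $H^W_\beta:=2\operatorname{diag}(\beta)-W$. For finite $\Lambda$ and symmetric $W\in[0,\infty)^{\Lambda\times\Lambda}$ (diagonal entries allowed), $\nu^W_\Lambda$ is the probability measure $\nu^W_\Lambda(d\beta)=(2/\pi)^{|\Lambda|/2}1_{\{H^W_\beta>0\}}\frac{e^{-\frac12\langle 1,H^W_\beta 1\rangle}}{\sqrt{\det H^W_\beta}}d\beta$ on $\mathbb{R}^\Lambda$, where $H>0$ means positive definite and $1$ is the all-ones vector. *)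

theory Defs
  imports "HOL-Probability.Probability"
begin

section \<open>Sample space of encoded jump processes\<close>

text \<open>A path is encoded as a sequence n \<mapsto> (X_n, T_n); the space over a vertex set L
  is L^N0 x (0,oo)^N0 (as a sequence of pairs) with the product sigma-algebra.\<close>

definition seq_space :: "'v set \<Rightarrow> (nat \<Rightarrow> 'v \<times> real) measure" where
  "seq_space L = PiM UNIV (\<lambda>_. count_space L \<Otimes>\<^sub>M restrict_space borel {0<..})"

section \<open>The vrjp in exchangeable time scale (with self-loops)\<close>

text \<open>Local time (in exchangeable time scale) at vertex v accumulated before step k.\<close>
definition loc_time :: "(nat \<Rightarrow> 'v) \<Rightarrow> (nat \<Rightarrow> real) \<Rightarrow> nat \<Rightarrow> 'v \<Rightarrow> real" where
  "loc_time x t k v = (\<Sum>m<k. if x m = v then t m else 0)"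

text \<open>Joint density of (waiting time s, next position j) when at vertex i with local times l.
  In exchangeable time scale the process jumps i -> j (j \<noteq> i) at rate
  W i j * sqrt(1 + l j) / (2 * sqrt(1 + l i + s)) (this is the rate W_ij L_j of the vrjp after
  the time change D), and the self-loop clock at i rings at rate W i i / 2.\<close>
definition vrjp_step_density ::
  "'v set \<Rightarrow> ('v \<Rightarrow> 'v \<Rightarrow> real) \<Rightarrow> ('v \<Rightarrow> real) \<Rightarrow> 'v \<Rightarrow> real \<Rightarrow> 'v \<Rightarrow> real" where
  "vrjp_step_density L W l i s j =
     (let S = exp (- (\<Sum>k\<in>L - {i}. W i k * sqrt (1 + l k)) * (sqrt (1 + l i + s) - sqrt (1 + l i))
                   - W i i * s / 2)
      in (if j = i then W i i / 2 else W i j * sqrt (1 + l j) / (2 * sqrt (1 + l i + s))) * S)"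

text \<open>Density of (X_0..X_n) = x and (T_0..T_{n-1}) = t.\<close>
definition vrjp_fdd_density ::
  "'v set \<Rightarrow> ('v \<Rightarrow> 'v \<Rightarrow> real) \<Rightarrow> 'v \<Rightarrow> nat \<Rightarrow> (nat \<Rightarrow> 'v) \<Rightarrow> (nat \<Rightarrow> real) \<Rightarrow> real" where
  "vrjp_fdd_density L W \<rho> n x t =
     (if x 0 = \<rho> \<and> (\<forall>k\<le>n. x k \<in> L) \<and> (\<forall>k<n. t k > 0)
      then (\<Prod>k<n. vrjp_step_density L W (loc_time x t k) (x k) (t k) (x (Suc k)))
      else 0)"

definition is_vrjp_law ::
  "'v set \<Rightarrow> ('v \<Rightarrow> 'v \<Rightarrow> real) \<Rightarrow> 'v \<Rightarrow> (nat \<Rightarrow> 'v \<times> real) measure \<Rightarrow> bool" where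
  "is_vrjp_law L W \<rho> P \<longleftrightarrow>
     sets P = sets (seq_space L) \<and> prob_space P \<and>
     (\<forall>n x B. B \<in> sets (PiM {..<n} (\<lambda>_. borel)) \<longrightarrow>
        emeasure P {\<omega> \<in> space (seq_space L). (\<forall>k\<le>n. fst (\<omega> k) = x k)
                                      \<and> (\<lambda>k\<in>{..<n}. snd (\<omega> k)) \<in> B}
        = (\<integral>\<^sup>+ t. indicator B t * ennreal (vrjp_fdd_density L W \<rho> n x t) \<partial>PiM {..<n} (\<lambda>_. lborel)))"

text \<open>P^{W,L}_rho: the law of (X_n,T_n)_n.\<close>
definition vrjp_law ::
  "'v set \<Rightarrow> ('v \<Rightarrow> 'v \<Rightarrow> real) \<Rightarrow> 'v \<Rightarrow> (nat \<Rightarrow> 'v \<times> real) measure" where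
  "vrjp_law L W \<rho> = (THE P. is_vrjp_law L W \<rho> P)"

section \<open>Restriction and self-loop removal\<close>

fun restr_idx :: "'v set \<Rightarrow> (nat \<Rightarrow> 'v \<times> real) \<Rightarrow> nat \<Rightarrow> nat" where
  "restr_idx J \<omega> 0 = 0"
| "restr_idx J \<omega> (Suc n) = (LEAST l. l > restr_idx J \<omega> n \<and> fst (\<omega> l) \<in> J)"

definition restr_J :: "'v set \<Rightarrow> (nat \<Rightarrow> 'v \<times> real) \<Rightarrow> (nat \<Rightarrow> 'v \<times> real)" where
  "restr_J J \<omega> = (\<lambda>n. \<omega> (restr_idx J \<omega> n))"

fun loop_idx :: "(nat \<Rightarrow> 'v \<times> real) \<Rightarrow> nat \<Rightarrow> nat" where
  "loop_idx \<omega> 0 = 0"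
| "loop_idx \<omega> (Suc n) = (LEAST l. l > loop_idx \<omega> n \<and> fst (\<omega> l) \<noteq> fst (\<omega> (loop_idx \<omega> n)))"

definition remove_loops :: "(nat \<Rightarrow> 'v \<times> real) \<Rightarrow> (nat \<Rightarrow> 'v \<times> real)" where
  "remove_loops \<omega> = (\<lambda>n. (fst (\<omega> (loop_idx \<omega> n)),
                          \<Sum>l\<in>{loop_idx \<omega> n..<loop_idx \<omega> (Suc n)}. snd (\<omega> l)))"

section \<open>Matrices indexed by finite sets\<close>

definition Hmat :: "('v \<Rightarrow> 'v \<Rightarrow> real) \<Rightarrow> ('v \<Rightarrow> real) \<Rightarrow> 'v \<Rightarrow> 'v \<Rightarrow> real" where
  "Hmat W \<beta> i j = (if i = j then 2 * \<beta> i else 0) - W i j"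

definition pos_def_on :: "'v set \<Rightarrow> ('v \<Rightarrow> 'v \<Rightarrow> real) \<Rightarrow> bool" where
  "pos_def_on S A \<longleftrightarrow>
     (\<forall>x. (\<forall>k. k \<notin> S \<longrightarrow> x k = 0) \<and> (\<exists>k. x k \<noteq> 0) \<longrightarrow> (\<Sum>i\<in>S. \<Sum>j\<in>S. x i * A i j * x j) > 0)"

definition det_on :: "'v set \<Rightarrow> ('v \<Rightarrow> 'v \<Rightarrow> real) \<Rightarrow> real" where
  "det_on S A = (\<Sum>p | p permutes S. of_int (sign p) * (\<Prod>i\<in>S. A i (p i)))"

text \<open>Inverse of the S x S block of A (extended by 0 outside S x S).\<close>
definition inv_on :: "'v set \<Rightarrow> ('v \<Rightarrow> 'v \<Rightarrow> real) \<Rightarrow> 'v \<Rightarrow> 'v \<Rightarrow> real" where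
  "inv_on S A = (THE G. (\<forall>k\<in>S. \<forall>l\<in>S. (\<Sum>m\<in>S. A k m * G m l) = (if k = l then 1 else 0))
                      \<and> (\<forall>k l. k \<notin> S \<or> l \<notin> S \<longrightarrow> G k l = 0))"

section \<open>The measure nu^W_L\<close>

definition nu_meas :: "('v \<Rightarrow> 'v \<Rightarrow> real) \<Rightarrow> 'v set \<Rightarrow> ('v \<Rightarrow> real) measure" where
  "nu_meas W L = density (PiM L (\<lambda>_. lborel))
     (\<lambda>\<beta>. ennreal (if pos_def_on L (Hmat W \<beta>)
                   then (2 / pi) powr (real (card L) / 2)
                        * exp (- (1/2) * (\<Sum>i\<in>L. \<Sum>j\<in>L. Hmat W \<beta> i j))
                        / sqrt (det_on L (Hmat W \<beta>))
                   else 0))"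

section \<open>Effective weights\<close>

definition WJ :: "('v \<Rightarrow> 'v \<Rightarrow> real) \<Rightarrow> 'v set \<Rightarrow> 'v set \<Rightarrow> ('v \<Rightarrow> real) \<Rightarrow> 'v \<Rightarrow> 'v \<Rightarrow> real" where
  "WJ W I J \<beta> i j =
     (if i \<in> J \<and> j \<in> J
      then W i j + (\<Sum>k\<in>I. \<Sum>l\<in>I. W i k * inv_on I (Hmat W \<beta>) k l * W l j)
      else 0)"

definition WJne :: "('v \<Rightarrow> 'v \<Rightarrow> real) \<Rightarrow> 'v set \<Rightarrow> 'v set \<Rightarrow> ('v \<Rightarrow> real) \<Rightarrow> 'v \<Rightarrow> 'v \<Rightarrow> real" where
  "WJne W I J \<beta> i j = (if i \<noteq> j then WJ W I J \<beta> i j else 0)"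

definition What :: "('v \<Rightarrow> 'v \<Rightarrow> real) \<Rightarrow> 'v set \<Rightarrow> 'v set \<Rightarrow> 'v \<Rightarrow> 'v \<Rightarrow> 'v \<Rightarrow> real" where
  "What W I J \<rho> i j =
     (if i \<in> I \<and> j \<in> I then W i j
      else if i \<in> I \<and> j = \<rho> then (\<Sum>k\<in>J. W i k)
      else if i = \<rho> \<and> j \<in> I then (\<Sum>k\<in>J. W j k)
      else 0)"

section \<open>Weighted graph hypotheses\<close>

text \<open>W is the weight function of a finite connected graph without self-loops on L:
  edges are exactly the pairs with positive weight.\<close>
definition connected_weights :: "'v set \<Rightarrow> ('v \<Rightarrow> 'v \<Rightarrow> real) \<Rightarrow> bool" where
  "connected_weights L W \<longleftrightarrow>
     finite L \<and> (\<forall>i j. W i j = W j i) \<and> (\<forall>i j. W i j \<ge> 0) \<and> (\<forall>i. W i i = 0)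
     \<and> (\<forall>i j. i \<notin> L \<or> j \<notin> L \<longrightarrow> W i j = 0)
     \<and> (\<forall>i\<in>L. \<forall>j\<in>L. (i, j) \<in> {(a, b). a \<in> L \<and> b \<in> L \<and> W a b > 0}\<^sup>*)"

end

theory Submission
  imports Defs "HOL-Real_Asymp.Real_Asymp" "Jordan_Normal_Form.Determinant"
begin

text \<open>
  The step densities of the process telescope: apart from a factor \<open>W\<^bsub>ij\<^esub>/2\<close> per jump, the density
  of a path ending in \<open>x\<close> with local times \<open>l\<close> is \<open>sqrt (1 + l\<^sub>x)\<close> times the Laplace transform
  \<open>E exp (- \<Sum>\<^sub>i \<beta>\<^sub>i l\<^sub>i)\<close>, where \<open>\<beta>\<close> has law \<open>\<nu>\<^sup>W\<close>. Under this expectation the waiting times in an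
  excursion into \<open>I\<close> can be integrated out, each visit to \<open>i\<close> giving a factor \<open>1/\<beta>\<^sub>i\<close>, and the sum over all
  excursions between two visits to \<open>J\<close> is the Neumann series for \<open>W\<^sup>J(\<beta>\<^sub>I)/2\<close>. By the block (Schur
  complement) decomposition of \<open>H\<^sub>\<beta>\<close>, the vector \<open>\<beta>\<^sub>J\<close> has law \<open>\<nu>\<close> with weights \<open>W\<^sup>J(\<beta>\<^sub>I)\<close> given \<open>\<beta>\<^sub>I\<close>,
  so what remains is the path density on \<open>J\<close> for the weights \<open>W\<^sup>J(\<beta>\<^sub>I)\<close>, averaged over \<open>\<beta>\<^sub>I\<close>. The marginal
  law of \<open>\<beta>\<^sub>I\<close> depends on the weights between \<open>I\<close> and \<open>J\<close> only through the row sums, hence \<open>J\<close> may be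
  collapsed to the single vertex \<open>\<rho>\<close>. Removing self-loops amounts to summing an exponential series: \<open>m\<close>
  self-loops at \<open>i\<close> within total time \<open>s\<close> contribute \<open>(W\<^bsub>ii\<^esub> s/2)\<^sup>m/m!\<close>.
\<close>

section \<open>Matrices indexed by finite sets\<close>

text \<open>Two obstacles shape the argument. It is not known beforehand that the process returns to
  \<open>J\<close> infinitely often, or that it makes only finitely many self-loops in a row. Hence
  only excursions of length at most \<open>M\<close> are summed, \<open>M\<close> tends to infinity
  inside an inequality, and equality comes from comparing two probability measures. Moreover
  \<open>vrjp_law\<close> and \<open>inv_on\<close> are definite descriptions, which say something
  only where existence and uniqueness hold. For a law this demands a positive entry in every row of
  the weights; connectedness and \<open>card J \<ge> 2\<close> pass this on to the effective
  weights, even off the diagonal. For the inverse, the work is confined to those \<beta> whose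
  \<open>I\<close> block is positive definite, a set of full measure under both mixing laws; on it
  \<open>WJ\<close> agrees with a limit that is measurable everywhere. The Laplace transform is
  found by eliminating one vertex at a time: each elimination leaves an integral of
  \<open>exp (- (v * p - q / v)^2)\<close> over \<open>v > 0\<close>, whose value does not depend on
  \<open>q\<close>. All integrands are nonnegative, so the integrals over times and over \<beta> can
  be exchanged.\<close>

lemma det_on_reindex:
  assumes f: "bij_betw f {0..<n} S"
  shows "det_on S A = Determinant.det (mat n n (\<lambda>(a, b). A (f a) (f b)))"
proof -
  let ?F = "map_permutation {0..<n} f"
  have inj: "inj_on f {0..<n}" using f by (rule bij_betw_imp_inj_on)
  define g where "g = inv_into {0..<n} f"
  have g: "bij_betw g S {0..<n}" unfolding g_def by (rule bij_betw_inv_into[OF f])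
  have gf: "g (f x) = x" if "x \<in> {0..<n}" for x
    using that inj by (simp add: g_def)
  have fg: "f (g x) = x" if "x \<in> S" for x
    using that f by (simp add: g_def bij_betw_inv_into_right)
  have "Determinant.det (mat n n (\<lambda>(a, b). A (f a) (f b)))
      = (\<Sum>p | p permutes {0..<n}. of_int (sign p) * (\<Prod>i = 0..<n. A (f i) (f (p i))))"
    by (subst det_def'[of _ n])
       (auto intro!: sum.cong prod.cong simp: permutes_in_image)
  also have "\<dots> = (\<Sum>p | p permutes S. of_int (sign p) * (\<Prod>i\<in>S. A i (p i)))"
  proof (rule sum.reindex_bij_witness[where j="?F" and i="map_permutation S g"])
    fix p assume "p \<in> {p. p permutes {0..<n}}"
    then have p: "p permutes {0..<n}" by simp
    show "map_permutation S g (?F p) = p"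
      by (rule map_permutation_compose_inv[OF f p gf])
    show "?F p \<in> {p. p permutes S}"
      using map_permutation_permutes[OF f p] by simp
    have "(\<Prod>i\<in>S. A i (?F p i)) = (\<Prod>i\<in>{0..<n}. A (f i) (?F p (f i)))"
      by (rule prod.reindex_bij_betw[OF f, symmetric])
    also have "\<dots> = (\<Prod>i\<in>{0..<n}. A (f i) (f (p i)))"
      by (rule prod.cong) (auto simp: map_permutation_apply[OF inj])
    finally show "of_int (sign (?F p)) * (\<Prod>i\<in>S. A i (?F p i)) =
        of_int (sign p) * (\<Prod>i = 0..<n. A (f i) (f (p i)))"
      using sign_map_permutation[OF inj p] by simp
  next
    fix p assume "p \<in> {p. p permutes S}"
    then have p: "p permutes S" by simp
    show "?F (map_permutation S g p) = p"
      by (rule map_permutation_compose_inv[OF g p fg])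
    show "map_permutation S g p \<in> {p. p permutes {0..<n}}"
      using map_permutation_permutes[OF g p] by simp
  qed
  finally show ?thesis by (simp add: det_on_def)
qed

text \<open>Block elimination from the right: multiplication by a block unitriangular matrix of
  determinant 1 clears the upper right block and puts the Schur complement into the lower right one.
  The computation is done on matrices with numbered rows, where multiplicativity of the determinant
  is available through \<open>det_on_reindex\<close>.\<close>

lemma det_on_block:
  assumes "finite I" "finite J" "I \<inter> J = {}"
    and G: "\<And>k l. k \<in> I \<Longrightarrow> l \<in> I \<Longrightarrow> (\<Sum>m\<in>I. A k m * G m l) = (if k = l then 1 else (0::real))"
  shows "det_on (I \<union> J) A
       = det_on I A * det_on J (\<lambda>i j. A i j - (\<Sum>k\<in>I. \<Sum>l\<in>I. A i k * G k l * A l j))"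
proof -
  define n where "n = card I"
  define m where "m = card J"
  obtain f where f: "bij_betw f {0..<n} I"
    using ex_bij_betw_nat_finite[OF \<open>finite I\<close>] n_def by blast
  obtain g where g: "bij_betw g {0..<m} J"
    using ex_bij_betw_nat_finite[OF \<open>finite J\<close>] m_def by blast
  \<comment> \<open>\<open>I\<close> is numbered before \<open>J\<close>, so the reindexed matrix
    has the four-block shape.\<close>
  define h where "h a = (if a < n then f a else g (a - n))" for a
  have fI: "f a \<in> I" if "a < n" for a using that bij_betwE[OF f] by auto
  have h: "bij_betw h {0..<n + m} (I \<union> J)"
  proof -
    have 1: "bij_betw h {0..<n} I"
      using f by (subst bij_betw_cong[of _ _ f]) (auto simp: h_def)
    have "bij_betw (\<lambda>a. a - n) {n..<n+m} {0..<m}"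
      by (rule bij_betw_byWitness[of _ "\<lambda>a. a + n"]) auto
    from bij_betw_trans[OF this g] have 2: "bij_betw h {n..<n+m} J"
      by (subst bij_betw_cong[of _ _ "g \<circ> (\<lambda>a. a - n)"]) (auto simp: h_def)
    have "bij_betw h ({0..<n} \<union> {n..<n+m}) (I \<union> J)"
      by (rule bij_betw_combine[OF 1 2 \<open>I \<inter> J = {}\<close>])
    then show ?thesis by (simp add: ivl_disj_un_two(3))
  qed
  let ?S = "\<lambda>i j. A i j - (\<Sum>k\<in>I. \<Sum>l\<in>I. A i k * G k l * A l j)"
  let ?A1 = "mat n n (\<lambda>(a, b). A (f a) (f b))"
  let ?A2 = "mat n m (\<lambda>(a, b). A (f a) (g b))"
  let ?A3 = "mat m n (\<lambda>(a, b). A (g a) (f b))"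
  let ?A4 = "mat m m (\<lambda>(a, b). A (g a) (g b))"
  \<comment> \<open>This block is minus \<open>G\<close> times the upper right block, so that
    \<open>?A1 * ?B + ?A2 = 0\<close> because \<open>G\<close> is a right inverse on
    \<open>I\<close>.\<close>
  let ?B = "mat n m (\<lambda>(a, b). - (\<Sum>l\<in>I. G (f a) l * A l (g b)))"
  let ?SS = "mat m m (\<lambda>(a, b). ?S (g a) (g b))"
  have blk: "mat (n + m) (n + m) (\<lambda>(a, b). A (h a) (h b)) = four_block_mat ?A1 ?A2 ?A3 ?A4"
    by (rule eq_matI) (auto simp: h_def)
  have AG: "(\<Sum>c<n. A k (f c) * x (f c)) = (\<Sum>m\<in>I. A k m * x m)" for k and x :: "'a \<Rightarrow> real"
    using sum.reindex_bij_betw[OF f, of "\<lambda>m. A k m * x m"] by (simp add: atLeast0LessThan)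
  have z: "?A1 * ?B + ?A2 = 0\<^sub>m n m"
  proof (rule eq_matI, goal_cases)
    case (1 a b)
    then have a: "a < n" "b < m" by auto
    have "(\<Sum>c<n. A (f a) (f c) * (\<Sum>l\<in>I. G (f c) l * A l (g b)))
        = (\<Sum>k\<in>I. A (f a) k * (\<Sum>l\<in>I. G k l * A l (g b)))"
      using AG[of "f a" "\<lambda>k. (\<Sum>l\<in>I. G k l * A l (g b))"] by simp
    also have "\<dots> = (\<Sum>l\<in>I. (\<Sum>k\<in>I. A (f a) k * G k l) * A l (g b))"
      by (simp add: sum_distrib_left sum_distrib_right mult.assoc) (rule sum.swap)
    also have "\<dots> = (\<Sum>l\<in>I. if l = f a then A l (g b) else 0)"
      using a fI by (intro sum.cong) (auto simp: G)
    also have "\<dots> = A (f a) (g b)"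
      using a fI \<open>finite I\<close> by simp
    finally show ?case using a
      by (simp add: scalar_prod_def sum_negf atLeast0LessThan)
  qed auto
  have s: "?A3 * ?B + ?A4 = ?SS"
  proof (rule eq_matI, goal_cases)
    case (1 a b)
    then have a: "a < m" "b < m" by auto
    have "(\<Sum>c<n. A (g a) (f c) * (\<Sum>l\<in>I. G (f c) l * A l (g b)))
        = (\<Sum>k\<in>I. A (g a) k * (\<Sum>l\<in>I. G k l * A l (g b)))"
      using AG[of "g a" "\<lambda>k. (\<Sum>l\<in>I. G k l * A l (g b))"] by simp
    then show ?case using a
      by (simp add: scalar_prod_def sum_negf atLeast0LessThan sum_distrib_left mult.assoc)
  qed auto
  have t: "?A1 * 1\<^sub>m n + ?A2 * 0\<^sub>m m n = ?A1" "?A3 * 1\<^sub>m n + ?A4 * 0\<^sub>m m n = ?A3"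
    by (auto intro!: eq_matI)
  have "four_block_mat ?A1 ?A2 ?A3 ?A4 * four_block_mat (1\<^sub>m n) ?B (0\<^sub>m m n) (1\<^sub>m m)
      = four_block_mat ?A1 (0\<^sub>m n m) ?A3 ?SS"
    by (subst mult_four_block_mat[of _ n n _ m _ m]) (auto simp: z s t)
  moreover have "Determinant.det (four_block_mat ?A1 ?A2 ?A3 ?A4 * four_block_mat (1\<^sub>m n) ?B (0\<^sub>m m n) (1\<^sub>m m))
     = Determinant.det (four_block_mat ?A1 ?A2 ?A3 ?A4)
        * Determinant.det (four_block_mat (1\<^sub>m n) ?B (0\<^sub>m m n) (1\<^sub>m m))"
    by (rule det_mult[of _ "n + m"]) auto
  moreover have "Determinant.det (four_block_mat (1\<^sub>m n) ?B (0\<^sub>m m n) (1\<^sub>m m)) = 1"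
    by (subst det_four_block_mat_lower_left_zero[of _ n _ m]) auto
  moreover have "Determinant.det (four_block_mat ?A1 (0\<^sub>m n m) ?A3 ?SS)
     = Determinant.det ?A1 * Determinant.det ?SS"
    by (rule det_four_block_mat_upper_right_zero[of _ n _ m]) auto
  ultimately have "Determinant.det (four_block_mat ?A1 ?A2 ?A3 ?A4)
     = Determinant.det ?A1 * Determinant.det ?SS" by simp
  then show ?thesis
    using det_on_reindex[OF h, of A] det_on_reindex[OF f, of A] det_on_reindex[OF g, of ?S] blk
    by simp
qed


section \<open>Schur complements and positive definiteness\<close>

definition schur :: "'v set \<Rightarrow> ('v \<Rightarrow> 'v \<Rightarrow> real) \<Rightarrow> 'v \<Rightarrow> 'v \<Rightarrow> real" where
  "schur I A i j = A i j - (\<Sum>k\<in>I. \<Sum>l\<in>I. A i k * inv_on I A k l * A l j)"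

lemma pos_def_onI:
  assumes "\<And>x i. (\<And>k. k \<notin> S \<Longrightarrow> x k = 0) \<Longrightarrow> i \<in> S \<Longrightarrow> x i \<noteq> 0 \<Longrightarrow> (\<Sum>i\<in>S. \<Sum>j\<in>S. x i * A i j * x j) > 0"
  shows "pos_def_on S A"
  unfolding pos_def_on_def
proof (intro allI impI)
  fix x :: "'a \<Rightarrow> real"
  assume x: "(\<forall>k. k \<notin> S \<longrightarrow> x k = 0) \<and> (\<exists>k. x k \<noteq> 0)"
  then obtain k where "k \<in> S" "x k \<noteq> 0" by auto
  with x show "(\<Sum>i\<in>S. \<Sum>j\<in>S. x i * A i j * x j) > 0" by (intro assms[of x k]) auto
qed

lemma pos_def_onD:
  assumes "pos_def_on S A" "i \<in> S" "x i \<noteq> 0"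
  shows "(\<Sum>i\<in>S. \<Sum>j\<in>S. x i * A i j * x j) > 0"
proof -
  define y where "y k = (if k \<in> S then x k else 0)" for k
  have "(\<Sum>i\<in>S. \<Sum>j\<in>S. y i * A i j * y j) > 0"
    by (rule assms(1)[unfolded pos_def_on_def, rule_format]) (use assms(2,3) in \<open>auto simp: y_def\<close>)
  then show ?thesis by (simp add: y_def cong: sum.cong)
qed

lemma pos_def_on_cong:
  assumes "\<And>i j. i \<in> S \<Longrightarrow> j \<in> S \<Longrightarrow> A i j = B i j"
  shows "pos_def_on S A \<longleftrightarrow> pos_def_on S B"
  unfolding pos_def_on_def using assms by (simp cong: sum.cong)

lemma det_on_cong:
  assumes "\<And>i j. i \<in> S \<Longrightarrow> j \<in> S \<Longrightarrow> A i j = B i j"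
  shows "det_on S A = det_on S B"
  unfolding det_on_def
  using assms by (intro sum.cong refl arg_cong2[of _ _ _ _ "(*)"] prod.cong) (auto simp: permutes_in_image)

lemma inv_on_cong:
  assumes "\<And>i j. i \<in> S \<Longrightarrow> j \<in> S \<Longrightarrow> A i j = B i j"
  shows "inv_on S A = inv_on S B"
  unfolding inv_on_def using assms by (simp cong: sum.cong)

lemma pos_def_on_empty [simp]: "pos_def_on {} A"
  by (auto simp: pos_def_on_def)

lemma det_on_empty [simp]: "det_on {} A = 1"
  by (simp add: det_on_def)

text \<open>Completing the square in the coordinates of \<open>I\<close>. With the \<open>J\<close>
  coordinates held fixed, \<open>- c\<close> is the stationary point of the form, and the Schur
  complement is what remains there.\<close>

lemma quadratic_form_block:
  fixes A G :: "'v \<Rightarrow> 'v \<Rightarrow> real"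
  assumes "finite I" "finite J" "I \<inter> J = {}"
    and sym: "\<And>i j. i \<in> I \<union> J \<Longrightarrow> j \<in> I \<union> J \<Longrightarrow> A i j = A j i"
    and G: "\<And>k l. k \<in> I \<Longrightarrow> l \<in> I \<Longrightarrow> (\<Sum>m\<in>I. A k m * G m l) = (if k = l then 1 else 0)"
    and c: "\<And>k. k \<in> I \<Longrightarrow> c k = (\<Sum>l\<in>I. G k l * (\<Sum>j\<in>J. A l j * x j))"
  shows "(\<Sum>i\<in>I\<union>J. \<Sum>j\<in>I\<union>J. x i * A i j * x j)
    = (\<Sum>i\<in>I. \<Sum>j\<in>I. (x i + c i) * A i j * (x j + c j))
      + (\<Sum>i\<in>J. \<Sum>j\<in>J. x i * (A i j - (\<Sum>k\<in>I. \<Sum>l\<in>I. A i k * G k l * A l j)) * x j)"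
proof -
  define b where "b k = (\<Sum>j\<in>J. A k j * x j)" for k
  have Ac: "(\<Sum>j\<in>I. A k j * c j) = b k" if "k \<in> I" for k
  proof -
    have "(\<Sum>j\<in>I. A k j * c j) = (\<Sum>j\<in>I. \<Sum>l\<in>I. A k j * G j l * b l)"
      by (intro sum.cong refl) (simp add: c b_def sum_distrib_left mult.assoc)
    also have "\<dots> = (\<Sum>l\<in>I. (\<Sum>j\<in>I. A k j * G j l) * b l)"
      by (subst sum.swap) (simp add: sum_distrib_right)
    also have "\<dots> = (\<Sum>l\<in>I. if l = k then b l else 0)"
      using that by (intro sum.cong refl) (auto simp: G)
    finally show ?thesis using that \<open>finite I\<close> by simp
  qed
  \<comment> \<open>By symmetry the mixed sums \<open>e1\<close>, \<open>e2\<close>,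
    \<open>e4\<close>, \<open>e5\<close> all equal the pairing of \<open>x\<close> with
    \<open>b\<close>, and \<open>e3\<close>, \<open>e6\<close> equal that of \<open>c\<close> with
    \<open>b\<close>. The completed square is then linear arithmetic in these quantities.\<close>
  have e1: "(\<Sum>i\<in>I. \<Sum>j\<in>I. x i * A i j * c j) = (\<Sum>i\<in>I. x i * b i)"
    by (intro sum.cong refl) (simp add: Ac[symmetric] sum_distrib_left mult.assoc)
  have e2: "(\<Sum>i\<in>I. \<Sum>j\<in>I. c i * A i j * x j) = (\<Sum>i\<in>I. x i * b i)"
  proof (subst sum.swap, subst e1[symmetric], intro sum.cong refl)
    fix i j assume "i \<in> I" "j \<in> I"
    then show "c j * A j i * x i = x i * A i j * c j" using sym[of i j] by simp
  qed
  have e3: "(\<Sum>i\<in>I. \<Sum>j\<in>I. c i * A i j * c j) = (\<Sum>i\<in>I. c i * b i)"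
    by (intro sum.cong refl) (simp add: Ac[symmetric] sum_distrib_left mult.assoc)
  have e4: "(\<Sum>i\<in>I. \<Sum>j\<in>J. x i * A i j * x j) = (\<Sum>i\<in>I. x i * b i)"
    by (intro sum.cong refl) (simp add: b_def sum_distrib_left mult.assoc)
  have e5: "(\<Sum>i\<in>J. \<Sum>j\<in>I. x i * A i j * x j) = (\<Sum>i\<in>I. x i * b i)"
  proof (subst sum.swap, subst e4[symmetric], intro sum.cong refl)
    fix i j assume "i \<in> I" "j \<in> J"
    then show "x j * A j i * x i = x i * A i j * x j" using sym[of i j] by simp
  qed
  have "(\<Sum>i\<in>J. \<Sum>j\<in>J. x i * (\<Sum>k\<in>I. \<Sum>l\<in>I. A i k * G k l * A l j) * x j)
      = (\<Sum>i\<in>J. \<Sum>k\<in>I. x i * A i k * c k)"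
  proof (rule sum.cong[OF refl])
    fix i assume "i \<in> J"
    have "(\<Sum>j\<in>J. x i * (\<Sum>k\<in>I. \<Sum>l\<in>I. A i k * G k l * A l j) * x j)
       = (\<Sum>j\<in>J. \<Sum>k\<in>I. x i * A i k * (\<Sum>l\<in>I. G k l * (A l j * x j)))"
      by (simp add: sum_distrib_left sum_distrib_right mult.assoc)
    also have "\<dots> = (\<Sum>k\<in>I. \<Sum>j\<in>J. x i * A i k * (\<Sum>l\<in>I. G k l * (A l j * x j)))"
      by (rule sum.swap)
    also have "\<dots> = (\<Sum>k\<in>I. x i * A i k * c k)"
    proof (rule sum.cong[OF refl])
      fix k assume "k \<in> I"
      have "(\<Sum>j\<in>J. \<Sum>l\<in>I. G k l * (A l j * x j)) = c k"
        by (subst sum.swap) (simp add: c \<open>k \<in> I\<close> sum_distrib_left)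
      then show "(\<Sum>j\<in>J. x i * A i k * (\<Sum>l\<in>I. G k l * (A l j * x j))) = x i * A i k * c k"
        by (simp add: sum_distrib_left[symmetric])
    qed
    finally show "(\<Sum>j\<in>J. x i * (\<Sum>k\<in>I. \<Sum>l\<in>I. A i k * G k l * A l j) * x j)
       = (\<Sum>k\<in>I. x i * A i k * c k)" .
  qed
  also have "\<dots> = (\<Sum>i\<in>I. c i * b i)"
  proof (subst sum.swap, rule sum.cong[OF refl])
    fix i assume "i \<in> I"
    have "(\<Sum>j\<in>J. x j * A j i * c i) = (\<Sum>j\<in>J. c i * (A i j * x j))"
      using \<open>i \<in> I\<close> sym by (intro sum.cong refl) (simp add: sym[of i])
    then show "(\<Sum>j\<in>J. x j * A j i * c i) = c i * b i" by (simp add: b_def sum_distrib_left)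
  qed
  finally have e6: "(\<Sum>i\<in>J. \<Sum>j\<in>J. x i * (\<Sum>k\<in>I. \<Sum>l\<in>I. A i k * G k l * A l j) * x j)
      = (\<Sum>i\<in>I. c i * b i)" .
  have "(\<Sum>i\<in>I\<union>J. \<Sum>j\<in>I\<union>J. x i * A i j * x j)
     = (\<Sum>i\<in>I. \<Sum>j\<in>I. x i * A i j * x j) + (\<Sum>i\<in>I. \<Sum>j\<in>J. x i * A i j * x j)
     + ((\<Sum>i\<in>J. \<Sum>j\<in>I. x i * A i j * x j) + (\<Sum>i\<in>J. \<Sum>j\<in>J. x i * A i j * x j))"
    using assms(1-3) by (simp add: sum.union_disjoint sum.distrib)
  moreover have "(\<Sum>i\<in>I. \<Sum>j\<in>I. (x i + c i) * A i j * (x j + c j))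
     = (\<Sum>i\<in>I. \<Sum>j\<in>I. x i * A i j * x j) + (\<Sum>i\<in>I. \<Sum>j\<in>I. x i * A i j * c j)
     + ((\<Sum>i\<in>I. \<Sum>j\<in>I. c i * A i j * x j) + (\<Sum>i\<in>I. \<Sum>j\<in>I. c i * A i j * c j))"
    by (simp add: sum.distrib distrib_left distrib_right)
  moreover have "(\<Sum>i\<in>J. \<Sum>j\<in>J. x i * (A i j - (\<Sum>k\<in>I. \<Sum>l\<in>I. A i k * G k l * A l j)) * x j)
     = (\<Sum>i\<in>J. \<Sum>j\<in>J. x i * A i j * x j)
       - (\<Sum>i\<in>J. \<Sum>j\<in>J. x i * (\<Sum>k\<in>I. \<Sum>l\<in>I. A i k * G k l * A l j) * x j)"
    by (simp add: right_diff_distrib left_diff_distrib sum_subtractf)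
  ultimately show ?thesis using e1 e2 e3 e4 e5 e6 by linarith
qed

text \<open>Read off from the completed square: vectors supported on \<open>I\<close> isolate the
  first summand, vectors with stationary \<open>I\<close> part isolate the second, and conversely
  one of the two is always positive. It is stated for any right inverse \<open>G\<close> because
  \<open>pos_def_on_solvable\<close> applies it to a single pivot, before \<open>inv_on\<close> is
  known to exist.\<close>

lemma pos_def_on_block:
  fixes A G :: "'v \<Rightarrow> 'v \<Rightarrow> real"
  assumes "finite I" "finite J" "I \<inter> J = {}"
    and sym: "\<And>i j. i \<in> I \<union> J \<Longrightarrow> j \<in> I \<union> J \<Longrightarrow> A i j = A j i"
    and G: "\<And>k l. k \<in> I \<Longrightarrow> l \<in> I \<Longrightarrow> (\<Sum>m\<in>I. A k m * G m l) = (if k = l then 1 else 0)"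
  shows "pos_def_on (I \<union> J) A \<longleftrightarrow> pos_def_on I A
    \<and> pos_def_on J (\<lambda>i j. A i j - (\<Sum>k\<in>I. \<Sum>l\<in>I. A i k * G k l * A l j))" (is "_ \<longleftrightarrow> _ \<and> pos_def_on J ?S")
proof -
  define c where "c x k = (\<Sum>l\<in>I. G k l * (\<Sum>j\<in>J. A l j * x j))" for x k
  have Q: "(\<Sum>i\<in>I\<union>J. \<Sum>j\<in>I\<union>J. x i * A i j * x j)
    = (\<Sum>i\<in>I. \<Sum>j\<in>I. (x i + c x i) * A i j * (x j + c x j))
      + (\<Sum>i\<in>J. \<Sum>j\<in>J. x i * ?S i j * x j)" for x
    by (rule quadratic_form_block[OF assms]) (simp_all add: c_def)
  show ?thesis
  proof (intro iffI conjI)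
    assume pd: "pos_def_on (I \<union> J) A"
    show "pos_def_on I A"
    proof (rule pos_def_onI)
      fix x i assume x: "\<And>k. k \<notin> I \<Longrightarrow> x k = (0::real)" "i \<in> I" "x i \<noteq> 0"
      have "0 < (\<Sum>i\<in>I\<union>J. \<Sum>j\<in>I\<union>J. x i * A i j * x j)"
        using x by (intro pos_def_onD[OF pd]) auto
      also have "\<dots> = (\<Sum>i\<in>I. \<Sum>j\<in>I. x i * A i j * x j)"
        using assms(1,2) x(1) by (intro sum.mono_neutral_cong_right sum.cong) (auto intro!: sum.mono_neutral_cong_right)
      finally show "0 < (\<Sum>i\<in>I. \<Sum>j\<in>I. x i * A i j * x j)" .
    qed
    show "pos_def_on J ?S"
    proof (rule pos_def_onI)
      fix x i assume x: "\<And>k. k \<notin> J \<Longrightarrow> x k = (0::real)" "i \<in> J" "x i \<noteq> 0"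
      \<comment> \<open>On \<open>I\<close> the vector takes its stationary value; this removes the
        square and leaves the form of the Schur complement at \<open>x\<close>.\<close>
      define y where "y k = (if k \<in> I then - c x k else x k)" for k
      have yx: "y k = x k" if "k \<in> J" for k using that assms(3) by (auto simp: y_def)
      then have cy: "c y k = c x k" for k by (simp add: c_def cong: sum.cong)
      have "0 < (\<Sum>i\<in>I\<union>J. \<Sum>j\<in>I\<union>J. y i * A i j * y j)"
        using x yx by (intro pos_def_onD[OF pd, of i]) auto
      also have "\<dots> = (\<Sum>i\<in>J. \<Sum>j\<in>J. y i * ?S i j * y j)"
        unfolding Q cy by (simp add: y_def cong: sum.cong)
      also have "\<dots> = (\<Sum>i\<in>J. \<Sum>j\<in>J. x i * ?S i j * x j)"
        by (simp add: yx cong: sum.cong)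
      finally show "0 < (\<Sum>i\<in>J. \<Sum>j\<in>J. x i * ?S i j * x j)" .
    qed
  next
    assume "pos_def_on I A \<and> pos_def_on J ?S"
    then have pI: "pos_def_on I A" and pJ: "pos_def_on J ?S" by auto
    have nn: "0 \<le> (\<Sum>i\<in>S. \<Sum>j\<in>S. x i * B i j * x j)" if "pos_def_on S B" for S B and x :: "'v \<Rightarrow> real"
      using pos_def_onD[OF that, of _ x] by (cases "\<exists>i\<in>S. x i \<noteq> 0") (auto intro: less_imp_le)
    show "pos_def_on (I \<union> J) A"
    proof (rule pos_def_onI)
      fix x i assume x: "\<And>k. k \<notin> I \<union> J \<Longrightarrow> x k = (0::real)" "i \<in> I \<union> J" "x i \<noteq> 0"
      show "0 < (\<Sum>i\<in>I\<union>J. \<Sum>j\<in>I\<union>J. x i * A i j * x j)"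
      proof (cases "\<exists>j\<in>J. x j \<noteq> 0")
        case True
        then have "0 < (\<Sum>i\<in>J. \<Sum>j\<in>J. x i * ?S i j * x j)" using pos_def_onD[OF pJ] by blast
        then show ?thesis unfolding Q using nn[OF pI, of "\<lambda>i. x i + c x i"] by linarith
      next
        case False
        then have "c x k = 0" for k by (simp add: c_def cong: sum.cong)
        moreover have "i \<in> I" using x False by auto
        ultimately have "0 < (\<Sum>i\<in>I. \<Sum>j\<in>I. (x i + c x i) * A i j * (x j + c x j))"
          using pos_def_onD[OF pI, of i x] x by simp
        then show ?thesis unfolding Q using nn[OF pJ, of x] by linarith
      qed
    qed
  qed
qed

lemma pos_def_on_singleton: "pos_def_on {i} A \<longleftrightarrow> A i i > 0"
proof
  assume "pos_def_on {i} A"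
  from pos_def_onD[OF this, of i "\<lambda>_. 1"] show "A i i > 0" by simp
next
  assume "A i i > 0"
  then show "pos_def_on {i} A"
    by (intro pos_def_onI) (auto simp: mult.commute[of _ "A i i"] mult.assoc simp flip: power2_eq_square)
qed

text \<open>Gaussian elimination with one pivot: \<open>A i i\<close> is positive, the Schur
  complement of \<open>{i}\<close> is again symmetric and positive definite, and the induction
  hypothesis solves it for the reduced right-hand side.\<close>

lemma pos_def_on_solvable:
  assumes "finite S" "\<And>i j. i \<in> S \<Longrightarrow> j \<in> S \<Longrightarrow> A i j = A j i" "pos_def_on S A"
  shows "\<exists>v. \<forall>i\<in>S. (\<Sum>j\<in>S. A i j * v j) = r i"
  using assms
proof (induction S arbitrary: A r rule: finite_induct)
  case (insert i S)
  have ii: "A i i > 0"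
  proof -
    have "0 < (\<Sum>k\<in>insert i S. \<Sum>l\<in>insert i S. (if k = i then 1 else 0) * A k l * (if l = i then 1 else 0))"
      by (rule pos_def_onD[OF insert.prems(2)]) auto
    also have "\<dots> = A i i"
      using insert.hyps by (simp add: if_distrib[of "\<lambda>x. _ * x"] if_distrib[of "\<lambda>x. x * _"] sum.delta cong: if_cong)
    finally show ?thesis .
  qed
  let ?B = "\<lambda>j k. A j k - A j i * A i k / A i i"
  have "pos_def_on ({i} \<union> S) A \<longleftrightarrow> pos_def_on {i} A \<and>
     pos_def_on S (\<lambda>j k. A j k - (\<Sum>m\<in>{i}. \<Sum>l\<in>{i}. A j m * (1 / A i i) * A l k))"
  proof (rule pos_def_on_block)
    show "A j k = A k j" if "j \<in> {i} \<union> S" "k \<in> {i} \<union> S" for j k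
      using insert.prems(1)[of j k] that by simp
  qed (use insert.hyps ii in auto)
  then have pd: "pos_def_on S ?B" using insert.prems(2) by simp
  have sB: "?B j k = ?B k j" if "j \<in> S" "k \<in> S" for j k
    using insert.prems(1)[of j k] insert.prems(1)[of i k] insert.prems(1)[of i j] that by simp
  obtain v where v: "\<And>j. j \<in> S \<Longrightarrow> (\<Sum>k\<in>S. ?B j k * v k) = r j - A j i * r i / A i i"
    using insert.IH[OF sB pd, of "\<lambda>j. r j - A j i * r i / A i i"] by auto
  \<comment> \<open>Back-substitution for the eliminated coordinate.\<close>
  define w where "w k = (if k = i then (r i - (\<Sum>l\<in>S. A i l * v l)) / A i i else v k)" for k
  have wS: "(\<Sum>k\<in>S. A j k * w k) = (\<Sum>k\<in>S. A j k * v k)" for j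
    using insert.hyps by (intro sum.cong refl) (auto simp: w_def)
  have "(\<Sum>k\<in>insert i S. A j k * w k) = r j" if "j \<in> insert i S" for j
  proof (cases "j = i")
    case True
    then show ?thesis using insert.hyps ii by (simp add: wS) (simp add: w_def)
  next
    case False
    then have j: "j \<in> S" using that by simp
    have "(\<Sum>k\<in>S. ?B j k * v k) = (\<Sum>k\<in>S. A j k * v k) - A j i / A i i * (\<Sum>k\<in>S. A i k * v k)"
      by (simp add: sum_subtractf left_diff_distrib sum_distrib_left mult.assoc)
    with v[OF j] have "(\<Sum>k\<in>S. A j k * v k) = r j - A j i * r i / A i i + A j i / A i i * (\<Sum>k\<in>S. A i k * v k)"
      by simp
    then show ?thesis using insert.hyps ii by (simp add: wS) (simp add: w_def field_simps)
  qed
  then show ?case by blast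
qed simp

lemma pos_def_on_injective:
  assumes "pos_def_on S A" "\<And>i. i \<in> S \<Longrightarrow> (\<Sum>j\<in>S. A i j * v j) = 0" "k \<in> S"
  shows "v k = 0"
proof (rule ccontr)
  assume "v k \<noteq> 0"
  from pos_def_onD[of _ _ _ v, OF assms(1,3) this]
  have "0 < (\<Sum>i\<in>S. v i * (\<Sum>j\<in>S. A i j * v j))"
    by (simp add: sum_distrib_left mult.assoc)
  also have "\<dots> = 0" using assms(2) by simp
  finally show False by simp
qed

text \<open>Solving for each unit vector gives the columns of an inverse, injectivity makes them
  unique on \<open>S\<close>, and the prescribed value 0 fixes the rest; so the definite description
  in \<open>inv_on\<close> is met.\<close>

lemma inv_on:
  assumes "finite S" "\<And>i j. i \<in> S \<Longrightarrow> j \<in> S \<Longrightarrow> A i j = A j i" "pos_def_on S A"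
  shows inv_on_right: "k \<in> S \<Longrightarrow> l \<in> S \<Longrightarrow> (\<Sum>m\<in>S. A k m * inv_on S A m l) = (if k = l then 1 else 0)"
    and inv_on_outside: "k \<notin> S \<or> l \<notin> S \<Longrightarrow> inv_on S A k l = 0"
    and inv_on_sym: "inv_on S A k l = inv_on S A l k"
    and inv_on_unique: "(\<And>k l. k \<in> S \<Longrightarrow> l \<in> S \<Longrightarrow> (\<Sum>m\<in>S. A k m * G m l) = (if k = l then 1 else 0))
       \<Longrightarrow> k \<in> S \<Longrightarrow> l \<in> S \<Longrightarrow> G k l = inv_on S A k l"
proof -
  let ?P = "\<lambda>G. (\<forall>k\<in>S. \<forall>l\<in>S. (\<Sum>m\<in>S. A k m * G m l) = (if k = l then 1 else 0))
                      \<and> (\<forall>k l. k \<notin> S \<or> l \<notin> S \<longrightarrow> G k l = 0)"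
  have "\<exists>v. \<forall>i\<in>S. (\<Sum>j\<in>S. A i j * v j) = (if i = l then 1 else 0)" for l
    by (rule pos_def_on_solvable[OF assms])
  then obtain V where V: "\<And>l i. i \<in> S \<Longrightarrow> (\<Sum>j\<in>S. A i j * V l j) = (if i = l then 1 else 0)" by metis
  define G0 where "G0 k l = (if k \<in> S \<and> l \<in> S then V l k else 0)" for k l
  have P0: "?P G0" using V by (auto simp: G0_def cong: sum.cong)
  have uniq: "G k l = G' k l" if "\<And>k l. k \<in> S \<Longrightarrow> l \<in> S \<Longrightarrow> (\<Sum>m\<in>S. A k m * G m l) = (if k = l then 1 else 0)"
      "\<And>k l. k \<in> S \<Longrightarrow> l \<in> S \<Longrightarrow> (\<Sum>m\<in>S. A k m * G' m l) = (if k = l then 1 else 0)"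
      "k \<in> S" "l \<in> S" for G G' k l
  proof -
    have "(\<lambda>k. G k l - G' k l) k = 0"
      by (rule pos_def_on_injective[OF assms(3) _ that(3)])
         (simp add: right_diff_distrib sum_subtractf that)
    then show ?thesis by simp
  qed
  have "?P (inv_on S A)"
    unfolding inv_on_def
  proof (rule theI[of ?P, OF P0])
    fix G assume G: "?P G"
    show "G = G0"
    proof (intro ext)
      fix k l show "G k l = G0 k l"
      proof (cases "k \<in> S \<and> l \<in> S")
        case True then show ?thesis using uniq[of G G0 k l] G P0 by blast
      next
        case False
        then have "G k l = 0" "G0 k l = 0" using G P0 by blast+
        then show ?thesis by simp
      qed
    qed
  qed
  then have 1: "\<And>k l. k \<in> S \<Longrightarrow> l \<in> S \<Longrightarrow> (\<Sum>m\<in>S. A k m * inv_on S A m l) = (if k = l then 1 else 0)"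
    and 2: "\<And>k l. k \<notin> S \<or> l \<notin> S \<Longrightarrow> inv_on S A k l = 0" by blast+
  show "k \<in> S \<Longrightarrow> l \<in> S \<Longrightarrow> (\<Sum>m\<in>S. A k m * inv_on S A m l) = (if k = l then 1 else 0)" by (rule 1)
  show "k \<notin> S \<or> l \<notin> S \<Longrightarrow> inv_on S A k l = 0" by (rule 2)
  show "(\<And>k l. k \<in> S \<Longrightarrow> l \<in> S \<Longrightarrow> (\<Sum>m\<in>S. A k m * G m l) = (if k = l then 1 else 0))
       \<Longrightarrow> k \<in> S \<Longrightarrow> l \<in> S \<Longrightarrow> G k l = inv_on S A k l"
    by (rule uniq[OF _ 1])
  show "inv_on S A k l = inv_on S A l k"
  proof (cases "k \<in> S \<and> l \<in> S")
    case True
    let ?G = "inv_on S A"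
    \<comment> \<open>Symmetry comes from evaluating one triple product, the transpose of
      \<open>?G\<close> times \<open>A\<close> times \<open>?G\<close>, in two ways:
      \<open>A\<close> is first combined with the right factor, then with the left one.\<close>
    have "(\<Sum>m\<in>S. \<Sum>n\<in>S. ?G m k * A m n * ?G n l) = (\<Sum>m\<in>S. ?G m k * (\<Sum>n\<in>S. A m n * ?G n l))"
      by (simp add: sum_distrib_left mult.assoc)
    also have "\<dots> = (\<Sum>m\<in>S. if m = l then ?G m k else 0)"
      using True by (intro sum.cong refl) (auto simp: 1)
    also have "\<dots> = ?G l k" using True assms(1) by simp
    finally have a: "(\<Sum>m\<in>S. \<Sum>n\<in>S. ?G m k * A m n * ?G n l) = ?G l k" .
    have "(\<Sum>m\<in>S. \<Sum>n\<in>S. ?G m k * A m n * ?G n l) = (\<Sum>n\<in>S. \<Sum>m\<in>S. A n m * ?G m k * ?G n l)"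
      by (subst sum.swap) (intro sum.cong refl, simp add: assms(2))
    also have "\<dots> = (\<Sum>n\<in>S. (\<Sum>m\<in>S. A n m * ?G m k) * ?G n l)"
      by (simp add: sum_distrib_right)
    also have "\<dots> = (\<Sum>n\<in>S. if n = k then ?G n l else 0)"
      using True by (intro sum.cong refl) (auto simp: 1)
    also have "\<dots> = ?G k l" using True assms(1) by simp
    finally show ?thesis using a by simp
  next
    case False then show ?thesis using 2 by metis
  qed
qed

text \<open>If the \<open>I\<close> block is not positive definite, \<open>inv_on\<close> gives no
  usable Schur complement. Both sides are then false, the left one by restriction to vectors
  supported on \<open>I\<close>.\<close>

lemma pos_def_on_Un:
  assumes "finite I" "finite J" "I \<inter> J = {}"
    and sym: "\<And>i j. i \<in> I \<union> J \<Longrightarrow> j \<in> I \<union> J \<Longrightarrow> A i j = A j i"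
  shows "pos_def_on (I \<union> J) A \<longleftrightarrow> pos_def_on I A \<and> pos_def_on J (schur I A)"
proof (cases "pos_def_on I A")
  case True
  show ?thesis unfolding schur_def[abs_def]
    by (rule pos_def_on_block[OF assms inv_on_right]) (use assms True in auto)
next
  case False
  have "pos_def_on I A" if "pos_def_on (I \<union> J) A"
  proof (rule pos_def_onI)
    fix x i assume x: "\<And>k. k \<notin> I \<Longrightarrow> x k = (0::real)" "i \<in> I" "x i \<noteq> 0"
    have "0 < (\<Sum>i\<in>I\<union>J. \<Sum>j\<in>I\<union>J. x i * A i j * x j)"
      using x by (intro pos_def_onD[OF that]) auto
    also have "\<dots> = (\<Sum>i\<in>I. \<Sum>j\<in>I. x i * A i j * x j)"
      using assms(1,2) x(1) by (intro sum.mono_neutral_cong_right sum.cong) (auto intro!: sum.mono_neutral_cong_right)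
    finally show "0 < (\<Sum>i\<in>I. \<Sum>j\<in>I. x i * A i j * x j)" .
  qed
  with False show ?thesis by blast
qed

lemma det_on_Un:
  assumes "finite I" "finite J" "I \<inter> J = {}"
    and sym: "\<And>i j. i \<in> I \<union> J \<Longrightarrow> j \<in> I \<union> J \<Longrightarrow> A i j = A j i"
    and "pos_def_on I A"
  shows "det_on (I \<union> J) A = det_on I A * det_on J (schur I A)"
  unfolding schur_def[abs_def]
  by (rule det_on_block[OF assms(1-3) inv_on_right]) (use assms in auto)

lemma schur_sym:
  assumes "finite I" and sym: "\<And>i j. i \<in> I \<union> J \<Longrightarrow> j \<in> I \<union> J \<Longrightarrow> A i j = A j i"
    and "pos_def_on I A" "i \<in> J" "j \<in> J"
  shows "schur I A i j = schur I A j i"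
proof -
  have "(\<Sum>k\<in>I. \<Sum>l\<in>I. A i k * inv_on I A k l * A l j) = (\<Sum>k\<in>I. \<Sum>l\<in>I. A j k * inv_on I A k l * A l i)"
  proof (subst sum.swap, intro sum.cong refl)
    fix k l assume "k \<in> I" "l \<in> I"
    then show "A i l * inv_on I A l k * A k j = A j k * inv_on I A k l * A l i"
      using inv_on_sym[of I A k l] sym[of i l] sym[of k j] assms by simp
  qed
  then show ?thesis using sym[of i j] assms by (simp add: schur_def)
qed

lemma inv_on_singleton: "A i i \<noteq> 0 \<Longrightarrow> inv_on {i} A i i = 1 / A i i"
proof -
  assume "A i i \<noteq> 0"
  then have "inv_on {i} A = (\<lambda>k l. if k = i \<and> l = i then 1 / A i i else 0)"
    unfolding inv_on_def by (intro the_equality) (auto simp: fun_eq_iff field_simps)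
  then show ?thesis by simp
qed

lemma det_on_singleton [simp]: "det_on {i} A = A i i"
  by (simp add: det_on_def permutes_sing)

lemma schur_singleton: "A i i \<noteq> 0 \<Longrightarrow> schur {i} A j k = A j k - A j i * A i k / A i i"
  by (simp add: schur_def inv_on_singleton)

text \<open>Removing one vertex at a time writes the determinant as a product of positive
  pivots.\<close>

lemma pos_def_det_pos:
  assumes "finite S" "\<And>i j. i \<in> S \<Longrightarrow> j \<in> S \<Longrightarrow> A i j = A j i" "pos_def_on S A"
  shows "det_on S A > 0"
  using assms
proof (induction S arbitrary: A rule: finite_induct)
  case (insert i S)
  have "pos_def_on {i} A" "pos_def_on S (schur {i} A)"
    using pos_def_on_Un[of "{i}" S A] insert by auto
  moreover have "det_on S (schur {i} A) > 0"
    using insert \<open>pos_def_on {i} A\<close> by (intro insert.IH calculation schur_sym[of _ S]) auto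
  ultimately show ?case
    using det_on_Un[of "{i}" S A] insert by (auto simp: pos_def_on_singleton)
qed simp

section \<open>A Gaussian integral\<close>

text \<open>The error function up to the factor \<open>sqrt pi / 2\<close>. It makes the
  antiderivative of the integral below explicit, so that the fundamental theorem of calculus
  evaluates it.\<close>

definition gauss_int :: "real \<Rightarrow> real" where
  "gauss_int y = (LBINT s=ereal 0..ereal y. exp (- s\<^sup>2))"

lemma DERIV_gauss_int: "DERIV gauss_int y :> exp (- y\<^sup>2)"
proof -
  let ?a = "-(\<bar>y\<bar> + 1)" and ?b = "\<bar>y\<bar> + 1"
  have "((\<lambda>u. LBINT s=ereal 0..ereal u. exp (- s\<^sup>2)) has_vector_derivative (exp (- y\<^sup>2))) (at y within {?a..?b})"
    by (rule interval_integral_FTC2) (auto intro!: continuous_intros)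
  moreover have "at y within {?a..?b} = at y"
    by (rule at_within_Icc_at) auto
  ultimately show ?thesis
    unfolding gauss_int_def[abs_def] by (simp add: has_real_derivative_iff_has_vector_derivative)
qed

lemma gauss_int_0 [simp]: "gauss_int 0 = 0"
  by (simp add: gauss_int_def)

lemma gauss_int_minus: "gauss_int (- y) = - gauss_int y"
proof -
  have "gauss_int (- y) = (LBINT s=ereal y..ereal 0. exp (- s\<^sup>2))"
    unfolding gauss_int_def by (subst interval_integral_reflect) simp
  also have "\<dots> = - gauss_int y"
    unfolding gauss_int_def by (subst interval_integral_endpoints_reverse) simp
  finally show ?thesis .
qed

lemma gauss_int_at_top: "(gauss_int \<longlongrightarrow> sqrt pi / 2) at_top"
proof -
  have i: "integrable lborel (\<lambda>x. indicator {0..} x *\<^sub>R exp (- x\<^sup>2) :: real)"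
    using gaussian_moment_0 by (auto simp: has_bochner_integral_iff)
  have v: "(\<integral>x. indicator {0..} x *\<^sub>R exp (- x\<^sup>2) \<partial>lborel) = sqrt pi / 2"
    using gaussian_moment_0 by (auto simp: has_bochner_integral_iff)
  have "((\<lambda>y. \<integral> x. indicator {.. y} x *\<^sub>R (indicator {0..} x *\<^sub>R exp (- x\<^sup>2)) \<partial>lborel) \<longlongrightarrow> sqrt pi / 2) at_top"
    using tendsto_integral_at_top[OF _ i] unfolding v by simp
  then show ?thesis
  proof (rule Lim_transform_eventually)
    show "\<forall>\<^sub>F y in at_top. (\<integral> x. indicator {.. y} x *\<^sub>R (indicator {0..} x *\<^sub>R exp (- x\<^sup>2)) \<partial>lborel) = gauss_int y"
      using eventually_ge_at_top[of 0]
    proof eventually_elim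
      case (elim y)
      then have "gauss_int y = (LBINT s:{0..y}. exp (- s\<^sup>2))"
        unfolding gauss_int_def by (rule interval_integral_Icc)
      also have "\<dots> = (\<integral> x. indicator {.. y} x *\<^sub>R (indicator {0..} x *\<^sub>R exp (- x\<^sup>2)) \<partial>lborel)"
        unfolding set_lebesgue_integral_def
        by (intro Bochner_Integration.integral_cong) (auto simp: indicator_def)
      finally show ?case by simp
    qed
  qed
qed

lemma gauss_int_at_bot: "(gauss_int \<longlongrightarrow> - (sqrt pi / 2)) at_bot"
  unfolding filterlim_at_bot_mirror
  using tendsto_minus[OF gauss_int_at_top] by (simp add: gauss_int_minus)

text \<open>With \<open>v = sqrt (2 * x - w)\<close>, whose derivative is the factor
  \<open>1 / sqrt (2 * x - w)\<close>, this is the Cauchy-Schloemilch integral of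
  \<open>exp (- (v * p - q / v)^2)\<close> over \<open>v > 0\<close>.\<close>

lemma cauchy_schloemilch_gauss:
  fixes p q w :: real
  assumes p: "p > 0" and q: "q \<ge> 0"
  shows "(\<integral>\<^sup>+x. ennreal (if 2 * x > w then exp (- (sqrt (2 * x - w) * p - q / sqrt (2 * x - w))\<^sup>2) / sqrt (2 * x - w) else 0) \<partial>lborel)
    = ennreal (sqrt pi / (2 * p))"
proof -
  define f where "f x = exp (- (sqrt (2 * x - w) * p - q / sqrt (2 * x - w))\<^sup>2) / sqrt (2 * x - w)" for x
  \<comment> \<open>The squares of \<open>v * p - q / v\<close> and \<open>- (v * p) - q / v\<close>
    differ by \<open>4 * p * q\<close>, so the factor \<open>exp (4 * p * q)\<close> gives both
    derivatives the same Gaussian. In the difference, the inner derivatives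
    \<open>p + q / v^2\<close> and \<open>- p + q / v^2\<close> leave the constant
    \<open>2 * p\<close>.\<close>
  define F where "F v = (gauss_int (v * p - q / v) - exp (4 * p * q) * gauss_int (- (v * p) - q / v)) / (2 * p)" for v
  let ?s = "\<lambda>x. sqrt (2 * x - w)"
  have dF: "DERIV F v :> exp (- (v * p - q / v)\<^sup>2)" if v: "v > 0" for v
  proof -
    have 1: "DERIV (\<lambda>v. gauss_int (v * p - q / v)) v :> exp (- (v * p - q / v)\<^sup>2) * (p + q / v\<^sup>2)"
      by (rule DERIV_chain2[OF DERIV_gauss_int])
         (use v in \<open>auto intro!: derivative_eq_intros simp: power2_eq_square field_simps\<close>)
    have 2: "DERIV (\<lambda>v. gauss_int (- (v * p) - q / v)) v :> exp (- (- (v * p) - q / v)\<^sup>2) * (- p + q / v\<^sup>2)"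
      by (rule DERIV_chain2[OF DERIV_gauss_int])
         (use v in \<open>auto intro!: derivative_eq_intros simp: power2_eq_square field_simps\<close>)
    have "exp (4 * p * q) * exp (- (- (v * p) - q / v)\<^sup>2) = exp (- (v * p - q / v)\<^sup>2)"
      unfolding exp_add[symmetric]
      by (rule arg_cong[where f=exp]) (use v in \<open>simp add: power2_eq_square field_simps\<close>)
    then have 3: "exp (- (v * p - q / v)\<^sup>2)
      = (exp (- (v * p - q / v)\<^sup>2) * (p + q / v\<^sup>2)
        - exp (4 * p * q) * (exp (- (- (v * p) - q / v)\<^sup>2) * (- p + q / v\<^sup>2))) / (2 * p)"
      unfolding mult.assoc[symmetric] using p by (simp add: field_simps)
    show ?thesis unfolding F_def
      by (subst 3) (intro DERIV_cdivide DERIV_diff DERIV_cmult 1 2)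
  qed
  have dFs: "DERIV (\<lambda>x. F (?s x)) x :> f x" if "2 * x > w" for x
  proof -
    have "DERIV (\<lambda>x. F (?s x)) x :> exp (- (?s x * p - q / ?s x)\<^sup>2) * (1 / ?s x)"
      by (rule DERIV_chain2[OF dF]) (use that in \<open>auto intro!: derivative_eq_intros simp: field_simps\<close>)
    then show ?thesis by (simp add: f_def)
  qed
  have cont: "isCont f x" if "2 * x > w" for x
    unfolding f_def using that by (intro continuous_intros) auto
  have F_top: "(F \<longlongrightarrow> (sqrt pi / 2 - exp (4 * p * q) * (- (sqrt pi / 2))) / (2 * p)) at_top"
    unfolding F_def
  proof (intro tendsto_intros)
    show "((\<lambda>x. gauss_int (x * p - q / x)) \<longlongrightarrow> sqrt pi / 2) at_top"
      by (rule filterlim_compose[OF gauss_int_at_top]) (use p in real_asymp)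
    show "((\<lambda>x. gauss_int (- (x * p) - q / x)) \<longlongrightarrow> - (sqrt pi / 2)) at_top"
      by (rule filterlim_compose[OF gauss_int_at_bot]) (use p in real_asymp)
  qed (use p in auto)
  \<comment> \<open>As \<open>v\<close> tends to 0, both arguments tend to 0 if \<open>q = 0\<close>
    and to minus infinity if \<open>q > 0\<close>. In either case \<open>F\<close> ends up
    \<open>sqrt pi / (2 * p)\<close> below its limit at infinity.\<close>
  have F_0: "(F \<longlongrightarrow> (sqrt pi / 2 - exp (4 * p * q) * (- (sqrt pi / 2))) / (2 * p) - sqrt pi / (2 * p)) (at_right 0)"
  proof (cases "q = 0")
    case True
    have "isCont gauss_int 0" using DERIV_gauss_int by (rule DERIV_isCont)
    then have c: "(gauss_int \<longlongrightarrow> 0) (at 0)" by (simp add: isCont_def)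
    have "((\<lambda>v. (gauss_int (v * p) - gauss_int (- (v * p))) / (2 * p)) \<longlongrightarrow> (0 - 0) / (2 * p)) (at_right 0)"
    proof (intro tendsto_intros)
      have "isCont (\<lambda>x. gauss_int (x * p)) 0" "isCont (\<lambda>x. gauss_int (- (x * p))) 0"
        by (auto intro!: continuous_intros DERIV_isCont[OF DERIV_gauss_int] isCont_o2[where g=gauss_int])
      then show "((\<lambda>x. gauss_int (x * p)) \<longlongrightarrow> 0) (at_right 0)"
        "((\<lambda>x. gauss_int (- (x * p))) \<longlongrightarrow> 0) (at_right 0)"
        by (auto simp: isCont_def intro: filterlim_at_split[THEN iffD1, THEN conjunct2])
    qed (use p in auto)
    then show ?thesis using True p by (simp add: F_def[abs_def] field_simps)
  next
    case False
    then have q: "q > 0" using assms by simp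
    have "(F \<longlongrightarrow> (- (sqrt pi / 2) - exp (4 * p * q) * (- (sqrt pi / 2))) / (2 * p)) (at_right 0)"
      unfolding F_def
    proof (intro tendsto_intros)
      show "((\<lambda>x. gauss_int (x * p - q / x)) \<longlongrightarrow> - (sqrt pi / 2)) (at_right 0)"
        by (rule filterlim_compose[OF gauss_int_at_bot]) (use p q in real_asymp)
      show "((\<lambda>x. gauss_int (- (x * p) - q / x)) \<longlongrightarrow> - (sqrt pi / 2)) (at_right 0)"
        by (rule filterlim_compose[OF gauss_int_at_bot]) (use p q in real_asymp)
    qed (use p in auto)
    also have "(- (sqrt pi / 2) - exp (4 * p * q) * (- (sqrt pi / 2))) / (2 * p)
      = (sqrt pi / 2 - exp (4 * p * q) * (- (sqrt pi / 2))) / (2 * p) - sqrt pi / (2 * p)"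
      using p by (simp add: field_simps)
    finally show ?thesis .
  qed
  have f_nn: "0 \<le> f x" if "2 * x > w" for x using that by (simp add: f_def)
  have s_top: "filterlim ?s at_top at_top"
    by real_asymp
  have s_0: "filterlim ?s (at_right 0) (at_right (w / 2))"
  proof -
    have "(?s \<longlongrightarrow> 0) (at_right (w / 2))"
    proof -
      have "isCont ?s (w / 2)" by (intro continuous_intros)
      then show ?thesis by (auto simp: isCont_def intro: filterlim_at_split[THEN iffD1, THEN conjunct2])
    qed
    moreover have "\<forall>\<^sub>F x in at_right (w / 2). ?s x \<in> {0<..}"
      using eventually_at_right_less[of "w / 2"] by eventually_elim auto
    ultimately show ?thesis by (simp add: filterlim_at) (erule eventually_mono, simp)
  qed
  define B0 where "B0 = (sqrt pi / 2 - exp (4 * p * q) * (- (sqrt pi / 2))) / (2 * p)"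
  note lims = filterlim_compose[OF F_top[folded B0_def] s_top] filterlim_compose[OF F_0[folded B0_def] s_0]
  define a b where "a = ereal (w / 2)" and "b = (\<infinity>::ereal)"
  have ab: "a < b" by (simp add: a_def b_def)
  note FTC = interval_integral_FTC_nonneg[OF ab, of "\<lambda>x. F (?s x)" f]
  have 1: "set_integrable lborel (einterval a b) f" and
    2: "(LBINT x=a..b. f x) = B0
       - (B0 - sqrt pi / (2 * p))"
  proof (atomize(full), intro conjI, goal_cases)
    case 1
    show ?case
      by (rule FTC(1)) (auto simp: a_def b_def ereal_tendsto_simps1
        intro!: dFs cont f_nn lims AE_I2)
  next
    case 2
    show ?case
      by (rule FTC(2)) (auto simp: a_def b_def ereal_tendsto_simps1
        intro!: dFs cont f_nn lims AE_I2)
  qed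
  have "(\<integral>\<^sup>+x. ennreal (indicator (einterval a b) x *\<^sub>R f x) \<partial>lborel) = ennreal (LBINT x=a..b. f x)"
    unfolding interval_lebesgue_integral_def set_lebesgue_integral_def using 1 ab
    by (subst nn_integral_eq_integral)
       (auto simp: set_integrable_def f_def einterval_def indicator_def a_def b_def)
  also have "(LBINT x=a..b. f x) = sqrt pi / (2 * p)" unfolding 2 by simp
  also have "(\<lambda>x. ennreal (indicator (einterval a b) x *\<^sub>R f x))
     = (\<lambda>x. ennreal (if 2 * x > w then exp (- (sqrt (2 * x - w) * p - q / sqrt (2 * x - w))\<^sup>2) / sqrt (2 * x - w) else 0))"
    by (auto simp: fun_eq_iff einterval_def indicator_def f_def a_def b_def)
  finally show ?thesis .
qed

text \<open>The integral left for one coordinate when its vertex is eliminated: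
  \<open>2 * x - w\<close> is the pivot and \<open>b\<close> the \<theta>-weighted sum of the
  weights to the other vertices. Completing the square with \<open>p = \<theta> / sqrt 2\<close> and
  \<open>q = b / sqrt 2\<close> reduces it to the previous lemma.\<close>

lemma nn_integral_gaussian_schur:
  fixes \<theta> b w :: real
  assumes "\<theta> > 0" "b \<ge> 0"
  shows "(\<integral>\<^sup>+x. ennreal (if 2 * x > w then exp (- x * \<theta>\<^sup>2 - b\<^sup>2 / (2 * (2 * x - w))) / sqrt (2 * x - w) else 0) \<partial>lborel)
    = ennreal (sqrt (pi / 2) * exp (- w * \<theta>\<^sup>2 / 2 - b * \<theta>) / \<theta>)"
proof -
  have *: "exp (- x * \<theta>\<^sup>2 - b\<^sup>2 / (2 * (2 * x - w)))
     = exp (- w * \<theta>\<^sup>2 / 2 - b * \<theta>)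
       * exp (- (sqrt (2 * x - w) * (\<theta> / sqrt 2) - (b / sqrt 2) / sqrt (2 * x - w))\<^sup>2)"
    if "2 * x > w" for x
  proof -
    define s where "s = sqrt (2 * x - w)"
    have s: "s > 0" "s\<^sup>2 = 2 * x - w" using that by (auto simp: s_def)
    have "(s * (\<theta> / sqrt 2) - (b / sqrt 2) / s)\<^sup>2 = ((s * \<theta> - b / s) / sqrt 2)\<^sup>2"
      by (simp add: diff_divide_distrib mult.commute)
    also have "\<dots> = (s * \<theta> - b / s)\<^sup>2 / 2" by (simp add: power_divide)
    also have "\<dots> = (s\<^sup>2 * \<theta>\<^sup>2 - 2 * b * \<theta> + b\<^sup>2 / s\<^sup>2) / 2"
      using s(1) by (simp add: power2_diff power_mult_distrib power_divide field_simps power2_eq_square)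
    finally have "(s * (\<theta> / sqrt 2) - (b / sqrt 2) / s)\<^sup>2 = ((2 * x - w) * \<theta>\<^sup>2 - 2 * b * \<theta> + b\<^sup>2 / (2 * x - w)) / 2"
      unfolding s(2) .
    then show ?thesis
      unfolding exp_add[symmetric] s_def[symmetric] using that
      by (intro arg_cong[where f=exp]) (simp add: field_simps)
  qed
  have "(\<integral>\<^sup>+x. ennreal (if 2 * x > w then exp (- x * \<theta>\<^sup>2 - b\<^sup>2 / (2 * (2 * x - w))) / sqrt (2 * x - w) else 0) \<partial>lborel)
   = (\<integral>\<^sup>+x. ennreal (exp (- w * \<theta>\<^sup>2 / 2 - b * \<theta>)) * ennreal (if 2 * x > w then
        exp (- (sqrt (2 * x - w) * (\<theta> / sqrt 2) - (b / sqrt 2) / sqrt (2 * x - w))\<^sup>2) / sqrt (2 * x - w) else 0) \<partial>lborel)"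
  proof (rule nn_integral_cong)
    fix x :: real
    show "ennreal (if 2 * x > w then exp (- x * \<theta>\<^sup>2 - b\<^sup>2 / (2 * (2 * x - w))) / sqrt (2 * x - w) else 0)
      = ennreal (exp (- w * \<theta>\<^sup>2 / 2 - b * \<theta>)) * ennreal (if 2 * x > w then
        exp (- (sqrt (2 * x - w) * (\<theta> / sqrt 2) - (b / sqrt 2) / sqrt (2 * x - w))\<^sup>2) / sqrt (2 * x - w) else 0)"
    proof (cases "2 * x > w")
      case True
      show ?thesis unfolding if_P[OF True] *[OF True]
        using True by (subst ennreal_mult[symmetric]) auto
    qed simp
  qed
  also have "\<dots> = ennreal (exp (- w * \<theta>\<^sup>2 / 2 - b * \<theta>)) * ennreal (sqrt pi / (2 * (\<theta> / sqrt 2)))"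
    using assms by (subst nn_integral_cmult) (simp_all add: cauchy_schloemilch_gauss)
  also have "\<dots> = ennreal (sqrt (pi / 2) * exp (- w * \<theta>\<^sup>2 / 2 - b * \<theta>) / \<theta>)"
  proof -
    have "sqrt pi / (2 * (\<theta> / sqrt 2)) = sqrt (pi / 2) / \<theta>"
      using assms by (simp add: real_sqrt_divide field_simps)
    then show ?thesis using assms by (simp add: ennreal_mult[symmetric] mult.commute)
  qed
  finally show ?thesis .
qed

section \<open>The Laplace transform of the law of \<open>\<beta>\<close>\<close>

lemma measurable_det_on:
  assumes "finite S" "\<And>i j. i \<in> S \<Longrightarrow> j \<in> S \<Longrightarrow> (\<lambda>x. A x i j) \<in> borel_measurable M"
  shows "(\<lambda>x. det_on S (A x)) \<in> borel_measurable M"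
  unfolding det_on_def
  using assms by (intro borel_measurable_sum borel_measurable_times borel_measurable_prod borel_measurable_const)
    (auto simp: permutes_in_image)

text \<open>The definition quantifies over all vectors, so measurability cannot be read off from it.
  Elimination replaces it by finitely many conditions that a pivot, a rational expression in the
  entries, is positive.\<close>

lemma pred_pos_def_on:
  assumes "finite S" "\<And>i j. i \<in> S \<Longrightarrow> j \<in> S \<Longrightarrow> (\<lambda>x. A x i j) \<in> borel_measurable M"
    and "\<And>x i j. i \<in> S \<Longrightarrow> j \<in> S \<Longrightarrow> A x i j = A x j i"
  shows "Measurable.pred M (\<lambda>x. pos_def_on S (A x))"
  using assms
proof (induction S arbitrary: A rule: finite_induct)
  case (insert i S)
  let ?B = "\<lambda>x j k. A x j k - A x j i * A x i k / A x i i"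
  have "pos_def_on (insert i S) (A x) \<longleftrightarrow> 0 < A x i i \<and> pos_def_on S (?B x)" for x
  proof -
    have "pos_def_on ({i} \<union> S) (A x) \<longleftrightarrow> pos_def_on {i} (A x) \<and> pos_def_on S (schur {i} (A x))"
    proof (rule pos_def_on_Un)
      show "A x j k = A x k j" if "j \<in> {i} \<union> S" "k \<in> {i} \<union> S" for j k
        using insert.prems(2)[of j k x] that by simp
    qed (use insert.hyps in auto)
    moreover have "pos_def_on S (schur {i} (A x)) \<longleftrightarrow> pos_def_on S (?B x)" if "0 < A x i i"
      using that by (intro pos_def_on_cong) (simp add: schur_singleton)
    ultimately show ?thesis by (auto simp: pos_def_on_singleton)
  qed
  moreover have "Measurable.pred M (\<lambda>x. pos_def_on S (?B x))"
  proof (rule insert.IH)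
    show "(\<lambda>x. ?B x j k) \<in> borel_measurable M" if "j \<in> S" "k \<in> S" for j k
      using insert.prems(1) that by (intro borel_measurable_diff borel_measurable_divide borel_measurable_times) auto
    show "?B x j k = ?B x k j" if "j \<in> S" "k \<in> S" for x j k
      using insert.prems(2)[of j k x] insert.prems(2)[of i k x] insert.prems(2)[of i j x] that by simp
  qed
  moreover have "(\<lambda>x. A x i i) \<in> borel_measurable M" using insert.prems(1) by simp
  ultimately show ?case by simp
qed simp

interpretation lborel_prod: product_sigma_finite "\<lambda>_. lborel :: real measure" ..

lemma measurable_Hmat:
  "i \<in> S \<Longrightarrow> (\<lambda>\<beta>. Hmat W \<beta> i j) \<in> borel_measurable (PiM S (\<lambda>_. lborel))"
  unfolding Hmat_def by (cases "i = j") auto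

lemma measurable_det_Hmat:
  "finite S \<Longrightarrow> (\<lambda>\<beta>. det_on S (Hmat W \<beta>)) \<in> borel_measurable (PiM S (\<lambda>_. lborel))"
  by (intro measurable_det_on measurable_Hmat)

lemma pred_pos_def_Hmat:
  assumes "finite S" "\<And>i j. i \<in> S \<Longrightarrow> j \<in> S \<Longrightarrow> W i j = W j i"
  shows "Measurable.pred (PiM S (\<lambda>_. lborel)) (\<lambda>\<beta>. pos_def_on S (Hmat W \<beta>))"
  using assms by (intro pred_pos_def_on measurable_Hmat) (auto simp: Hmat_def)

lemma measurable_pos_def_weight:
  fixes W :: "'v \<Rightarrow> 'v \<Rightarrow> real"
  assumes "finite S" "\<And>i j. i \<in> S \<Longrightarrow> j \<in> S \<Longrightarrow> W i j = W j i" "f \<in> borel_measurable (PiM S (\<lambda>_. lborel))"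
  shows "(\<lambda>\<beta>. if pos_def_on S (Hmat W \<beta>) then ennreal (f \<beta> / sqrt (det_on S (Hmat W \<beta>))) else 0)
     \<in> borel_measurable (PiM S (\<lambda>_. lborel))"
proof -
  note [measurable] = pred_pos_def_Hmat[OF assms(1,2)] measurable_det_Hmat[OF assms(1)] assms(3)
  show ?thesis by measurable
qed

lemma measurable_laplace_weight:
  fixes \<theta> :: "'v \<Rightarrow> real"
  shows "(\<lambda>\<beta>. exp (- (\<Sum>i\<in>S. \<beta> i * (\<theta> i)\<^sup>2))) \<in> borel_measurable (PiM S (\<lambda>_. lborel))"
  by measurable

text \<open>Induction on the vertex set, for all weights at once. With \<open>\<beta> i = y\<close>
  fixed, eliminating \<open>i\<close> replaces \<open>W\<close> by \<open>W' y\<close>, again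
  symmetric and nonnegative, so the induction hypothesis integrates out the other coordinates. What
  is left in \<open>y\<close> is the integral of \<open>nn_integral_gaussian_schur\<close>.\<close>

lemma laplace_pos_def:
  fixes W :: "'v \<Rightarrow> 'v \<Rightarrow> real"
  assumes "finite S" "\<And>i j. i \<in> S \<Longrightarrow> j \<in> S \<Longrightarrow> W i j = W j i"
    and "\<And>i j. i \<in> S \<Longrightarrow> j \<in> S \<Longrightarrow> W i j \<ge> 0" and \<theta>: "\<And>i. i \<in> S \<Longrightarrow> \<theta> i > 0"
  shows "(\<integral>\<^sup>+\<beta>. (if pos_def_on S (Hmat W \<beta>)
            then ennreal (exp (- (\<Sum>i\<in>S. \<beta> i * (\<theta> i)\<^sup>2)) / sqrt (det_on S (Hmat W \<beta>))) else 0) \<partial>PiM S (\<lambda>_. lborel))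
    = ennreal (sqrt (pi / 2) ^ card S * exp (- (\<Sum>i\<in>S. \<Sum>j\<in>S. \<theta> i * W i j * \<theta> j) / 2) / (\<Prod>i\<in>S. \<theta> i))"
  using assms
proof (induction S arbitrary: W rule: finite_induct)
  case empty
  show ?case by (subst lborel_prod.nn_integral_empty) simp_all
next
  case (insert i S)
  note sym = insert.prems(1) and nn = insert.prems(2) and pos = insert.prems(3)
  let ?f = "\<lambda>T W \<beta>. (if pos_def_on T (Hmat W \<beta>)
            then ennreal (exp (- (\<Sum>i\<in>T. \<beta> i * (\<theta> i)\<^sup>2)) / sqrt (det_on T (Hmat W \<beta>))) else 0)"
  let ?c = "sqrt (pi / 2) ^ card S * exp (- (\<Sum>i\<in>S. \<Sum>j\<in>S. \<theta> i * W i j * \<theta> j) / 2) / (\<Prod>i\<in>S. \<theta> i)"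
  define b where "b = (\<Sum>j\<in>S. W i j * \<theta> j)"
  have b: "b \<ge> 0" unfolding b_def using nn pos by (intro sum_nonneg mult_nonneg_nonneg) (auto intro: less_imp_le)
  have ti: "\<theta> i > 0" using pos by simp
  \<comment> \<open>The weights seen on \<open>S\<close> after elimination of \<open>i\<close>, with
    pivot \<open>2 * y - W i i\<close>. The integrand is supported where the pivot is positive, and
    there they are nonnegative.\<close>
  define W' where "W' y j k = W j k + W j i * W i k / (2 * y - W i i)" for y j k
  have fin: "finite (insert i S)" using insert.hyps by simp
  have meas: "?f (insert i S) W \<in> borel_measurable (PiM (insert i S) (\<lambda>_. lborel))"
    by (rule measurable_pos_def_weight[OF fin sym measurable_laplace_weight])
  have "(\<integral>\<^sup>+\<beta>. ?f (insert i S) W \<beta> \<partial>PiM (insert i S) (\<lambda>_. lborel))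
      = (\<integral>\<^sup>+y. (\<integral>\<^sup>+x. ?f (insert i S) W (x(i := y)) \<partial>PiM S (\<lambda>_. lborel)) \<partial>lborel)"
    by (rule lborel_prod.product_nn_integral_insert_rev[OF insert.hyps meas])
  also have "\<dots> = (\<integral>\<^sup>+y. ennreal ?c * ennreal (if 2 * y > W i i
       then exp (- y * (\<theta> i)\<^sup>2 - b\<^sup>2 / (2 * (2 * y - W i i))) / sqrt (2 * y - W i i) else 0) \<partial>lborel)"
  proof (rule nn_integral_cong)
    fix y :: real
    have pd: "pos_def_on (insert i S) (Hmat W (x(i := y))) \<longleftrightarrow> 2 * y > W i i \<and> pos_def_on S (Hmat (W' y) x)"
      and det: "2 * y > W i i \<Longrightarrow> det_on (insert i S) (Hmat W (x(i := y))) = (2 * y - W i i) * det_on S (Hmat (W' y) x)" for x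
    proof -
      have sH: "Hmat W (x(i := y)) j k = Hmat W (x(i := y)) k j" if "j \<in> {i} \<union> S" "k \<in> {i} \<union> S" for j k
        using sym[of j k] that by (auto simp: Hmat_def)
      have ii: "Hmat W (x(i := y)) i i = 2 * y - W i i" by (simp add: Hmat_def)
      have sch: "schur {i} (Hmat W (x(i := y))) j k = Hmat (W' y) x j k" if "2 * y > W i i" "j \<in> S" "k \<in> S" for j k
        using that insert.hyps by (subst schur_singleton) (auto simp: Hmat_def W'_def)
      have "pos_def_on ({i} \<union> S) (Hmat W (x(i := y))) \<longleftrightarrow>
         pos_def_on {i} (Hmat W (x(i := y))) \<and> pos_def_on S (schur {i} (Hmat W (x(i := y))))"
        by (rule pos_def_on_Un[OF _ _ _ sH]) (use insert.hyps in auto)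
      moreover have "pos_def_on S (schur {i} (Hmat W (x(i := y)))) \<longleftrightarrow> pos_def_on S (Hmat (W' y) x)"
        if "2 * y > W i i" using that by (intro pos_def_on_cong sch)
      ultimately show "pos_def_on (insert i S) (Hmat W (x(i := y))) \<longleftrightarrow> 2 * y > W i i \<and> pos_def_on S (Hmat (W' y) x)"
        by (auto simp: pos_def_on_singleton ii)
      assume y: "2 * y > W i i"
      have "det_on ({i} \<union> S) (Hmat W (x(i := y))) = det_on {i} (Hmat W (x(i := y))) * det_on S (schur {i} (Hmat W (x(i := y))))"
        by (rule det_on_Un[OF _ _ _ sH]) (use insert.hyps y in \<open>auto simp: pos_def_on_singleton ii\<close>)
      also have "det_on S (schur {i} (Hmat W (x(i := y)))) = det_on S (Hmat (W' y) x)"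
        by (intro det_on_cong sch y)
      finally show "det_on (insert i S) (Hmat W (x(i := y))) = (2 * y - W i i) * det_on S (Hmat (W' y) x)"
        by (simp only: det_on_singleton ii Un_insert_left Un_empty_left)
    qed
    show "(\<integral>\<^sup>+x. ?f (insert i S) W (x(i := y)) \<partial>PiM S (\<lambda>_. lborel)) = ennreal ?c * ennreal (if 2 * y > W i i
       then exp (- y * (\<theta> i)\<^sup>2 - b\<^sup>2 / (2 * (2 * y - W i i))) / sqrt (2 * y - W i i) else 0)"
    proof (cases "2 * y > W i i")
      case True
      have sW': "W' y j k = W' y k j" if "j \<in> S" "k \<in> S" for j k
        using sym[of j k] sym[of i j] sym[of i k] that by (simp add: W'_def)
      have nW': "W' y j k \<ge> 0" if "j \<in> S" "k \<in> S" for j k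
        using nn[of j k] nn[of j i] nn[of i k] that True by (simp add: W'_def)
      have pS: "\<And>j. j \<in> S \<Longrightarrow> \<theta> j > 0" using pos by simp
      have "(\<integral>\<^sup>+x. ?f (insert i S) W (x(i := y)) \<partial>PiM S (\<lambda>_. lborel))
        = (\<integral>\<^sup>+x. ennreal (exp (- y * (\<theta> i)\<^sup>2) / sqrt (2 * y - W i i)) * ?f S (W' y) x \<partial>PiM S (\<lambda>_. lborel))"
      proof (rule nn_integral_cong)
        fix x
        have "(\<Sum>j\<in>insert i S. (x(i := y)) j * (\<theta> j)\<^sup>2) = y * (\<theta> i)\<^sup>2 + (\<Sum>j\<in>S. x j * (\<theta> j)\<^sup>2)"
          using insert.hyps by (simp, intro sum.cong) auto
        then have eq: "exp (- (\<Sum>j\<in>insert i S. (x(i := y)) j * (\<theta> j)\<^sup>2)) / sqrt (det_on (insert i S) (Hmat W (x(i := y))))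
          = (exp (- y * (\<theta> i)\<^sup>2) / sqrt (2 * y - W i i)) * (exp (- (\<Sum>j\<in>S. x j * (\<theta> j)\<^sup>2)) / sqrt (det_on S (Hmat (W' y) x)))"
          unfolding det[OF True] by (simp add: real_sqrt_mult exp_add[symmetric])
        have nn': "0 \<le> exp (- (\<Sum>j\<in>S. x j * (\<theta> j)\<^sup>2)) / sqrt (det_on S (Hmat (W' y) x))"
          if "pos_def_on S (Hmat (W' y) x)"
        proof -
          have "0 < det_on S (Hmat (W' y) x)"
            by (rule pos_def_det_pos[OF insert.hyps(1) _ that]) (use sW' in \<open>auto simp: Hmat_def\<close>)
          then show ?thesis by simp
        qed
        show "?f (insert i S) W (x(i := y)) = ennreal (exp (- y * (\<theta> i)\<^sup>2) / sqrt (2 * y - W i i)) * ?f S (W' y) x"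
        proof (cases "pos_def_on S (Hmat (W' y) x)")
          case pdS: True
          have n: "0 \<le> exp (- y * (\<theta> i)\<^sup>2) / sqrt (2 * y - W i i)" using True by simp
          have "pos_def_on (insert i S) (Hmat W (x(i := y)))" using True pdS pd by blast
          then show ?thesis
            unfolding if_P[OF pdS] by (subst if_P, assumption, subst eq) (rule ennreal_mult[OF n nn'[OF pdS]])
        next
          case False
          then have "\<not> pos_def_on (insert i S) (Hmat W (x(i := y)))" using pd by blast
          with False show ?thesis by simp
        qed
      qed
      also have "\<dots> = ennreal (exp (- y * (\<theta> i)\<^sup>2) / sqrt (2 * y - W i i)) * (\<integral>\<^sup>+x. ?f S (W' y) x \<partial>PiM S (\<lambda>_. lborel))"
        by (rule nn_integral_cmult, rule measurable_pos_def_weight[OF insert.hyps(1) sW' measurable_laplace_weight])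
      also have "(\<integral>\<^sup>+x. ?f S (W' y) x \<partial>PiM S (\<lambda>_. lborel))
         = ennreal (sqrt (pi / 2) ^ card S * exp (- (\<Sum>i\<in>S. \<Sum>j\<in>S. \<theta> i * W' y i j * \<theta> j) / 2) / (\<Prod>i\<in>S. \<theta> i))"
        by (rule insert.IH[OF sW' nW' pS])
      \<comment> \<open>The correction has rank one and adds a single square to the quadratic form;
        half of it is the term \<open>b^2 / (2 * (2 * y - W i i))\<close> of the Gaussian
        integral.\<close>
      also have "(\<Sum>j\<in>S. \<Sum>k\<in>S. \<theta> j * W' y j k * \<theta> k) = (\<Sum>j\<in>S. \<Sum>k\<in>S. \<theta> j * W j k * \<theta> k) + b\<^sup>2 / (2 * y - W i i)"
      proof -
        have "(\<Sum>j\<in>S. \<Sum>k\<in>S. \<theta> j * (W j i * W i k / (2 * y - W i i)) * \<theta> k) = b * b / (2 * y - W i i)"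
          unfolding b_def sum_product sum_divide_distrib
        proof (intro sum.cong refl)
          fix j k assume "j \<in> S" "k \<in> S"
          then have "W j i = W i j" using sym[of j i] by simp
          then show "\<theta> j * (W j i * W i k / (2 * y - W i i)) * \<theta> k = W i j * \<theta> j * (W i k * \<theta> k) / (2 * y - W i i)"
            by simp
        qed
        then show ?thesis
          by (simp add: W'_def distrib_left distrib_right sum.distrib power2_eq_square)
      qed
      also have "ennreal (exp (- y * (\<theta> i)\<^sup>2) / sqrt (2 * y - W i i)) *
          ennreal (sqrt (pi / 2) ^ card S * exp (- ((\<Sum>j\<in>S. \<Sum>k\<in>S. \<theta> j * W j k * \<theta> k) + b\<^sup>2 / (2 * y - W i i)) / 2) / (\<Prod>i\<in>S. \<theta> i))
        = ennreal ?c * ennreal (exp (- y * (\<theta> i)\<^sup>2 - b\<^sup>2 / (2 * (2 * y - W i i))) / sqrt (2 * y - W i i))"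
      proof -
        have e: "exp (- ((\<Sum>j\<in>S. \<Sum>k\<in>S. \<theta> j * W j k * \<theta> k) + b\<^sup>2 / (2 * y - W i i)) / 2)
           = exp (- (\<Sum>j\<in>S. \<Sum>k\<in>S. \<theta> j * W j k * \<theta> k) / 2) * exp (- (b\<^sup>2 / (2 * (2 * y - W i i))))"
          unfolding exp_add[symmetric] by (rule arg_cong[where f=exp]) (use True in \<open>simp add: field_simps\<close>)
        have e2: "exp (- y * (\<theta> i)\<^sup>2 - b\<^sup>2 / (2 * (2 * y - W i i)))
           = exp (- y * (\<theta> i)\<^sup>2) * exp (- (b\<^sup>2 / (2 * (2 * y - W i i))))"
          unfolding exp_add[symmetric] by simp
        have p: "0 < (\<Prod>i\<in>S. \<theta> i)" using pS by (intro prod_pos) auto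
        show ?thesis unfolding e e2
          using p True by (subst (1 2) ennreal_mult[symmetric]) (auto simp: less_imp_le mult_ac)
      qed
      finally show ?thesis unfolding if_P[OF True] .
    next
      case False
      then show ?thesis by (simp add: pd)
    qed
  qed
  also have "\<dots> = ennreal ?c * ennreal (sqrt (pi / 2) * exp (- W i i * (\<theta> i)\<^sup>2 / 2 - b * \<theta> i) / \<theta> i)"
    using nn_integral_gaussian_schur[OF ti b, of "W i i"] by (subst nn_integral_cmult) auto
  also have "\<dots> = ennreal (sqrt (pi / 2) ^ card (insert i S) *
       exp (- (\<Sum>j\<in>insert i S. \<Sum>k\<in>insert i S. \<theta> j * W j k * \<theta> k) / 2) / (\<Prod>i\<in>insert i S. \<theta> i))"
  proof -
    have "(\<Sum>j\<in>S. \<theta> j * W j i * \<theta> i) = b * \<theta> i" "(\<Sum>j\<in>S. \<theta> i * W i j * \<theta> j) = b * \<theta> i"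
      unfolding b_def sum_distrib_right by (auto intro!: sum.cong simp: sym[of _ i])
    then have s: "(\<Sum>j\<in>insert i S. \<Sum>k\<in>insert i S. \<theta> j * W j k * \<theta> k)
       = W i i * (\<theta> i)\<^sup>2 + 2 * (b * \<theta> i) + (\<Sum>j\<in>S. \<Sum>k\<in>S. \<theta> j * W j k * \<theta> k)"
      using insert.hyps by (simp add: sum.distrib power2_eq_square)
    have e: "exp (- (W i i * (\<theta> i)\<^sup>2 + 2 * (b * \<theta> i) + (\<Sum>j\<in>S. \<Sum>k\<in>S. \<theta> j * W j k * \<theta> k)) / 2)
       = exp (- W i i * (\<theta> i)\<^sup>2 / 2 - b * \<theta> i) * exp (- (\<Sum>j\<in>S. \<Sum>k\<in>S. \<theta> j * W j k * \<theta> k) / 2)"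
      unfolding exp_add[symmetric] by (rule arg_cong[where f=exp]) (simp add: field_simps)
    have p: "0 < (\<Prod>i\<in>S. \<theta> i)" using pos by (intro prod_pos) auto
    have se: "exp (- (\<Sum>j\<in>insert i S. \<Sum>k\<in>insert i S. \<theta> j * W j k * \<theta> k) / 2)
       = exp (- W i i * (\<theta> i)\<^sup>2 / 2 - b * \<theta> i) * exp (- (\<Sum>j\<in>S. \<Sum>k\<in>S. \<theta> j * W j k * \<theta> k) / 2)"
      by (subst s) (rule e)
    have pr: "(\<Prod>i\<in>insert i S. \<theta> i) = \<theta> i * (\<Prod>i\<in>S. \<theta> i)" and
      ca: "sqrt (pi / 2) ^ card (insert i S) = sqrt (pi / 2) * sqrt (pi / 2) ^ card S"
      using insert.hyps by simp_all
    show ?thesis unfolding se pr ca using p ti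
      by (subst ennreal_mult[symmetric]) (auto simp: less_imp_le mult_ac)
  qed
  finally show ?case .
qed

text \<open>An M-matrix argument. Split column \<open>l\<close> of the inverse into its positive
  part \<open>p\<close> and negative part \<open>n\<close>. Their supports are disjoint, so pairing
  \<open>n\<close> with \<open>p\<close> meets only off-diagonal entries of \<open>Hmat\<close> and
  is at most 0, while pairing \<open>n\<close> with the whole column gives
  \<open>n l \<ge> 0\<close>. Hence the form at \<open>n\<close> is at most 0, which contradicts
  positive definiteness if \<open>n\<close> is not 0.\<close>

lemma inv_on_nonneg:
  assumes "finite S" "\<And>i j. i \<in> S \<Longrightarrow> j \<in> S \<Longrightarrow> W i j = W j i"
    and nn: "\<And>i j. i \<in> S \<Longrightarrow> j \<in> S \<Longrightarrow> W i j \<ge> 0" and pd: "pos_def_on S (Hmat W \<beta>)"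
  shows "inv_on S (Hmat W \<beta>) k l \<ge> 0"
proof (rule ccontr)
  let ?H = "Hmat W \<beta>" let ?G = "inv_on S ?H"
  assume neg: "\<not> ?G k l \<ge> 0"
  have sH: "\<And>i j. i \<in> S \<Longrightarrow> j \<in> S \<Longrightarrow> ?H i j = ?H j i" using assms(2) by (auto simp: Hmat_def)
  note inv = inv_on[OF assms(1) sH pd]
  have kl: "k \<in> S" "l \<in> S" using neg inv(2)[of k l] by auto
  define n where "n i = max 0 (- ?G i l)" for i
  define p where "p i = max 0 (?G i l)" for i
  have g: "?G i l = p i - n i" for i by (simp add: n_def p_def)
  have "0 < (\<Sum>i\<in>S. \<Sum>j\<in>S. n i * ?H i j * n j)"
    by (rule pos_def_onD[OF pd kl(1)]) (use neg in \<open>simp add: n_def\<close>)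
  moreover have "(\<Sum>i\<in>S. \<Sum>j\<in>S. n i * ?H i j * p j) \<le> 0"
  proof (intro sum_nonpos)
    fix i j assume "i \<in> S" "j \<in> S"
    then show "n i * ?H i j * p j \<le> 0"
      using nn[of i j] by (cases "i = j") (auto simp: n_def p_def Hmat_def max_def mult_nonneg_nonneg)
  qed
  moreover have "(\<Sum>i\<in>S. \<Sum>j\<in>S. n i * ?H i j * p j) - (\<Sum>i\<in>S. \<Sum>j\<in>S. n i * ?H i j * n j) = n l"
  proof -
    have "(\<Sum>i\<in>S. \<Sum>j\<in>S. n i * ?H i j * p j) - (\<Sum>i\<in>S. \<Sum>j\<in>S. n i * ?H i j * n j)
       = (\<Sum>i\<in>S. n i * (\<Sum>j\<in>S. ?H i j * ?G j l))"
      unfolding g by (simp add: right_diff_distrib sum_subtractf sum_distrib_left mult.assoc)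
    also have "\<dots> = (\<Sum>i\<in>S. if i = l then n i else 0)"
      using kl by (intro sum.cong refl) (simp add: inv(1))
    finally show ?thesis using kl assms(1) by simp
  qed
  moreover have "n l \<ge> 0" by (simp add: n_def)
  ultimately show False by linarith
qed

section \<open>Effective weights as a Schur complement, and the splitting of \<nu>\<close>

lemma Hmat_sym: "W i j = W j i \<Longrightarrow> Hmat W \<beta> i j = Hmat W \<beta> j i"
  by (auto simp: Hmat_def)

lemma WJ_cong:
  assumes "\<And>k. k \<in> I \<Longrightarrow> \<beta> k = \<beta>' k"
  shows "WJ W I J \<beta> = WJ W I J \<beta>'"
proof -
  have "inv_on I (Hmat W \<beta>) = inv_on I (Hmat W \<beta>')"
    by (intro inv_on_cong) (simp add: Hmat_def assms)
  then show ?thesis unfolding WJ_def[abs_def] by (simp only:)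
qed

lemma WJ_nonneg:
  assumes "finite I" "\<And>i j. W i j = W j i" "\<And>i j. W i j \<ge> 0" "pos_def_on I (Hmat W \<beta>)"
  shows "WJ W I J \<beta> i j \<ge> 0"
  unfolding WJ_def using assms inv_on_nonneg[OF assms(1) _ _ assms(4)]
  by (auto intro!: add_nonneg_nonneg sum_nonneg mult_nonneg_nonneg)

text \<open>This is where the effective weights come from: between \<open>I\<close> and
  \<open>J\<close> the entries of \<open>Hmat\<close> are those of \<open>- W\<close>, so
  eliminating \<open>I\<close> keeps \<open>2 * \<beta>\<close> on the diagonal of \<open>J\<close>
  and adds to \<open>W\<close> the weight of passages through \<open>I\<close>.\<close>

lemma schur_Hmat:
  assumes "I \<inter> J = {}" "i \<in> J" "j \<in> J"
  shows "schur I (Hmat W \<beta>) i j = Hmat (WJ W I J \<beta>) \<beta> i j"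
proof -
  have "Hmat W \<beta> i k = - W i k" "Hmat W \<beta> k j = - W k j" if "k \<in> I" for k
    using assms that by (auto simp: Hmat_def)
  then show ?thesis using assms(2,3) by (simp add: schur_def Hmat_def WJ_def)
qed

lemma WJ_sym:
  assumes "finite I" "\<And>i j. W i j = W j i" "I \<inter> J = {}" "pos_def_on I (Hmat W \<beta>)"
  shows "WJ W I J \<beta> i j = WJ W I J \<beta> j i"
proof (cases "i \<in> J \<and> j \<in> J")
  case True
  have "schur I (Hmat W \<beta>) i j = schur I (Hmat W \<beta>) j i"
    using assms True by (intro schur_sym[of I J]) (auto intro: Hmat_sym)
  then show ?thesis using True assms(3) by (cases "i = j") (simp_all add: schur_Hmat Hmat_def)
qed (auto simp: WJ_def)

lemma measurable_merge_pd:
  fixes W :: "'v \<Rightarrow> 'v \<Rightarrow> real"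
  assumes "finite L" "\<And>i j. W i j = W j i" "F \<in> borel_measurable (PiM L (\<lambda>_. lborel))"
  shows "(\<lambda>\<beta>. if pos_def_on L (Hmat W \<beta>) then F \<beta> * ennreal (1 / sqrt (det_on L (Hmat W \<beta>))) else 0)
     \<in> borel_measurable (PiM L (\<lambda>_. lborel))"
proof -
  note [measurable] = pred_pos_def_Hmat[OF assms(1,2)] measurable_det_Hmat[OF assms(1)] assms(3)
  show ?thesis by measurable
qed

text \<open>Fubini along \<open>merge\<close>. By the block lemmas, both the condition of positive
  definiteness and the determinant split into a factor for \<open>I\<close> and a factor for
  \<open>J\<close> with weights \<open>WJ W I J x\<close>, and these weights depend on the
  \<open>I\<close> coordinates alone.\<close>

lemma nn_integral_pos_def_Un:
  fixes W :: "'v \<Rightarrow> 'v \<Rightarrow> real"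
  assumes fin: "finite I" "finite J" "I \<inter> J = {}" and sym: "\<And>i j. W i j = W j i"
    and F: "F \<in> borel_measurable (PiM (I \<union> J) (\<lambda>_. lborel))"
  shows "(\<integral>\<^sup>+\<beta>. (if pos_def_on (I \<union> J) (Hmat W \<beta>) then F \<beta> * ennreal (1 / sqrt (det_on (I \<union> J) (Hmat W \<beta>))) else 0)
        \<partial>PiM (I \<union> J) (\<lambda>_. lborel))
    = (\<integral>\<^sup>+x. (if pos_def_on I (Hmat W x) then ennreal (1 / sqrt (det_on I (Hmat W x))) *
        (\<integral>\<^sup>+y. (if pos_def_on J (Hmat (WJ W I J x) y)
            then F (merge I J (x, y)) * ennreal (1 / sqrt (det_on J (Hmat (WJ W I J x) y))) else 0) \<partial>PiM J (\<lambda>_. lborel))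
        else 0) \<partial>PiM I (\<lambda>_. lborel))"
proof (subst lborel_prod.product_nn_integral_fold[OF fin(3,1,2)], rule measurable_merge_pd, goal_cases)
  case 4
  show ?case
  proof (rule nn_integral_cong)
    fix x :: "'v \<Rightarrow> real" assume xs: "x \<in> space (PiM I (\<lambda>_. lborel))"
    let ?b = "\<lambda>y. merge I J (x, y)"
    have sH: "\<And>y i j. Hmat W (?b y) i j = Hmat W (?b y) j i" using sym by (auto simp: Hmat_def)
    have HI: "Hmat W (?b y) i j = Hmat W x i j" if "i \<in> I" "j \<in> I" for y i j
      using that by (auto simp: Hmat_def merge_def)
    have WJe: "WJ W I J (?b y) = WJ W I J x" for y
      by (rule WJ_cong) (auto simp: merge_def)
    have HJ: "schur I (Hmat W (?b y)) i j = Hmat (WJ W I J x) y i j" if "i \<in> J" "j \<in> J" for y i j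
      using that fin(3) by (subst schur_Hmat[OF fin(3) that], unfold WJe) (auto simp: Hmat_def merge_def)
    have pI: "pos_def_on I (Hmat W (?b y)) \<longleftrightarrow> pos_def_on I (Hmat W x)" for y
      by (intro pos_def_on_cong HI)
    have pJ: "pos_def_on J (schur I (Hmat W (?b y))) \<longleftrightarrow> pos_def_on J (Hmat (WJ W I J x) y)" for y
      by (intro pos_def_on_cong HJ)
    have pd: "pos_def_on (I \<union> J) (Hmat W (?b y)) \<longleftrightarrow> pos_def_on I (Hmat W x) \<and> pos_def_on J (Hmat (WJ W I J x) y)" for y
      by (subst pos_def_on_Un[OF fin sH]) (simp add: pI pJ)
    have det: "det_on (I \<union> J) (Hmat W (?b y)) = det_on I (Hmat W x) * det_on J (Hmat (WJ W I J x) y)"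
      if "pos_def_on I (Hmat W x)" for y
    proof -
      have "det_on I (Hmat W (?b y)) = det_on I (Hmat W x)" by (intro det_on_cong HI)
      moreover have "det_on J (schur I (Hmat W (?b y))) = det_on J (Hmat (WJ W I J x) y)" by (intro det_on_cong HJ)
      ultimately show ?thesis using that by (subst det_on_Un[OF fin sH]) (simp_all add: pI)
    qed
    show "(\<integral>\<^sup>+y. (if pos_def_on (I \<union> J) (Hmat W (?b y)) then F (?b y) * ennreal (1 / sqrt (det_on (I \<union> J) (Hmat W (?b y)))) else 0)
        \<partial>PiM J (\<lambda>_. lborel))
     = (if pos_def_on I (Hmat W x) then ennreal (1 / sqrt (det_on I (Hmat W x))) *
        (\<integral>\<^sup>+y. (if pos_def_on J (Hmat (WJ W I J x) y)
            then F (?b y) * ennreal (1 / sqrt (det_on J (Hmat (WJ W I J x) y))) else 0) \<partial>PiM J (\<lambda>_. lborel))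
        else 0)"
    proof (cases "pos_def_on I (Hmat W x)")
      case True
      have dI: "det_on I (Hmat W x) > 0"
        by (rule pos_def_det_pos[OF fin(1) _ True]) (use sym in \<open>auto simp: Hmat_def\<close>)
      show ?thesis
      proof -
        have sW: "\<And>i j. WJ W I J x i j = WJ W I J x j i" by (rule WJ_sym[OF fin(1) sym fin(3) True])
        have "(\<lambda>y. (if pos_def_on J (Hmat (WJ W I J x) y)
            then F (?b y) * ennreal (1 / sqrt (det_on J (Hmat (WJ W I J x) y))) else 0)) \<in> borel_measurable (PiM J (\<lambda>_. lborel))"
        proof (rule measurable_merge_pd[OF fin(2) sW])
          show "(\<lambda>y. F (?b y)) \<in> borel_measurable (PiM J (\<lambda>_. lborel))"
            by (rule measurable_compose[OF measurable_Pair1'[OF xs] measurable_compose[OF measurable_merge F]])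
        qed
        note m = this
        have "F (?b y) * ennreal (1 / sqrt (det_on I (Hmat W x) * det_on J (Hmat (WJ W I J x) y)))
           = ennreal (1 / sqrt (det_on I (Hmat W x))) * (F (?b y) * ennreal (1 / sqrt (det_on J (Hmat (WJ W I J x) y))))"
          if "pos_def_on J (Hmat (WJ W I J x) y)" for y
        proof -
          have "det_on J (Hmat (WJ W I J x) y) > 0"
            by (rule pos_def_det_pos[OF fin(2) _ that]) (use sW in \<open>auto intro: Hmat_sym\<close>)
          with dI have "ennreal (1 / sqrt (det_on I (Hmat W x) * det_on J (Hmat (WJ W I J x) y)))
            = ennreal (1 / sqrt (det_on I (Hmat W x))) * ennreal (1 / sqrt (det_on J (Hmat (WJ W I J x) y)))"
            by (subst ennreal_mult[symmetric]) (auto simp: real_sqrt_mult)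
          then show ?thesis by (simp only: mult_ac)
        qed
        then show ?thesis using True
          by (subst if_P[OF True], subst nn_integral_cmult[OF m, symmetric])
             (auto intro!: nn_integral_cong simp: pd det)
      qed
    qed (simp add: pd)
  qed
qed (use fin sym F in auto)


lemma pos_def_nonneg_sqrt_det:
  assumes "finite S" "\<And>i j. W i j = W j i" "pos_def_on S (Hmat W \<beta>)"
  shows "det_on S (Hmat W \<beta>) > 0"
  by (rule pos_def_det_pos[OF assms(1) _ assms(3)]) (use assms(2) in \<open>auto intro: Hmat_sym\<close>)

text \<open>The density of \<nu> already contains \<open>exp (- \<beta> j)\<close>, which the
  \<open>- 1\<close> in the exponent accounts for; together they give the weight integrated in
  \<open>laplace_pos_def\<close>. Later facts on \<nu> are choices of \<theta>: the value 1 gives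
  the marginal law on \<open>I\<close>, and \<open>sqrt (1 + l j)\<close> gives the tilt by
  \<open>exp (- \<beta> j * l j)\<close>.\<close>

lemma nn_integral_nu_meas_block:
  fixes W :: "'v \<Rightarrow> 'v \<Rightarrow> real"
  assumes fin: "finite I" "finite J" "I \<inter> J = {}" and sym: "\<And>i j. W i j = W j i" and nn: "\<And>i j. W i j \<ge> 0"
    and g: "g \<in> borel_measurable (PiM I (\<lambda>_. lborel))" and \<theta>: "\<And>j. j \<in> J \<Longrightarrow> \<theta> j > 0"
  shows "(\<integral>\<^sup>+\<beta>. g (restrict \<beta> I) * ennreal (exp (- (\<Sum>j\<in>J. \<beta> j * ((\<theta> j)\<^sup>2 - 1)))) \<partial>nu_meas W (I \<union> J))
    = (\<integral>\<^sup>+x. (if pos_def_on I (Hmat W x) then g x *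
         ennreal (sqrt (2 / pi) ^ card I * exp ((\<Sum>i\<in>I\<union>J. \<Sum>j\<in>I\<union>J. W i j) / 2 - (\<Sum>i\<in>I. x i)
            - (\<Sum>i\<in>J. \<Sum>j\<in>J. \<theta> i * WJ W I J x i j * \<theta> j) / 2) / (sqrt (det_on I (Hmat W x)) * (\<Prod>j\<in>J. \<theta> j)))
        else 0) \<partial>PiM I (\<lambda>_. lborel))"
proof -
  let ?L = "I \<union> J"
  let ?M = "PiM ?L (\<lambda>_. lborel :: real measure)"
  have finL: "finite ?L" using fin by simp
  \<comment> \<open>The part of the density of \<nu> that is free of \<beta>.\<close>
  define C where "C = sqrt (2 / pi) ^ card ?L * exp ((\<Sum>i\<in>?L. \<Sum>j\<in>?L. W i j) / 2)"
  have C: "C \<ge> 0" by (simp add: C_def)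
  note [measurable] = pred_pos_def_Hmat[OF finL sym] measurable_det_Hmat[OF finL] g
  have [measurable]: "(\<lambda>\<beta>. g (restrict \<beta> I)) \<in> borel_measurable ?M"
    by (rule measurable_compose[OF measurable_restrict_subset g]) auto
  have sumH: "(\<Sum>i\<in>?L. \<Sum>j\<in>?L. Hmat W \<beta> i j) = 2 * (\<Sum>i\<in>I. \<beta> i) + 2 * (\<Sum>j\<in>J. \<beta> j) - (\<Sum>i\<in>?L. \<Sum>j\<in>?L. W i j)" for \<beta>
  proof -
    have "(\<Sum>i\<in>?L. \<Sum>j\<in>?L. Hmat W \<beta> i j) = (\<Sum>i\<in>?L. 2 * \<beta> i) - (\<Sum>i\<in>?L. \<Sum>j\<in>?L. W i j)"
      using finL by (simp add: Hmat_def sum_subtractf)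
    also have "(\<Sum>i\<in>?L. 2 * \<beta> i) = 2 * (\<Sum>i\<in>I. \<beta> i) + 2 * (\<Sum>j\<in>J. \<beta> j)"
      using fin by (simp add: sum.union_disjoint sum_distrib_left)
    finally show ?thesis .
  qed
  define F where "F \<beta> = g (restrict \<beta> I) * ennreal (C * exp (- (\<Sum>i\<in>I. \<beta> i)) * exp (- (\<Sum>j\<in>J. \<beta> j * (\<theta> j)\<^sup>2)))" for \<beta>
  have F[measurable]: "F \<in> borel_measurable ?M"
    unfolding F_def by measurable
  have "(\<integral>\<^sup>+\<beta>. g (restrict \<beta> I) * ennreal (exp (- (\<Sum>j\<in>J. \<beta> j * ((\<theta> j)\<^sup>2 - 1)))) \<partial>nu_meas W ?L)
     = (\<integral>\<^sup>+\<beta>. (if pos_def_on ?L (Hmat W \<beta>) then F \<beta> * ennreal (1 / sqrt (det_on ?L (Hmat W \<beta>))) else 0) \<partial>?M)"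
    unfolding nu_meas_def
  proof (subst nn_integral_density, goal_cases)
    case 1
    have "(\<lambda>\<beta>. \<Sum>i\<in>?L. \<Sum>j\<in>?L. Hmat W \<beta> i j) \<in> borel_measurable ?M"
      unfolding sumH by measurable
    note [measurable] = this
    show ?case by measurable
  next
    case 2
    show ?case by measurable
  next
    case 3
    show ?case
    proof (rule nn_integral_cong)
      fix \<beta>
      show "ennreal (if pos_def_on ?L (Hmat W \<beta>) then (2 / pi) powr (real (card ?L) / 2) *
             exp (- (1 / 2) * (\<Sum>i\<in>?L. \<Sum>j\<in>?L. Hmat W \<beta> i j)) / sqrt (det_on ?L (Hmat W \<beta>)) else 0) *
            (g (restrict \<beta> I) * ennreal (exp (- (\<Sum>j\<in>J. \<beta> j * ((\<theta> j)\<^sup>2 - 1)))))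
          = (if pos_def_on ?L (Hmat W \<beta>) then F \<beta> * ennreal (1 / sqrt (det_on ?L (Hmat W \<beta>))) else 0)"
      proof (cases "pos_def_on ?L (Hmat W \<beta>)")
        case True
        have d: "det_on ?L (Hmat W \<beta>) > 0" by (rule pos_def_nonneg_sqrt_det[OF finL sym True])
        have p: "(2 / pi) powr (real (card ?L) / 2) = sqrt (2 / pi) ^ card ?L"
          by (simp add: powr_realpow[symmetric] powr_half_sqrt[symmetric] powr_powr)
        have "exp (- (1 / 2) * (\<Sum>i\<in>?L. \<Sum>j\<in>?L. Hmat W \<beta> i j)) * exp (- (\<Sum>j\<in>J. \<beta> j * ((\<theta> j)\<^sup>2 - 1)))
           = exp ((\<Sum>i\<in>?L. \<Sum>j\<in>?L. W i j) / 2) * exp (- (\<Sum>i\<in>I. \<beta> i)) * exp (- (\<Sum>j\<in>J. \<beta> j * (\<theta> j)\<^sup>2))"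
          unfolding exp_add[symmetric] sumH
          by (rule arg_cong[where f=exp]) (simp add: right_diff_distrib sum_subtractf, simp add: field_simps)
        then have "(2 / pi) powr (real (card ?L) / 2) * exp (- (1 / 2) * (\<Sum>i\<in>?L. \<Sum>j\<in>?L. Hmat W \<beta> i j)) / sqrt (det_on ?L (Hmat W \<beta>))
            * exp (- (\<Sum>j\<in>J. \<beta> j * ((\<theta> j)\<^sup>2 - 1)))
           = (C * exp (- (\<Sum>i\<in>I. \<beta> i)) * exp (- (\<Sum>j\<in>J. \<beta> j * (\<theta> j)\<^sup>2))) * (1 / sqrt (det_on ?L (Hmat W \<beta>)))"
          unfolding p C_def by (simp add: mult.assoc)
        then have "ennreal ((2 / pi) powr (real (card ?L) / 2) * exp (- (1 / 2) * (\<Sum>i\<in>?L. \<Sum>j\<in>?L. Hmat W \<beta> i j)) / sqrt (det_on ?L (Hmat W \<beta>)))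
            * ennreal (exp (- (\<Sum>j\<in>J. \<beta> j * ((\<theta> j)\<^sup>2 - 1))))
           = ennreal (C * exp (- (\<Sum>i\<in>I. \<beta> i)) * exp (- (\<Sum>j\<in>J. \<beta> j * (\<theta> j)\<^sup>2))) * ennreal (1 / sqrt (det_on ?L (Hmat W \<beta>)))"
          using d C by (subst (1 2) ennreal_mult[symmetric]) auto
        then show ?thesis unfolding if_P[OF True] F_def
          by (metis (no_types, lifting) mult.assoc mult.commute)
      qed simp
    qed
  qed
  also have "\<dots> = (\<integral>\<^sup>+x. (if pos_def_on I (Hmat W x) then ennreal (1 / sqrt (det_on I (Hmat W x))) *
        (\<integral>\<^sup>+y. (if pos_def_on J (Hmat (WJ W I J x) y)
            then F (merge I J (x, y)) * ennreal (1 / sqrt (det_on J (Hmat (WJ W I J x) y))) else 0) \<partial>PiM J (\<lambda>_. lborel))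
        else 0) \<partial>PiM I (\<lambda>_. lborel))"
    by (rule nn_integral_pos_def_Un[OF fin sym F])
  also have "\<dots> = (\<integral>\<^sup>+x. (if pos_def_on I (Hmat W x) then g x *
         ennreal (sqrt (2 / pi) ^ card I * exp ((\<Sum>i\<in>?L. \<Sum>j\<in>?L. W i j) / 2 - (\<Sum>i\<in>I. x i)
            - (\<Sum>i\<in>J. \<Sum>j\<in>J. \<theta> i * WJ W I J x i j * \<theta> j) / 2) / (sqrt (det_on I (Hmat W x)) * (\<Prod>j\<in>J. \<theta> j)))
        else 0) \<partial>PiM I (\<lambda>_. lborel))"
  proof (rule nn_integral_cong, rule if_cong[OF refl _ refl])
    fix x :: "'v \<Rightarrow> real"
    assume xs: "x \<in> space (PiM I (\<lambda>_. lborel))" and pd: "pos_def_on I (Hmat W x)"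
    let ?W = "WJ W I J x"
    have sW: "\<And>i j. ?W i j = ?W j i" by (rule WJ_sym[OF fin(1) sym fin(3) pd])
    have nW: "\<And>i j. ?W i j \<ge> 0" by (rule WJ_nonneg[OF fin(1) sym nn pd])
    have dI: "det_on I (Hmat W x) > 0" by (rule pos_def_nonneg_sqrt_det[OF fin(1) sym pd])
    define c where "c = C * exp (- (\<Sum>i\<in>I. x i))"
    have c: "c \<ge> 0" using C by (simp add: c_def)
    let ?E = "\<lambda>y. (if pos_def_on J (Hmat ?W y)
          then ennreal (exp (- (\<Sum>j\<in>J. y j * (\<theta> j)\<^sup>2)) / sqrt (det_on J (Hmat ?W y))) else 0)"
    have mE: "?E \<in> borel_measurable (PiM J (\<lambda>_. lborel))"
      by (rule measurable_pos_def_weight[OF fin(2) sW measurable_laplace_weight])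
    have "(\<integral>\<^sup>+y. (if pos_def_on J (Hmat ?W y)
            then F (merge I J (x, y)) * ennreal (1 / sqrt (det_on J (Hmat ?W y))) else 0) \<partial>PiM J (\<lambda>_. lborel))
       = (\<integral>\<^sup>+y. g x * ennreal c * ?E y \<partial>PiM J (\<lambda>_. lborel))"
    proof (rule nn_integral_cong)
      fix y
      have rm: "restrict (merge I J (x, y)) I = x"
        using xs by (auto simp: merge_def space_PiM PiE_def extensional_def fun_eq_iff)
      have "F (merge I J (x, y)) = g x * ennreal (c * exp (- (\<Sum>j\<in>J. y j * (\<theta> j)\<^sup>2)))"
      proof -
        have "(\<Sum>i\<in>I. merge I J (x, y) i) = (\<Sum>i\<in>I. x i)" by (intro sum.cong) (auto simp: merge_def)
        moreover have "(\<Sum>j\<in>J. merge I J (x, y) j * (\<theta> j)\<^sup>2) = (\<Sum>j\<in>J. y j * (\<theta> j)\<^sup>2)"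
          using fin(3) by (intro sum.cong) (auto simp: merge_def)
        ultimately show ?thesis unfolding F_def rm c_def by (simp only:)
      qed
      moreover have "ennreal (c * exp (- (\<Sum>j\<in>J. y j * (\<theta> j)\<^sup>2))) * ennreal (1 / sqrt (det_on J (Hmat ?W y)))
          = ennreal c * ennreal (exp (- (\<Sum>j\<in>J. y j * (\<theta> j)\<^sup>2)) / sqrt (det_on J (Hmat ?W y)))"
        if "pos_def_on J (Hmat ?W y)"
        using pos_def_nonneg_sqrt_det[OF fin(2) sW that] c by (subst (1 2) ennreal_mult[symmetric]) auto
      ultimately show "(if pos_def_on J (Hmat ?W y)
            then F (merge I J (x, y)) * ennreal (1 / sqrt (det_on J (Hmat ?W y))) else 0) = g x * ennreal c * ?E y"
        by (simp add: mult.assoc)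
    qed
    also have "\<dots> = g x * ennreal c * (\<integral>\<^sup>+y. ?E y \<partial>PiM J (\<lambda>_. lborel))"
      by (rule nn_integral_cmult[OF mE])
    also have "(\<integral>\<^sup>+y. ?E y \<partial>PiM J (\<lambda>_. lborel))
       = ennreal (sqrt (pi / 2) ^ card J * exp (- (\<Sum>i\<in>J. \<Sum>j\<in>J. \<theta> i * ?W i j * \<theta> j) / 2) / (\<Prod>i\<in>J. \<theta> i))"
      by (rule laplace_pos_def[OF fin(2) sW nW \<theta>])
    finally have "ennreal (1 / sqrt (det_on I (Hmat W x))) *
        (\<integral>\<^sup>+y. (if pos_def_on J (Hmat (WJ W I J x) y)
            then F (merge I J (x, y)) * ennreal (1 / sqrt (det_on J (Hmat (WJ W I J x) y))) else 0) \<partial>PiM J (\<lambda>_. lborel))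
      = g x * (ennreal (1 / sqrt (det_on I (Hmat W x))) * (ennreal c *
        ennreal (sqrt (pi / 2) ^ card J * exp (- (\<Sum>i\<in>J. \<Sum>j\<in>J. \<theta> i * ?W i j * \<theta> j) / 2) / (\<Prod>i\<in>J. \<theta> i))))"
      by (simp only: mult_ac)
    also have "ennreal (1 / sqrt (det_on I (Hmat W x))) * (ennreal c *
        ennreal (sqrt (pi / 2) ^ card J * exp (- (\<Sum>i\<in>J. \<Sum>j\<in>J. \<theta> i * ?W i j * \<theta> j) / 2) / (\<Prod>i\<in>J. \<theta> i)))
      = ennreal (1 / sqrt (det_on I (Hmat W x)) * (c *
        (sqrt (pi / 2) ^ card J * exp (- (\<Sum>i\<in>J. \<Sum>j\<in>J. \<theta> i * ?W i j * \<theta> j) / 2) / (\<Prod>i\<in>J. \<theta> i))))"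
    proof -
      have "0 \<le> 1 / sqrt (det_on I (Hmat W x))" using dI by simp
      then show ?thesis by (simp only: ennreal_mult'[OF c] ennreal_mult')
    qed
    also have "1 / sqrt (det_on I (Hmat W x)) * (c *
        (sqrt (pi / 2) ^ card J * exp (- (\<Sum>i\<in>J. \<Sum>j\<in>J. \<theta> i * ?W i j * \<theta> j) / 2) / (\<Prod>i\<in>J. \<theta> i)))
      = sqrt (2 / pi) ^ card I * exp ((\<Sum>i\<in>?L. \<Sum>j\<in>?L. W i j) / 2 - (\<Sum>i\<in>I. x i)
            - (\<Sum>i\<in>J. \<Sum>j\<in>J. \<theta> i * ?W i j * \<theta> j) / 2) / (sqrt (det_on I (Hmat W x)) * (\<Prod>j\<in>J. \<theta> j))"
    proof -
      have e: "exp ((\<Sum>i\<in>?L. \<Sum>j\<in>?L. W i j) / 2 - (\<Sum>i\<in>I. x i) - (\<Sum>i\<in>J. \<Sum>j\<in>J. \<theta> i * ?W i j * \<theta> j) / 2)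
         = exp ((\<Sum>i\<in>?L. \<Sum>j\<in>?L. W i j) / 2) * exp (- (\<Sum>i\<in>I. x i)) * exp (- (\<Sum>i\<in>J. \<Sum>j\<in>J. \<theta> i * ?W i j * \<theta> j) / 2)"
        unfolding exp_add[symmetric] by simp
      \<comment> \<open>Each coordinate of \<open>J\<close> that was integrated out returns
        \<open>sqrt (pi / 2)\<close> and so uses up one normalising factor
        \<open>sqrt (2 / pi)\<close>.\<close>
      have q: "sqrt (2 / pi) ^ card ?L * sqrt (pi / 2) ^ card J = sqrt (2 / pi) ^ card I"
      proof -
        have "sqrt (2 / pi) * sqrt (pi / 2) = 1" by (simp add: real_sqrt_mult[symmetric])
        then have "sqrt (2 / pi) ^ card J * sqrt (pi / 2) ^ card J = 1"
          by (simp add: power_mult_distrib[symmetric])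
        moreover have "card ?L = card I + card J" using fin by (simp add: card_Un_disjoint)
        ultimately show ?thesis by (simp add: power_add mult.assoc)
      qed
      show ?thesis unfolding e q[symmetric] c_def C_def by simp
    qed
    finally show "ennreal (1 / sqrt (det_on I (Hmat W x))) *
        (\<integral>\<^sup>+y. (if pos_def_on J (Hmat (WJ W I J x) y)
            then F (merge I J (x, y)) * ennreal (1 / sqrt (det_on J (Hmat (WJ W I J x) y))) else 0) \<partial>PiM J (\<lambda>_. lborel))
      = g x * ennreal (sqrt (2 / pi) ^ card I * exp ((\<Sum>i\<in>?L. \<Sum>j\<in>?L. W i j) / 2 - (\<Sum>i\<in>I. x i)
            - (\<Sum>i\<in>J. \<Sum>j\<in>J. \<theta> i * ?W i j * \<theta> j) / 2) / (sqrt (det_on I (Hmat W x)) * (\<Prod>j\<in>J. \<theta> j)))" .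
  qed
  finally show ?thesis .
qed

section \<open>Excursions and effective weights\<close>

text \<open>\<open>exc W I \<beta> j M k\<close> is the total weight of the paths from \<open>k\<close> to \<open>j\<close> that make at most \<open>M\<close>
  intermediate visits, all of them in \<open>I\<close>.\<close>

fun exc :: "('v \<Rightarrow> 'v \<Rightarrow> real) \<Rightarrow> 'v set \<Rightarrow> ('v \<Rightarrow> real) \<Rightarrow> 'v \<Rightarrow> nat \<Rightarrow> 'v \<Rightarrow> real" where
  "exc W I \<beta> j 0 k = W k j / 2"
| "exc W I \<beta> j (Suc M) k = W k j / 2 + (\<Sum>m\<in>I. W k m / 2 * (exc W I \<beta> j M m / \<beta> m))"

lemma pos_def_Hmat_diag:
  assumes "finite I" "pos_def_on I (Hmat W \<beta>)" "W i i \<ge> 0" "i \<in> I"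
  shows "\<beta> i > 0"
proof -
  have "0 < (\<Sum>k\<in>I. \<Sum>l\<in>I. (if k = i then 1 else 0) * Hmat W \<beta> k l * (if l = i then 1 else 0))"
    by (rule pos_def_onD[OF assms(2,4)]) simp
  also have "\<dots> = (\<Sum>k\<in>I. if k = i then Hmat W \<beta> i i else 0)"
  proof (rule sum.cong[OF refl])
    fix k
    have "(\<Sum>l\<in>I. (if k = i then 1 else 0) * Hmat W \<beta> k l * (if l = i then 1 else 0))
       = (\<Sum>l\<in>I. if l = i then (if k = i then Hmat W \<beta> k l else 0) else 0)"
      by (intro sum.cong) auto
    also have "\<dots> = (if k = i then Hmat W \<beta> i i else 0)" using assms by simp
    finally show "(\<Sum>l\<in>I. (if k = i then 1 else 0) * Hmat W \<beta> k l * (if l = i then 1 else 0))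
       = (if k = i then Hmat W \<beta> i i else 0)" .
  qed
  also have "\<dots> = Hmat W \<beta> i i" using assms by simp
  also have "\<dots> = 2 * \<beta> i - W i i" by (simp add: Hmat_def)
  finally show ?thesis using assms(3) by simp
qed

lemma exc_nonneg:
  assumes "\<And>i j. W i j \<ge> 0" "\<And>i. i \<in> I \<Longrightarrow> \<beta> i > 0"
  shows "exc W I \<beta> j M k \<ge> 0"
  using assms by (induction M arbitrary: k) (auto intro!: add_nonneg_nonneg sum_nonneg mult_nonneg_nonneg simp: less_imp_le)

lemma exc_mono:
  assumes "\<And>i j. W i j \<ge> 0" "\<And>i. i \<in> I \<Longrightarrow> \<beta> i > 0"
  shows "exc W I \<beta> j M k \<le> exc W I \<beta> j (Suc M) k"
proof (induction M arbitrary: k)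
  case 0
  show ?case using assms by (auto intro!: sum_nonneg mult_nonneg_nonneg simp: less_imp_le)
next
  case (Suc M)
  show ?case
    unfolding exc.simps(2)[of W I \<beta> j "Suc M"] exc.simps(2)[of W I \<beta> j M]
    using assms by (intro add_left_mono sum_mono mult_left_mono divide_right_mono Suc[unfolded exc.simps(2)[symmetric]])
      (auto simp: less_imp_le Suc.IH[simplified])
qed

section \<open>Convergence of the Neumann series to the effective weights\<close>

context
  fixes W :: "'v \<Rightarrow> 'v \<Rightarrow> real" and I :: "'v set" and \<beta> :: "'v \<Rightarrow> real"
  assumes fin: "finite I" and sym: "\<And>i j. W i j = W j i" and nn: "\<And>i j. W i j \<ge> 0"
    and pd: "pos_def_on I (Hmat W \<beta>)"
begin

text \<open>Row \<open>m\<close> of \<open>Hmat\<close> times its inverse, applied to column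
  \<open>j\<close> of \<open>W\<close>, with the weights moved to the right-hand side. The result is
  a fixed-point equation of the same form as the recursion of \<open>exc\<close>.\<close>

lemma inv_on_Hmat_eq:
  assumes "m \<in> I"
  shows "2 * \<beta> m * (\<Sum>l\<in>I. inv_on I (Hmat W \<beta>) m l * W l j) = W m j + (\<Sum>n\<in>I. W m n * (\<Sum>l\<in>I. inv_on I (Hmat W \<beta>) n l * W l j))"
proof -
  let ?G = "inv_on I (Hmat W \<beta>)"
  have sH: "\<And>i j. i \<in> I \<Longrightarrow> j \<in> I \<Longrightarrow> Hmat W \<beta> i j = Hmat W \<beta> j i" using sym by (auto simp: Hmat_def)
  have "(\<Sum>n\<in>I. Hmat W \<beta> m n * (\<Sum>l\<in>I. ?G n l * W l j)) = (\<Sum>l\<in>I. (\<Sum>n\<in>I. Hmat W \<beta> m n * ?G n l) * W l j)"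
    by (simp add: sum_distrib_left sum_distrib_right mult.assoc) (rule sum.swap)
  also have "\<dots> = (\<Sum>l\<in>I. if l = m then W l j else 0)"
    using inv_on_right[OF fin sH pd assms] by (intro sum.cong) auto
  also have "\<dots> = W m j" using assms fin by simp
  finally have "(\<Sum>n\<in>I. Hmat W \<beta> m n * (\<Sum>l\<in>I. ?G n l * W l j)) = W m j" .
  moreover have "(\<Sum>n\<in>I. Hmat W \<beta> m n * (\<Sum>l\<in>I. ?G n l * W l j))
     = (\<Sum>n\<in>I. (if n = m then 2 * \<beta> m * (\<Sum>l\<in>I. ?G m l * W l j) else 0)) - (\<Sum>n\<in>I. W m n * (\<Sum>l\<in>I. ?G n l * W l j))"
    unfolding sum_subtractf[symmetric] by (intro sum.cong) (auto simp: Hmat_def left_diff_distrib)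
  ultimately show ?thesis using assms fin by simp
qed

text \<open>By induction \<open>exc\<close> divided by \<beta> stays below the solution \<psi> of
  the fixed-point equation, so the increasing sequence converges on \<open>I\<close>. Its limit
  solves the same equation, and positive definiteness makes the solution unique.\<close>

lemma exc_limit:
  "(\<lambda>M. exc W I \<beta> j M k) \<longlonglongrightarrow> (W k j + (\<Sum>m\<in>I. \<Sum>l\<in>I. W k m * inv_on I (Hmat W \<beta>) m l * W l j)) / 2"
proof -
  let ?G = "inv_on I (Hmat W \<beta>)"
  define \<psi> where "\<psi> m = (\<Sum>l\<in>I. ?G m l * W l j)" for m
  have bp: "\<beta> i > 0" if "i \<in> I" for i by (rule pos_def_Hmat_diag[OF fin pd nn that])
  have psi: "2 * \<beta> m * \<psi> m = W m j + (\<Sum>n\<in>I. W m n * \<psi> n)" if "m \<in> I" for m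
    unfolding \<psi>_def by (rule inv_on_Hmat_eq[OF that])
  have psi_nn: "\<psi> m \<ge> 0" for m
    unfolding \<psi>_def using nn inv_on_nonneg[OF fin sym nn pd] by (intro sum_nonneg mult_nonneg_nonneg)
  have le: "exc W I \<beta> j M m / \<beta> m \<le> \<psi> m" if "m \<in> I" for m M
    using that
  proof (induction M arbitrary: m)
    case 0
    have "W m j \<le> 2 * \<beta> m * \<psi> m"
      unfolding psi[OF 0] using nn psi_nn by (auto intro!: sum_nonneg mult_nonneg_nonneg)
    then show ?case using bp[OF 0] by (simp add: field_simps)
  next
    case (Suc M)
    have "W m j / 2 + (\<Sum>n\<in>I. W m n / 2 * (exc W I \<beta> j M n / \<beta> n)) \<le> W m j / 2 + (\<Sum>n\<in>I. W m n / 2 * \<psi> n)"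
      using nn by (intro add_left_mono sum_mono mult_left_mono Suc.IH) auto
    also have "\<dots> = \<beta> m * \<psi> m" using psi[OF Suc.prems] by (simp add: sum_divide_distrib[symmetric])
    finally show ?case using bp[OF Suc.prems] by (simp add: field_simps)
  qed
  define s where "s m = (SUP M. exc W I \<beta> j M m)" for m
  have lim: "(\<lambda>M. exc W I \<beta> j M m) \<longlonglongrightarrow> s m" if "m \<in> I" for m
    unfolding s_def
  proof (rule LIMSEQ_incseq_SUP)
    show "incseq (\<lambda>M. exc W I \<beta> j M m)" by (intro incseq_SucI exc_mono nn bp)
    show "bdd_above (range (\<lambda>M. exc W I \<beta> j M m))"
      using le[OF that] bp[OF that] by (intro bdd_aboveI[of _ "\<beta> m * \<psi> m"]) (auto simp: field_simps)
  qed
  have lim2: "(\<lambda>M. exc W I \<beta> j (Suc M) k) \<longlonglongrightarrow> W k j / 2 + (\<Sum>m\<in>I. W k m / 2 * (s m / \<beta> m))" for k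
    unfolding exc.simps(2) using bp by (intro tendsto_intros lim) (auto simp: less_imp_neq[symmetric] dest: bp)
  have seq: "s m = W m j / 2 + (\<Sum>n\<in>I. W m n / 2 * (s n / \<beta> n))" if "m \<in> I" for m
    by (rule LIMSEQ_unique[OF LIMSEQ_Suc[OF lim[OF that]] lim2])
  \<comment> \<open>The difference of the two solutions lies in the kernel of the \<open>I\<close>
    block of \<open>Hmat\<close>.\<close>
  have sp: "s m / \<beta> m - \<psi> m = 0" if "m \<in> I" for m
  proof (rule pos_def_on_injective[OF pd _ that])
    fix i assume i: "i \<in> I"
    have "(\<Sum>n\<in>I. Hmat W \<beta> i n * (s n / \<beta> n - \<psi> n))
       = (\<Sum>n\<in>I. (if n = i then 2 * \<beta> i * (s i / \<beta> i - \<psi> i) else 0)) - (\<Sum>n\<in>I. W i n * (s n / \<beta> n - \<psi> n))"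
      unfolding sum_subtractf[symmetric] by (intro sum.cong) (auto simp: Hmat_def left_diff_distrib)
    also have "(\<Sum>n\<in>I. (if n = i then 2 * \<beta> i * (s i / \<beta> i - \<psi> i) else 0)) = 2 * s i - 2 * \<beta> i * \<psi> i"
      using i fin bp[OF i] by (simp add: right_diff_distrib)
    also have "2 * s i = W i j + (\<Sum>n\<in>I. W i n * (s n / \<beta> n))"
      by (subst seq[OF i]) (simp add: distrib_left sum_distrib_left)
    also have "2 * \<beta> i * \<psi> i = W i j + (\<Sum>n\<in>I. W i n * \<psi> n)" by (rule psi[OF i])
    also have "W i j + (\<Sum>n\<in>I. W i n * (s n / \<beta> n)) - (W i j + (\<Sum>n\<in>I. W i n * \<psi> n)) - (\<Sum>n\<in>I. W i n * (s n / \<beta> n - \<psi> n)) = 0"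
      by (simp add: right_diff_distrib sum_subtractf)
    finally show "(\<Sum>n\<in>I. Hmat W \<beta> i n * (s n / \<beta> n - \<psi> n)) = 0" .
  qed
  have "W k j / 2 + (\<Sum>m\<in>I. W k m / 2 * (s m / \<beta> m)) = W k j / 2 + (\<Sum>m\<in>I. W k m / 2 * \<psi> m)"
    using sp by simp
  also have "\<dots> = (W k j + (\<Sum>m\<in>I. \<Sum>l\<in>I. W k m * ?G m l * W l j)) / 2"
    by (simp add: \<psi>_def add_divide_distrib sum_divide_distrib sum_distrib_left mult.assoc)
  finally show ?thesis using LIMSEQ_imp_Suc[OF lim2[of k]] by (simp only:)
qed

lemma exc_limit_WJ:
  "k \<in> J \<Longrightarrow> j \<in> J \<Longrightarrow> (\<lambda>M. exc W I \<beta> j M k) \<longlonglongrightarrow> WJ W I J \<beta> k j / 2"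
  using exc_limit[of j k] by (simp add: WJ_def)

end

text \<open>Otherwise \<open>i\<close>, together with the vertices of \<open>I\<close> where \<psi>
  is positive, would be closed under the edges of the graph, and \<open>j0\<close> could not be
  reached. Asking for \<open>j \<noteq> i\<close> makes the result serve the weights without
  diagonal as well; it guarantees that the laws on \<open>J\<close> exist.\<close>

lemma WJ_row_positive:
  assumes conn: "connected_weights L W" and L: "L = I \<union> J" "I \<inter> J = {}"
    and "i \<in> J" "j0 \<in> J" "j0 \<noteq> i" and pd: "pos_def_on I (Hmat W \<beta>)"
  shows "\<exists>j\<in>J. j \<noteq> i \<and> WJ W I J \<beta> i j > 0"
proof (rule ccontr)
  assume neg: "\<not> ?thesis"
  have fin: "finite I" "finite J" and sym: "\<And>i j. W i j = W j i" and nn: "\<And>i j. W i j \<ge> 0"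
    using conn L by (auto simp: connected_weights_def)
  let ?G = "inv_on I (Hmat W \<beta>)"
  have sH: "\<And>i j. i \<in> I \<Longrightarrow> j \<in> I \<Longrightarrow> Hmat W \<beta> i j = Hmat W \<beta> j i" using sym by (auto simp: Hmat_def)
  have Gs: "?G k l = ?G l k" for k l by (rule inv_on_sym[OF fin(1) sH pd])
  have Gn: "?G k l \<ge> 0" for k l by (rule inv_on_nonneg[OF fin(1) sym nn pd])
  define \<psi> where "\<psi> m = (\<Sum>l\<in>I. ?G m l * W l i)" for m
  have psi_nn: "\<psi> m \<ge> 0" for m unfolding \<psi>_def using nn Gn by (intro sum_nonneg mult_nonneg_nonneg)
  have psi: "2 * \<beta> m * \<psi> m = W m i + (\<Sum>n\<in>I. W m n * \<psi> n)" if "m \<in> I" for m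
    unfolding \<psi>_def by (rule inv_on_Hmat_eq[OF fin(1) sym nn pd that])
  have bp: "\<beta> i > 0" if "i \<in> I" for i by (rule pos_def_Hmat_diag[OF fin(1) pd nn that])
  have WJ0: "WJ W I J \<beta> i j = 0" if "j \<in> J" "j \<noteq> i" for j
    using neg that WJ_nonneg[OF fin(1) sym nn pd, of J i j] by force
  have WJe: "WJ W I J \<beta> i j = W i j + (\<Sum>k\<in>I. \<psi> k * W k j)" if "j \<in> J" for j
  proof -
    have "(\<Sum>k\<in>I. \<Sum>l\<in>I. W i k * ?G k l * W l j) = (\<Sum>l\<in>I. \<Sum>k\<in>I. ?G l k * W k i * W l j)"
      by (subst sum.swap) (intro sum.cong refl, simp add: Gs sym)
    then show ?thesis using that \<open>i \<in> J\<close> by (simp add: WJ_def \<psi>_def sum_distrib_right)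
  qed
  define R where "R = insert i {k \<in> I. \<psi> k > 0}"
  have closed: "b \<in> R" if a: "a \<in> R" and ab: "W a b > 0" "b \<in> L" for a b
  proof (cases "b \<in> I")
    case True
    have "0 < 2 * \<beta> b * \<psi> b"
    proof (cases "a = i")
      case a: True
      then have "0 < W b i" using ab sym by metis
      moreover have "0 \<le> (\<Sum>n\<in>I. W b n * \<psi> n)" using nn psi_nn by (intro sum_nonneg mult_nonneg_nonneg)
      ultimately show ?thesis unfolding psi[OF True] by linarith
    next
      case False
      then have a: "a \<in> I" "\<psi> a > 0" using a by (auto simp: R_def)
      have "0 < W b a * \<psi> a" using ab a sym by (metis mult_pos_pos)
      also have "\<dots> \<le> (\<Sum>n\<in>I. W b n * \<psi> n)"
        using a fin nn psi_nn by (intro member_le_sum) auto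
      finally show ?thesis unfolding psi[OF True] using nn[of b i] by linarith
    qed
    then show ?thesis using True bp[OF True] by (simp add: R_def zero_less_mult_iff)
  next
    case False
    then have b: "b \<in> J" using ab L by auto
    show ?thesis
    proof (cases "b = i")
      case False
      have "0 \<le> (\<Sum>k\<in>I. \<psi> k * W k b)" using nn psi_nn by (intro sum_nonneg mult_nonneg_nonneg)
      with WJ0[OF b False] WJe[OF b] nn[of i b] have z: "W i b = 0" "(\<Sum>k\<in>I. \<psi> k * W k b) = 0" by linarith+
      then have "a \<noteq> i" using ab by auto
      then have a: "a \<in> I" "\<psi> a > 0" using a by (auto simp: R_def)
      have "0 < \<psi> a * W a b" using ab a by simp
      also have "\<dots> \<le> (\<Sum>k\<in>I. \<psi> k * W k b)" using a fin nn psi_nn by (intro member_le_sum) auto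
      finally show ?thesis using z by simp
    qed (simp add: R_def)
  qed
  have "(i, j0) \<in> {(a, b). a \<in> L \<and> b \<in> L \<and> W a b > 0}\<^sup>*"
    using conn assms by (auto simp: connected_weights_def)
  then have "j0 \<in> R"
  proof (induction rule: rtrancl_induct)
    case base
    show ?case by (simp add: R_def)
  next
    case (step y z)
    then show ?case using closed[of y z] by simp
  qed
  then show False using assms by (auto simp: R_def)
qed

lemma measurable_exc: "(\<lambda>\<beta>. exc W I \<beta> j M k) \<in> borel_measurable (PiM I (\<lambda>_. lborel))"
proof (induction M arbitrary: k)
  case (Suc M)
  note [measurable] = Suc
  show ?case unfolding exc.simps by measurable
qed simp

text \<open>A measurable version of \<open>W\<^sup>J\<close>.\<close>

definition WJlim :: "('v \<Rightarrow> 'v \<Rightarrow> real) \<Rightarrow> 'v set \<Rightarrow> 'v set \<Rightarrow> ('v \<Rightarrow> real) \<Rightarrow> 'v \<Rightarrow> 'v \<Rightarrow> real" where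
  "WJlim W I J \<beta> i j = (if i \<in> J \<and> j \<in> J then 2 * lim (\<lambda>M. exc W I \<beta> j M i) else 0)"

lemma measurable_WJlim: "(\<lambda>\<beta>. WJlim W I J \<beta> i j) \<in> borel_measurable (PiM I (\<lambda>_. lborel))"
proof -
  have "(\<lambda>\<beta>. lim (\<lambda>M. exc W I \<beta> j M i)) \<in> borel_measurable (PiM I (\<lambda>_. lborel))"
    by (rule borel_measurable_lim_metric[OF measurable_exc])
  then show ?thesis unfolding WJlim_def by (cases "i \<in> J \<and> j \<in> J") auto
qed

lemma WJlim_eq:
  assumes "finite I" "\<And>i j. W i j = W j i" "\<And>i j. W i j \<ge> 0" "pos_def_on I (Hmat W \<beta>)"
  shows "WJlim W I J \<beta> = WJ W I J \<beta>"
proof (intro ext)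
  fix i j
  show "WJlim W I J \<beta> i j = WJ W I J \<beta> i j"
  proof (cases "i \<in> J \<and> j \<in> J")
    case True
    then have "lim (\<lambda>M. exc W I \<beta> j M i) = WJ W I J \<beta> i j / 2"
      by (intro limI exc_limit_WJ assms) auto
    then show ?thesis using True by (simp add: WJlim_def)
  qed (auto simp: WJlim_def WJ_def)
qed

section \<open>Marginal and conditional laws of \<open>\<beta>\<close>\<close>

definition wquad :: "('v \<Rightarrow> 'v \<Rightarrow> real) \<Rightarrow> 'v set \<Rightarrow> ('v \<Rightarrow> real) \<Rightarrow> real" where
  "wquad W S \<theta> = (\<Sum>i\<in>S. \<Sum>j\<in>S. \<theta> i * W i j * \<theta> j)"

text \<open>The closed form of the Laplace transform of \<nu> at \<open>l\<close>, by
  \<open>nn_integral_nu_meas_laplace\<close> below, with \<open>sqrt (1 + l i)\<close> in the role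
  of \<theta>. In path densities \<open>l\<close> is the vector of local times.\<close>

definition vrjp_weight :: "('v \<Rightarrow> 'v \<Rightarrow> real) \<Rightarrow> 'v set \<Rightarrow> ('v \<Rightarrow> real) \<Rightarrow> real" where
  "vrjp_weight W S l = exp (wquad W S (\<lambda>_. 1) / 2 - wquad W S (\<lambda>i. sqrt (1 + l i)) / 2) / (\<Prod>i\<in>S. sqrt (1 + l i))"

lemma sets_nu_meas [measurable_cong]: "sets (nu_meas W L) = sets (PiM L (\<lambda>_. borel))"
  unfolding nu_meas_def sets_density by (intro sets_PiM_cong) auto

lemma AE_nu_meas_pos_def:
  assumes "finite I" "finite J" "I \<inter> J = {}" "\<And>i j. W i j = W j i"
  shows "AE \<beta> in nu_meas W (I \<union> J). pos_def_on I (Hmat W \<beta>)"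
proof -
  let ?L = "I \<union> J"
  have fin: "finite ?L" using assms by simp
  have m: "(\<lambda>\<beta>. ennreal (if pos_def_on ?L (Hmat W \<beta>)
                   then (2 / pi) powr (real (card ?L) / 2)
                        * exp (- (1/2) * (\<Sum>i\<in>?L. \<Sum>j\<in>?L. Hmat W \<beta> i j))
                        / sqrt (det_on ?L (Hmat W \<beta>))
                   else 0)) \<in> borel_measurable (PiM ?L (\<lambda>_. lborel))"
  proof -
    have "(\<lambda>\<beta>. \<Sum>i\<in>?L. \<Sum>j\<in>?L. Hmat W \<beta> i j) \<in> borel_measurable (PiM ?L (\<lambda>_. lborel))"
      by (intro borel_measurable_sum measurable_Hmat)
    note [measurable] = this pred_pos_def_Hmat[OF fin assms(4)] measurable_det_Hmat[OF fin]
    show ?thesis by measurable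
  qed
  show ?thesis
    unfolding nu_meas_def AE_density[OF m]
  proof (rule AE_I2, intro impI)
    fix \<beta> assume "0 < ennreal (if pos_def_on ?L (Hmat W \<beta>)
                   then (2 / pi) powr (real (card ?L) / 2)
                        * exp (- (1/2) * (\<Sum>i\<in>?L. \<Sum>j\<in>?L. Hmat W \<beta> i j))
                        / sqrt (det_on ?L (Hmat W \<beta>))
                   else 0)"
    then have "pos_def_on ?L (Hmat W \<beta>)" by (auto split: if_splits)
    then show "pos_def_on I (Hmat W \<beta>)"
      using pos_def_on_Un[OF assms(1-3), of "Hmat W \<beta>"] assms(4) by (auto simp: Hmat_def)
  qed
qed

text \<open>The block formula with empty first block, where \<open>WJ\<close> is \<open>W\<close>
  itself and the outer integral is over a single point.\<close>

lemma nn_integral_nu_meas_laplace: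
  fixes W :: "'v \<Rightarrow> 'v \<Rightarrow> real"
  assumes fin: "finite L" and sym: "\<And>i j. W i j = W j i" and nn: "\<And>i j. W i j \<ge> 0"
    and l: "\<And>j. j \<in> L \<Longrightarrow> l j \<ge> 0"
  shows "(\<integral>\<^sup>+\<beta>. ennreal (exp (- (\<Sum>j\<in>L. \<beta> j * l j))) \<partial>nu_meas W L) = ennreal (vrjp_weight W L l)"
proof -
  have e: "exp (- (\<Sum>j\<in>L. \<beta> j * l j)) = exp (- (\<Sum>j\<in>L. \<beta> j * ((sqrt (1 + l j))\<^sup>2 - 1)))" for \<beta>
    using l by (intro arg_cong[where f=exp] arg_cong[where f=uminus] sum.cong) auto
  have WJ: "WJ W {} L (\<lambda>x. undefined) i j = W i j" if "i \<in> L" "j \<in> L" for i j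
    using that by (simp add: WJ_def)
  have "(\<integral>\<^sup>+\<beta>. ennreal (exp (- (\<Sum>j\<in>L. \<beta> j * l j))) \<partial>nu_meas W L)
    = (\<integral>\<^sup>+\<beta>. (\<lambda>_. 1) (restrict \<beta> {}) * ennreal (exp (- (\<Sum>j\<in>L. \<beta> j * ((sqrt (1 + l j))\<^sup>2 - 1)))) \<partial>nu_meas W ({} \<union> L))"
    by (simp only: e Un_empty_left mult_1)
  also have "\<dots> = ennreal (vrjp_weight W L l)"
    using l WJ by (subst nn_integral_nu_meas_block[OF _ fin _ sym nn])
       (auto simp: lborel_prod.nn_integral_empty vrjp_weight_def wquad_def intro: add_pos_nonneg cong: sum.cong)
  finally show ?thesis .
qed

text \<open>The total mass is the Laplace transform at 0.\<close>

lemma prob_space_nu_meas: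
  assumes "finite L" "\<And>i j. W i j = W j i" "\<And>i j. W i j \<ge> 0"
  shows "prob_space (nu_meas W L)"
proof
  have "emeasure (nu_meas W L) (space (nu_meas W L)) = (\<integral>\<^sup>+\<beta>. ennreal (exp (- (\<Sum>j\<in>L. \<beta> j * 0))) \<partial>nu_meas W L)"
    by simp
  also have "\<dots> = ennreal (vrjp_weight W L (\<lambda>_. 0))"
    by (rule nn_integral_nu_meas_laplace[OF assms]) simp
  also have "\<dots> = 1" by (simp add: vrjp_weight_def)
  finally show "emeasure (nu_meas W L) (space (nu_meas W L)) = 1" .
qed

text \<open>Conditionally on \<open>\<beta>\<^sub>I\<close>, the vector \<open>\<beta>\<^sub>J\<close> has the law \<open>\<nu>\<close> with weights \<open>W\<^sup>J(\<beta>\<^sub>I)\<close>.\<close>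

lemma nn_integral_nu_meas_tilt:
  fixes W :: "'v \<Rightarrow> 'v \<Rightarrow> real"
  assumes fin: "finite I" "finite J" "I \<inter> J = {}" and sym: "\<And>i j. W i j = W j i" and nn: "\<And>i j. W i j \<ge> 0"
    and g: "g \<in> borel_measurable (PiM I (\<lambda>_. lborel))" and l: "\<And>j. j \<in> J \<Longrightarrow> l j \<ge> 0"
  shows "(\<integral>\<^sup>+\<beta>. g (restrict \<beta> I) * ennreal (exp (- (\<Sum>j\<in>J. \<beta> j * l j))) \<partial>nu_meas W (I \<union> J))
    = (\<integral>\<^sup>+\<beta>. g (restrict \<beta> I) * ennreal (vrjp_weight (WJlim W I J (restrict \<beta> I)) J l) \<partial>nu_meas W (I \<union> J))"
proof -
  \<comment> \<open>The block formula is used twice, with \<open>\<theta> j = sqrt (1 + l j)\<close>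
    and, read backwards, with \<theta> equal to 1; \<open>vrjp_weight\<close> is the quotient of the
    two integrands over \<open>I\<close>. \<open>WJlim\<close> stands in for \<open>WJ\<close>
    because \<open>h\<close> has to be measurable also where \<open>Hmat\<close> is not positive
    definite.\<close>
  define h where "h x = g x * ennreal (vrjp_weight (WJlim W I J x) J l)" for x
  note [measurable] = measurable_WJlim g
  have h: "h \<in> borel_measurable (PiM I (\<lambda>_. lborel))"
    unfolding h_def vrjp_weight_def wquad_def by measurable
  have e: "exp (- (\<Sum>j\<in>J. \<beta> j * l j)) = exp (- (\<Sum>j\<in>J. \<beta> j * ((sqrt (1 + l j))\<^sup>2 - 1)))" for \<beta>
    using l by (intro arg_cong[where f=exp] arg_cong[where f=uminus] sum.cong) auto
  have sp: "sqrt (1 + l j) > 0" if "j \<in> J" for j using l[OF that] by simp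
  have pp: "(\<Prod>j\<in>J. sqrt (1 + l j)) > 0" by (intro prod_pos ballI sp)
  have "(\<integral>\<^sup>+\<beta>. g (restrict \<beta> I) * ennreal (exp (- (\<Sum>j\<in>J. \<beta> j * l j))) \<partial>nu_meas W (I \<union> J))
     = (\<integral>\<^sup>+x. (if pos_def_on I (Hmat W x) then g x *
         ennreal (sqrt (2 / pi) ^ card I * exp ((\<Sum>i\<in>I\<union>J. \<Sum>j\<in>I\<union>J. W i j) / 2 - (\<Sum>i\<in>I. x i)
            - (\<Sum>i\<in>J. \<Sum>j\<in>J. sqrt (1 + l i) * WJ W I J x i j * sqrt (1 + l j)) / 2) / (sqrt (det_on I (Hmat W x)) * (\<Prod>j\<in>J. sqrt (1 + l j))))
        else 0) \<partial>PiM I (\<lambda>_. lborel))"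
    unfolding e by (rule nn_integral_nu_meas_block[OF fin sym nn g sp])
  also have "\<dots> = (\<integral>\<^sup>+x. (if pos_def_on I (Hmat W x) then h x *
         ennreal (sqrt (2 / pi) ^ card I * exp ((\<Sum>i\<in>I\<union>J. \<Sum>j\<in>I\<union>J. W i j) / 2 - (\<Sum>i\<in>I. x i)
            - (\<Sum>i\<in>J. \<Sum>j\<in>J. 1 * WJ W I J x i j * 1) / 2) / (sqrt (det_on I (Hmat W x)) * (\<Prod>j\<in>J. 1)))
        else 0) \<partial>PiM I (\<lambda>_. lborel))"
  proof (rule nn_integral_cong, rule if_cong[OF refl _ refl])
    fix x :: "'v \<Rightarrow> real"
    assume pd: "pos_def_on I (Hmat W x)"
    have d: "det_on I (Hmat W x) > 0" by (rule pos_def_nonneg_sqrt_det[OF fin(1) sym pd])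
    define q where "q = wquad (WJ W I J x) J (\<lambda>i. sqrt (1 + l i))"
    define q1 where "q1 = wquad (WJ W I J x) J (\<lambda>_. 1)"
    define c where "c = (\<Sum>i\<in>I\<union>J. \<Sum>j\<in>I\<union>J. W i j) / 2 - (\<Sum>i\<in>I. x i)"
    define p where "p = (\<Prod>j\<in>J. sqrt (1 + l j))"
    have hx: "h x = g x * ennreal (exp (q1 / 2 - q / 2) / p)"
      by (simp only: h_def WJlim_eq[OF fin(1) sym nn pd] vrjp_weight_def q_def q1_def p_def)
    have "exp (c - q / 2) = exp (q1 / 2 - q / 2) * exp (c - q1 / 2)" by (simp add: exp_add[symmetric])
    then have "sqrt (2 / pi) ^ card I * exp (c - q / 2) / (sqrt (det_on I (Hmat W x)) * p)
      = (exp (q1 / 2 - q / 2) / p) * (sqrt (2 / pi) ^ card I * exp (c - q1 / 2) / (sqrt (det_on I (Hmat W x)) * 1))"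
      by (simp add: mult_ac)
    then have "ennreal (sqrt (2 / pi) ^ card I * exp (c - q / 2) / (sqrt (det_on I (Hmat W x)) * p))
      = ennreal (exp (q1 / 2 - q / 2) / p) * ennreal (sqrt (2 / pi) ^ card I * exp (c - q1 / 2) / (sqrt (det_on I (Hmat W x)) * 1))"
      using d pp by (simp only: p_def[symmetric]) (rule ennreal_mult, auto)
    then show "g x * ennreal (sqrt (2 / pi) ^ card I * exp ((\<Sum>i\<in>I\<union>J. \<Sum>j\<in>I\<union>J. W i j) / 2 - (\<Sum>i\<in>I. x i)
            - (\<Sum>i\<in>J. \<Sum>j\<in>J. sqrt (1 + l i) * WJ W I J x i j * sqrt (1 + l j)) / 2) / (sqrt (det_on I (Hmat W x)) * (\<Prod>j\<in>J. sqrt (1 + l j))))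
       = h x * ennreal (sqrt (2 / pi) ^ card I * exp ((\<Sum>i\<in>I\<union>J. \<Sum>j\<in>I\<union>J. W i j) / 2 - (\<Sum>i\<in>I. x i)
            - (\<Sum>i\<in>J. \<Sum>j\<in>J. 1 * WJ W I J x i j * 1) / 2) / (sqrt (det_on I (Hmat W x)) * (\<Prod>j\<in>J. 1)))"
      unfolding c_def[symmetric] p_def[symmetric] hx q_def[unfolded wquad_def, symmetric] q1_def[unfolded wquad_def, symmetric]
      by (simp only: prod.neutral_const mult.assoc)
  qed
  also have "\<dots> = (\<integral>\<^sup>+\<beta>. h (restrict \<beta> I) * ennreal (exp (- (\<Sum>j\<in>J. \<beta> j * (1\<^sup>2 - 1)))) \<partial>nu_meas W (I \<union> J))"
    by (rule nn_integral_nu_meas_block[OF fin sym nn h, symmetric]) simp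
  finally show ?thesis by (simp add: h_def)
qed

text \<open>With \<theta> equal to 1 the block formula gives the marginal density on
  \<open>I\<close>. The effective weights enter it only through the sum of all their entries, so
  collapsing \<open>J\<close> to one vertex with the same row sums \<open>\<eta>\<close> leaves it
  unchanged.\<close>

lemma nn_integral_nu_meas_What:
  fixes W :: "'v \<Rightarrow> 'v \<Rightarrow> real"
  assumes fin: "finite I" "finite J" "I \<inter> J = {}" and sym: "\<And>i j. W i j = W j i" and nn: "\<And>i j. W i j \<ge> 0"
    and g: "g \<in> borel_measurable (PiM I (\<lambda>_. lborel))" and \<rho>: "\<rho> \<in> J"
  shows "(\<integral>\<^sup>+\<beta>. g (restrict \<beta> I) \<partial>nu_meas (What W I J \<rho>) (insert \<rho> I)) = (\<integral>\<^sup>+\<beta>. g (restrict \<beta> I) \<partial>nu_meas W (I \<union> J))"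
proof -
  let ?V = "What W I J \<rho>"
  have rI: "\<rho> \<notin> I" using fin(3) \<rho> by auto
  have sV: "?V i j = ?V j i" for i j
  proof -
    consider "i \<in> I" "j \<in> I" | "i \<in> I" "j \<notin> I" | "i \<notin> I" "j \<in> I" | "i \<notin> I" "j \<notin> I" by blast
    then show ?thesis
    proof cases
      case 1
      then show ?thesis unfolding What_def by (simp only: simp_thms if_True) (rule sym)
    qed (simp_all add: What_def rI)
  qed
  have nV: "?V i j \<ge> 0" for i j
    unfolding What_def by (simp add: nn sum_nonneg)
  define \<eta> where "\<eta> i = (\<Sum>k\<in>J. W i k)" for i
  have blk: "(\<integral>\<^sup>+\<beta>. g (restrict \<beta> I) \<partial>nu_meas U (I \<union> K))
     = (\<integral>\<^sup>+x. (if pos_def_on I (Hmat U x) then g x *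
         ennreal (sqrt (2 / pi) ^ card I * exp ((\<Sum>i\<in>I\<union>K. \<Sum>j\<in>I\<union>K. U i j) / 2 - (\<Sum>i\<in>I. x i)
            - (\<Sum>i\<in>K. \<Sum>j\<in>K. WJ U I K x i j) / 2) / sqrt (det_on I (Hmat U x)))
        else 0) \<partial>PiM I (\<lambda>_. lborel))"
    if "finite K" "I \<inter> K = {}" "\<And>i j. U i j = U j i" "\<And>i j. U i j \<ge> 0" for U K
    using nn_integral_nu_meas_block[where \<theta> = "\<lambda>_. 1" and W = U and I = I and J = K,
      OF fin(1) that(1,2) that(3) that(4) g] by (simp cong: if_cong)
  have VI: "?V i j = W i j" if "i \<in> I" "j \<in> I" for i j using that by (simp add: What_def)
  have V\<rho>: "?V i \<rho> = \<eta> i" "?V \<rho> i = \<eta> i" if "i \<in> I" for i using that rI by (auto simp: What_def \<eta>_def)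
  have V\<rho>\<rho>: "?V \<rho> \<rho> = 0" using rI by (simp add: What_def)
  have H: "Hmat ?V x i j = Hmat W x i j" if "i \<in> I" "j \<in> I" for x i j using VI that by (simp add: Hmat_def)
  have pdV: "pos_def_on I (Hmat ?V x) = pos_def_on I (Hmat W x)" for x by (intro pos_def_on_cong H)
  have detV: "det_on I (Hmat ?V x) = det_on I (Hmat W x)" for x by (intro det_on_cong H)
  have invV: "inv_on I (Hmat ?V x) = inv_on I (Hmat W x)" for x by (intro inv_on_cong H)
  \<comment> \<open>The weights inside \<open>J\<close> occur once in the total sum of
    \<open>W\<close> and once in that of \<open>WJ\<close>, with opposite signs, and cancel; for the
    collapsed weights the corresponding entry is 0. Both sides reduce to the weights inside
    \<open>I\<close>, the sum of \<open>\<eta>\<close> and the quadratic form \<open>q\<close> in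
    \<open>\<eta>\<close>.\<close>
  have ex: "(\<Sum>i\<in>I\<union>{\<rho>}. \<Sum>j\<in>I\<union>{\<rho>}. ?V i j) / 2 - (\<Sum>i\<in>I. x i) - (\<Sum>i\<in>{\<rho>}. \<Sum>j\<in>{\<rho>}. WJ ?V I {\<rho>} x i j) / 2
     = (\<Sum>i\<in>I\<union>J. \<Sum>j\<in>I\<union>J. W i j) / 2 - (\<Sum>i\<in>I. x i) - (\<Sum>i\<in>J. \<Sum>j\<in>J. WJ W I J x i j) / 2" for x
  proof -
    let ?G = "inv_on I (Hmat W x)"
    define q where "q = (\<Sum>k\<in>I. \<Sum>l\<in>I. \<eta> k * ?G k l * \<eta> l)"
    have 1: "(\<Sum>i\<in>I\<union>{\<rho>}. \<Sum>j\<in>I\<union>{\<rho>}. ?V i j) = (\<Sum>i\<in>I. \<Sum>j\<in>I. W i j) + 2 * (\<Sum>i\<in>I. \<eta> i)"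
      using fin(1) rI by (simp add: sum.distrib VI V\<rho> V\<rho>\<rho>)
    have 2: "(\<Sum>i\<in>{\<rho>}. \<Sum>j\<in>{\<rho>}. WJ ?V I {\<rho>} x i j) = q"
      by (simp add: WJ_def invV V\<rho> V\<rho>\<rho> q_def)
    have "(\<Sum>i\<in>I\<union>J. \<Sum>j\<in>I\<union>J. W i j) = (\<Sum>i\<in>I. \<Sum>j\<in>I. W i j) + (\<Sum>i\<in>I. \<eta> i) + ((\<Sum>i\<in>J. \<Sum>j\<in>I. W i j) + (\<Sum>i\<in>J. \<Sum>j\<in>J. W i j))"
      using fin by (simp add: sum.union_disjoint sum.distrib \<eta>_def)
    moreover have "(\<Sum>i\<in>J. \<Sum>j\<in>I. W i j) = (\<Sum>i\<in>I. \<eta> i)"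
      unfolding \<eta>_def by (subst sum.swap) (simp add: sym)
    ultimately have 3: "(\<Sum>i\<in>I\<union>J. \<Sum>j\<in>I\<union>J. W i j) = (\<Sum>i\<in>I. \<Sum>j\<in>I. W i j) + 2 * (\<Sum>i\<in>I. \<eta> i) + (\<Sum>i\<in>J. \<Sum>j\<in>J. W i j)"
      by simp
    have "(\<Sum>i\<in>J. \<Sum>j\<in>J. \<Sum>k\<in>I. \<Sum>l\<in>I. W i k * ?G k l * W l j) = (\<Sum>k\<in>I. \<Sum>l\<in>I. \<Sum>i\<in>J. \<Sum>j\<in>J. W i k * ?G k l * W l j)"
    proof -
      have "(\<Sum>i\<in>J. \<Sum>j\<in>J. \<Sum>k\<in>I. \<Sum>l\<in>I. W i k * ?G k l * W l j) = (\<Sum>i\<in>J. \<Sum>k\<in>I. \<Sum>j\<in>J. \<Sum>l\<in>I. W i k * ?G k l * W l j)"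
        by (intro sum.cong refl sum.swap)
      also have "\<dots> = (\<Sum>k\<in>I. \<Sum>i\<in>J. \<Sum>j\<in>J. \<Sum>l\<in>I. W i k * ?G k l * W l j)" by (rule sum.swap)
      also have "\<dots> = (\<Sum>k\<in>I. \<Sum>i\<in>J. \<Sum>l\<in>I. \<Sum>j\<in>J. W i k * ?G k l * W l j)" by (intro sum.cong refl sum.swap)
      also have "\<dots> = (\<Sum>k\<in>I. \<Sum>l\<in>I. \<Sum>i\<in>J. \<Sum>j\<in>J. W i k * ?G k l * W l j)" by (intro sum.cong refl sum.swap)
      finally show ?thesis .
    qed
    also have "\<dots> = q"
    proof (unfold q_def, intro sum.cong refl)
      fix k l
      have "\<eta> k * ?G k l * \<eta> l = (\<Sum>i\<in>J. W i k) * ?G k l * (\<Sum>j\<in>J. W l j)" by (simp add: \<eta>_def sym)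
      also have "\<dots> = (\<Sum>i\<in>J. \<Sum>j\<in>J. W i k * ?G k l * W l j)"
        by (simp add: sum_distrib_left sum_distrib_right) (rule sum.swap)
      finally show "(\<Sum>i\<in>J. \<Sum>j\<in>J. W i k * ?G k l * W l j) = \<eta> k * ?G k l * \<eta> l" by simp
    qed
    finally have 4: "(\<Sum>i\<in>J. \<Sum>j\<in>J. WJ W I J x i j) = (\<Sum>i\<in>J. \<Sum>j\<in>J. W i j) + q"
      by (simp add: WJ_def sum.distrib)
    show ?thesis unfolding 1 2 3 4 by (simp add: field_simps)
  qed
  have "(\<integral>\<^sup>+\<beta>. g (restrict \<beta> I) \<partial>nu_meas ?V (insert \<rho> I)) = (\<integral>\<^sup>+\<beta>. g (restrict \<beta> I) \<partial>nu_meas ?V (I \<union> {\<rho>}))"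
    by simp
  also have "\<dots> = (\<integral>\<^sup>+\<beta>. g (restrict \<beta> I) \<partial>nu_meas W (I \<union> J))"
    by (subst blk[OF _ _ sV nV], simp, simp add: rI, subst blk[OF fin(2,3) sym nn], unfold ex pdV detV, rule refl)
  finally show ?thesis .
qed

section \<open>Path densities\<close>

lemma loc_time_0 [simp]: "loc_time x t 0 = (\<lambda>_. 0)"
  by (simp add: loc_time_def fun_eq_iff)

lemma loc_time_Suc: "loc_time x t (Suc k) v = loc_time x t k v + (if x k = v then t k else 0)"
  by (simp add: loc_time_def)

lemma loc_time_nonneg: "(\<And>k. k < n \<Longrightarrow> t k \<ge> 0) \<Longrightarrow> loc_time x t n v \<ge> 0"
  unfolding loc_time_def by (intro sum_nonneg) auto

lemma loc_time_cong:
  "(\<And>k. k < n \<Longrightarrow> x k = x' k) \<Longrightarrow> (\<And>k. k < n \<Longrightarrow> t k = t' k) \<Longrightarrow> loc_time x t n = loc_time x' t' n"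
  unfolding loc_time_def fun_eq_iff by (auto intro!: sum.cong)

text \<open>With \<open>D(l, i) = sqrt (1 + l i) * vrjp_weight W L l\<close>, the density of a step from \<open>i\<close> to \<open>j\<close>
  is \<open>W i j / 2 * D(l', j) / D(l, i)\<close>, so that the densities of consecutive steps telescope.\<close>

lemma vrjp_step_density_eq:
  assumes fin: "finite L" and sym: "\<And>i j. W i j = W j i" and i: "i \<in> L" and s: "s > 0" and l: "\<And>v. l v \<ge> 0"
    and l': "\<And>v. l' v = l v + (if i = v then s else 0)"
  shows "vrjp_step_density L W l i s j * (sqrt (1 + l i) * vrjp_weight W L l)
    = W i j / 2 * (sqrt (1 + l' j) * vrjp_weight W L l')"
proof -
  define L' where "L' = L - {i}"
  have LL: "L = insert i L'" "i \<notin> L'" "finite L'" using i fin by (auto simp: L'_def)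
  define c where "c = (\<Sum>k\<in>L'. W i k * sqrt (1 + l k))"
  define a where "a = sqrt (1 + l i)"
  define a' where "a' = sqrt (1 + l i + s)"
  have a: "a > 0" "a' > 0" "a * a = 1 + l i" "a' * a' = 1 + l i + s"
    using l[of i] s by (auto simp: a_def a'_def)
  have q: "wquad W L \<theta> = W i i * (\<theta> i * \<theta> i) + 2 * \<theta> i * (\<Sum>k\<in>L'. W i k * \<theta> k) + wquad W L' \<theta>" for \<theta>
  proof -
    have "(\<Sum>k\<in>L'. \<theta> k * W k i * \<theta> i) = \<theta> i * (\<Sum>k\<in>L'. W i k * \<theta> k)"
      unfolding sum_distrib_left by (intro sum.cong refl) (simp add: sym[of _ i])
    moreover have "(\<Sum>k\<in>L'. \<theta> i * W i k * \<theta> k) = \<theta> i * (\<Sum>k\<in>L'. W i k * \<theta> k)"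
      unfolding sum_distrib_left by (intro sum.cong refl) simp
    ultimately show ?thesis unfolding wquad_def LL(1) using LL(2,3) by (simp add: sum.distrib)
  qed
  have l'L: "l' k = l k" if "k \<in> L'" for k using that LL(2) by (auto simp: l')
  have "(\<Sum>k\<in>L'. W i k * sqrt (1 + l' k)) = c" "wquad W L' (\<lambda>i. sqrt (1 + l' i)) = wquad W L' (\<lambda>i. sqrt (1 + l i))"
    by (simp_all add: c_def wquad_def l'L)
  moreover have "sqrt (1 + l' i) = a'" by (simp add: l' a'_def add.assoc)
  \<comment> \<open>Only terms involving \<open>i\<close> change: the diagonal one by
    \<open>W i i * s\<close>, since \<open>a' * a' - a * a = s\<close>, and the mixed ones by
    \<open>2 * c * (a' - a)\<close>. Minus half of this is the exponent of the survival factor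
    \<open>S\<close> below.\<close>
  ultimately have Q: "wquad W L (\<lambda>i. sqrt (1 + l' i)) = wquad W L (\<lambda>i. sqrt (1 + l i)) + W i i * s + 2 * c * (a' - a)"
    unfolding q[of "\<lambda>i. sqrt (1 + l' i)"] q[of "\<lambda>i. sqrt (1 + l i)"]
    using a by (simp add: c_def[symmetric] a_def[symmetric] field_simps)
  have P: "(\<Prod>k\<in>L. sqrt (1 + l' k)) = a' * (\<Prod>k\<in>L'. sqrt (1 + l k))" "(\<Prod>k\<in>L. sqrt (1 + l k)) = a * (\<Prod>k\<in>L'. sqrt (1 + l k))"
    unfolding LL(1) using LL(2,3) \<open>sqrt (1 + l' i) = a'\<close> by (simp_all add: l'L a_def cong: prod.cong)
  define p where "p = (\<Prod>k\<in>L'. sqrt (1 + l k))"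
  have p: "p > 0" unfolding p_def by (intro prod_pos ballI) (simp add: l add_pos_nonneg)
  define S where "S = exp (- c * (a' - a) - W i i * s / 2)"
  have vw: "vrjp_weight W L l' * a' = vrjp_weight W L l * a * S"
  proof -
    have "exp (wquad W L (\<lambda>_. 1) / 2 - wquad W L (\<lambda>i. sqrt (1 + l' i)) / 2)
       = exp (wquad W L (\<lambda>_. 1) / 2 - wquad W L (\<lambda>i. sqrt (1 + l i)) / 2) * S"
      unfolding S_def exp_add[symmetric] Q by (rule arg_cong[where f=exp]) (simp add: field_simps)
    then show ?thesis unfolding vrjp_weight_def P p_def[symmetric] using a p by simp
  qed
  have step: "vrjp_step_density L W l i s j
      = (if j = i then W i i / 2 else W i j * sqrt (1 + l j) / (2 * a')) * S"
    unfolding vrjp_step_density_def Let_def S_def c_def a_def a'_def L'_def by simp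
  have sj: "sqrt (1 + l' j) = (if j = i then a' else sqrt (1 + l j))"
    using \<open>sqrt (1 + l' i) = a'\<close> by (auto simp: l')
  have "vrjp_step_density L W l i s j * (a * vrjp_weight W L l) = W i j / 2 * (sqrt (1 + l' j) / a') * (vrjp_weight W L l * a * S)"
    unfolding step sj using a by auto
  also have "\<dots> = W i j / 2 * (sqrt (1 + l' j) * vrjp_weight W L l')"
    unfolding vw[symmetric] using a by simp
  finally show ?thesis by (simp add: a_def)
qed

text \<open>At local time 0 the telescoping factor is 1, so only the one at the end of the path
  survives.\<close>

lemma prod_vrjp_step_density:
  assumes fin: "finite L" and sym: "\<And>i j. W i j = W j i"
    and "\<And>k. k \<le> n \<Longrightarrow> x k \<in> L" "\<And>k. k < n \<Longrightarrow> t k > 0"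
  shows "(\<Prod>k<n. vrjp_step_density L W (loc_time x t k) (x k) (t k) (x (Suc k)))
    = (\<Prod>k<n. W (x k) (x (Suc k)) / 2) * (sqrt (1 + loc_time x t n (x n)) * vrjp_weight W L (loc_time x t n))"
  using assms(3,4)
proof (induction n)
  case 0
  show ?case by (simp add: vrjp_weight_def)
next
  case (Suc n)
  let ?D = "\<lambda>k. sqrt (1 + loc_time x t k (x k)) * vrjp_weight W L (loc_time x t k)"
  have ln: "loc_time x t n v \<ge> 0" for v using Suc.prems by (intro loc_time_nonneg) (auto simp: less_imp_le)
  have "vrjp_step_density L W (loc_time x t n) (x n) (t n) (x (Suc n)) * ?D n = W (x n) (x (Suc n)) / 2 * ?D (Suc n)"
    by (rule vrjp_step_density_eq[OF fin sym]) (use Suc.prems ln in \<open>auto simp: loc_time_Suc\<close>)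
  note step = this
  have "(\<Prod>k<Suc n. vrjp_step_density L W (loc_time x t k) (x k) (t k) (x (Suc k)))
     = (\<Prod>k<n. W (x k) (x (Suc k)) / 2) * (vrjp_step_density L W (loc_time x t n) (x n) (t n) (x (Suc n)) * ?D n)"
    using Suc.IH Suc.prems by simp
  then show ?case unfolding step by simp
qed

lemma vrjp_fdd_density_eq:
  assumes fin: "finite L" and sym: "\<And>i j. W i j = W j i"
  shows "vrjp_fdd_density L W \<rho> n x t = (if x 0 = \<rho> \<and> (\<forall>k\<le>n. x k \<in> L) \<and> (\<forall>k<n. t k > 0)
    then (\<Prod>k<n. W (x k) (x (Suc k)) / 2) * (sqrt (1 + loc_time x t n (x n)) * vrjp_weight W L (loc_time x t n)) else 0)"
  unfolding vrjp_fdd_density_def using prod_vrjp_step_density[OF assms, of n x t] by auto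

lemma vrjp_step_density_nonneg:
  assumes "\<And>i j. W i j \<ge> 0" "\<And>v. l v \<ge> 0" "s > 0"
  shows "vrjp_step_density L W l i s j \<ge> 0"
  unfolding vrjp_step_density_def Let_def using assms by (auto intro!: mult_nonneg_nonneg divide_nonneg_nonneg add_nonneg_nonneg simp: less_imp_le)

text \<open>The sum over \<open>j\<close> is the total jump rate times the probability of no jump so
  far, hence minus the derivative of that probability. The integral is 1 because some rate out of
  \<open>i\<close>, possibly that of the self-loop, is positive.\<close>

lemma vrjp_step_density_total:
  fixes W :: "'v \<Rightarrow> 'v \<Rightarrow> real"
  assumes fin: "finite L" and nn: "\<And>i j. W i j \<ge> 0" and i: "i \<in> L" and l: "\<And>v. l v \<ge> 0"
    and ex: "\<exists>j\<in>L. W i j > 0"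
  shows "(\<integral>\<^sup>+s. (\<Sum>j\<in>L. if s > 0 then ennreal (vrjp_step_density L W l i s j) else 0) \<partial>lborel) = 1"
proof -
  define c where "c = (\<Sum>k\<in>L - {i}. W i k * sqrt (1 + l k))"
  define r where "r = 1 + l i"
  \<comment> \<open>Minus the probability that no jump occurs up to time \<open>s\<close>.\<close>
  define F where "F s = - exp (- c * (sqrt (r + s) - sqrt r) - W i i * s / 2)" for s
  define f where "f s = (c / (2 * sqrt (r + s)) + W i i / 2) * exp (- c * (sqrt (r + s) - sqrt r) - W i i * s / 2)" for s
  have r: "r \<ge> 1" using l[of i] by (simp add: r_def)
  have c: "c \<ge> 0" unfolding c_def using nn l by (intro sum_nonneg mult_nonneg_nonneg) auto
  have cW: "c > 0 \<or> W i i > 0"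
  proof -
    obtain j where j: "j \<in> L" "W i j > 0" using ex by auto
    show ?thesis
    proof (cases "j = i")
      case False
      have "0 < W i j * sqrt (1 + l j)" using j l[of j] by simp
      also have "\<dots> \<le> c" unfolding c_def using j False fin nn l by (intro member_le_sum) auto
      finally show ?thesis by simp
    qed (use j in auto)
  qed
  have sumstep: "(\<Sum>j\<in>L. vrjp_step_density L W l i s j) = f s" if "s > 0" for s
  proof -
    let ?S = "exp (- c * (sqrt (r + s) - sqrt r) - W i i * s / 2)"
    have "(\<Sum>j\<in>L. vrjp_step_density L W l i s j) = vrjp_step_density L W l i s i + (\<Sum>j\<in>L-{i}. vrjp_step_density L W l i s j)"
      using fin i by (rule sum.remove)
    also have "vrjp_step_density L W l i s i = W i i / 2 * ?S"
      by (simp add: vrjp_step_density_def Let_def c_def r_def)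
    also have "(\<Sum>j\<in>L-{i}. vrjp_step_density L W l i s j) = (\<Sum>j\<in>L-{i}. W i j * sqrt (1 + l j) * (1 / (2 * sqrt (r + s)) * ?S))"
      by (intro sum.cong refl) (auto simp: vrjp_step_density_def Let_def c_def r_def)
    also have "\<dots> = c * (1 / (2 * sqrt (r + s)) * ?S)"
      unfolding c_def sum_distrib_right ..
    finally show ?thesis by (simp add: f_def distrib_right)
  qed
  have "(\<integral>\<^sup>+s. (\<Sum>j\<in>L. if s > 0 then ennreal (vrjp_step_density L W l i s j) else 0) \<partial>lborel)
      = (\<integral>\<^sup>+s. ennreal (f s) * indicator {0..} s \<partial>lborel)"
  proof (rule nn_integral_cong_AE)
    show "AE s in lborel. (\<Sum>j\<in>L. if s > 0 then ennreal (vrjp_step_density L W l i s j) else 0) = ennreal (f s) * indicator {0..} s"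
      using AE_lborel_singleton[of "0::real"]
    proof eventually_elim
      case (elim s)
      show ?case
      proof (cases "s > 0")
        case True
        then show ?thesis using sumstep[OF True] vrjp_step_density_nonneg[of W l s L i, OF nn l True]
          by (simp add: sum_ennreal)
      qed (use elim in auto)
    qed
  qed
  also have "\<dots> = ennreal (0 - F 0)"
  proof (rule nn_integral_FTC_atLeast)
    show "f \<in> borel_measurable borel" unfolding f_def by measurable
    show "DERIV F x :> f x" if "0 \<le> x" for x
      unfolding F_def f_def using that r
      by (auto intro!: derivative_eq_intros simp: field_simps)
    show "0 \<le> f x" if "0 \<le> x" for x unfolding f_def using c nn r that by auto
    \<comment> \<open>The rate of jumps to other vertices decays like \<open>1 / sqrt s\<close>, but
      its integral \<open>c * (sqrt (r + s) - sqrt r)\<close> still diverges if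
      \<open>c > 0\<close>; otherwise the self-loop clock alone drives \<open>F\<close> to
      0.\<close>
    show "(F \<longlongrightarrow> 0) at_top"
    proof (cases "c > 0")
      case True
      have "((\<lambda>s. - exp (- c * (sqrt (r + s) - sqrt r) - W i i * s / 2)) \<longlongrightarrow> - 0) at_top"
      proof (intro tendsto_minus filterlim_compose[OF exp_at_bot])
        show "LIM s at_top. - c * (sqrt (r + s) - sqrt r) - W i i * s / 2 :> at_bot"
        proof (rule filterlim_at_bot_mono)
          show "LIM s at_top. - c * (sqrt (r + s) - sqrt r) :> at_bot" using True by real_asymp
          show "\<forall>\<^sub>F s in at_top. - c * (sqrt (r + s) - sqrt r) - W i i * s / 2 \<le> - c * (sqrt (r + s) - sqrt r)"
            by (rule eventually_mono[OF eventually_ge_at_top[of 0]]) (use nn[of i i] in auto)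
        qed
      qed
      then show ?thesis by (simp add: F_def[abs_def])
    next
      case False
      then have "c = 0" "W i i > 0" using c cW by auto
      then show ?thesis unfolding F_def by simp real_asymp
    qed
  qed
  also have "\<dots> = 1" by (simp add: F_def)
  finally show ?thesis .
qed

lemma measurable_vrjp_step_density:
  assumes [measurable]: "\<And>i j. (\<lambda>y. W y i j) \<in> borel_measurable N" "\<And>v. (\<lambda>y. l y v) \<in> borel_measurable N" "s \<in> borel_measurable N"
  shows "(\<lambda>y. vrjp_step_density L (W y) (l y) i (s y) j) \<in> borel_measurable N"
  unfolding vrjp_step_density_def Let_def by (cases "j = i") simp_all

lemma measurable_loc_time:
  assumes "\<And>k. k < n \<Longrightarrow> (\<lambda>y. t y k) \<in> borel_measurable N"
  shows "(\<lambda>y. loc_time x (t y) n v) \<in> borel_measurable N"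
  unfolding loc_time_def
proof (rule borel_measurable_sum)
  fix k assume "k \<in> {..<n}"
  then show "(\<lambda>y. if x k = v then t y k else 0) \<in> borel_measurable N"
    using assms[of k] by (cases "x k = v") auto
qed

lemma measurable_vrjp_fdd_density:
  assumes W: "\<And>i j. (\<lambda>y. W y i j) \<in> borel_measurable N" and t: "\<And>k. k < n \<Longrightarrow> (\<lambda>y. t y k) \<in> borel_measurable N"
  shows "(\<lambda>y. vrjp_fdd_density L (W y) \<rho> n x (t y)) \<in> borel_measurable N"
proof -
  have p: "Measurable.pred N (\<lambda>y. \<forall>k\<in>{..<n}. t y k > 0)"
    using t by (intro pred_intros_finite) auto
  have q: "(\<lambda>y. \<Prod>k<n. vrjp_step_density L (W y) (loc_time x (t y) k) (x k) (t y k) (x (Suc k))) \<in> borel_measurable N"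
    by (intro borel_measurable_prod measurable_vrjp_step_density W measurable_loc_time t) auto
  show ?thesis
  proof (cases "x 0 = \<rho> \<and> (\<forall>k\<le>n. x k \<in> L)")
    case True
    then have "vrjp_fdd_density L (W y) \<rho> n x (t y) = (if \<forall>k\<in>{..<n}. t y k > 0
       then \<Prod>k<n. vrjp_step_density L (W y) (loc_time x (t y) k) (x k) (t y k) (x (Suc k)) else 0)" for y
      by (auto simp: vrjp_fdd_density_def)
    then show ?thesis using p q by simp
  next
    case False
    then have "vrjp_fdd_density L (W y) \<rho> n x (t y) = 0" for y by (auto simp: vrjp_fdd_density_def)
    then show ?thesis by simp
  qed
qed

lemma measurable_vrjp_step_density_random:
  assumes fin: "finite L" and xs: "\<And>k. k \<le> m \<Longrightarrow> (\<lambda>y. xs y k) \<in> measurable N (count_space L)"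
    and t: "\<And>k. k < m \<Longrightarrow> (\<lambda>y. t y k) \<in> borel_measurable N"
    and s: "s \<in> borel_measurable N" and j: "j \<in> measurable N (count_space L)"
  shows "(\<lambda>y. vrjp_step_density L W (loc_time (xs y) (t y) m) (xs y m) (s y) (j y)) \<in> borel_measurable N"
proof -
  have l: "(\<lambda>y. loc_time (xs y) (t y) m v) \<in> borel_measurable N" for v
    unfolding loc_time_def
  proof (rule borel_measurable_sum)
    fix k assume "k \<in> {..<m}"
    then have [measurable]: "(\<lambda>y. xs y k) \<in> measurable N (count_space L)" "(\<lambda>y. t y k) \<in> borel_measurable N"
      using xs[of k] t[of k] by auto
    have "Measurable.pred N (\<lambda>y. xs y k = v)"
      by (rule pred_eq_const1[where N = "count_space L"]) auto
    then show "(\<lambda>y. if xs y k = v then t y k else 0) \<in> borel_measurable N" by simp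
  qed
  have cL: "countable L" using fin by (rule countable_finite)
  have "(\<lambda>y. vrjp_step_density L W (loc_time (xs y) (t y) m) i (s y) j') \<in> borel_measurable N" for i j'
    using l s by (intro measurable_vrjp_step_density) auto
  then have "(\<lambda>y. vrjp_step_density L W (loc_time (xs y) (t y) m) (xs y m) (s y) j') \<in> borel_measurable N" for j'
    by (rule measurable_compose_countable'[OF _ xs[OF order_refl] cL])
  then show ?thesis
    by (rule measurable_compose_countable'[OF _ j cL])
qed

section \<open>Existence and uniqueness of the law\<close>

text \<open>Coordinate \<open>Suc k\<close> stores the waiting time \<open>T k\<close> before the
  jump it records, hence the shift. The value 1 is a dummy for nonpositive entries, which have
  probability 0 there; it sends every sample point, and not just almost every one, into
  \<open>seq_space\<close>.\<close>

definition jump_time :: "(nat \<Rightarrow> real \<times> 'v) \<Rightarrow> nat \<Rightarrow> real" where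
  "jump_time z k = (if fst (z (Suc k)) > 0 then fst (z (Suc k)) else 1)"

lemma jump_time_pos: "jump_time z k > 0"
  by (simp add: jump_time_def)

definition step_weight :: "'v set \<Rightarrow> ('v \<Rightarrow> 'v \<Rightarrow> real) \<Rightarrow> nat \<Rightarrow> (nat \<Rightarrow> real \<times> 'v) \<Rightarrow> real \<times> 'v \<Rightarrow> ennreal" where
  "step_weight L W m z = (\<lambda>(s, j). if s > 0 then
      ennreal (vrjp_step_density L W (loc_time (\<lambda>k. snd (z k)) (jump_time z) m) (snd (z m)) s j) else 0)"

text \<open>The \<open>n\<close>-th coordinate of the Ionescu-Tulcea construction is the pair \<open>(T\<^bsub>n-1\<^esub>, X\<^sub>n)\<close>.\<close>

definition vrjp_kernel :: "'v set \<Rightarrow> ('v \<Rightarrow> 'v \<Rightarrow> real) \<Rightarrow> 'v \<Rightarrow> nat \<Rightarrow> (nat \<Rightarrow> real \<times> 'v) \<Rightarrow> (real \<times> 'v) measure" where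
  "vrjp_kernel L W \<rho> n z = (case n of 0 \<Rightarrow> return (borel \<Otimes>\<^sub>M count_space L) (1, \<rho>)
     | Suc m \<Rightarrow> density (lborel \<Otimes>\<^sub>M count_space L) (step_weight L W m z))"

lemma sets_lborel_pair [measurable_cong]: "sets (lborel \<Otimes>\<^sub>M count_space L) = sets (borel \<Otimes>\<^sub>M count_space L)"
  by (intro sets_pair_measure_cong) auto

lemma nn_integral_lborel_count_space:
  assumes "finite L" "f \<in> borel_measurable (borel \<Otimes>\<^sub>M count_space L)"
  shows "(\<integral>\<^sup>+p. f p \<partial>(lborel \<Otimes>\<^sub>M count_space L)) = (\<integral>\<^sup>+s. (\<Sum>j\<in>L. f (s, j)) \<partial>(lborel :: real measure))"
proof -
  interpret sigma_finite_measure "count_space L" using assms(1) by (rule sigma_finite_measure_count_space_finite)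
  have "f \<in> borel_measurable (lborel \<Otimes>\<^sub>M count_space L)" using assms(2) by measurable
  from nn_integral_fst[OF this] show ?thesis
    using assms(1) by (simp add: nn_integral_count_space_finite)
qed

text \<open>\<open>row\<close> rules out absorbing vertices: from a vertex whose row vanishes the
  step density would be 0, and there would be no next position.\<close>

locale vrjp_data =
  fixes L :: "'v set" and W :: "'v \<Rightarrow> 'v \<Rightarrow> real" and \<rho> :: 'v
  assumes fin: "finite L" and nn: "\<And>i j. W i j \<ge> 0" and row: "\<And>i. i \<in> L \<Longrightarrow> \<exists>j\<in>L. W i j > 0" and \<rho>: "\<rho> \<in> L"
begin

abbreviation "ST \<equiv> borel \<Otimes>\<^sub>M count_space L :: (real \<times> 'v) measure"

lemma step_weight_measurable:
  "(\<lambda>p. step_weight L W m (fst p) (snd p)) \<in> borel_measurable (PiM {0..<Suc m} (\<lambda>_. ST) \<Otimes>\<^sub>M ST)"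
proof -
  let ?N = "PiM {0..<Suc m} (\<lambda>_. ST) \<Otimes>\<^sub>M ST"
  have z: "(\<lambda>p. fst p k) \<in> measurable ?N ST" if "k \<le> m" for k
    by (rule measurable_compose[OF measurable_fst measurable_component_singleton]) (use that in auto)
  have xs: "(\<lambda>p. snd (fst p k)) \<in> measurable ?N (count_space L)" if "k \<le> m" for k
    using measurable_compose[OF z[OF that] measurable_snd] by simp
  have t0: "(\<lambda>p. fst (fst p k)) \<in> borel_measurable ?N" if "k \<le> m" for k
    using measurable_compose[OF z[OF that] measurable_fst] by simp
  have t: "(\<lambda>p. jump_time (fst p) k) \<in> borel_measurable ?N" if "k < m" for k
  proof -
    have [measurable]: "(\<lambda>p. fst (fst p (Suc k))) \<in> borel_measurable ?N" using t0[of "Suc k"] that by simp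
    show ?thesis unfolding jump_time_def by measurable
  qed
  have s[measurable]: "(\<lambda>p. fst (snd p)) \<in> borel_measurable ?N" by measurable
  have j: "(\<lambda>p. snd (snd p)) \<in> measurable ?N (count_space L)" by measurable
  have [measurable]: "(\<lambda>p. vrjp_step_density L W (loc_time (\<lambda>k. snd (fst p k)) (jump_time (fst p)) m) (snd (fst p m)) (fst (snd p)) (snd (snd p))) \<in> borel_measurable ?N"
    by (rule measurable_vrjp_step_density_random[OF fin xs t s j])
  show ?thesis unfolding step_weight_def case_prod_beta by measurable
qed

lemma step_weight_measurable1:
  "z \<in> space (PiM {0..<Suc m} (\<lambda>_. ST)) \<Longrightarrow> step_weight L W m z \<in> borel_measurable ST"
  using measurable_compose[OF measurable_Pair1' step_weight_measurable] by fastforce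

lemma nn_integral_vrjp_kernel:
  assumes z: "z \<in> space (PiM {0..<Suc m} (\<lambda>_. ST))" and [measurable]: "h \<in> borel_measurable ST"
  shows "(\<integral>\<^sup>+p. h p \<partial>vrjp_kernel L W \<rho> (Suc m) z) = (\<integral>\<^sup>+s. (\<Sum>j\<in>L. step_weight L W m z (s, j) * h (s, j)) \<partial>lborel)"
proof -
  note [measurable] = step_weight_measurable1[OF z]
  show ?thesis unfolding vrjp_kernel_def nat.case
    by (subst nn_integral_density) (simp_all add: nn_integral_lborel_count_space[OF fin])
qed

lemma sets_vrjp_kernel: "sets (vrjp_kernel L W \<rho> n z) = sets ST"
  by (cases n) (simp_all add: vrjp_kernel_def sets_lborel_pair)

lemma prob_space_vrjp_kernel:
  assumes z: "z \<in> space (PiM {0..<n} (\<lambda>_. ST))"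
  shows "prob_space (vrjp_kernel L W \<rho> n z)"
proof (cases n)
  case 0
  show ?thesis unfolding 0 vrjp_kernel_def nat.case by (rule prob_space_return) (simp add: space_pair_measure \<rho>)
next
  case (Suc m)
  have zL: "snd (z m) \<in> L" using z by (auto simp: Suc space_PiM space_pair_measure PiE_iff mem_Times_iff)
  show ?thesis
  proof
    have "emeasure (vrjp_kernel L W \<rho> n z) (space (vrjp_kernel L W \<rho> n z)) = (\<integral>\<^sup>+p. 1 \<partial>vrjp_kernel L W \<rho> (Suc m) z)"
      by (simp add: Suc)
    also have "\<dots> = (\<integral>\<^sup>+s. (\<Sum>j\<in>L. step_weight L W m z (s, j) * 1) \<partial>lborel)"
      by (rule nn_integral_vrjp_kernel) (use z Suc in auto)
    also have "\<dots> = 1"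
      unfolding step_weight_def prod.case mult_1_right
      by (rule vrjp_step_density_total) (auto intro!: fin nn zL row[OF zL] loc_time_nonneg less_imp_le[OF jump_time_pos])
    finally show "emeasure (vrjp_kernel L W \<rho> n z) (space (vrjp_kernel L W \<rho> n z)) = 1" .
  qed
qed

lemma measurable_vrjp_kernel: "vrjp_kernel L W \<rho> n \<in> measurable (PiM {0..<n} (\<lambda>_. ST)) (subprob_algebra ST)"
proof (rule measurable_subprob_algebra)
  fix z assume z: "z \<in> space (PiM {0..<n} (\<lambda>_. ST))"
  show "subprob_space (vrjp_kernel L W \<rho> n z)"
    by (rule prob_space_imp_subprob_space[OF prob_space_vrjp_kernel[OF z]])
  show "sets (vrjp_kernel L W \<rho> n z) = sets ST" by (rule sets_vrjp_kernel)
next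
  fix A assume A[measurable]: "A \<in> sets ST"
  show "(\<lambda>z. emeasure (vrjp_kernel L W \<rho> n z) A) \<in> borel_measurable (PiM {0..<n} (\<lambda>_. ST))"
  proof (cases n)
    case 0
    then show ?thesis by (simp add: vrjp_kernel_def)
  next
    case (Suc m)
    have "(\<lambda>z. \<integral>\<^sup>+s. (\<Sum>j\<in>L. step_weight L W m z (s, j) * indicator A (s, j)) \<partial>lborel) \<in> borel_measurable (PiM {0..<Suc m} (\<lambda>_. ST))"
    proof (rule sigma_finite_measure.borel_measurable_nn_integral[OF lborel.sigma_finite_measure_axioms], unfold case_prod_beta, rule borel_measurable_sum)
      fix j assume "j \<in> L"
      then have j[measurable]: "j \<in> space (count_space L)" by simp
      have 1: "(\<lambda>x. (fst x, (snd x, j))) \<in> measurable (PiM {0..<Suc m} (\<lambda>_. ST) \<Otimes>\<^sub>M lborel) (PiM {0..<Suc m} (\<lambda>_. ST) \<Otimes>\<^sub>M ST)"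
        by measurable
      have 2: "(\<lambda>x. (snd x, j)) \<in> measurable (PiM {0..<Suc m} (\<lambda>_. ST) \<Otimes>\<^sub>M lborel) ST"
        by measurable
      show "(\<lambda>x. step_weight L W m (fst x) (snd x, j) * indicator A (snd x, j)) \<in> borel_measurable (PiM {0..<Suc m} (\<lambda>_. ST) \<Otimes>\<^sub>M lborel)"
        using measurable_compose[OF 1 step_weight_measurable] measurable_compose[OF 2 borel_measurable_indicator[OF A]]
        by (intro borel_measurable_times_ennreal) simp_all
    qed
    also have "?this \<longleftrightarrow> ?thesis"
    proof (unfold Suc, rule measurable_cong)
      fix z assume z: "z \<in> space (PiM {0..<Suc m} (\<lambda>_. ST))"
      have "emeasure (vrjp_kernel L W \<rho> (Suc m) z) A = (\<integral>\<^sup>+p. indicator A p \<partial>vrjp_kernel L W \<rho> (Suc m) z)"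
        by (rule nn_integral_indicator[symmetric]) (simp add: sets_vrjp_kernel)
      also have "\<dots> = (\<integral>\<^sup>+s. (\<Sum>j\<in>L. step_weight L W m z (s, j) * indicator A (s, j)) \<partial>lborel)"
        by (rule nn_integral_vrjp_kernel[OF z]) simp
      finally show "(\<integral>\<^sup>+s. (\<Sum>j\<in>L. step_weight L W m z (s, j) * indicator A (s, j)) \<partial>lborel) = emeasure (vrjp_kernel L W \<rho> (Suc m) z) A" by simp
    qed
    finally show ?thesis .
  qed
qed

sublocale IT: Ionescu_Tulcea "vrjp_kernel L W \<rho>" "\<lambda>_. ST"
  by (rule Ionescu_Tulcea.intro[OF measurable_vrjp_kernel prob_space_vrjp_kernel])

end

section \<open>Finite-dimensional distributions of the constructed process\<close>

lemma PiM_lborel_borel: "sets (PiM K (\<lambda>_. lborel :: real measure)) = sets (PiM K (\<lambda>_. borel))"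
  by (intro sets_PiM_cong) auto

lemma vrjp_fdd_density_Suc:
  "vrjp_fdd_density L W \<rho> (Suc n) x (t(n := s)) = vrjp_fdd_density L W \<rho> n x t *
    (if s > 0 \<and> x (Suc n) \<in> L then vrjp_step_density L W (loc_time x t n) (x n) s (x (Suc n)) else 0)"
proof -
  have l: "loc_time x (t(n := s)) k = loc_time x t k" if "k \<le> n" for k
    using that by (intro loc_time_cong) auto
  have "(\<Prod>k<Suc n. vrjp_step_density L W (loc_time x (t(n := s)) k) (x k) ((t(n := s)) k) (x (Suc k)))
     = (\<Prod>k<n. vrjp_step_density L W (loc_time x t k) (x k) (t k) (x (Suc k))) * vrjp_step_density L W (loc_time x t n) (x n) s (x (Suc n))"
    using l by simp
  moreover have "(\<forall>k<Suc n. (t(n := s)) k > 0) \<longleftrightarrow> (\<forall>k<n. t k > 0) \<and> s > 0"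
    by (auto simp: less_Suc_eq)
  moreover have "(\<forall>k\<le>Suc n. x k \<in> L) \<longleftrightarrow> (\<forall>k\<le>n. x k \<in> L) \<and> x (Suc n) \<in> L"
    by (auto simp: le_Suc_eq)
  ultimately show ?thesis unfolding vrjp_fdd_density_def by auto
qed

lemma vrjp_fdd_density_nonneg:
  assumes "\<And>i j. W i j \<ge> 0"
  shows "vrjp_fdd_density L W \<rho> n x t \<ge> 0"
  unfolding vrjp_fdd_density_def using assms
  by (auto intro!: prod_nonneg vrjp_step_density_nonneg loc_time_nonneg simp: less_imp_le)

context vrjp_data
begin

text \<open>Formulated for integrands \<open>g\<close> instead of events, because the induction step
  integrates out the last waiting time and hands the result on as an integrand \<open>g'\<close> of
  the earlier ones. There is one coordinate more than there are waiting times, since coordinate 0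
  holds only the starting point.\<close>

lemma nn_integral_C_vrjp:
  fixes g :: "(nat \<Rightarrow> real) \<Rightarrow> ennreal"
  assumes "g \<in> borel_measurable (PiM {..<n} (\<lambda>_. borel))"
  shows "(\<integral>\<^sup>+z. indicator {z. \<forall>k\<le>n. snd (z k) = x k} z * g (\<lambda>k\<in>{..<n}. jump_time z k) \<partial>IT.C 0 (Suc n) (\<lambda>_. undefined))
    = (\<integral>\<^sup>+t. g t * ennreal (vrjp_fdd_density L W \<rho> n x t) \<partial>PiM {..<n} (\<lambda>_. lborel))"
  using assms
proof (induction n arbitrary: g)
  case 0
  have u: "(\<lambda>_. undefined) \<in> space (PiM {0..<0::nat} (\<lambda>_. ST))" by (simp add: space_PiM)
  define h where "h z = indicator {z. \<forall>k\<le>(0::nat). snd (z k) = x k} z * g (\<lambda>k\<in>{..<0}. jump_time z k)" for z :: "nat \<Rightarrow> real \<times> 'v"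
  have g0: "(\<lambda>k\<in>{..<0::nat}. jump_time z k) = (\<lambda>_. undefined)" for z :: "nat \<Rightarrow> real \<times> 'v" by auto
  have hm: "h \<in> borel_measurable (PiM {0..<Suc 0} (\<lambda>_. ST))"
  proof -
    have [measurable]: "(\<lambda>z. snd (z 0)) \<in> measurable (PiM {0..<Suc 0} (\<lambda>_. ST)) (count_space L)"
      by (rule measurable_compose[OF _ measurable_snd], rule measurable_component_singleton) simp
    have "Measurable.pred (PiM {0..<Suc 0} (\<lambda>_. ST)) (\<lambda>z. snd (z 0) = x 0)"
      by (rule pred_eq_const1[where N = "count_space L"]) auto
    then have "(\<lambda>z. (if snd (z 0) = x 0 then 1 else 0) * g (\<lambda>_. undefined)) \<in> borel_measurable (PiM {0..<Suc 0} (\<lambda>_. ST))"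
      by simp
    then show ?thesis unfolding h_def g0 by (simp add: indicator_def)
  qed
  have "(\<integral>\<^sup>+z. h z \<partial>IT.C 0 (Suc 0) (\<lambda>_. undefined)) = (\<integral>\<^sup>+z. h z \<partial>IT.eP 0 (\<lambda>_. undefined))"
    by (simp only: IT.C.simps add_0 bind_return[OF IT.measurable_eP[of 0] u])
  also have "\<dots> = (\<integral>\<^sup>+p. h ((\<lambda>_. undefined)(0 := p)) \<partial>vrjp_kernel L W \<rho> 0 (\<lambda>_. undefined))"
    by (rule IT.nn_integral_eP[OF u hm])
  also have "\<dots> = h ((\<lambda>_. undefined)(0 := (1, \<rho>)))"
    unfolding vrjp_kernel_def nat.case
  proof (rule nn_integral_return)
    show "(1, \<rho>) \<in> space ST" using \<rho> by (simp add: space_pair_measure)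
    show "(\<lambda>p. h ((\<lambda>_. undefined)(0 := p))) \<in> borel_measurable ST"
      by (rule measurable_compose[OF measurable_fun_upd[where J="{0..<0}"] hm]) (auto simp: u)
  qed
  also have "\<dots> = (\<integral>\<^sup>+t. g t * ennreal (vrjp_fdd_density L W \<rho> 0 x t) \<partial>PiM {..<0} (\<lambda>_. lborel))"
    using \<rho> by (auto simp: h_def restrict_def lborel_prod.nn_integral_empty vrjp_fdd_density_def indicator_def)
  finally show ?case unfolding h_def .
next
  case (Suc n)
  note gm = Suc.prems
  let ?X = "\<lambda>n z. indicator {z. \<forall>k\<le>n. snd (z k) = x k} z :: ennreal"
  let ?T = "\<lambda>n z. (\<lambda>k\<in>{..<n}. jump_time z k)"
  have u: "(\<lambda>_. undefined) \<in> space (PiM {0..<0::nat} (\<lambda>_. ST))" by (simp add: space_PiM)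
  define h where "h z = ?X (Suc n) z * g (?T (Suc n) z)" for z :: "nat \<Rightarrow> real \<times> 'v"
  define w where "w t s = (if s > 0 \<and> x (Suc n) \<in> L then ennreal (vrjp_step_density L W (loc_time x t n) (x n) s (x (Suc n))) else 0)" for t s
  define g' where "g' t = (\<integral>\<^sup>+s. g (t(n := s)) * w t s \<partial>lborel)" for t
  have gup: "(\<lambda>p. g ((fst p)(n := snd p))) \<in> borel_measurable (PiM {..<n} (\<lambda>_. borel) \<Otimes>\<^sub>M borel)"
    by (rule measurable_compose[OF measurable_fun_upd[where J="{..<n}"] gm]) auto
  have tk: "(\<lambda>p. fst p k) \<in> borel_measurable (PiM {..<n} (\<lambda>_. borel) \<Otimes>\<^sub>M borel)" if "k < n" for k
    by (rule measurable_compose[OF measurable_fst measurable_component_singleton]) (use that in auto)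
  have wm: "(\<lambda>p. w (fst p) (snd p)) \<in> borel_measurable (PiM {..<n} (\<lambda>_. borel) \<Otimes>\<^sub>M borel)"
  proof -
    have [measurable]: "(\<lambda>p. vrjp_step_density L W (loc_time x (fst p) n) (x n) (snd p) (x (Suc n)))
        \<in> borel_measurable (PiM {..<n} (\<lambda>_. borel) \<Otimes>\<^sub>M borel)"
      by (intro measurable_vrjp_step_density measurable_loc_time tk) auto
    show ?thesis unfolding w_def by (cases "x (Suc n) \<in> L") simp_all
  qed
  have g'm: "g' \<in> borel_measurable (PiM {..<n} (\<lambda>_. borel))"
    unfolding g'_def
    by (rule sigma_finite_measure.borel_measurable_nn_integral[OF lborel.sigma_finite_measure_axioms])
       (unfold case_prod_beta, intro borel_measurable_times_ennreal, use gup wm in simp_all)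
  have snd_m: "(\<lambda>z. snd (z k)) \<in> measurable (PiM {0..<Suc (Suc n)} (\<lambda>_. ST)) (count_space L)" if "k \<le> Suc n" for k
    by (rule measurable_compose[OF _ measurable_snd], rule measurable_component_singleton) (use that in auto)
  have fst_m: "(\<lambda>z. fst (z k)) \<in> borel_measurable (PiM {0..<Suc (Suc n)} (\<lambda>_. ST))" if "k \<le> Suc n" for k
    by (rule measurable_compose[OF _ measurable_fst], rule measurable_component_singleton) (use that in auto)
  have hm: "h \<in> borel_measurable (PiM {0..<Suc (Suc n)} (\<lambda>_. ST))"
  proof -
    have p: "Measurable.pred (PiM {0..<Suc (Suc n)} (\<lambda>_. ST)) (\<lambda>z. \<forall>k\<in>{..Suc n}. snd (z k) = x k)"
      by (intro pred_intros_finite pred_eq_const1[where N = "count_space L"] snd_m) auto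
    have q: "(\<lambda>z. ?T (Suc n) z) \<in> measurable (PiM {0..<Suc (Suc n)} (\<lambda>_. ST)) (PiM {..<Suc n} (\<lambda>_. borel))"
    proof (rule measurable_restrict)
      fix k assume "k \<in> {..<Suc n}"
      then have [measurable]: "(\<lambda>z. fst (z (Suc k))) \<in> borel_measurable (PiM {0..<Suc (Suc n)} (\<lambda>_. ST))" by (intro fst_m) auto
      show "(\<lambda>z. jump_time z k) \<in> borel_measurable (PiM {0..<Suc (Suc n)} (\<lambda>_. ST))"
        unfolding jump_time_def by measurable
    qed
    have "(\<lambda>z. (if \<forall>k\<in>{..Suc n}. snd (z k) = x k then 1 else 0) * g (?T (Suc n) z)) \<in> borel_measurable (PiM {0..<Suc (Suc n)} (\<lambda>_. ST))"
      by (rule borel_measurable_times_ennreal[OF _ measurable_compose[OF q gm]]) (use p in simp)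
    also have "(\<lambda>z. (if \<forall>k\<in>{..Suc n}. snd (z k) = x k then 1 else 0) * g (?T (Suc n) z)) = h"
      by (auto simp: h_def fun_eq_iff indicator_def)
    finally show ?thesis .
  qed
  have inner: "(\<integral>\<^sup>+p. h (z(Suc n := p)) \<partial>vrjp_kernel L W \<rho> (Suc n) z) = ?X n z * g' (?T n z)"
    if z: "z \<in> space (PiM {0..<Suc n} (\<lambda>_. ST))" for z
  proof -
    have hz: "(\<lambda>p. h (z(Suc n := p))) \<in> borel_measurable ST"
      by (rule measurable_compose[OF measurable_fun_upd[where J="{0..<Suc n}"] hm]) (use z in auto)
    have "(\<integral>\<^sup>+p. h (z(Suc n := p)) \<partial>vrjp_kernel L W \<rho> (Suc n) z)
      = (\<integral>\<^sup>+s. (\<Sum>j\<in>L. step_weight L W n z (s, j) * h (z(Suc n := (s, j)))) \<partial>lborel)"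
      by (rule nn_integral_vrjp_kernel[OF z hz])
    also have "\<dots> = (\<integral>\<^sup>+s. ?X n z * (g ((?T n z)(n := s)) * w (?T n z) s) \<partial>lborel)"
    proof (rule nn_integral_cong)
      fix s :: real
      show "(\<Sum>j\<in>L. step_weight L W n z (s, j) * h (z(Suc n := (s, j)))) = ?X n z * (g ((?T n z)(n := s)) * w (?T n z) s)"
      proof (cases "s > 0 \<and> (\<forall>k\<le>n. snd (z k) = x k)")
        case True
        have Xs: "?X (Suc n) (z(Suc n := (s, j))) = (if j = x (Suc n) then 1 else 0)" for j
          using True by (auto simp: indicator_def le_Suc_eq)
        have Ts: "?T (Suc n) (z(Suc n := (s, j))) = (?T n z)(n := s)" for j
          using True by (auto simp: fun_eq_iff jump_time_def)
        have l: "loc_time (\<lambda>k. snd (z k)) (jump_time z) n = loc_time x (?T n z) n"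
          using True by (intro loc_time_cong) auto
        have "(\<Sum>j\<in>L. step_weight L W n z (s, j) * h (z(Suc n := (s, j))))
           = (\<Sum>j\<in>L. if j = x (Suc n) then step_weight L W n z (s, j) * g ((?T n z)(n := s)) else 0)"
          unfolding h_def Xs Ts by (intro sum.cong) auto
        also have "\<dots> = w (?T n z) s * g ((?T n z)(n := s))"
          using True fin by (simp add: w_def step_weight_def l)
        finally show ?thesis using True by (simp add: mult.commute)
      next
        case False
        show ?thesis
        proof (cases "s > 0")
          case True
          then have nX: "\<not> (\<forall>k\<le>n. snd (z k) = x k)" using False by simp
          then have "?X (Suc n) (z(Suc n := (s, j))) = 0" for j
          proof -
            obtain k where "k \<le> n" "snd (z k) \<noteq> x k" using nX by auto
            then have "k \<le> Suc n" "snd ((z(Suc n := (s, j))) k) \<noteq> x k" by auto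
            then have "z(Suc n := (s, j)) \<notin> {z. \<forall>k\<le>Suc n. snd (z k) = x k}" by blast
            then show ?thesis by (rule indicator_simps(2))
          qed
          then show ?thesis using nX by (simp add: h_def)
        qed (simp add: step_weight_def w_def)
      qed
    qed
    also have "\<dots> = ?X n z * g' (?T n z)"
    proof -
      have "?T n z \<in> space (PiM {..<n} (\<lambda>_. borel))" by (simp add: space_PiM)
      then have "(\<lambda>s. g ((?T n z)(n := s)) * w (?T n z) s) \<in> borel_measurable borel"
        using measurable_compose[OF measurable_Pair1' gup, of "?T n z"] measurable_compose[OF measurable_Pair1' wm, of "?T n z"]
        by (intro borel_measurable_times_ennreal) simp_all
      then show ?thesis unfolding g'_def by (intro nn_integral_cmult) simp
    qed
    finally show ?thesis .
  qed
  have "(\<integral>\<^sup>+z. h z \<partial>IT.C 0 (Suc (Suc n)) (\<lambda>_. undefined))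
     = (\<integral>\<^sup>+z. (\<integral>\<^sup>+z'. h z' \<partial>IT.eP (Suc n) z) \<partial>IT.C 0 (Suc n) (\<lambda>_. undefined))"
  proof -
    have "IT.eP (Suc n) \<in> measurable (IT.C 0 (Suc n) (\<lambda>_. undefined)) (subprob_algebra (PiM {0..<Suc (Suc n)} (\<lambda>_. ST)))"
      using IT.measurable_eP[of "Suc n"] IT.sets_C[OF u, of "Suc n"] by (simp cong: measurable_cong_sets)
    then show ?thesis
      using nn_integral_bind[OF hm] by (subst IT.C.simps(2)) simp
  qed
  also have "\<dots> = (\<integral>\<^sup>+z. ?X n z * g' (?T n z) \<partial>IT.C 0 (Suc n) (\<lambda>_. undefined))"
  proof (rule nn_integral_cong)
    fix z assume "z \<in> space (IT.C 0 (Suc n) (\<lambda>_. undefined))"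
    then have z: "z \<in> space (PiM {0..<Suc n} (\<lambda>_. ST))" using IT.space_C[OF u, of "Suc n"] by simp
    show "(\<integral>\<^sup>+z'. h z' \<partial>IT.eP (Suc n) z) = ?X n z * g' (?T n z)"
      using IT.nn_integral_eP[OF z hm] inner[OF z] by simp
  qed
  also have "\<dots> = (\<integral>\<^sup>+t. g' t * ennreal (vrjp_fdd_density L W \<rho> n x t) \<partial>PiM {..<n} (\<lambda>_. lborel))"
    by (rule Suc.IH[OF g'm])
  also have "\<dots> = (\<integral>\<^sup>+t. (\<integral>\<^sup>+s. g (t(n := s)) * ennreal (vrjp_fdd_density L W \<rho> (Suc n) x (t(n := s))) \<partial>lborel) \<partial>PiM {..<n} (\<lambda>_. lborel))"
  proof (rule nn_integral_cong)
    fix t assume "t \<in> space (PiM {..<n} (\<lambda>_. lborel :: real measure))"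
    then have t: "t \<in> space (PiM {..<n} (\<lambda>_. borel :: real measure))" by (simp add: space_PiM)
    have m: "(\<lambda>s. g (t(n := s)) * w t s) \<in> borel_measurable borel"
      using measurable_compose[OF measurable_Pair1' gup, of t] measurable_compose[OF measurable_Pair1' wm, of t] t
      by (intro borel_measurable_times_ennreal) simp_all
    have d: "ennreal (vrjp_fdd_density L W \<rho> (Suc n) x (t(n := s))) = ennreal (vrjp_fdd_density L W \<rho> n x t) * w t s" for s
    proof (cases "s > 0 \<and> x (Suc n) \<in> L")
      case True
      then show ?thesis
        unfolding vrjp_fdd_density_Suc w_def by (simp add: ennreal_mult' vrjp_fdd_density_nonneg nn)
    qed (auto simp: vrjp_fdd_density_Suc w_def)
    have "g' t * ennreal (vrjp_fdd_density L W \<rho> n x t) = (\<integral>\<^sup>+s. ennreal (vrjp_fdd_density L W \<rho> n x t) * (g (t(n := s)) * w t s) \<partial>lborel)"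
      unfolding g'_def using m by (subst nn_integral_cmult) (auto simp: mult.commute)
    also have "\<dots> = (\<integral>\<^sup>+s. g (t(n := s)) * ennreal (vrjp_fdd_density L W \<rho> (Suc n) x (t(n := s))) \<partial>lborel)"
      unfolding d by (simp only: mult_ac)
    finally show "g' t * ennreal (vrjp_fdd_density L W \<rho> n x t)
       = (\<integral>\<^sup>+s. g (t(n := s)) * ennreal (vrjp_fdd_density L W \<rho> (Suc n) x (t(n := s))) \<partial>lborel)" .
  qed
  also have "\<dots> = (\<integral>\<^sup>+t. g t * ennreal (vrjp_fdd_density L W \<rho> (Suc n) x t) \<partial>PiM {..<Suc n} (\<lambda>_. lborel))"
  proof -
    have "(\<lambda>t. ennreal (vrjp_fdd_density L W \<rho> (Suc n) x t)) \<in> borel_measurable (PiM {..<Suc n} (\<lambda>_. borel))"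
      by (rule measurable_compose[OF measurable_vrjp_fdd_density measurable_ennreal]) auto
    then have "(\<lambda>t. g t * ennreal (vrjp_fdd_density L W \<rho> (Suc n) x t)) \<in> borel_measurable (PiM (insert n {..<n}) (\<lambda>_. lborel))"
      using gm by (subst measurable_cong_sets[OF PiM_lborel_borel refl]) (auto simp: lessThan_Suc)
    from lborel_prod.product_nn_integral_insert[OF _ _ this] show ?thesis by (simp add: lessThan_Suc)
  qed
  finally show ?case unfolding h_def .
qed

end

section \<open>Cylinder sets and uniqueness of the law\<close>

definition cylinder :: "'v set \<Rightarrow> nat \<Rightarrow> (nat \<Rightarrow> 'v) \<Rightarrow> (nat \<Rightarrow> real) set \<Rightarrow> (nat \<Rightarrow> 'v \<times> real) set" where
  "cylinder L n x B = {\<omega> \<in> space (seq_space L). (\<forall>k\<le>n. fst (\<omega> k) = x k) \<and> (\<lambda>k\<in>{..<n}. snd (\<omega> k)) \<in> B}"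

definition cylinders :: "'v set \<Rightarrow> (nat \<Rightarrow> 'v \<times> real) set set" where
  "cylinders L = {cylinder L n x B |n x B. B \<in> sets (PiM {..<n} (\<lambda>_. borel))}"

lemma is_vrjp_law_cylinder:
  "is_vrjp_law L W \<rho> P \<longleftrightarrow> sets P = sets (seq_space L) \<and> prob_space P \<and>
     (\<forall>n x B. B \<in> sets (PiM {..<n} (\<lambda>_. borel)) \<longrightarrow> emeasure P (cylinder L n x B)
        = (\<integral>\<^sup>+ t. indicator B t * ennreal (vrjp_fdd_density L W \<rho> n x t) \<partial>PiM {..<n} (\<lambda>_. lborel)))"
  unfolding is_vrjp_law_def cylinder_def ..

lemma space_seq_space: "\<omega> \<in> space (seq_space L) \<longleftrightarrow> (\<forall>n. fst (\<omega> n) \<in> L \<and> snd (\<omega> n) > 0)"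
  by (auto simp: seq_space_def space_PiM space_pair_measure space_restrict_space mem_Times_iff PiE_iff)

lemma measurable_seq_component:
  "(\<lambda>\<omega>. \<omega> n) \<in> measurable (seq_space L) (count_space L \<Otimes>\<^sub>M restrict_space borel {0<..})"
  unfolding seq_space_def by (rule measurable_component_singleton) simp

lemma measurable_seq_fst [measurable]: "(\<lambda>\<omega>. fst (\<omega> n)) \<in> measurable (seq_space L) (count_space L)"
  by (rule measurable_compose[OF measurable_seq_component measurable_fst])

lemma measurable_seq_snd [measurable]: "(\<lambda>\<omega>. snd (\<omega> n)) \<in> borel_measurable (seq_space L)"
proof -
  have "(\<lambda>\<omega>. snd (\<omega> n)) \<in> measurable (seq_space L) (restrict_space borel {0<..})"
    by (rule measurable_compose[OF measurable_seq_component measurable_snd])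
  then show ?thesis by (rule measurable_restrict_space2_iff[THEN iffD1, THEN conjunct1])
qed

lemma sets_cylinder [measurable]:
  assumes "B \<in> sets (PiM {..<n} (\<lambda>_. borel))"
  shows "cylinder L n x B \<in> sets (seq_space L)"
proof -
  have 1: "Measurable.pred (seq_space L) (\<lambda>\<omega>. \<forall>k\<in>{..n}. fst (\<omega> k) = x k)"
    by (intro pred_intros_finite pred_eq_const1[where N = "count_space L"] measurable_seq_fst) auto
  have 2: "(\<lambda>\<omega>. \<lambda>k\<in>{..<n}. snd (\<omega> k)) \<in> measurable (seq_space L) (PiM {..<n} (\<lambda>_. borel))"
    by (intro measurable_restrict measurable_seq_snd)
  have 3: "Measurable.pred (seq_space L) (\<lambda>\<omega>. (\<lambda>k\<in>{..<n}. snd (\<omega> k)) \<in> B)"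
    using measurable_sets[OF 2 assms] by (simp add: pred_def vimage_def Int_def conj_commute)
  have "cylinder L n x B = {\<omega> \<in> space (seq_space L). (\<forall>k\<in>{..n}. fst (\<omega> k) = x k) \<and> (\<lambda>k\<in>{..<n}. snd (\<omega> k)) \<in> B}"
    by (auto simp: cylinder_def)
  also have "\<dots> \<in> sets (seq_space L)" using 1 3 by measurable
  finally show ?thesis .
qed

lemma cylinders_subset_Pow: "cylinders L \<subseteq> Pow (space (seq_space L))"
  by (auto simp: cylinders_def cylinder_def)

lemma Int_stable_cylinders: "Int_stable (cylinders L)"
proof (rule Int_stableI)
  have *: "cylinder L n x B \<inter> cylinder L m y C \<in> cylinders L"
    if nm: "n \<le> m" and B: "B \<in> sets (PiM {..<n} (\<lambda>_. borel))" and C: "C \<in> sets (PiM {..<m} (\<lambda>_. borel))" for n m x y B C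
  proof -
    define D where "D = (if \<forall>k\<le>n. x k = y k then {t \<in> space (PiM {..<m} (\<lambda>_. borel)). restrict t {..<n} \<in> B} \<inter> C else {})"
    have "{t \<in> space (PiM {..<m} (\<lambda>_. borel)). restrict t {..<n} \<in> B} \<in> sets (PiM {..<m} (\<lambda>_. borel :: real measure))"
      using measurable_sets[OF measurable_restrict_subset[of "{..<n}" "{..<m}"] B] nm
      by (auto simp: vimage_def Int_def conj_commute)
    then have D: "D \<in> sets (PiM {..<m} (\<lambda>_. borel))" using C by (simp add: D_def)
    have mn: "{..<m} \<inter> {..<n} = {..<n}" using nm by auto
    have xy: "x k = y k" if "\<forall>k\<le>n. fst (\<omega> k) = x k" "\<forall>k\<le>m. fst (\<omega> k) = y k" "k \<le> n" for \<omega> :: "nat \<Rightarrow> 'a \<times> real" and k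
      using that nm by (metis order_trans)
    have "cylinder L n x B \<inter> cylinder L m y C = cylinder L m y D"
      unfolding cylinder_def D_def using xy nm by (auto simp: mn space_PiM)
    then show ?thesis using D by (auto simp: cylinders_def)
  qed
  fix a b assume "a \<in> cylinders L" "b \<in> cylinders L"
  then obtain n x B m y C where ab: "a = cylinder L n x B" "B \<in> sets (PiM {..<n} (\<lambda>_. borel))"
    "b = cylinder L m y C" "C \<in> sets (PiM {..<m} (\<lambda>_. borel))" by (auto simp: cylinders_def)
  show "a \<inter> b \<in> cylinders L"
    using *[OF _ ab(2,4), of x y] *[OF _ ab(4,2), of y x] ab(1,3)
    by (cases "n \<le> m") (auto simp: Int_commute)
qed

text \<open>Finiteness of \<open>L\<close> makes any condition on finitely many positions a finite
  union over their possible values.\<close>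

lemma cylinder_union:
  assumes "finite L" and S: "S = {\<omega> \<in> space (seq_space L). (\<lambda>k\<in>{..n}. fst (\<omega> k)) \<in> Y \<and> (\<lambda>k\<in>{..<n}. snd (\<omega> k)) \<in> B}"
    and B: "B \<in> sets (PiM {..<n} (\<lambda>_. borel))"
  shows "S \<in> sigma_sets (space (seq_space L)) (cylinders L)"
proof -
  let ?Y = "PiE {..n} (\<lambda>_. L) \<inter> Y"
  have "S = (\<Union>y\<in>?Y. cylinder L n y B)"
    unfolding S
  proof (intro equalityI subsetI)
    fix \<omega> assume w: "\<omega> \<in> {\<omega> \<in> space (seq_space L). (\<lambda>k\<in>{..n}. fst (\<omega> k)) \<in> Y \<and> (\<lambda>k\<in>{..<n}. snd (\<omega> k)) \<in> B}"
    then have "(\<lambda>k\<in>{..n}. fst (\<omega> k)) \<in> ?Y" by (auto simp: space_seq_space)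
    moreover have "\<omega> \<in> cylinder L n (\<lambda>k\<in>{..n}. fst (\<omega> k)) B" using w by (auto simp: cylinder_def)
    ultimately show "\<omega> \<in> (\<Union>y\<in>?Y. cylinder L n y B)" by blast
  next
    fix \<omega> assume "\<omega> \<in> (\<Union>y\<in>?Y. cylinder L n y B)"
    then obtain y where y: "y \<in> PiE {..n} (\<lambda>_. L)" "y \<in> Y" "\<omega> \<in> cylinder L n y B" by auto
    then have "(\<lambda>k\<in>{..n}. fst (\<omega> k)) = y"
      by (intro ext) (auto simp: cylinder_def PiE_def extensional_def)
    then show "\<omega> \<in> {\<omega> \<in> space (seq_space L). (\<lambda>k\<in>{..n}. fst (\<omega> k)) \<in> Y \<and> (\<lambda>k\<in>{..<n}. snd (\<omega> k)) \<in> B}"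
      using y by (auto simp: cylinder_def)
  qed
  moreover have "finite ?Y" using assms(1) by (intro finite_Int disjI1 finite_PiE) auto
  moreover have "cylinder L n y B \<in> cylinders L" for y using B by (auto simp: cylinders_def)
  ultimately show ?thesis
    using sigma_sets_UNION[of "(\<lambda>y. cylinder L n y B) ` ?Y" "space (seq_space L)" "cylinders L"]
    by (auto intro: countable_finite sigma_sets.Basic)
qed

lemma sets_seq_space:
  assumes fin: "finite L"
  shows "sets (seq_space L) = sigma_sets (space (seq_space L)) (cylinders L)"
proof
  let ?\<Omega> = "space (seq_space L)"
  show "sigma_sets ?\<Omega> (cylinders L) \<subseteq> sets (seq_space L)"
    by (rule sets.sigma_sets_subset) (auto simp: cylinders_def sets_cylinder)
  let ?S = "sigma ?\<Omega> (cylinders L)"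
  have sp: "space ?S = ?\<Omega>" and st: "sets ?S = sigma_sets ?\<Omega> (cylinders L)"
    by (rule space_measure_of_conv, rule sets_measure_of[OF cylinders_subset_Pow])
  have 1: "(\<lambda>\<omega>. fst (\<omega> n)) \<in> measurable ?S (count_space L)" for n
  proof (subst measurable_count_space_eq2[OF fin], intro conjI ballI)
    show "(\<lambda>\<omega>. fst (\<omega> n)) \<in> space ?S \<rightarrow> L" by (auto simp: sp space_seq_space)
    fix v assume "v \<in> L"
    have "(\<lambda>\<omega>. fst (\<omega> n)) -` {v} \<inter> space ?S = {\<omega> \<in> ?\<Omega>. (\<lambda>k\<in>{..n}. fst (\<omega> k)) \<in> {y. y n = v} \<and> (\<lambda>k\<in>{..<n}. snd (\<omega> k)) \<in> space (PiM {..<n} (\<lambda>_. borel))}"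
      by (auto simp: sp space_PiM)
    from cylinder_union[OF fin this] show "(\<lambda>\<omega>. fst (\<omega> n)) -` {v} \<inter> space ?S \<in> sets ?S" by (simp add: st)
  qed
  have 2: "(\<lambda>\<omega>. snd (\<omega> n)) \<in> measurable ?S (restrict_space borel {0<..})" for n
  proof (rule measurable_restrict_space2)
    show "(\<lambda>\<omega>. snd (\<omega> n)) \<in> space ?S \<rightarrow> {0<..}" by (auto simp: sp space_seq_space)
    show "(\<lambda>\<omega>. snd (\<omega> n)) \<in> borel_measurable ?S"
    proof (rule measurableI)
      fix C assume C: "C \<in> sets (borel :: real measure)"
      \<comment> \<open>A cylinder of length \<open>n\<close> constrains the waiting times with
        index below \<open>n\<close>, so the waiting time with index \<open>n\<close> first appears
        at length \<open>Suc n\<close>.\<close>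
      let ?B = "{t \<in> space (PiM {..<Suc n} (\<lambda>_. borel)). t n \<in> C}"
      have B: "?B \<in> sets (PiM {..<Suc n} (\<lambda>_. borel))"
      proof -
        have "(\<lambda>t. t n) \<in> measurable (PiM {..<Suc n} (\<lambda>_. borel)) borel" by (rule measurable_component_singleton) simp
        from measurable_sets[OF this C] show ?thesis by (simp add: vimage_def Int_def conj_commute)
      qed
      have "(\<lambda>\<omega>. snd (\<omega> n)) -` C \<inter> space ?S = {\<omega> \<in> ?\<Omega>. (\<lambda>k\<in>{..Suc n}. fst (\<omega> k)) \<in> UNIV \<and> (\<lambda>k\<in>{..<Suc n}. snd (\<omega> k)) \<in> ?B}"
        by (auto simp: sp space_PiM)
      from cylinder_union[OF fin this B] show "(\<lambda>\<omega>. snd (\<omega> n)) -` C \<inter> space ?S \<in> sets ?S" by (simp add: st)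
    qed simp
  qed
  have "(\<lambda>\<omega> n. (fst (\<omega> n), snd (\<omega> n))) \<in> measurable ?S (PiM UNIV (\<lambda>_. count_space L \<Otimes>\<^sub>M restrict_space borel {0<..}))"
    by (intro measurable_abs_UNIV measurable_Pair 1 2)
  then have id: "(\<lambda>\<omega>. \<omega>) \<in> measurable ?S (seq_space L)"
    by (simp only: seq_space_def[symmetric] prod.collapse)
  show "sets (seq_space L) \<subseteq> sigma_sets ?\<Omega> (cylinders L)"
  proof
    fix A assume A: "A \<in> sets (seq_space L)"
    from measurable_sets[OF id A] have "A \<inter> ?\<Omega> \<in> sigma_sets ?\<Omega> (cylinders L)" by (simp add: sp st)
    moreover have "A \<inter> ?\<Omega> = A" using sets.sets_into_space[OF A] by auto
    ultimately show "A \<in> sigma_sets ?\<Omega> (cylinders L)" by simp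
  qed
qed

lemma space_in_cylinders:
  assumes "finite L"
  shows "\<Union> ((\<lambda>v. cylinder L 0 (\<lambda>_. v) (space (PiM {..<0} (\<lambda>_. borel)))) ` L) = space (seq_space L)"
  by (auto simp: cylinder_def space_seq_space space_PiM restrict_def)

text \<open>The cylinders generate the sigma-algebra and are stable under intersection; finitely
  many of length 0 cover the space.\<close>

lemma measure_eqI_cylinders:
  assumes fin: "finite L" and sets: "sets P = sets (seq_space L)" "sets Q = sets (seq_space L)" and "finite_measure P"
    and eq: "\<And>n x B. B \<in> sets (PiM {..<n} (\<lambda>_. borel)) \<Longrightarrow> emeasure P (cylinder L n x B) = emeasure Q (cylinder L n x B)"
  shows "P = Q"
proof (rule measure_eqI_generator_eq_countable[OF Int_stable_cylinders cylinders_subset_Pow])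
  show "emeasure P X = emeasure Q X" if "X \<in> cylinders L" for X using that eq by (auto simp: cylinders_def)
  show "sets P = sigma_sets (space (seq_space L)) (cylinders L)" "sets Q = sigma_sets (space (seq_space L)) (cylinders L)"
    using sets sets_seq_space[OF fin] by auto
  let ?A = "(\<lambda>v. cylinder L 0 (\<lambda>_. v) (space (PiM {..<0} (\<lambda>_. borel)))) ` L"
  show "?A \<subseteq> cylinders L" by (auto simp: cylinders_def intro!: exI)
  show "\<Union> ?A = space (seq_space L)" by (rule space_in_cylinders[OF fin])
  show "countable ?A" using fin by (intro countable_finite) auto
  interpret finite_measure P by fact
  show "emeasure P a \<noteq> \<infinity>" for a by simp
qed

lemma is_vrjp_law_unique:
  assumes "finite L" "is_vrjp_law L W \<rho> P" "is_vrjp_law L W \<rho> Q"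
  shows "P = Q"
  using assms by (intro measure_eqI_cylinders[OF assms(1)])
    (auto simp: is_vrjp_law_cylinder prob_space.finite_measure)

lemma vrjp_law_eq:
  assumes "finite L" "is_vrjp_law L W \<rho> P"
  shows "vrjp_law L W \<rho> = P"
  unfolding vrjp_law_def
  by (rule the_equality[where P = "is_vrjp_law L W \<rho>", OF assms(2)]) (rule is_vrjp_law_unique[OF assms(1) _ assms(2)])

context vrjp_data
begin

text \<open>The image of the Ionescu-Tulcea limit under the map that pairs each position with the
  waiting time stored one coordinate later has the required finite-dimensional densities. Uniqueness
  then identifies it with the definite description \<open>vrjp_law\<close>.\<close>

theorem is_vrjp_law: "is_vrjp_law L W \<rho> (vrjp_law L W \<rho>)"
proof -
  let ?\<phi> = "\<lambda>z n. (snd (z n), jump_time z n)"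
  let ?I = "PiM UNIV (\<lambda>_. ST)"
  have m: "?\<phi> \<in> measurable ?I (seq_space L)"
    unfolding seq_space_def
  proof (intro measurable_abs_UNIV measurable_Pair measurable_restrict_space2)
    fix n :: nat
    show "(\<lambda>z. snd (z n)) \<in> measurable ?I (count_space L)"
      by (rule measurable_compose[OF _ measurable_snd], rule measurable_component_singleton) simp
    have [measurable]: "(\<lambda>z. fst (z (Suc n))) \<in> borel_measurable ?I"
      by (rule measurable_compose[OF _ measurable_fst], rule measurable_component_singleton) simp
    show "(\<lambda>z. jump_time z n) \<in> borel_measurable ?I" unfolding jump_time_def by measurable
    show "(\<lambda>z. jump_time z n) \<in> space ?I \<rightarrow> {0<..}" by (auto simp: jump_time_pos)
  qed
  let ?P = "distr IT.PF.lim (seq_space L) ?\<phi>"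
  have ml: "?\<phi> \<in> measurable IT.PF.lim (seq_space L)"
    using m by (simp add: measurable_cong_sets[OF IT.PF.sets_lim refl])
  have u: "(\<lambda>_. undefined) \<in> space (PiM {0..<0::nat} (\<lambda>_. ST))" by (simp add: space_PiM)
  \<comment> \<open>The total mass is that of the projection to the empty set of
    coordinates.\<close>
  have ps: "prob_space IT.PF.lim"
  proof
    have "emeasure IT.PF.lim (IT.PF.emb UNIV {} (space (PiM {} (\<lambda>_. ST)))) = emeasure (IT.CI {}) (space (PiM {} (\<lambda>_. ST)))"
      by (rule IT.lim) auto
    also have "IT.PF.emb UNIV {} (space (PiM {} (\<lambda>_. ST))) = space IT.PF.lim"
      by (auto simp: prod_emb_def IT.PF.space_lim space_PiM)
    also have "emeasure (IT.CI {}) (space (PiM {} (\<lambda>_. ST))) = 1"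
      using prob_space.emeasure_space_1[OF IT.PF.prob_space_P[of "{}"]] by (simp add: IT.CI_def)
    finally show "emeasure IT.PF.lim (space IT.PF.lim) = 1" .
  qed
  have "is_vrjp_law L W \<rho> ?P"
    unfolding is_vrjp_law_cylinder
  proof (intro conjI allI impI)
    show "prob_space ?P" by (rule prob_space.prob_space_distr[OF ps ml])
    fix n :: nat and x and B :: "(nat \<Rightarrow> real) set" assume B: "B \<in> sets (PiM {..<n} (\<lambda>_. borel))"
    define X where "X = {z \<in> space (PiM {0..<Suc n} (\<lambda>_. ST)). (\<forall>k\<in>{..n}. snd (z k) = x k) \<and> (\<lambda>k\<in>{..<n}. jump_time z k) \<in> B}"
    have snd_m: "(\<lambda>z. snd (z k)) \<in> measurable (PiM {0..<Suc n} (\<lambda>_. ST)) (count_space L)" if "k \<le> n" for k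
      by (rule measurable_compose[OF _ measurable_snd], rule measurable_component_singleton) (use that in auto)
    have fst_m: "(\<lambda>z. fst (z k)) \<in> borel_measurable (PiM {0..<Suc n} (\<lambda>_. ST))" if "k \<le> n" for k
      by (rule measurable_compose[OF _ measurable_fst], rule measurable_component_singleton) (use that in auto)
    have X: "X \<in> sets (PiM {0..<Suc n} (\<lambda>_. ST))"
    proof -
      have p: "Measurable.pred (PiM {0..<Suc n} (\<lambda>_. ST)) (\<lambda>z. \<forall>k\<in>{..n}. snd (z k) = x k)"
        by (intro pred_intros_finite pred_eq_const1[where N = "count_space L"] snd_m) auto
      have q: "(\<lambda>z. \<lambda>k\<in>{..<n}. jump_time z k) \<in> measurable (PiM {0..<Suc n} (\<lambda>_. ST)) (PiM {..<n} (\<lambda>_. borel))"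
      proof (rule measurable_restrict)
        fix k assume "k \<in> {..<n}"
        then have [measurable]: "(\<lambda>z. fst (z (Suc k))) \<in> borel_measurable (PiM {0..<Suc n} (\<lambda>_. ST))" by (intro fst_m) auto
        show "(\<lambda>z. jump_time z k) \<in> borel_measurable (PiM {0..<Suc n} (\<lambda>_. ST))"
          unfolding jump_time_def by measurable
      qed
      have r: "Measurable.pred (PiM {0..<Suc n} (\<lambda>_. ST)) (\<lambda>z. (\<lambda>k\<in>{..<n}. jump_time z k) \<in> B)"
        using measurable_sets[OF q B] by (simp add: pred_def vimage_def Int_def conj_commute)
      show ?thesis unfolding X_def using p r by measurable
    qed
    have e: "?\<phi> -` cylinder L n x B \<inter> space IT.PF.lim = IT.PF.emb UNIV {0..<Suc n} X"
    proof -
      have "restrict z {0..<Suc n} \<in> X \<longleftrightarrow> ?\<phi> z \<in> cylinder L n x B" if z: "z \<in> space ?I" for z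
      proof -
        have "?\<phi> z \<in> space (seq_space L)" using measurable_space[OF m z] .
        moreover have "restrict z {0..<Suc n} \<in> space (PiM {0..<Suc n} (\<lambda>_. ST))"
          using z by (auto simp: space_PiM)
        moreover have "(\<lambda>k\<in>{..<n}. jump_time (restrict z {0..<Suc n}) k) = (\<lambda>k\<in>{..<n}. jump_time z k)"
          by (auto simp: fun_eq_iff jump_time_def)
        ultimately show ?thesis
          unfolding X_def cylinder_def by (auto simp: less_Suc_eq_le)
      qed
      then show ?thesis
        by (auto simp: prod_emb_def IT.PF.space_lim space_PiM)
    qed
    have "emeasure ?P (cylinder L n x B) = emeasure IT.PF.lim (IT.PF.emb UNIV {0..<Suc n} X)"
      by (simp only: emeasure_distr[OF ml sets_cylinder[OF B]] e)
    also have "\<dots> = emeasure (IT.CI {0..<Suc n}) X"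
      using X by (intro IT.lim) auto
    also have "\<dots> = emeasure (IT.C 0 (Suc n) (\<lambda>_. undefined)) X"
    proof -
      have "X \<subseteq> (\<Pi>\<^sub>E i\<in>{0..<Suc n}. space ST)" by (auto simp: X_def space_PiM)
      then have "IT.PF.emb {0..<Suc n} {0..<Suc n} X = X" by (rule prod_emb_id)
      then show ?thesis using IT.emeasure_CI[of "{0..<Suc n}" "Suc n" X] X by simp
    qed
    also have "\<dots> = (\<integral>\<^sup>+z. indicator X z \<partial>IT.C 0 (Suc n) (\<lambda>_. undefined))"
      using X IT.sets_C[OF u, of "Suc n"] by (intro nn_integral_indicator[symmetric]) simp
    also have "\<dots> = (\<integral>\<^sup>+z. indicator {z. \<forall>k\<le>n. snd (z k) = x k} z * indicator B (\<lambda>k\<in>{..<n}. jump_time z k) \<partial>IT.C 0 (Suc n) (\<lambda>_. undefined))"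
      using IT.space_C[OF u, of "Suc n"]
      by (intro nn_integral_cong) (auto simp: X_def indicator_def)
    also have "\<dots> = (\<integral>\<^sup>+t. indicator B t * ennreal (vrjp_fdd_density L W \<rho> n x t) \<partial>PiM {..<n} (\<lambda>_. lborel))"
      using B by (intro nn_integral_C_vrjp) simp
    finally show "emeasure ?P (cylinder L n x B) = \<dots>" .
  qed simp
  with vrjp_law_eq[OF fin this] show ?thesis by simp
qed

end

text \<open>Measurability in the parameter need only be checked on cylinders, where the mass is an
  explicit integral of a density that is measurable in the weights. \<open>K\<close> and
  \<open>W\<close> are kept apart so that a law written with \<open>WJ\<close> can be treated
  through the measurable weights \<open>WJlim\<close>.\<close>

lemma measurable_vrjp_law:
  assumes "finite L" and W: "\<And>i j. (\<lambda>y. W y i j) \<in> borel_measurable N"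
    and K: "\<And>y. y \<in> space N \<Longrightarrow> is_vrjp_law L (W y) \<rho> (K y)"
  shows "K \<in> measurable N (prob_algebra (seq_space L))"
proof (rule measurable_prob_algebra_generated[OF sets_seq_space[OF assms(1)] Int_stable_cylinders cylinders_subset_Pow])
  fix y assume "y \<in> space N"
  from K[OF this] show "prob_space (K y)" "sets (K y) = sets (seq_space L)" by (auto simp: is_vrjp_law_def)
next
  fix A assume "A \<in> cylinders L"
  then obtain n x B where A: "A = cylinder L n x B" and B: "B \<in> sets (PiM {..<n} (\<lambda>_. borel))" by (auto simp: cylinders_def)
  have "(\<lambda>y. \<integral>\<^sup>+ t. indicator B t * ennreal (vrjp_fdd_density L (W y) \<rho> n x t) \<partial>PiM {..<n} (\<lambda>_. lborel)) \<in> borel_measurable N"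
  proof (rule sigma_finite_measure.borel_measurable_nn_integral)
    show "sigma_finite_measure (PiM {..<n} (\<lambda>_. lborel :: real measure))" by (intro lborel_prod.sigma_finite) simp
    have s: "sets (N \<Otimes>\<^sub>M PiM {..<n} (\<lambda>_. lborel)) = sets (N \<Otimes>\<^sub>M PiM {..<n} (\<lambda>_. borel :: real measure))"
      by (intro sets_pair_measure_cong PiM_lborel_borel refl)
    have "(\<lambda>p. vrjp_fdd_density L (W (fst p)) \<rho> n x (snd p)) \<in> borel_measurable (N \<Otimes>\<^sub>M PiM {..<n} (\<lambda>_. borel))"
    proof (rule measurable_vrjp_fdd_density)
      show "(\<lambda>p. W (fst p) i j) \<in> borel_measurable (N \<Otimes>\<^sub>M PiM {..<n} (\<lambda>_. borel))" for i j
        by (rule measurable_compose[OF measurable_fst W])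
      show "(\<lambda>p. snd p k) \<in> borel_measurable (N \<Otimes>\<^sub>M PiM {..<n} (\<lambda>_. borel))" if "k < n" for k
        by (rule measurable_compose[OF measurable_snd measurable_component_singleton]) (use that in auto)
    qed
    then have "(\<lambda>p. indicator B (snd p) * ennreal (vrjp_fdd_density L (W (fst p)) \<rho> n x (snd p))) \<in> borel_measurable (N \<Otimes>\<^sub>M PiM {..<n} (\<lambda>_. borel))"
      using B by measurable
    then show "(\<lambda>(y, t). indicator B t * ennreal (vrjp_fdd_density L (W y) \<rho> n x t)) \<in> borel_measurable (N \<Otimes>\<^sub>M PiM {..<n} (\<lambda>_. lborel))"
      unfolding case_prod_beta by (subst measurable_cong_sets[OF s refl])
  qed
  also have "?this \<longleftrightarrow> (\<lambda>y. emeasure (K y) A) \<in> borel_measurable N"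
    using K B by (intro measurable_cong) (auto simp: is_vrjp_law_cylinder A)
  finally show "(\<lambda>y. emeasure (K y) A) \<in> borel_measurable N" .
qed

section \<open>Cutting paths into blocks\<close>

text \<open>The sequence \<open>word x z\<close> spells \<open>x 0\<close>, the list
  \<open>z 0\<close>, \<open>x 1\<close>, the list \<open>z 1\<close>, and so on, and
  \<open>blk_len z k\<close> is the position of the letter \<open>x k\<close>. The letters
  \<open>x k\<close> form the path that is kept; the lists \<open>z k\<close> are what is cut
  out.\<close>

definition blk_len :: "(nat \<Rightarrow> 'v list) \<Rightarrow> nat \<Rightarrow> nat" where
  "blk_len z k = (\<Sum>j<k. Suc (length (z j)))"

definition word :: "(nat \<Rightarrow> 'v) \<Rightarrow> (nat \<Rightarrow> 'v list) \<Rightarrow> nat \<Rightarrow> 'v" where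
  "word x z l = (let k = (LEAST k. l < blk_len z (Suc k)) in (x k # z k) ! (l - blk_len z k))"

lemma blk_len_0 [simp]: "blk_len z 0 = 0"
  by (simp add: blk_len_def)

lemma blk_len_Suc: "blk_len z (Suc k) = blk_len z k + Suc (length (z k))"
  by (simp add: blk_len_def)

lemma blk_len_mono: "j \<le> k \<Longrightarrow> blk_len z j \<le> blk_len z k"
  by (rule lift_Suc_mono_le[of "blk_len z"]) (simp add: blk_len_Suc)

lemma word_block:
  assumes "i \<le> length (z k)"
  shows "word x z (blk_len z k + i) = (x k # z k) ! i"
proof -
  have "(LEAST j. blk_len z k + i < blk_len z (Suc j)) = k"
  proof (rule Least_equality)
    show "blk_len z k + i < blk_len z (Suc k)" using assms by (simp add: blk_len_Suc)
    fix j assume j: "blk_len z k + i < blk_len z (Suc j)"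
    show "k \<le> j"
    proof (rule ccontr)
      assume "\<not> k \<le> j"
      then have "blk_len z (Suc j) \<le> blk_len z k" by (intro blk_len_mono) simp
      with j show False by simp
    qed
  qed
  then show ?thesis by (simp add: word_def Let_def)
qed

lemma word_blk_len [simp]: "word x z (blk_len z k) = x k"
  using word_block[of 0 z k x] by simp

text \<open>The first letter of the next block is included so that every step that starts in a
  block, also the last one, is read off from a single list.\<close>

lemma word_block_ext:
  assumes "i \<le> Suc (length (z k))"
  shows "word x z (blk_len z k + i) = (x k # z k @ [x (Suc k)]) ! i"
proof (cases "i = Suc (length (z k))")
  case True
  then have "word x z (blk_len z k + i) = x (Suc k)"
    using word_blk_len[of x z "Suc k"] by (simp add: blk_len_Suc)
  then show ?thesis using True by (simp add: nth_append)
next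
  case False
  then have "i \<le> length (z k)" using assms by simp
  then show ?thesis using word_block[of i z k x] by (cases i) (auto simp: nth_append)
qed

lemma block_cases:
  assumes "l < blk_len z n"
  obtains k i where "k < n" "i \<le> length (z k)" "l = blk_len z k + i"
  using assms
proof (induction n arbitrary: thesis)
  case (Suc n)
  show ?case
  proof (cases "l < blk_len z n")
    case True
    show ?thesis by (rule Suc.IH[OF _ True]) (use Suc.prems(1) less_SucI in blast)
  next
    case False
    show ?thesis
      by (rule Suc.prems(1)[of n "l - blk_len z n"]) (use False Suc.prems(2) in \<open>auto simp: blk_len_Suc\<close>)
  qed
qed simp

lemma sum_blocks:
  fixes f :: "nat \<Rightarrow> 'a :: comm_monoid_add"
  shows "(\<Sum>l<blk_len z n. f l) = (\<Sum>k<n. \<Sum>i<Suc (length (z k)). f (blk_len z k + i))"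
proof (induction n)
  case (Suc n)
  have "(\<Sum>l<a + b. f l) = (\<Sum>l<a. f l) + (\<Sum>i<b. f (a + i))" for a b
    by (induction b) (simp_all add: add.assoc)
  then show ?case by (simp only: blk_len_Suc Suc sum.lessThan_Suc[of _ n])
qed simp

lemma prod_blocks:
  fixes f :: "nat \<Rightarrow> 'a :: comm_monoid_mult"
  shows "(\<Prod>l<blk_len z n. f l) = (\<Prod>k<n. \<Prod>i<Suc (length (z k)). f (blk_len z k + i))"
proof (induction n)
  case (Suc n)
  have "(\<Prod>l<a + b. f l) = (\<Prod>l<a. f l) * (\<Prod>i<b. f (a + i))" for a b
    by (induction b) (simp_all add: mult.assoc)
  then show ?case by (simp only: blk_len_Suc Suc prod.lessThan_Suc[of _ n])
qed simp

text \<open>The factors \<open>W / 2\<close> are those that remain when the step densities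
  telescope. The final step into \<open>b\<close> is included, so the weights of consecutive blocks
  multiply to that of the whole word.\<close>

fun path_weight :: "('v \<Rightarrow> 'v \<Rightarrow> real) \<Rightarrow> 'v \<Rightarrow> 'v list \<Rightarrow> 'v \<Rightarrow> real" where
  "path_weight W a [] b = W a b / 2"
| "path_weight W a (c # cs) b = W a c / 2 * path_weight W c cs b"

lemma path_weight_eq_prod:
  "path_weight W a zs b = (\<Prod>i<Suc (length zs). W ((a # zs @ [b]) ! i) ((a # zs @ [b]) ! Suc i) / 2)"
proof (induction zs arbitrary: a)
  case (Cons c zs)
  show ?case
    unfolding path_weight.simps Cons.IH list.size
    by (subst (2) prod.lessThan_Suc_shift) simp
qed simp

lemma prod_word_weights:
  "(\<Prod>l<blk_len z n. W (word x z l) (word x z (Suc l)) / 2) = (\<Prod>k<n. path_weight W (x k) (z k) (x (Suc k)))"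
  unfolding prod_blocks path_weight_eq_prod
proof (intro prod.cong refl)
  fix k i assume "i \<in> {..<Suc (length (z k))}"
  then show "W (word x z (blk_len z k + i)) (word x z (Suc (blk_len z k + i))) / 2
    = W ((x k # z k @ [x (Suc k)]) ! i) ((x k # z k @ [x (Suc k)]) ! Suc i) / 2"
    using word_block_ext[of i z k x] word_block_ext[of "Suc i" z k x] by simp
qed

text \<open>Both the restriction to \<open>J\<close> and the removal of self-loops cut a path into blocks: a new block starts
  at the first letter \<open>b\<close> with \<open>Q a b\<close>, where \<open>a\<close> is the first letter of the current block.\<close>

fun cut_idx :: "('v \<Rightarrow> 'v \<Rightarrow> bool) \<Rightarrow> (nat \<Rightarrow> 'v \<times> real) \<Rightarrow> nat \<Rightarrow> nat" where
  "cut_idx Q \<omega> 0 = 0"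
| "cut_idx Q \<omega> (Suc n) = (LEAST l. l > cut_idx Q \<omega> n \<and> Q (fst (\<omega> (cut_idx Q \<omega> n))) (fst (\<omega> l)))"

lemma restr_idx_eq: "restr_idx J \<omega> = cut_idx (\<lambda>a b. b \<in> J) \<omega>"
proof
  fix n show "restr_idx J \<omega> n = cut_idx (\<lambda>a b. b \<in> J) \<omega> n" by (induction n) simp_all
qed

lemma loop_idx_eq: "loop_idx \<omega> = cut_idx (\<lambda>a b. b \<noteq> a) \<omega>"
proof
  fix n show "loop_idx \<omega> n = cut_idx (\<lambda>a b. b \<noteq> a) \<omega> n" by (induction n) simp_all
qed

text \<open>No letter of a block after its first one is accepted by \<open>Q\<close>, and the first
  letter of the next block is accepted, so each \<open>LEAST\<close> search stops exactly at a block
  boundary.\<close>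

lemma cut_idx_word:
  assumes w: "\<And>l. l \<le> blk_len z n \<Longrightarrow> fst (\<omega> l) = word x z l"
    and Q: "\<And>k. k < n \<Longrightarrow> Q (x k) (x (Suc k))" and nQ: "\<And>k c. k < n \<Longrightarrow> c \<in> set (z k) \<Longrightarrow> \<not> Q (x k) c"
    and "k \<le> n"
  shows "cut_idx Q \<omega> k = blk_len z k"
  using \<open>k \<le> n\<close>
proof (induction k)
  case (Suc k)
  then have IH: "cut_idx Q \<omega> k = blk_len z k" by simp
  have le: "blk_len z (Suc k) \<le> blk_len z n" using Suc.prems by (rule blk_len_mono)
  have fk: "fst (\<omega> (blk_len z k)) = x k" using w[of "blk_len z k"] blk_len_mono[of k n z] Suc.prems by simp
  show ?case unfolding cut_idx.simps IH fk
  proof (rule Least_equality)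
    show "blk_len z (Suc k) > blk_len z k \<and> Q (x k) (fst (\<omega> (blk_len z (Suc k))))"
    proof
      show "blk_len z (Suc k) > blk_len z k" by (simp add: blk_len_Suc)
      have "fst (\<omega> (blk_len z (Suc k))) = x (Suc k)" using w[OF le] by simp
      then show "Q (x k) (fst (\<omega> (blk_len z (Suc k))))" using Q[of k] Suc.prems by simp
    qed
    fix l assume l: "l > blk_len z k \<and> Q (x k) (fst (\<omega> l))"
    show "blk_len z (Suc k) \<le> l"
    proof (rule ccontr)
      assume "\<not> blk_len z (Suc k) \<le> l"
      then obtain i where i: "l = blk_len z k + Suc i" "i < length (z k)"
        using l by (metis add_Suc_right blk_len_Suc less_imp_Suc_add linorder_not_less nat_add_left_cancel_less Suc_less_eq)
      have "fst (\<omega> l) = z k ! i"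
        using w[of l] word_block[of "Suc i" z k x] i le by (simp add: blk_len_Suc)
      then show False using nQ[of k "z k ! i"] l i Suc.prems by simp
    qed
  qed
qed simp

text \<open>The block boundaries are the cut indices of \<omega>, hence determined by \<omega>.
  Cylinders over different words are therefore disjoint even when the words have different
  lengths.\<close>

lemma word_inject:
  fixes \<omega> :: "nat \<Rightarrow> 'v \<times> real"
  assumes "\<And>l. l \<le> blk_len z n \<Longrightarrow> fst (\<omega> l) = word x z l" "\<And>l. l \<le> blk_len z' n \<Longrightarrow> fst (\<omega> l) = word x z' l"
    and Q: "\<And>k. k < n \<Longrightarrow> Q (x k) (x (Suc k))"
    and nQ: "\<And>k c. k < n \<Longrightarrow> c \<in> set (z k) \<Longrightarrow> \<not> Q (x k) c" "\<And>k c. k < n \<Longrightarrow> c \<in> set (z' k) \<Longrightarrow> \<not> Q (x k) c"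
    and "k < n"
  shows "z k = z' k"
proof -
  have b: "blk_len z j = blk_len z' j" if "j \<le> n" for j
    using cut_idx_word[where Q = Q and x = x and z = z and n = n and \<omega> = \<omega>, OF assms(1) Q nQ(1) that] cut_idx_word[where Q = Q and x = x and z = z' and n = n and \<omega> = \<omega>, OF assms(2) Q nQ(2) that] by simp
  have len: "length (z k) = length (z' k)"
    using b[of "Suc k"] b[of k] \<open>k < n\<close> by (simp add: blk_len_Suc)
  show ?thesis
  proof (rule nth_equalityI[OF len])
    fix i assume i: "i < length (z k)"
    have le: "blk_len z k + Suc i \<le> blk_len z n" "blk_len z' k + Suc i \<le> blk_len z' n"
      using blk_len_mono[of "Suc k" n z] blk_len_mono[of "Suc k" n z'] \<open>k < n\<close> i len by (simp_all add: blk_len_Suc)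
    have "z k ! i = word x z (blk_len z k + Suc i)" using i by (subst word_block) auto
    also have "\<dots> = word x z' (blk_len z' k + Suc i)"
      using assms(1)[OF le(1)] assms(2)[OF le(2)] b[of k] \<open>k < n\<close> by simp
    also have "\<dots> = z' k ! i" using i len by (subst word_block) auto
    finally show "z k ! i = z' k ! i" .
  qed
qed

section \<open>Integrating out waiting times block by block\<close>

abbreviation LB :: "nat \<Rightarrow> (nat \<Rightarrow> real) measure" where
  "LB n \<equiv> PiM {..<n} (\<lambda>_. lborel)"

text \<open>Integrating out the coordinates \<open>m, \<dots>, m + p - 1\<close> of a product measure with densities \<open>q\<close>
  turns the functional \<open>V\<close> of these coordinates into a single coordinate with density \<open>\<kappa>\<close>.\<close>

definition block_integral :: "nat \<Rightarrow> nat \<Rightarrow> (nat \<Rightarrow> real \<Rightarrow> ennreal) \<Rightarrow> ((nat \<Rightarrow> real) \<Rightarrow> real) \<Rightarrow> (real \<Rightarrow> ennreal) \<Rightarrow> bool" where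
  "block_integral m p q V \<kappa> \<longleftrightarrow> (\<forall>\<Psi> \<in> borel_measurable (LB m \<Otimes>\<^sub>M borel).
     (\<integral>\<^sup>+t. \<Psi> (restrict t {..<m}, V t) * (\<Prod>i<p. q (m + i) (t (m + i))) \<partial>LB (m + p))
       = (\<integral>\<^sup>+t. (\<integral>\<^sup>+s. \<Psi> (t, s) * \<kappa> s \<partial>lborel) \<partial>LB m))"

lemma nn_integral_LB_Suc:
  assumes "f \<in> borel_measurable (LB (Suc n))"
  shows "(\<integral>\<^sup>+t. f t \<partial>LB (Suc n)) = (\<integral>\<^sup>+t. (\<integral>\<^sup>+s. f (t(n := s)) \<partial>lborel) \<partial>LB n)"
  using lborel_prod.product_nn_integral_insert[of "{..<n}" n f] assms by (simp add: lessThan_Suc)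

lemma LB_restrict: "t \<in> space (LB n) \<Longrightarrow> restrict t {..<n} = t"
  by (auto simp: space_PiM PiE_def extensional_restrict)

lemma measurable_LB_component: "k < n \<Longrightarrow> (\<lambda>t. t k) \<in> borel_measurable (LB n)"
  using measurable_component_singleton[of k "{..<n}" "\<lambda>_. lborel :: real measure"] by simp

lemma measurable_LB_upd: "(\<lambda>p. (fst p)(n := snd p)) \<in> measurable (LB n \<Otimes>\<^sub>M lborel) (LB (Suc n))"
  by (rule measurable_fun_upd[where J="{..<n}"]) (auto simp: lessThan_Suc)

lemma measurable_LB_upd': "(\<lambda>p. (fst p)(n := snd p)) \<in> measurable (LB n \<Otimes>\<^sub>M borel) (LB (Suc n))"
  using measurable_LB_upd by (simp cong: measurable_cong_sets sets_pair_measure_cong)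

lemma LB_pair_sets: "sets (LB n \<Otimes>\<^sub>M (lborel :: real measure)) = sets (LB n \<Otimes>\<^sub>M borel)"
  by (intro sets_pair_measure_cong) auto

text \<open>The form used for the restriction to \<open>J\<close>: the waiting time at the first
  letter is kept, and those of the excursion after it integrate to constants, one after the other
  from the end.\<close>

lemma block_integral_first:
  assumes q: "\<And>l. q l \<in> borel_measurable borel"
  shows "block_integral m (Suc r) q (\<lambda>t. t m) (\<lambda>s. q m s * (\<Prod>i<r. \<integral>\<^sup>+u. q (m + Suc i) u \<partial>lborel))"
  unfolding block_integral_def
proof (induction r)
  case 0
  show ?case
  proof
    fix \<Psi> :: "(nat \<Rightarrow> real) \<times> real \<Rightarrow> ennreal" assume \<Psi>: "\<Psi> \<in> borel_measurable (LB m \<Otimes>\<^sub>M borel)"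
    have r: "(\<lambda>t. restrict t {..<m}) \<in> measurable (LB (Suc m)) (LB m)"
      by (rule measurable_restrict_subset) auto
    note c = measurable_LB_component[OF lessI]
    have f: "(\<lambda>t. \<Psi> (restrict t {..<m}, t m) * q m (t m)) \<in> borel_measurable (LB (Suc m))"
      by (intro borel_measurable_times_ennreal measurable_compose[OF _ \<Psi>] measurable_compose[OF c q] measurable_Pair r c)
    have "(\<integral>\<^sup>+t. \<Psi> (restrict t {..<m}, t m) * q m (t m) \<partial>LB (Suc m))
       = (\<integral>\<^sup>+t. (\<integral>\<^sup>+s. \<Psi> (restrict (t(m := s)) {..<m}, s) * q m s \<partial>lborel) \<partial>LB m)"
      by (subst nn_integral_LB_Suc[OF f]) simp
    also have "\<dots> = (\<integral>\<^sup>+t. (\<integral>\<^sup>+s. \<Psi> (t, s) * q m s \<partial>lborel) \<partial>LB m)"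
    proof (rule nn_integral_cong)
      fix t assume "t \<in> space (LB m)"
      then have "restrict (t(m := s)) {..<m} = t" for s
        using LB_restrict[of t m] by (simp add: restrict_upd)
      then show "(\<integral>\<^sup>+s. \<Psi> (restrict (t(m := s)) {..<m}, s) * q m s \<partial>lborel) = (\<integral>\<^sup>+s. \<Psi> (t, s) * q m s \<partial>lborel)" by simp
    qed
    finally show "(\<integral>\<^sup>+t. \<Psi> (restrict t {..<m}, t m) * (\<Prod>i<Suc 0. q (m + i) (t (m + i))) \<partial>LB (m + Suc 0))
       = (\<integral>\<^sup>+t. (\<integral>\<^sup>+s. \<Psi> (t, s) * (q m s * (\<Prod>i<0. \<integral>\<^sup>+u. q (m + Suc i) u \<partial>lborel)) \<partial>lborel) \<partial>LB m)"
      by simp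
  qed
next
  case (Suc r)
  show ?case
  proof
    fix \<Psi> :: "(nat \<Rightarrow> real) \<times> real \<Rightarrow> ennreal" assume \<Psi>: "\<Psi> \<in> borel_measurable (LB m \<Otimes>\<^sub>M borel)"
    let ?N = "m + Suc r"
    let ?c = "\<integral>\<^sup>+u. q ?N u \<partial>lborel"
    define F where "F t = \<Psi> (restrict t {..<m}, t m) * (\<Prod>i<Suc r. q (m + i) (t (m + i)))" for t
    have Fm: "F \<in> borel_measurable (LB n)" if "n \<ge> ?N" for n
      unfolding F_def
      by (intro borel_measurable_times_ennreal borel_measurable_prod_ennreal measurable_compose[OF _ \<Psi>] measurable_compose[OF _ q]
          measurable_Pair measurable_restrict_subset measurable_LB_component) (use that in auto)
    have Fu: "F (t(?N := s)) = F t" for t s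
    proof -
      have "restrict (t(?N := s)) {..<m} = restrict t {..<m}" by auto
      moreover have "(\<Prod>i<Suc r. q (m + i) ((t(?N := s)) (m + i))) = (\<Prod>i<Suc r. q (m + i) (t (m + i)))"
        by (intro prod.cong) auto
      ultimately show ?thesis unfolding F_def by simp
    qed
    have f: "(\<lambda>t. F t * q ?N (t ?N)) \<in> borel_measurable (LB (Suc ?N))"
      by (intro borel_measurable_times_ennreal Fm measurable_compose[OF _ q] measurable_LB_component) auto
    have "(\<integral>\<^sup>+t. \<Psi> (restrict t {..<m}, t m) * (\<Prod>i<Suc (Suc r). q (m + i) (t (m + i))) \<partial>LB (m + Suc (Suc r)))
       = (\<integral>\<^sup>+t. F t * q ?N (t ?N) \<partial>LB (Suc ?N))"
      by (simp add: F_def mult.assoc)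
    also have "\<dots> = (\<integral>\<^sup>+t. (\<integral>\<^sup>+s. F t * q ?N s \<partial>lborel) \<partial>LB ?N)"
      by (subst nn_integral_LB_Suc[OF f]) (simp only: Fu fun_upd_same)
    also have "\<dots> = (\<integral>\<^sup>+t. F t * ?c \<partial>LB ?N)"
      using q by (intro nn_integral_cong nn_integral_cmult) simp
    also have "\<dots> = (\<integral>\<^sup>+t. F t \<partial>LB ?N) * ?c"
      by (rule nn_integral_multc) (rule Fm, simp)
    also have "(\<integral>\<^sup>+t. F t \<partial>LB ?N) = (\<integral>\<^sup>+t. (\<integral>\<^sup>+s. \<Psi> (t, s) * (q m s * (\<Prod>i<r. \<integral>\<^sup>+u. q (m + Suc i) u \<partial>lborel)) \<partial>lborel) \<partial>LB m)"
      unfolding F_def using Suc \<Psi> by blast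
    also have "\<dots> * ?c = (\<integral>\<^sup>+t. (\<integral>\<^sup>+s. \<Psi> (t, s) * (q m s * (\<Prod>i<r. \<integral>\<^sup>+u. q (m + Suc i) u \<partial>lborel)) \<partial>lborel) * ?c \<partial>LB m)"
    proof (rule nn_integral_multc[symmetric], rule sigma_finite_measure.borel_measurable_nn_integral[OF lborel.sigma_finite_measure_axioms])
      show "(\<lambda>(t, s). \<Psi> (t, s) * (q m s * (\<Prod>i<r. \<integral>\<^sup>+u. q (m + Suc i) u \<partial>lborel))) \<in> borel_measurable (LB m \<Otimes>\<^sub>M lborel)"
        unfolding case_prod_beta prod.collapse measurable_cong_sets[OF LB_pair_sets refl]
        by (intro borel_measurable_times_ennreal \<Psi> measurable_compose[OF measurable_snd q] borel_measurable_const)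
    qed
    also have "\<dots> = (\<integral>\<^sup>+t. (\<integral>\<^sup>+s. \<Psi> (t, s) * (q m s * (\<Prod>i<Suc r. \<integral>\<^sup>+u. q (m + Suc i) u \<partial>lborel)) \<partial>lborel) \<partial>LB m)"
    proof (rule nn_integral_cong)
      fix t assume t: "t \<in> space (LB m)"
      have "(\<lambda>s. \<Psi> (t, s) * (q m s * (\<Prod>i<r. \<integral>\<^sup>+u. q (m + Suc i) u \<partial>lborel))) \<in> borel_measurable lborel"
        using measurable_compose[OF measurable_Pair1'[OF t] \<Psi>] q by simp
      from nn_integral_multc[OF this, of ?c, symmetric]
      show "(\<integral>\<^sup>+s. \<Psi> (t, s) * (q m s * (\<Prod>i<r. \<integral>\<^sup>+u. q (m + Suc i) u \<partial>lborel)) \<partial>lborel) * ?c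
         = (\<integral>\<^sup>+s. \<Psi> (t, s) * (q m s * (\<Prod>i<Suc r. \<integral>\<^sup>+u. q (m + Suc i) u \<partial>lborel)) \<partial>lborel)"
        by (simp add: mult.assoc)
    qed
    finally show "(\<integral>\<^sup>+t. \<Psi> (restrict t {..<m}, t m) * (\<Prod>i<Suc (Suc r). q (m + i) (t (m + i))) \<partial>LB (m + Suc (Suc r)))
       = (\<integral>\<^sup>+t. (\<integral>\<^sup>+s. \<Psi> (t, s) * (q m s * (\<Prod>i<Suc r. \<integral>\<^sup>+u. q (m + Suc i) u \<partial>lborel)) \<partial>lborel) \<partial>LB m)" .
  qed
qed

lemma nn_integral_power_triangle:
  fixes v :: real
  shows "(\<integral>\<^sup>+s. indicator {s<..} v * (indicator {0<..} s * ennreal (s ^ r / fact r)) \<partial>lborel)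
    = indicator {0<..} v * ennreal (v ^ Suc r / fact (Suc r))"
proof (cases "v > 0")
  case True
  have "(\<integral>\<^sup>+s. indicator {s<..} v * (indicator {0<..} s * ennreal (s ^ r / fact r)) \<partial>lborel)
     = (\<integral>\<^sup>+s. ennreal (s ^ r / fact r) * indicator {0..v} s \<partial>lborel)"
  proof (rule nn_integral_cong_AE)
    show "AE s in lborel. indicator {s<..} v * (indicator {0<..} s * ennreal (s ^ r / fact r)) = ennreal (s ^ r / fact r) * indicator {0..v} s"
      using AE_lborel_singleton[of 0] AE_lborel_singleton[of v]
      by eventually_elim (auto simp: indicator_def)
  qed
  also have "\<dots> = ennreal (v ^ Suc r / fact (Suc r) - 0 ^ Suc r / fact (Suc r))"
  proof (rule nn_integral_FTC_Icc)
    show "((\<lambda>s. s ^ Suc r / fact (Suc r)) has_real_derivative s ^ r / fact r) (at s)" for s :: real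
      by (auto intro!: derivative_eq_intros simp del: power_Suc of_nat_Suc simp: fact_Suc)
  qed (use True in auto)
  finally show ?thesis using True by simp
next
  case False
  then have z: "(\<lambda>s. indicator {s<..} v * (indicator {0<..} s * ennreal (s ^ r / fact r))) = (\<lambda>s. 0)"
    by (auto simp: indicator_def fun_eq_iff)
  show ?thesis unfolding z using False by simp
qed

text \<open>The form used for self-loops: under Lebesgue measure the sum of \<open>Suc r\<close>
  positive times has density \<open>s ^ r / fact r\<close>, the volume of the simplex of
  intermediate jump times. Each further time is one convolution with Lebesgue measure on the half
  line.\<close>

lemma block_integral_sum:
  "block_integral m (Suc r) (\<lambda>_. indicator {0<..}) (\<lambda>t. \<Sum>i<Suc r. t (m + i))
     (\<lambda>s. indicator {0<..} s * ennreal (s ^ r / fact r))"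
proof (induction r)
  case 0
  show ?case using block_integral_first[of "\<lambda>_. indicator {0<..}" m 0] by (simp add: one_ennreal.rep_eq)
next
  case (Suc r)
  show ?case unfolding block_integral_def
  proof
    fix \<Psi> :: "(nat \<Rightarrow> real) \<times> real \<Rightarrow> ennreal" assume \<Psi>: "\<Psi> \<in> borel_measurable (LB m \<Otimes>\<^sub>M borel)"
    let ?N = "m + Suc r"
    let ?I = "indicator {0<..} :: real \<Rightarrow> ennreal"
    let ?S = "\<lambda>t. \<Sum>i<Suc r. t (m + i)"
    \<comment> \<open>The newest waiting time \<open>u\<close> is absorbed into the test function,
      so that the induction hypothesis applies to the sum of the earlier ones.\<close>
    define \<Psi>' where "\<Psi>' p = (\<integral>\<^sup>+u. \<Psi> (fst p, snd p + u) * ?I u \<partial>lborel)" for p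
    have \<Psi>'m: "\<Psi>' \<in> borel_measurable (LB m \<Otimes>\<^sub>M borel)"
      unfolding \<Psi>'_def
    proof (rule sigma_finite_measure.borel_measurable_nn_integral[OF lborel.sigma_finite_measure_axioms])
      have [measurable]: "(\<lambda>p. (fst (fst p), snd (fst p) + snd p)) \<in> measurable ((LB m \<Otimes>\<^sub>M borel) \<Otimes>\<^sub>M lborel) (LB m \<Otimes>\<^sub>M borel)"
        by measurable
      show "(\<lambda>(p, u). \<Psi> (fst p, snd p + u) * ?I u) \<in> borel_measurable ((LB m \<Otimes>\<^sub>M borel) \<Otimes>\<^sub>M lborel)"
        unfolding case_prod_beta
        by (intro borel_measurable_times_ennreal measurable_compose[OF _ \<Psi>]) measurable
    qed
    define G where "G t = (\<Prod>i<Suc r. ?I (t (m + i)))" for t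
    have f: "(\<lambda>t. \<Psi> (restrict t {..<m}, ?S t + t ?N) * (G t * ?I (t ?N))) \<in> borel_measurable (LB (Suc ?N))"
      unfolding G_def
      by (intro borel_measurable_times_ennreal borel_measurable_prod_ennreal measurable_compose[OF _ \<Psi>] borel_measurable_sum borel_measurable_add
          measurable_compose[OF _ borel_measurable_indicator[of "{0<..}" borel]]
          measurable_Pair measurable_restrict_subset measurable_LB_component) auto
    have "(\<integral>\<^sup>+t. \<Psi> (restrict t {..<m}, \<Sum>i<Suc (Suc r). t (m + i)) * (\<Prod>i<Suc (Suc r). ?I (t (m + i))) \<partial>LB (m + Suc (Suc r)))
      = (\<integral>\<^sup>+t. \<Psi> (restrict t {..<m}, ?S t + t ?N) * (G t * ?I (t ?N)) \<partial>LB (Suc ?N))"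
      by (simp add: G_def)
    also have "\<dots> = (\<integral>\<^sup>+t. (\<integral>\<^sup>+u. \<Psi> (restrict t {..<m}, ?S t + u) * (G t * ?I u) \<partial>lborel) \<partial>LB ?N)"
    proof (subst nn_integral_LB_Suc[OF f], intro nn_integral_cong)
      fix t :: "nat \<Rightarrow> real" and u :: real
      have "restrict (t(?N := u)) {..<m} = restrict t {..<m}" by auto
      moreover have "?S (t(?N := u)) = ?S t" "G (t(?N := u)) = G t" unfolding G_def by (auto intro!: sum.cong prod.cong)
      ultimately show "\<Psi> (restrict (t(?N := u)) {..<m}, ?S (t(?N := u)) + (t(?N := u)) ?N) * (G (t(?N := u)) * ?I ((t(?N := u)) ?N))
         = \<Psi> (restrict t {..<m}, ?S t + u) * (G t * ?I u)" by (simp only: fun_upd_same)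
    qed
    also have "\<dots> = (\<integral>\<^sup>+t. \<Psi>' (restrict t {..<m}, ?S t) * G t \<partial>LB ?N)"
    proof (rule nn_integral_cong)
      fix t assume "t \<in> space (LB ?N)"
      then have rt: "restrict t {..<m} \<in> space (LB m)" by (auto simp: space_PiM)
      have "(\<lambda>u. \<Psi> (restrict t {..<m}, ?S t + u)) \<in> borel_measurable borel"
        by (rule measurable_compose[OF _ measurable_compose[OF measurable_Pair1'[OF rt] \<Psi>]]) simp
      then have m: "(\<lambda>u. \<Psi> (restrict t {..<m}, ?S t + u) * ?I u) \<in> borel_measurable lborel" by simp
      have "(\<integral>\<^sup>+u. \<Psi> (restrict t {..<m}, ?S t + u) * (G t * ?I u) \<partial>lborel)
         = (\<integral>\<^sup>+u. \<Psi> (restrict t {..<m}, ?S t + u) * ?I u * G t \<partial>lborel)" by (simp only: mult_ac)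
      also have "\<dots> = \<Psi>' (restrict t {..<m}, ?S t) * G t"
        unfolding nn_integral_multc[OF m] \<Psi>'_def by simp
      finally show "(\<integral>\<^sup>+u. \<Psi> (restrict t {..<m}, ?S t + u) * (G t * ?I u) \<partial>lborel) = \<Psi>' (restrict t {..<m}, ?S t) * G t" .
    qed
    also have "\<dots> = (\<integral>\<^sup>+t. (\<integral>\<^sup>+s. \<Psi>' (t, s) * (?I s * ennreal (s ^ r / fact r)) \<partial>lborel) \<partial>LB m)"
      unfolding G_def using Suc \<Psi>'m unfolding block_integral_def by blast
    also have "\<dots> = (\<integral>\<^sup>+t. (\<integral>\<^sup>+v. \<Psi> (t, v) * (?I v * ennreal (v ^ Suc r / fact (Suc r))) \<partial>lborel) \<partial>LB m)"
    proof (rule nn_integral_cong)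
      fix t assume t: "t \<in> space (LB m)"
      define k where "k s = ?I s * ennreal (s ^ r / fact r)" for s :: real
      have k[measurable]: "k \<in> borel_measurable borel" unfolding k_def by measurable
      have P[measurable]: "(\<lambda>v. \<Psi> (t, v)) \<in> borel_measurable borel"
        by (rule measurable_compose[OF measurable_Pair1'[OF t] \<Psi>])
      have I2[measurable]: "(\<lambda>p. indicator {fst p<..} (snd p) :: ennreal) \<in> borel_measurable (borel \<Otimes>\<^sub>M (borel :: real measure))"
      proof -
        have "(\<lambda>p. if fst p < snd p then 1 else 0 :: ennreal) \<in> borel_measurable (borel \<Otimes>\<^sub>M (borel :: real measure))" by measurable
        then show ?thesis by (simp add: indicator_def)
      qed
      \<comment> \<open>The substitution \<open>v = s + u\<close> makes the new total time the
        variable of integration; after an exchange of integrals, a power of \<open>s\<close> is left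
        to be integrated over \<open>0 < s < v\<close>.\<close>
      have tr: "\<Psi>' (t, s) = (\<integral>\<^sup>+v. \<Psi> (t, v) * indicator {s<..} v \<partial>lborel)" for s
      proof -
        have "(\<integral>\<^sup>+v. \<Psi> (t, v) * indicator {s<..} v \<partial>lborel) = ennreal \<bar>1\<bar> * (\<integral>\<^sup>+u. \<Psi> (t, s + 1 * u) * indicator {s<..} (s + 1 * u) \<partial>lborel)"
          by (rule nn_integral_real_affine) auto
        then show ?thesis by (simp add: \<Psi>'_def indicator_def)
      qed
      have "(\<integral>\<^sup>+s. \<Psi>' (t, s) * k s \<partial>lborel) = (\<integral>\<^sup>+s. (\<integral>\<^sup>+v. \<Psi> (t, v) * indicator {s<..} v * k s \<partial>lborel) \<partial>lborel)"
        unfolding tr by (intro nn_integral_cong nn_integral_multc[symmetric]) simp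
      also have "\<dots> = (\<integral>\<^sup>+v. (\<integral>\<^sup>+s. \<Psi> (t, v) * indicator {s<..} v * k s \<partial>lborel) \<partial>lborel)"
      proof (rule lborel_pair.Fubini'[symmetric])
        have "(\<lambda>p. \<Psi> (t, snd p) * indicator {fst p<..} (snd p) * k (fst p)) \<in> borel_measurable (borel \<Otimes>\<^sub>M borel)"
          by measurable
        then show "(\<lambda>(s, v). \<Psi> (t, v) * indicator {s<..} v * k s) \<in> borel_measurable (lborel \<Otimes>\<^sub>M lborel)"
          by (simp add: case_prod_beta cong: measurable_cong_sets sets_pair_measure_cong)
      qed
      also have "\<dots> = (\<integral>\<^sup>+v. \<Psi> (t, v) * (?I v * ennreal (v ^ Suc r / fact (Suc r))) \<partial>lborel)"
      proof (rule nn_integral_cong)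
        fix v :: real
        have "(\<lambda>s. indicator {s<..} v * k s) \<in> borel_measurable lborel"
        proof -
          have "(\<lambda>s. if s < v then k s else 0) \<in> borel_measurable borel" by measurable
          moreover have "(\<lambda>s. if s < v then k s else 0) = (\<lambda>s. indicator {s<..} v * k s)" by (auto simp: fun_eq_iff)
          ultimately show ?thesis by simp
        qed
        from nn_integral_cmult[OF this, of "\<Psi> (t, v)"] nn_integral_power_triangle[of v r]
        show "(\<integral>\<^sup>+s. \<Psi> (t, v) * indicator {s<..} v * k s \<partial>lborel) = \<Psi> (t, v) * (?I v * ennreal (v ^ Suc r / fact (Suc r)))"
          unfolding k_def by (simp only: mult.assoc)
      qed
      finally show "(\<integral>\<^sup>+s. \<Psi>' (t, s) * (?I s * ennreal (s ^ r / fact r)) \<partial>lborel)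
        = (\<integral>\<^sup>+v. \<Psi> (t, v) * (?I v * ennreal (v ^ Suc r / fact (Suc r))) \<partial>lborel)" unfolding k_def .
    qed
    finally show "(\<integral>\<^sup>+t. \<Psi> (restrict t {..<m}, \<Sum>i<Suc (Suc r). t (m + i)) * (\<Prod>i<Suc (Suc r). ?I (t (m + i))) \<partial>LB (m + Suc (Suc r)))
      = (\<integral>\<^sup>+t. (\<integral>\<^sup>+v. \<Psi> (t, v) * (?I v * ennreal (v ^ Suc r / fact (Suc r))) \<partial>lborel) \<partial>LB m)" .
  qed
qed

text \<open>The last block is peeled off. The condition on \<open>restrict\<close> says that
  \<open>V k\<close> sees no coordinate beyond the end of block \<open>k\<close>, so the earlier
  functionals are unaffected and the remaining integrand has the same form with \<open>h'\<close>
  for \<open>h\<close>.\<close>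

lemma block_integrals:
  fixes z :: "nat \<Rightarrow> 'v list" and h :: "(nat \<Rightarrow> real) \<Rightarrow> ennreal"
  assumes q: "\<And>l. q l \<in> borel_measurable borel" and \<kappa>: "\<And>k. \<kappa> k \<in> borel_measurable borel"
    and V: "\<And>k M. blk_len z (Suc k) \<le> M \<Longrightarrow> V k \<in> borel_measurable (LB M)"
    and Vr: "\<And>k M t. blk_len z (Suc k) \<le> M \<Longrightarrow> V k (restrict t {..<M}) = V k t"
    and BI: "\<And>k. k < n \<Longrightarrow> block_integral (blk_len z k) (Suc (length (z k))) q (V k) (\<kappa> k)"
    and h: "h \<in> borel_measurable (LB n)"
  shows "(\<integral>\<^sup>+t. h (\<lambda>k\<in>{..<n}. V k t) * (\<Prod>l<blk_len z n. q l (t l)) \<partial>LB (blk_len z n)) = (\<integral>\<^sup>+s. h s * (\<Prod>k<n. \<kappa> k (s k)) \<partial>LB n)"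
  using BI h
proof (induction n arbitrary: h)
  case 0
  show ?case unfolding blk_len_0 lessThan_0 by (subst (1 2) lborel_prod.nn_integral_empty) (simp_all add: restrict_def)
next
  case (Suc n)
  note h = Suc.prems(2)
  let ?m = "blk_len z n" and ?p = "Suc (length (z n))"
  let ?V = "\<lambda>t. \<lambda>k\<in>{..<n}. V k t"
  define Q where "Q t = (\<Prod>l<?m. q l (t l))" for t
  define h' where "h' v = (\<integral>\<^sup>+s. h (v(n := s)) * \<kappa> n s \<partial>lborel)" for v
  have hu: "(\<lambda>p. h ((fst p)(n := snd p))) \<in> borel_measurable (LB n \<Otimes>\<^sub>M borel)"
    by (rule measurable_compose[OF measurable_LB_upd' h])
  have h'm: "h' \<in> borel_measurable (LB n)"
    unfolding h'_def
  proof (rule sigma_finite_measure.borel_measurable_nn_integral[OF lborel.sigma_finite_measure_axioms])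
    show "(\<lambda>(v, s). h (v(n := s)) * \<kappa> n s) \<in> borel_measurable (LB n \<Otimes>\<^sub>M lborel)"
      unfolding case_prod_beta measurable_cong_sets[OF LB_pair_sets refl]
      by (intro borel_measurable_times_ennreal hu measurable_compose[OF measurable_snd \<kappa>])
  qed
  have kn: "blk_len z (Suc k) \<le> ?m" if "k < n" for k using that by (intro blk_len_mono) simp
  have Vm: "?V \<in> measurable (LB ?m) (LB n)"
  proof (rule measurable_restrict)
    fix k assume "k \<in> {..<n}"
    then show "V k \<in> measurable (LB ?m) lborel" using V[OF kn[of k]] by simp
  qed
  have Qm: "Q \<in> borel_measurable (LB ?m)"
    unfolding Q_def by (intro borel_measurable_prod_ennreal measurable_compose[OF _ q] measurable_LB_component) simp
  define \<Psi> where "\<Psi> = (\<lambda>(t, s). h ((?V t)(n := s)) * Q t)"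
  have \<Psi>: "\<Psi> \<in> borel_measurable (LB ?m \<Otimes>\<^sub>M borel)"
  proof -
    have "(\<lambda>p. (?V (fst p), snd p)) \<in> measurable (LB ?m \<Otimes>\<^sub>M borel) (LB n \<Otimes>\<^sub>M borel)"
      by (intro measurable_Pair measurable_compose[OF measurable_fst Vm] measurable_snd)
    from measurable_compose[OF this hu] show ?thesis
      unfolding \<Psi>_def case_prod_beta by (intro borel_measurable_times_ennreal measurable_compose[OF measurable_fst Qm]) simp
  qed
  have "(\<integral>\<^sup>+t. h (\<lambda>k\<in>{..<Suc n}. V k t) * (\<Prod>l<blk_len z (Suc n). q l (t l)) \<partial>LB (blk_len z (Suc n)))
     = (\<integral>\<^sup>+t. \<Psi> (restrict t {..<?m}, V n t) * (\<Prod>i<?p. q (?m + i) (t (?m + i))) \<partial>LB (?m + ?p))"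
    unfolding blk_len_Suc[of z n]
  proof (rule nn_integral_cong)
    fix t
    have 1: "(\<lambda>k\<in>{..<Suc n}. V k t) = (?V (restrict t {..<?m}))(n := V n t)"
      using Vr[OF kn] by (auto simp: fun_eq_iff less_Suc_eq)
    have "(\<Prod>l<a + b. f l) = (\<Prod>l<a. f l) * (\<Prod>i<b. f (a + i))" for a b and f :: "nat \<Rightarrow> ennreal"
      by (induction b) (simp_all add: mult.assoc)
    then have 2: "(\<Prod>l<?m + ?p. q l (t l)) = Q (restrict t {..<?m}) * (\<Prod>i<?p. q (?m + i) (t (?m + i)))"
      unfolding Q_def by (simp add: mult.assoc)
    show "h (\<lambda>k\<in>{..<Suc n}. V k t) * (\<Prod>l<?m + ?p. q l (t l)) = \<Psi> (restrict t {..<?m}, V n t) * (\<Prod>i<?p. q (?m + i) (t (?m + i)))"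
      unfolding 1 2 \<Psi>_def prod.case by (simp only: mult.assoc)
  qed
  also have "\<dots> = (\<integral>\<^sup>+t. (\<integral>\<^sup>+s. \<Psi> (t, s) * \<kappa> n s \<partial>lborel) \<partial>LB ?m)"
    using Suc.prems(1)[of n] \<Psi> unfolding block_integral_def by simp
  also have "\<dots> = (\<integral>\<^sup>+t. h' (?V t) * Q t \<partial>LB ?m)"
  proof (rule nn_integral_cong)
    fix t assume t: "t \<in> space (LB ?m)"
    then have vt: "?V t \<in> space (LB n)" by (simp add: space_PiM)
    have "(\<lambda>s. h ((?V t)(n := s)) * \<kappa> n s) \<in> borel_measurable lborel"
      using measurable_compose[OF measurable_Pair1'[OF vt] hu] \<kappa>[of n] by simp
    from nn_integral_multc[OF this, of "Q t"] show "(\<integral>\<^sup>+s. \<Psi> (t, s) * \<kappa> n s \<partial>lborel) = h' (?V t) * Q t"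
      unfolding \<Psi>_def prod.case h'_def by (simp only: mult_ac)
  qed
  also have "\<dots> = (\<integral>\<^sup>+s. h' s * (\<Prod>k<n. \<kappa> k (s k)) \<partial>LB n)"
    unfolding Q_def by (rule Suc.IH[OF _ h'm]) (use Suc.prems(1) in simp)
  also have "\<dots> = (\<integral>\<^sup>+s. h s * (\<Prod>k<Suc n. \<kappa> k (s k)) \<partial>LB (Suc n))"
  proof -
    have f: "(\<lambda>s. h s * (\<Prod>k<Suc n. \<kappa> k (s k))) \<in> borel_measurable (LB (Suc n))"
      by (intro borel_measurable_times_ennreal h borel_measurable_prod_ennreal measurable_compose[OF _ \<kappa>] measurable_LB_component) simp
    show ?thesis
    proof (subst nn_integral_LB_Suc[OF f], rule nn_integral_cong)
      fix v assume v: "v \<in> space (LB n)"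
      have pr: "(\<Prod>k<n. \<kappa> k ((v(n := s)) k)) = (\<Prod>k<n. \<kappa> k (v k))" for s by (intro prod.cong) auto
      have "(\<lambda>s. h (v(n := s)) * \<kappa> n s) \<in> borel_measurable lborel"
        using measurable_compose[OF measurable_Pair1'[OF v] hu] \<kappa>[of n] by simp
      from nn_integral_multc[OF this, of "\<Prod>k<n. \<kappa> k (v k)"]
      show "h' v * (\<Prod>k<n. \<kappa> k (v k)) = (\<integral>\<^sup>+s. h (v(n := s)) * (\<Prod>k<Suc n. \<kappa> k ((v(n := s)) k)) \<partial>lborel)"
        unfolding h'_def prod.lessThan_Suc pr fun_upd_same by (simp only: mult_ac)
    qed
  qed
  finally show ?case .
qed

text \<open>After integration each block is a single coordinate with a density of its own, so the
  sum over all choices of blocks becomes a product of sums by distributivity.\<close>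

lemma sum_words_integral:
  fixes h :: "(nat \<Rightarrow> real) \<Rightarrow> ennreal" and a :: "nat \<Rightarrow> 'v list \<Rightarrow> ennreal"
  assumes fin: "\<And>k. k < n \<Longrightarrow> finite (Z k)"
    and q: "\<And>z l. q z l \<in> borel_measurable borel" and \<kappa>: "\<And>k y. \<kappa> k y \<in> borel_measurable borel"
    and V: "\<And>z k M. blk_len z (Suc k) \<le> M \<Longrightarrow> V z k \<in> borel_measurable (LB M)"
    and Vr: "\<And>z k M t. blk_len z (Suc k) \<le> M \<Longrightarrow> V z k (restrict t {..<M}) = V z k t"
    and BI: "\<And>z k. z \<in> PiE {..<n} Z \<Longrightarrow> k < n \<Longrightarrow> block_integral (blk_len z k) (Suc (length (z k))) (q z) (V z k) (\<kappa> k (z k))"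
    and h: "h \<in> borel_measurable (LB n)"
  shows "(\<Sum>z\<in>PiE {..<n} Z. \<integral>\<^sup>+t. (\<Prod>k<n. a k (z k)) * h (\<lambda>k\<in>{..<n}. V z k t) * (\<Prod>l<blk_len z n. q z l (t l)) \<partial>LB (blk_len z n))
    = (\<integral>\<^sup>+s. h s * (\<Prod>k<n. \<Sum>y\<in>Z k. a k y * \<kappa> k y (s k)) \<partial>LB n)"
proof -
  have "(\<Sum>z\<in>PiE {..<n} Z. \<integral>\<^sup>+t. (\<Prod>k<n. a k (z k)) * h (\<lambda>k\<in>{..<n}. V z k t) * (\<Prod>l<blk_len z n. q z l (t l)) \<partial>LB (blk_len z n))
     = (\<Sum>z\<in>PiE {..<n} Z. \<integral>\<^sup>+s. (\<Prod>k<n. a k (z k)) * h s * (\<Prod>k<n. \<kappa> k (z k) (s k)) \<partial>LB n)"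
  proof (intro sum.cong refl)
    fix z assume z: "z \<in> PiE {..<n} Z"
    show "(\<integral>\<^sup>+t. (\<Prod>k<n. a k (z k)) * h (\<lambda>k\<in>{..<n}. V z k t) * (\<Prod>l<blk_len z n. q z l (t l)) \<partial>LB (blk_len z n))
       = (\<integral>\<^sup>+s. (\<Prod>k<n. a k (z k)) * h s * (\<Prod>k<n. \<kappa> k (z k) (s k)) \<partial>LB n)"
      by (rule block_integrals[where q = "q z" and V = "V z" and \<kappa> = "\<lambda>k. \<kappa> k (z k)" and h = "\<lambda>s. (\<Prod>k<n. a k (z k)) * h s"])
         (use q \<kappa> V Vr BI[OF z] h in auto)
  qed
  also have "\<dots> = (\<integral>\<^sup>+s. (\<Sum>z\<in>PiE {..<n} Z. (\<Prod>k<n. a k (z k)) * h s * (\<Prod>k<n. \<kappa> k (z k) (s k))) \<partial>LB n)"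
    by (rule nn_integral_sum[symmetric])
       (intro borel_measurable_times_ennreal borel_measurable_const h borel_measurable_prod_ennreal measurable_compose[OF _ \<kappa>] measurable_LB_component, simp)
  also have "\<dots> = (\<integral>\<^sup>+s. h s * (\<Prod>k<n. \<Sum>y\<in>Z k. a k y * \<kappa> k y (s k)) \<partial>LB n)"
  proof (rule nn_integral_cong)
    fix s
    have "(\<Prod>k<n. \<Sum>y\<in>Z k. a k y * \<kappa> k y (s k)) = (\<Sum>z\<in>PiE {..<n} Z. \<Prod>k<n. a k (z k) * \<kappa> k (z k) (s k))"
      using fin by (intro prod_sum_PiE) auto
    then show "(\<Sum>z\<in>PiE {..<n} Z. (\<Prod>k<n. a k (z k)) * h s * (\<Prod>k<n. \<kappa> k (z k) (s k))) = h s * (\<Prod>k<n. \<Sum>y\<in>Z k. a k y * \<kappa> k y (s k))"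
      by (simp add: sum_distrib_left prod.distrib mult_ac)
  qed
  finally show ?thesis .
qed

text \<open>Every choice \<open>z\<close> of blocks prescribes a cylinder inside \<open>E\<close>.
  These are disjoint by \<open>word_inject\<close>, so their masses add up. With finite sets
  \<open>Z k\<close> this gives only an inequality, which is what \<open>law_eqI_cut\<close> asks
  for.\<close>

lemma cut_lower_bound:
  fixes P :: "(nat \<Rightarrow> 'v \<times> real) measure"
  assumes P: "is_vrjp_law L W \<rho> P"
    and fin: "\<And>k. k < n \<Longrightarrow> finite (Z k)" and Q: "\<And>k. k < n \<Longrightarrow> Q (x k) (x (Suc k))"
    and nQ: "\<And>k y c. k < n \<Longrightarrow> y \<in> Z k \<Longrightarrow> c \<in> set y \<Longrightarrow> \<not> Q (x k) c"
    and V: "\<And>z k M. blk_len z (Suc k) \<le> M \<Longrightarrow> V z k \<in> borel_measurable (LB M)"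
    and Vr: "\<And>z k M t. blk_len z (Suc k) \<le> M \<Longrightarrow> V z k (restrict t {..<M}) = V z k t"
    and B: "B \<in> sets (LB n)" and E: "E \<in> sets (seq_space L)"
    and cover: "\<And>z \<omega>. z \<in> PiE {..<n} Z \<Longrightarrow> \<omega> \<in> space (seq_space L) \<Longrightarrow> (\<And>l. l \<le> blk_len z n \<Longrightarrow> fst (\<omega> l) = word x z l)
        \<Longrightarrow> (\<lambda>k\<in>{..<n}. V z k (\<lambda>l. snd (\<omega> l))) \<in> B \<Longrightarrow> \<omega> \<in> E"
  shows "(\<Sum>z\<in>PiE {..<n} Z. \<integral>\<^sup>+t. indicator B (\<lambda>k\<in>{..<n}. V z k t) * ennreal (vrjp_fdd_density L W \<rho> (blk_len z n) (word x z) t) \<partial>LB (blk_len z n))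
    \<le> emeasure P E"
proof -
  define D where "D z = {t \<in> space (LB (blk_len z n)). (\<lambda>k\<in>{..<n}. V z k t) \<in> B}" for z
  define C where "C z = cylinder L (blk_len z n) (word x z) (D z)" for z
  have sP: "sets P = sets (seq_space L)" using P by (simp add: is_vrjp_law_def)
  have finZ: "finite (PiE {..<n} Z)" using fin by (intro finite_PiE) auto
  have le: "blk_len z (Suc k) \<le> blk_len z n" if "k < n" for z k using that by (intro blk_len_mono) simp
  have Vm: "(\<lambda>t. \<lambda>k\<in>{..<n}. V z k t) \<in> measurable (LB (blk_len z n)) (LB n)" for z
  proof (rule measurable_restrict)
    fix k assume "k \<in> {..<n}"
    then show "V z k \<in> measurable (LB (blk_len z n)) lborel" using V[OF le[of k z]] by simp
  qed
  have D: "D z \<in> sets (LB (blk_len z n))" for z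
    using measurable_sets[OF Vm B] by (simp add: D_def vimage_def Int_def conj_commute)
  then have D': "D z \<in> sets (PiM {..<blk_len z n} (\<lambda>_. borel))" for z by (simp add: PiM_lborel_borel)
  have Cs: "C z \<in> sets P" for z unfolding C_def sP by (rule sets_cylinder[OF D'])
  have eC: "emeasure P (C z) = (\<integral>\<^sup>+t. indicator B (\<lambda>k\<in>{..<n}. V z k t) * ennreal (vrjp_fdd_density L W \<rho> (blk_len z n) (word x z) t) \<partial>LB (blk_len z n))" for z
  proof -
    have "emeasure P (C z) = (\<integral>\<^sup>+t. indicator (D z) t * ennreal (vrjp_fdd_density L W \<rho> (blk_len z n) (word x z) t) \<partial>LB (blk_len z n))"
      using P D'[of z] unfolding is_vrjp_law_cylinder C_def by blast
    also have "\<dots> = (\<integral>\<^sup>+t. indicator B (\<lambda>k\<in>{..<n}. V z k t) * ennreal (vrjp_fdd_density L W \<rho> (blk_len z n) (word x z) t) \<partial>LB (blk_len z n))"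
      by (intro nn_integral_cong) (auto simp: D_def indicator_def)
    finally show ?thesis .
  qed
  have CE: "C z \<subseteq> E" if z: "z \<in> PiE {..<n} Z" for z
  proof
    fix \<omega> assume "\<omega> \<in> C z"
    then have w: "\<omega> \<in> space (seq_space L)" "\<And>l. l \<le> blk_len z n \<Longrightarrow> fst (\<omega> l) = word x z l"
      and d: "(\<lambda>k\<in>{..<n}. V z k (\<lambda>l\<in>{..<blk_len z n}. snd (\<omega> l))) \<in> B"
      by (auto simp: C_def D_def cylinder_def)
    have "V z k (\<lambda>l\<in>{..<blk_len z n}. snd (\<omega> l)) = V z k (\<lambda>l. snd (\<omega> l))" if "k < n" for k
      by (rule Vr[OF le[OF that]])
    then have "(\<lambda>k\<in>{..<n}. V z k (\<lambda>l\<in>{..<blk_len z n}. snd (\<omega> l))) = (\<lambda>k\<in>{..<n}. V z k (\<lambda>l. snd (\<omega> l)))"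
      by (intro restrict_ext) simp
    with d show "\<omega> \<in> E" by (intro cover[OF z w]) auto
  qed
  have disj: "disjoint_family_on C (PiE {..<n} Z)"
    unfolding disjoint_family_on_def
  proof (intro ballI impI)
    fix z z' assume z: "z \<in> PiE {..<n} Z" "z' \<in> PiE {..<n} Z" "z \<noteq> z'"
    show "C z \<inter> C z' = {}"
    proof (rule ccontr)
      assume "C z \<inter> C z' \<noteq> {}"
      then obtain \<omega> where w: "\<omega> \<in> C z" "\<omega> \<in> C z'" by auto
      have "z k = z' k" if "k < n" for k
      proof (rule word_inject[where n = n and \<omega> = \<omega> and x = x and Q = Q])
        show "fst (\<omega> l) = word x z l" if "l \<le> blk_len z n" for l using w(1) that by (auto simp: C_def cylinder_def)
        show "fst (\<omega> l) = word x z' l" if "l \<le> blk_len z' n" for l using w(2) that by (auto simp: C_def cylinder_def)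
        show "\<And>k. k < n \<Longrightarrow> Q (x k) (x (Suc k))" by (rule Q)
        show "\<not> Q (x k) c" if "k < n" "c \<in> set (z k)" for k c using nQ[OF that(1) _ that(2)] z(1) that(1) by auto
        show "\<not> Q (x k) c" if "k < n" "c \<in> set (z' k)" for k c using nQ[OF that(1) _ that(2)] z(2) that(1) by auto
      qed fact
      then have "z = z'" by (intro PiE_ext[OF z(1,2)]) auto
      with z(3) show False by simp
    qed
  qed
  have "(\<Sum>z\<in>PiE {..<n} Z. emeasure P (C z)) = emeasure P (\<Union>z\<in>PiE {..<n} Z. C z)"
    by (rule sum_emeasure[OF _ disj finZ]) (use Cs in auto)
  also have "\<dots> \<le> emeasure P E"
    using CE E by (intro emeasure_mono) (auto simp: sP)
  finally show ?thesis unfolding eC .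
qed

text \<open>If there is no further cut point the next cut index is arbitrary, so a cut path may
  leave \<open>J\<close>, and a time given by an empty sum is 0. This larger space receives such
  paths as well.\<close>

definition ext_space :: "'v set \<Rightarrow> (nat \<Rightarrow> 'v \<times> real) measure" where
  "ext_space L = PiM UNIV (\<lambda>_. count_space L \<Otimes>\<^sub>M borel)"

section \<open>Measurability of the cut maps\<close>

context
  fixes L :: "'v set" and M :: "(nat \<Rightarrow> 'v \<times> real) measure"
  assumes fin: "finite L" and fst_meas: "\<And>n. (\<lambda>\<omega>. fst (\<omega> n)) \<in> measurable M (count_space L)"
    and snd_meas: "\<And>n. (\<lambda>\<omega>. snd (\<omega> n)) \<in> borel_measurable M"
begin

lemma measurable_random_letter:
  assumes "N \<in> measurable M (count_space UNIV)"
  shows "(\<lambda>\<omega>. fst (\<omega> (N \<omega>))) \<in> measurable M (count_space L)"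
  by (rule measurable_compose_countable'[OF fst_meas assms]) auto

lemma measurable_cut_idx: "(\<lambda>\<omega>. cut_idx Q \<omega> n) \<in> measurable M (count_space UNIV)"
proof (induction n)
  case (Suc n)
  note [measurable] = Suc
  have a: "(\<lambda>\<omega>. fst (\<omega> (cut_idx Q \<omega> n))) \<in> measurable M (count_space L)"
    by (rule measurable_random_letter[OF Suc])
  have "Measurable.pred M (\<lambda>\<omega>. Q (fst (\<omega> (cut_idx Q \<omega> n))) (fst (\<omega> l)))" for l
  proof (rule measurable_compose_countable'[OF _ a countable_finite[OF fin]])
    fix i
    show "Measurable.pred M (\<lambda>\<omega>. Q i (fst (\<omega> l)))"
      by (rule measurable_compose_countable'[OF _ fst_meas countable_finite[OF fin]]) simp
  qed
  note [measurable] = this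
  show ?case unfolding cut_idx.simps by measurable
qed simp

lemma measurable_restr_J_ext: "restr_J J \<in> measurable M (ext_space L)"
proof -
  have "(\<lambda>\<omega> n. (fst (\<omega> (cut_idx (\<lambda>a b. b \<in> J) \<omega> n)), snd (\<omega> (cut_idx (\<lambda>a b. b \<in> J) \<omega> n)))) \<in> measurable M (ext_space L)"
    unfolding ext_space_def
  proof (intro measurable_abs_UNIV measurable_Pair measurable_random_letter measurable_cut_idx)
    fix n
    show "(\<lambda>\<omega>. snd (\<omega> (cut_idx (\<lambda>a b. b \<in> J) \<omega> n))) \<in> borel_measurable M"
      by (rule measurable_compose_countable'[OF snd_meas measurable_cut_idx]) auto
  qed
  then show ?thesis by (simp add: restr_J_def[abs_def] restr_idx_eq)
qed

lemma measurable_remove_loops_ext: "remove_loops \<in> measurable M (ext_space L)"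
  unfolding remove_loops_def[abs_def] ext_space_def loop_idx_eq
proof (intro measurable_abs_UNIV measurable_Pair measurable_random_letter measurable_cut_idx)
  fix n
  note c = measurable_cut_idx[of "\<lambda>a b. b \<noteq> a"]
  have "(\<lambda>\<omega>. \<Sum>l\<in>{i..<cut_idx (\<lambda>a b. b \<noteq> a) \<omega> (Suc n)}. snd (\<omega> l)) \<in> borel_measurable M" for i
    by (rule measurable_compose_countable'[OF _ c, where f = "\<lambda>j \<omega>. \<Sum>l\<in>{i..<j}. snd (\<omega> l)"])
       (intro borel_measurable_sum snd_meas, auto)
  then show "(\<lambda>\<omega>. \<Sum>l\<in>{cut_idx (\<lambda>a b. b \<noteq> a) \<omega> n..<cut_idx (\<lambda>a b. b \<noteq> a) \<omega> (Suc n)}. snd (\<omega> l)) \<in> borel_measurable M"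
    by (rule measurable_compose_countable'[OF _ c]) auto
qed

end

lemma measurable_ext_fst: "(\<lambda>\<omega>. fst (\<omega> n)) \<in> measurable (ext_space L) (count_space L)"
  unfolding ext_space_def by (rule measurable_compose[OF _ measurable_fst], rule measurable_component_singleton) simp

lemma measurable_ext_snd: "(\<lambda>\<omega>. snd (\<omega> n)) \<in> borel_measurable (ext_space L)"
  unfolding ext_space_def by (rule measurable_compose[OF _ measurable_snd], rule measurable_component_singleton) simp

lemma measurable_restr_J: "finite L \<Longrightarrow> restr_J J \<in> measurable (seq_space L) (ext_space L)"
  by (rule measurable_restr_J_ext[OF _ measurable_seq_fst measurable_seq_snd])

lemma measurable_remove_loops: "finite L \<Longrightarrow> remove_loops \<in> measurable (seq_space L) (ext_space L)"
  by (rule measurable_remove_loops_ext[OF _ measurable_seq_fst measurable_seq_snd])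

lemma measurable_remove_loops_restr_J: "finite L \<Longrightarrow> remove_loops \<circ> restr_J J \<in> measurable (seq_space L) (ext_space L)"
  by (rule measurable_comp[OF measurable_restr_J measurable_remove_loops_ext[OF _ measurable_ext_fst measurable_ext_snd]])

text \<open>This lets preimages of events on \<open>J\<close> be formed under maps into
  \<open>ext_space L\<close>. The set of proper paths is itself an event there, given by countably
  many conditions.\<close>

lemma sets_seq_space_ext:
  assumes "finite J" "J \<subseteq> L" "A \<in> sets (seq_space J)"
  shows "A \<in> sets (ext_space L)"
proof -
  let ?M = "ext_space L"
  note f = measurable_ext_fst[of _ L] and s = measurable_ext_snd[of _ L]
  have sub: "\<omega> \<in> space (seq_space J) \<Longrightarrow> \<omega> \<in> space ?M" for \<omega>
    using assms(2) by (auto simp: space_seq_space ext_space_def space_PiM space_pair_measure PiE_iff mem_Times_iff)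
  have p: "Measurable.pred ?M (\<lambda>\<omega>. \<omega> \<in> space (seq_space J))"
    unfolding space_seq_space
  proof (intro pred_intros_countable pred_intros_logic)
    fix n
    show "Measurable.pred ?M (\<lambda>\<omega>. fst (\<omega> n) \<in> J)"
      by (rule measurable_compose[OF f]) simp
    note [measurable] = s[of n]
    show "Measurable.pred ?M (\<lambda>\<omega>. 0 < snd (\<omega> n))" by measurable
  qed
  have sp: "space (seq_space J) \<in> sets ?M"
  proof -
    have "{\<omega> \<in> space ?M. \<omega> \<in> space (seq_space J)} \<in> sets ?M" using p by measurable
    moreover have "{\<omega> \<in> space ?M. \<omega> \<in> space (seq_space J)} = space (seq_space J)" using sub by auto
    ultimately show ?thesis by simp
  qed
  have cyl: "C \<in> sets ?M" if Cc: "C \<in> cylinders J" for C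
  proof -
    obtain n x B where C: "C = cylinder J n x B" and B: "B \<in> sets (PiM {..<n} (\<lambda>_. borel))" using Cc by (auto simp: cylinders_def)
    have 1: "Measurable.pred ?M (\<lambda>\<omega>. \<forall>k\<in>{..n}. fst (\<omega> k) = x k)"
      by (intro pred_intros_finite pred_eq_const1[where N = "count_space L"] f) auto
    have 2: "(\<lambda>\<omega>. \<lambda>k\<in>{..<n}. snd (\<omega> k)) \<in> measurable ?M (PiM {..<n} (\<lambda>_. borel))"
      by (intro measurable_restrict s)
    have 3: "Measurable.pred ?M (\<lambda>\<omega>. (\<lambda>k\<in>{..<n}. snd (\<omega> k)) \<in> B)"
      using measurable_sets[OF 2 B] by (simp add: pred_def vimage_def Int_def conj_commute)
    have "C = space (seq_space J) \<inter> {\<omega> \<in> space ?M. (\<forall>k\<in>{..n}. fst (\<omega> k) = x k) \<and> (\<lambda>k\<in>{..<n}. snd (\<omega> k)) \<in> B}"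
      using sub by (auto simp: C cylinder_def)
    also have "\<dots> \<in> sets ?M" using 1 3 sp by measurable
    finally show ?thesis .
  qed
  have "A \<in> sigma_sets (space (seq_space J)) (cylinders J)" using assms(3) sets_seq_space[OF assms(1)] by simp
  then show ?thesis by (induction rule: sigma_sets.induct) (auto intro: cyl sp)
qed

text \<open>The inequality extends from cylinders to finite disjoint unions. For the whole space it
  shows that \<open>C\<close> lands in \<open>seq_space J\<close> almost surely; for the complement
  of a cylinder it yields the reverse inequality on the cylinder.\<close>

lemma law_eqI_lower_bound:
  fixes P :: "(nat \<Rightarrow> 'v \<times> real) measure"
  assumes fin: "finite L" "J \<subseteq> L" and P: "prob_space P" "sets P = sets (seq_space L)"
    and R: "prob_space R" "sets R = sets (seq_space J)"
    and C: "C \<in> measurable (seq_space L) (ext_space L)"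
    and le: "\<And>n x B. B \<in> sets (PiM {..<n} (\<lambda>_. borel)) \<Longrightarrow> emeasure R (cylinder J n x B) \<le> emeasure P (C -` cylinder J n x B \<inter> space (seq_space L))"
    and A: "A \<in> sets (seq_space J)"
  shows "emeasure P (C -` A \<inter> space (seq_space L)) = emeasure R A"
proof -
  interpret P: prob_space P by fact
  interpret R: prob_space R by fact
  have finJ: "finite J" using fin finite_subset by blast
  have spP: "space P = space (seq_space L)" using P(2) by (rule sets_eq_imp_space_eq)
  have spR: "space R = space (seq_space J)" using R(2) by (rule sets_eq_imp_space_eq)
  let ?p = "\<lambda>A. C -` A \<inter> space (seq_space L)"
  have pm: "?p A \<in> sets P" if "A \<in> sets (seq_space J)" for A
    using measurable_sets[OF C sets_seq_space_ext[OF finJ fin(2) that]] P(2) by simp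
  have cyl: "cylinder J n x B \<in> sets (seq_space J)" if "B \<in> sets (PiM {..<n} (\<lambda>_. borel))" for n x B
    by (rule sets_cylinder[OF that])
  have fu: "emeasure R (\<Union>i\<in>K. F i) \<le> emeasure P (?p (\<Union>i\<in>K. F i))"
    if K: "finite K" and F: "\<And>i. i \<in> K \<Longrightarrow> F i \<in> cylinders J" and d: "disjoint_family_on F K" for K :: "'k set" and F
  proof -
    have Fs: "F i \<in> sets (seq_space J)" if "i \<in> K" for i using F[OF that] cyl by (auto simp: cylinders_def)
    have "emeasure R (\<Union>i\<in>K. F i) = (\<Sum>i\<in>K. emeasure R (F i))"
      by (rule sum_emeasure[symmetric, OF _ d K]) (use Fs R(2) in auto)
    also have "\<dots> \<le> (\<Sum>i\<in>K. emeasure P (?p (F i)))"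
    proof (rule sum_mono)
      fix i assume "i \<in> K"
      then obtain n x B where "F i = cylinder J n x B" "B \<in> sets (PiM {..<n} (\<lambda>_. borel))"
        using F by (fastforce simp: cylinders_def)
      then show "emeasure R (F i) \<le> emeasure P (?p (F i))" using le by simp
    qed
    also have "\<dots> = emeasure P (\<Union>i\<in>K. ?p (F i))"
    proof (rule sum_emeasure[OF _ _ K])
      show "(\<lambda>i. ?p (F i)) ` K \<subseteq> sets P" using Fs pm by auto
      show "disjoint_family_on (\<lambda>i. ?p (F i)) K" using d unfolding disjoint_family_on_def by blast
    qed
    also have "(\<Union>i\<in>K. ?p (F i)) = ?p (\<Union>i\<in>K. F i)" by auto
    finally show ?thesis .
  qed
  define G where "G = ?p (space (seq_space J))"
  have G: "G \<in> sets P" unfolding G_def by (rule pm) simp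
  have PG: "emeasure P G = 1"
  proof (rule antisym)
    show "emeasure P G \<le> 1" by (rule P.emeasure_le_1)
    have u: "space (seq_space J) = (\<Union>v\<in>J. cylinder J 0 (\<lambda>_. v) (space (PiM {..<0} (\<lambda>_. borel))))"
      using space_in_cylinders[OF finJ] by simp
    have "1 = emeasure R (space (seq_space J))" using R.emeasure_space_1 spR by simp
    also have "\<dots> \<le> emeasure P (?p (space (seq_space J)))"
      unfolding u
    proof (rule fu[OF finJ])
      show "cylinder J 0 (\<lambda>_. v) (space (PiM {..<0} (\<lambda>_. borel))) \<in> cylinders J" for v
        by (auto simp: cylinders_def intro!: exI)
    qed (auto simp: disjoint_family_on_def cylinder_def)
    finally show "1 \<le> emeasure P G" by (simp add: G_def)
  qed
  \<comment> \<open>As a map into \<open>seq_space J\<close>, \<open>C\<close> is measurable after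
    restriction to the event \<open>G\<close> of full mass.\<close>
  define M1 where "M1 = distr (restrict_space P G) (seq_space J) C"
  have Cm: "C \<in> measurable (restrict_space P G) (seq_space J)"
  proof (rule measurableI)
    show "C \<omega> \<in> space (seq_space J)" if "\<omega> \<in> space (restrict_space P G)" for \<omega>
      using that by (auto simp: space_restrict_space G_def)
    fix A assume A: "A \<in> sets (seq_space J)"
    have "C -` A \<inter> space (restrict_space P G) = ?p A \<inter> G"
      using sets.sets_into_space[OF A] by (auto simp: space_restrict_space spP G_def)
    then show "C -` A \<inter> space (restrict_space P G) \<in> sets (restrict_space P G)"
      using pm[OF A] by (auto simp: sets_restrict_space)
  qed
  have eM: "emeasure M1 A = emeasure P (?p A)" if A: "A \<in> sets (seq_space J)" for A
  proof -
    have "C -` A \<inter> space (restrict_space P G) = ?p A"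
      using sets.sets_into_space[OF A] by (auto simp: space_restrict_space spP G_def)
    then show ?thesis
      unfolding M1_def emeasure_distr[OF Cm A] using G sets.sets_into_space[OF A]
      by (subst emeasure_restrict_space) (auto simp: spP G_def)
  qed
  interpret M1: prob_space M1
  proof
    have "space M1 = space (seq_space J)" by (simp add: M1_def)
    then show "emeasure M1 (space M1) = 1" using eM[of "space (seq_space J)"] PG by (simp add: G_def)
  qed
  have sM: "sets M1 = sets (seq_space J)" by (simp add: M1_def)
  have spM: "space M1 = space (seq_space J)" by (simp add: M1_def)
  have "M1 = R"
  proof (rule measure_eqI_cylinders[OF finJ sM R(2) M1.finite_measure_axioms])
    fix n :: nat and x :: "nat \<Rightarrow> 'v" and B :: "(nat \<Rightarrow> real) set" assume B: "B \<in> sets (PiM {..<n} (\<lambda>_. borel))"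
    let ?T = "space (PiM {..<n} (\<lambda>_. borel :: real measure))"
    let ?x = "restrict x {..n}"
    let ?K = "PiE {..n} (\<lambda>_. J)"
    \<comment> \<open>The complement of a cylinder is split according to the positions: for the word
      of the cylinder itself the times avoid \<open>B\<close>, for every other word they are
      free.\<close>
    define F where "F y = cylinder J n y (if y = ?x then ?T - B else ?T)" for y
    let ?c = "cylinder J n x B"
    have c: "?c \<in> sets (seq_space J)" by (rule cyl[OF B])
    have comp: "space (seq_space J) - ?c = (\<Union>y\<in>?K. F y)"
    proof (intro equalityI subsetI)
      fix \<omega> assume w: "\<omega> \<in> space (seq_space J) - ?c"
      let ?y = "\<lambda>k\<in>{..n}. fst (\<omega> k)"
      have y: "?y \<in> ?K" using w by (auto simp: space_seq_space)
      have "\<omega> \<in> F ?y"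
      proof (cases "?y = ?x")
        case True
        then have fx: "\<forall>k\<le>n. fst (\<omega> k) = x k" by (metis atMost_iff restrict_apply')
        then have "(\<lambda>k\<in>{..<n}. snd (\<omega> k)) \<notin> B" using w by (auto simp: cylinder_def)
        then show ?thesis using w True fx by (auto simp: F_def cylinder_def space_PiM)
      next
        case False
        then show ?thesis using w by (auto simp: F_def cylinder_def space_PiM)
      qed
      with y show "\<omega> \<in> (\<Union>y\<in>?K. F y)" by blast
    next
      fix \<omega> assume "\<omega> \<in> (\<Union>y\<in>?K. F y)"
      then obtain y where y: "y \<in> ?K" "\<omega> \<in> F y" by auto
      have "\<omega> \<notin> ?c"
      proof
        assume w: "\<omega> \<in> ?c"
        have "y = ?x"
        proof
          fix k show "y k = ?x k"
            using w y by (cases "k \<le> n") (auto simp: F_def cylinder_def PiE_def extensional_def)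
        qed
        then show False using w y by (auto simp: F_def cylinder_def)
      qed
      then show "\<omega> \<in> space (seq_space J) - ?c" using y by (auto simp: F_def cylinder_def)
    qed
    have "emeasure R (space (seq_space J) - ?c) \<le> emeasure P (?p (space (seq_space J) - ?c))"
      unfolding comp
    proof (rule fu)
      show "finite ?K" using finJ by (intro finite_PiE) auto
      show "F y \<in> cylinders J" for y using B by (auto simp: F_def cylinders_def)
      show "disjoint_family_on F ?K"
        unfolding disjoint_family_on_def
      proof (intro ballI impI)
        fix y y' assume y: "y \<in> ?K" "y' \<in> ?K" "y \<noteq> y'"
        then obtain k where "k \<le> n" "y k \<noteq> y' k" by (metis PiE_ext atMost_iff)
        then show "F y \<inter> F y' = {}" by (auto simp: F_def cylinder_def)
      qed
    qed
    also have "\<dots> = emeasure M1 (space (seq_space J) - ?c)" using c by (intro eM[symmetric]) auto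
    finally have "emeasure R (space R - ?c) \<le> emeasure M1 (space M1 - ?c)" by (simp add: spR spM)
    then have "R.prob (space R - ?c) \<le> M1.prob (space M1 - ?c)"
      by (simp add: R.emeasure_eq_measure M1.emeasure_eq_measure)
    then have "M1.prob ?c \<le> R.prob ?c"
      using R.prob_compl[of ?c] M1.prob_compl[of ?c] c by (simp add: R(2) sM)
    moreover have "emeasure R ?c \<le> emeasure M1 ?c" using le[OF B, of x] eM[OF c] by simp
    ultimately show "emeasure M1 ?c = emeasure R ?c"
      by (simp add: R.emeasure_eq_measure M1.emeasure_eq_measure)
  qed
  with eM[OF A] show ?thesis by simp
qed

lemma sets_cut_event:
  assumes C: "C \<in> measurable (seq_space L) (ext_space L)" and B: "B \<in> sets (PiM {..<n} (\<lambda>_. borel))"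
  shows "{\<omega> \<in> space (seq_space L). (\<forall>k\<le>n. fst (C \<omega> k) = x k) \<and> (\<lambda>k\<in>{..<n}. snd (C \<omega> k)) \<in> B} \<in> sets (seq_space L)"
proof -
  have Cm: "(\<lambda>\<omega>. C \<omega> n) \<in> measurable (seq_space L) (count_space L \<Otimes>\<^sub>M borel)" for n
    by (rule measurable_compose[OF C]) (simp add: ext_space_def)
  have 1: "Measurable.pred (seq_space L) (\<lambda>\<omega>. \<forall>k\<in>{..n}. fst (C \<omega> k) = x k)"
    by (intro pred_intros_finite pred_eq_const1[where N = "count_space L"] measurable_compose[OF Cm measurable_fst]) auto
  have 2: "(\<lambda>\<omega>. \<lambda>k\<in>{..<n}. snd (C \<omega> k)) \<in> measurable (seq_space L) (PiM {..<n} (\<lambda>_. borel))"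
    by (intro measurable_restrict measurable_compose[OF Cm measurable_snd])
  have 3: "Measurable.pred (seq_space L) (\<lambda>\<omega>. (\<lambda>k\<in>{..<n}. snd (C \<omega> k)) \<in> B)"
    using measurable_sets[OF 2 B] by (simp add: pred_def vimage_def Int_def conj_commute)
  have "{\<omega> \<in> space (seq_space L). (\<forall>k\<le>n. fst (C \<omega> k) = x k) \<and> (\<lambda>k\<in>{..<n}. snd (C \<omega> k)) \<in> B}
     = {\<omega> \<in> space (seq_space L). (\<forall>k\<in>{..n}. fst (C \<omega> k) = x k) \<and> (\<lambda>k\<in>{..<n}. snd (C \<omega> k)) \<in> B}" by auto
  also have "\<dots> \<in> sets (seq_space L)" using 1 3 by measurable
  finally show ?thesis .
qed

text \<open>Since both sides have total mass one and the complement of a cylinder is a finite disjoint union of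
  cylinders, a lower bound on cylinders suffices to identify the law of a cut process. In particular it is not
  necessary to know beforehand that the cut process is almost surely well-defined.\<close>

lemma law_eqI_cut:
  fixes P :: "(nat \<Rightarrow> 'v \<times> real) measure"
  assumes fin: "finite L" "J \<subseteq> L" and P: "prob_space P" "sets P = sets (seq_space L)"
    and R: "prob_space R" "sets R = sets (seq_space J)"
    and C: "C \<in> measurable (seq_space L) (ext_space L)"
    and le: "\<And>n x B. B \<in> sets (PiM {..<n} (\<lambda>_. borel)) \<Longrightarrow> emeasure R (cylinder J n x B) \<le>
       emeasure P {\<omega> \<in> space (seq_space L). (\<forall>k\<le>n. fst (C \<omega> k) = x k) \<and> (\<lambda>k\<in>{..<n}. snd (C \<omega> k)) \<in> B}"
    and A: "A \<in> sets (seq_space J)"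
  shows "emeasure P (C -` A \<inter> space (seq_space L)) = emeasure R A"
proof (rule law_eqI_lower_bound[OF fin P R C _ A])
  interpret P: prob_space P by fact
  interpret R: prob_space R by fact
  have finJ: "finite J" using fin finite_subset by blast
  have spP: "space P = space (seq_space L)" using P(2) by (rule sets_eq_imp_space_eq)
  have spR: "space R = space (seq_space J)" using R(2) by (rule sets_eq_imp_space_eq)
  define pre where "pre n x B = {\<omega> \<in> space (seq_space L). (\<forall>k\<le>n. fst (C \<omega> k) = x k) \<and> (\<lambda>k\<in>{..<n}. snd (C \<omega> k)) \<in> B}"
    for n and x :: "nat \<Rightarrow> 'v" and B
  have prem: "pre n x B \<in> sets (seq_space L)" if "B \<in> sets (PiM {..<n} (\<lambda>_. borel))" for n x B
    unfolding pre_def by (rule sets_cut_event[OF C that])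
  \<comment> \<open>The events bounded from below mention finitely many positions and times of the
    cut path, but not its membership in \<open>seq_space J\<close>, so positivity of the times is
    imposed through the choice of \<open>B\<close>.\<close>
  define Pos where "Pos n = {t \<in> space (PiM {..<n} (\<lambda>_. borel :: real measure)). \<forall>k\<in>{..<n}. t k > 0}" for n :: nat
  have Pos: "Pos n \<in> sets (PiM {..<n} (\<lambda>_. borel))" for n
  proof -
    have "Measurable.pred (PiM {..<n} (\<lambda>_. borel :: real measure)) (\<lambda>t. \<forall>k\<in>{..<n}. t k > 0)"
    proof (rule pred_intros_finite)
      fix k assume "k \<in> {..<n}"
      then have [measurable]: "(\<lambda>t. t k) \<in> measurable (PiM {..<n} (\<lambda>_. borel :: real measure)) borel"
        by (rule measurable_component_singleton)
      show "Measurable.pred (PiM {..<n} (\<lambda>_. borel :: real measure)) (\<lambda>t. t k > 0)" by measurable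
    qed simp
    then show ?thesis unfolding Pos_def by measurable
  qed
  \<comment> \<open>The lower bounds, summed over all words of length \<open>n\<close> in
    \<open>J\<close> with positive times, already exhaust the total mass 1.\<close>
  have good: "AE \<omega> in P. (\<forall>k\<le>n. fst (C \<omega> k) \<in> J) \<and> (\<forall>k<n. snd (C \<omega> k) > 0)" for n
  proof -
    let ?K = "PiE {..n} (\<lambda>_. J)"
    have K: "finite ?K" using finJ by (intro finite_PiE) auto
    have ne: "\<exists>k\<le>n. y k \<noteq> y' k" if "y \<in> ?K" "y' \<in> ?K" "y \<noteq> y'" for y y'
      using that by (metis PiE_ext atMost_iff)
    have u: "space (seq_space J) = (\<Union>y\<in>?K. cylinder J n y (Pos n))"
    proof (intro equalityI subsetI)
      fix \<omega> assume "\<omega> \<in> space (seq_space J)"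
      then have "\<omega> \<in> cylinder J n (\<lambda>k\<in>{..n}. fst (\<omega> k)) (Pos n)" "(\<lambda>k\<in>{..n}. fst (\<omega> k)) \<in> ?K"
        by (auto simp: cylinder_def Pos_def space_PiM space_seq_space)
      then show "\<omega> \<in> (\<Union>y\<in>?K. cylinder J n y (Pos n))" by blast
    qed (auto simp: cylinder_def)
    have "1 = emeasure R (\<Union>y\<in>?K. cylinder J n y (Pos n))" using R.emeasure_space_1 spR u by simp
    also have "\<dots> = (\<Sum>y\<in>?K. emeasure R (cylinder J n y (Pos n)))"
    proof (rule sum_emeasure[symmetric, OF _ _ K])
      show "(\<lambda>y. cylinder J n y (Pos n)) ` ?K \<subseteq> sets R" using Pos R(2) by (auto intro: sets_cylinder)
      show "disjoint_family_on (\<lambda>y. cylinder J n y (Pos n)) ?K"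
      proof (unfold disjoint_family_on_def, intro ballI impI equals0I)
        fix y y' \<omega> assume a: "y \<in> ?K" "y' \<in> ?K" "y \<noteq> y'" "\<omega> \<in> cylinder J n y (Pos n) \<inter> cylinder J n y' (Pos n)"
        from ne[OF a(1-3)] obtain k where "k \<le> n" "y k \<noteq> y' k" by blast
        with a(4) show False unfolding cylinder_def by force
      qed
    qed
    also have "\<dots> \<le> (\<Sum>y\<in>?K. emeasure P (pre n y (Pos n)))"
      unfolding pre_def by (intro sum_mono le Pos)
    also have "\<dots> = emeasure P (\<Union>y\<in>?K. pre n y (Pos n))"
    proof (rule sum_emeasure[OF _ _ K])
      show "(\<lambda>y. pre n y (Pos n)) ` ?K \<subseteq> sets P" using prem[OF Pos] P(2) by auto
      show "disjoint_family_on (\<lambda>y. pre n y (Pos n)) ?K"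
      proof (unfold disjoint_family_on_def, intro ballI impI equals0I)
        fix y y' \<omega> assume a: "y \<in> ?K" "y' \<in> ?K" "y \<noteq> y'" "\<omega> \<in> pre n y (Pos n) \<inter> pre n y' (Pos n)"
        from ne[OF a(1-3)] obtain k where "k \<le> n" "y k \<noteq> y' k" by blast
        with a(4) show False unfolding pre_def by force
      qed
    qed
    finally have "P.prob (\<Union>y\<in>?K. pre n y (Pos n)) = 1"
      using P.prob_le_1 by (simp add: P.emeasure_eq_measure antisym)
    moreover have "(\<Union>y\<in>?K. pre n y (Pos n)) \<in> sets P" using K prem[OF Pos] P(2) by auto
    ultimately have "AE \<omega> in P. \<omega> \<in> (\<Union>y\<in>?K. pre n y (Pos n))"
      by (subst (asm) P.prob_eq_1) auto
    then show ?thesis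
    proof eventually_elim
      case (elim \<omega>)
      then obtain y where y: "y \<in> ?K" "\<omega> \<in> pre n y (Pos n)" by auto
      have "snd (C \<omega> k) > 0" if "k < n" for k
      proof -
        have "(\<lambda>k\<in>{..<n}. snd (C \<omega> k)) k > 0" using y(2) that unfolding pre_def Pos_def by blast
        then show ?thesis using that by simp
      qed
      moreover have "fst (C \<omega> k) \<in> J" if "k \<le> n" for k using y that by (auto simp: pre_def)
      ultimately show ?case by blast
    qed
  qed
  have AEJ: "AE \<omega> in P. C \<omega> \<in> space (seq_space J)"
  proof -
    have "AE \<omega> in P. \<forall>n. (\<forall>k\<le>n. fst (C \<omega> k) \<in> J) \<and> (\<forall>k<n. snd (C \<omega> k) > 0)"
      using good by (subst AE_all_countable) blast
    then show ?thesis
    proof eventually_elim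
      case (elim \<omega>)
      then show ?case unfolding space_seq_space by blast
    qed
  qed
  fix n :: nat and x :: "nat \<Rightarrow> 'v" and B :: "(nat \<Rightarrow> real) set" assume B: "B \<in> sets (PiM {..<n} (\<lambda>_. borel))"
  have "emeasure R (cylinder J n x B) \<le> emeasure P (pre n x B)" using le[OF B] by (simp add: pre_def)
  also have "\<dots> = emeasure P (C -` cylinder J n x B \<inter> space (seq_space L))"
  proof (rule emeasure_eq_AE)
    show "AE \<omega> in P. (\<omega> \<in> pre n x B) = (\<omega> \<in> C -` cylinder J n x B \<inter> space (seq_space L))"
      using AEJ AE_space by eventually_elim (auto simp: pre_def cylinder_def spP)
    show "pre n x B \<in> sets P" using prem[OF B] P(2) by simp
    show "C -` cylinder J n x B \<inter> space (seq_space L) \<in> sets P"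
      using measurable_sets[OF C sets_seq_space_ext[OF finJ fin(2) sets_cylinder[OF B]]] P(2) by simp
  qed
  finally show "emeasure R (cylinder J n x B) \<le> emeasure P (C -` cylinder J n x B \<inter> space (seq_space L))" .
qed

section \<open>Removal of self-loops\<close>

text \<open>Fatou's lemma; it carries a bound that is uniform in the truncation level over to the
  limit.\<close>

lemma nn_integral_limit_le:
  assumes "\<And>M. u M \<in> borel_measurable N" "\<And>s. s \<in> space N \<Longrightarrow> (\<lambda>M. u M s) \<longlonglongrightarrow> (u' s :: ennreal)" "\<And>M. (\<integral>\<^sup>+s. u M s \<partial>N) \<le> E"
  shows "(\<integral>\<^sup>+s. u' s \<partial>N) \<le> E"
proof -
  have "(\<integral>\<^sup>+s. u' s \<partial>N) = (\<integral>\<^sup>+s. liminf (\<lambda>M. u M s) \<partial>N)"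
    by (intro nn_integral_cong) (metis assms(2) lim_imp_Liminf sequentially_bot)
  also have "\<dots> \<le> liminf (\<lambda>M. \<integral>\<^sup>+s. u M s \<partial>N)" by (rule nn_integral_liminf[OF assms(1)])
  also have "\<dots> \<le> limsup (\<lambda>M. \<integral>\<^sup>+s. u M s \<partial>N)" by (rule Liminf_le_Limsup) simp
  also have "\<dots> \<le> E" by (rule Limsup_bounded) (use assms(3) in simp)
  finally show ?thesis .
qed

text \<open>The coefficient \<open>c k i\<close> says whether the \<open>i\<close>-th waiting time
  of block \<open>k\<close> counts for the first letter of the block: always for self-loops, only
  for \<open>i = 0\<close> for excursions into \<open>I\<close>.\<close>

lemma loc_time_word:
  assumes "\<And>k i. k < n \<Longrightarrow> i \<le> length (z k) \<Longrightarrow> (x k # z k) ! i = v \<Longrightarrow> x k = v \<and> c k i = (1::real)"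
    and "\<And>k i. k < n \<Longrightarrow> i \<le> length (z k) \<Longrightarrow> x k = v \<Longrightarrow> (x k # z k) ! i \<noteq> v \<Longrightarrow> c k i = 0"
  shows "loc_time (word x z) t (blk_len z n) v = loc_time x (\<lambda>k. \<Sum>i<Suc (length (z k)). c k i * t (blk_len z k + i)) n v"
  unfolding loc_time_def sum_blocks
proof (rule sum.cong[OF refl])
  fix k assume k: "k \<in> {..<n}"
  show "(\<Sum>i<Suc (length (z k)). if word x z (blk_len z k + i) = v then t (blk_len z k + i) else 0)
     = (if x k = v then \<Sum>i<Suc (length (z k)). c k i * t (blk_len z k + i) else 0)"
  proof (cases "x k = v")
    case True
    then show ?thesis using assms k by (auto intro!: sum.cong simp: word_block simp del: sum.lessThan_Suc)
  next
    case False
    then have "(x k # z k) ! i \<noteq> v" if "i \<le> length (z k)" for i using assms(1)[of k i] k that by auto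
    then show ?thesis using False by (auto intro!: sum.neutral simp: word_block simp del: sum.lessThan_Suc)
  qed
qed

lemma measurable_vrjp_weight:
  assumes [measurable]: "\<And>i j. (\<lambda>y. W y i j) \<in> borel_measurable N" "\<And>v. (\<lambda>y. l y v) \<in> borel_measurable N"
  shows "(\<lambda>y. vrjp_weight (W y) L (l y)) \<in> borel_measurable N"
  unfolding vrjp_weight_def wquad_def by measurable

lemma path_weight_nonneg: "(\<And>i j. W i j \<ge> 0) \<Longrightarrow> path_weight W a y b \<ge> 0"
  by (induction y arbitrary: a) auto

lemma path_weight_replicate: "path_weight W a (replicate m a) b = (W a a / 2) ^ m * (W a b / 2)"
  by (induction m) auto

text \<open>The diagonal of \<open>W\<close> enters the quadratic form through \<open>W i i\<close>
  times the square of \<theta>. For nonnegative \<open>l\<close>, dropping it gains the factor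
  \<open>exp (W i i * l i / 2)\<close> at every vertex, which is what the series over self-loops
  produces.\<close>

lemma vrjp_weight_offdiag:
  assumes "finite L"
  shows "vrjp_weight (\<lambda>i j. if i \<noteq> j then W i j else 0) L l = vrjp_weight W L l * exp ((\<Sum>i\<in>L. W i i * (sqrt (1 + l i) * sqrt (1 + l i) - 1)) / 2)"
proof -
  let ?W = "\<lambda>i j. if i \<noteq> j then W i j else 0"
  have q: "wquad ?W L \<theta> = wquad W L \<theta> - (\<Sum>i\<in>L. W i i * (\<theta> i * \<theta> i))" for \<theta>
  proof -
    have "wquad W L \<theta> - wquad ?W L \<theta> = (\<Sum>i\<in>L. \<Sum>j\<in>L. if j = i then W i i * (\<theta> i * \<theta> i) else 0)"
      unfolding wquad_def sum_subtractf[symmetric] by (intro sum.cong refl) auto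
    also have "\<dots> = (\<Sum>i\<in>L. W i i * (\<theta> i * \<theta> i))" using assms by simp
    finally show ?thesis by simp
  qed
  have "exp (wquad ?W L (\<lambda>_. 1) / 2 - wquad ?W L (\<lambda>i. sqrt (1 + l i)) / 2)
     = exp (wquad W L (\<lambda>_. 1) / 2 - wquad W L (\<lambda>i. sqrt (1 + l i)) / 2)
       * exp ((\<Sum>i\<in>L. W i i * (sqrt (1 + l i) * sqrt (1 + l i) - 1)) / 2)"
    unfolding exp_add[symmetric] q
    by (rule arg_cong[where f=exp]) (simp add: right_diff_distrib sum_subtractf diff_divide_distrib)
  then show ?thesis unfolding vrjp_weight_def by simp
qed

lemma sum_loc_time:
  assumes "finite L" "\<And>k. k < n \<Longrightarrow> x k \<in> L"
  shows "(\<Sum>v\<in>L. f v * loc_time x s n v) = (\<Sum>k<n. f (x k) * s k)"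
proof -
  have "(\<Sum>v\<in>L. f v * loc_time x s n v) = (\<Sum>v\<in>L. \<Sum>k<n. if x k = v then f v * s k else 0)"
    unfolding loc_time_def sum_distrib_left by (intro sum.cong) auto
  also have "\<dots> = (\<Sum>k<n. \<Sum>v\<in>L. if x k = v then f v * s k else 0)" by (rule sum.swap)
  also have "\<dots> = (\<Sum>k<n. f (x k) * s k)" using assms by (intro sum.cong) auto
  finally show ?thesis .
qed

lemma prod_indicator_pos:
  fixes s :: "nat \<Rightarrow> real"
  shows "(\<Prod>k<n. indicator {0<..} (s k) :: ennreal) = (if \<forall>k<n. s k > (0::real) then 1 else 0)"
proof (cases "\<forall>k<n. s k > 0")
  case False
  then obtain k where "k < n" "\<not> s k > 0" by auto
  then have "(\<Prod>k<n. indicator {0<..} (s k) :: ennreal) = 0" by (intro prod_zero bexI[of _ k]) auto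
  then show ?thesis using False by simp
qed simp

text \<open>The excised words are powers of a single letter, of length at most \<open>M\<close>.
  Summing over them gives a truncated exponential series at each visit, with limit
  \<open>exp (W i i * s / 2)\<close>; by \<open>vrjp_weight_offdiag\<close> this factor turns the
  weight for \<open>W\<close> into the one for \<open>Wn\<close>.\<close>

theorem remove_loops_law:
  fixes W :: "'v \<Rightarrow> 'v \<Rightarrow> real"
  defines "Wn \<equiv> \<lambda>i j. if i \<noteq> j then W i j else 0"
  assumes W: "vrjp_data L W \<rho>" and sym: "\<And>i j. W i j = W j i" and Wn: "vrjp_data L Wn \<rho>"
    and A: "A \<in> sets (seq_space L)"
  shows "emeasure (vrjp_law L W \<rho>) (remove_loops -` A \<inter> space (seq_space L)) = emeasure (vrjp_law L Wn \<rho>) A"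
proof -
  have fin: "finite L" and nn: "\<And>i j. W i j \<ge> 0" using W by (auto simp: vrjp_data_def)
  have symn: "\<And>i j. Wn i j = Wn j i" unfolding Wn_def using sym by (metis (full_types))
  let ?P = "vrjp_law L W \<rho>" and ?R = "vrjp_law L Wn \<rho>"
  have P: "is_vrjp_law L W \<rho> ?P" by (rule vrjp_data.is_vrjp_law[OF W])
  have R: "is_vrjp_law L Wn \<rho> ?R" by (rule vrjp_data.is_vrjp_law[OF Wn])
  have PR: "prob_space ?P" "sets ?P = sets (seq_space L)" "prob_space ?R" "sets ?R = sets (seq_space L)"
    using P R by (auto simp: is_vrjp_law_def)
  show ?thesis
  proof (rule law_eqI_cut[OF fin order_refl PR measurable_remove_loops[OF fin] _ A])
    fix n :: nat and x and B :: "(nat \<Rightarrow> real) set" assume B: "B \<in> sets (PiM {..<n} (\<lambda>_. borel))"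
    then have B': "B \<in> sets (LB n)" by (simp add: PiM_lborel_borel)
    let ?E = "{\<omega> \<in> space (seq_space L). (\<forall>k\<le>n. fst (remove_loops \<omega> k) = x k) \<and> (\<lambda>k\<in>{..<n}. snd (remove_loops \<omega> k)) \<in> B}"
    have E: "?E \<in> sets (seq_space L)"
      by (rule sets_cut_event[OF measurable_remove_loops[OF fin] B])
    have Rc: "emeasure ?R (cylinder L n x B) = (\<integral>\<^sup>+s. indicator B s * ennreal (vrjp_fdd_density L Wn \<rho> n x s) \<partial>LB n)"
      using R B unfolding is_vrjp_law_cylinder by blast
    show "emeasure ?R (cylinder L n x B) \<le> emeasure ?P ?E"
    proof (cases "x 0 = \<rho> \<and> (\<forall>k\<le>n. x k \<in> L) \<and> (\<forall>k<n. x k \<noteq> x (Suc k))")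
      \<comment> \<open>A word with two equal consecutive letters, a wrong start or a letter outside
        \<open>L\<close> has mass 0 under the law without diagonal, so there is nothing to
        bound.\<close>
      case False
      have "vrjp_fdd_density L Wn \<rho> n x s = 0" for s
      proof (cases "x 0 = \<rho> \<and> (\<forall>k\<le>n. x k \<in> L)")
        case True
        then obtain k where "k < n" "x k = x (Suc k)" using False by auto
        then have "(\<Prod>k<n. Wn (x k) (x (Suc k)) / 2) = 0" by (intro prod_zero) (auto simp: Wn_def)
        then show ?thesis by (simp add: vrjp_fdd_density_eq[OF fin symn])
      qed (auto simp: vrjp_fdd_density_def)
      then show ?thesis unfolding Rc by simp
    next
      case True
      then have x0: "x 0 = \<rho>" and xL: "\<And>k. k \<le> n \<Longrightarrow> x k \<in> L" and xne: "\<And>k. k < n \<Longrightarrow> x k \<noteq> x (Suc k)" by auto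
      define Z where "Z M k = (\<lambda>m. replicate m (x k)) ` {..M}" for M :: nat and k
      define V where "V z k t = (\<Sum>i<Suc (length (z k)). t (blk_len z k + i))" for z :: "nat \<Rightarrow> 'v list" and k and t :: "nat \<Rightarrow> real"
      let ?q = "\<lambda>(z :: nat \<Rightarrow> 'v list) (l :: nat). indicator {0<..} :: real \<Rightarrow> ennreal"
      define \<kappa> where "\<kappa> k y s = indicator {0<..} s * ennreal (s ^ length y / fact (length y))" for k :: nat and y :: "'v list" and s :: real
      define a where "a k y = ennreal (path_weight W (x k) y (x (Suc k)))" for k y
      define h where "h s = indicator B s * ennreal (sqrt (1 + loc_time x s n (x n)) * vrjp_weight W L (loc_time x s n))" for s
      \<comment> \<open>The weight of at most \<open>M\<close> self-loops followed by the jump to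
        the next letter, given the total time \<open>s\<close> spent at the vertex.\<close>
      define c where "c M k s = W (x k) (x (Suc k)) / 2 * (\<Sum>m\<le>M. (W (x k) (x k) * s / 2) ^ m / fact m)" for M k and s :: real
      have h: "h \<in> borel_measurable (LB n)"
      proof -
        have l: "(\<lambda>s. loc_time x s n v) \<in> borel_measurable (LB n)" for v by (intro measurable_loc_time measurable_LB_component)
        note [measurable] = this
        have [measurable]: "(\<lambda>s. vrjp_weight W L (loc_time x s n)) \<in> borel_measurable (LB n)"
          by (rule measurable_vrjp_weight[OF _ l]) simp
        show ?thesis unfolding h_def using B' by measurable
      qed
      have Vm: "V z k \<in> borel_measurable (LB M)" if "blk_len z (Suc k) \<le> M" for z k M
        unfolding V_def by (intro borel_measurable_sum measurable_LB_component) (use that in \<open>auto simp: blk_len_Suc\<close>)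
      have Vr: "V z k (restrict t {..<M}) = V z k t" if "blk_len z (Suc k) \<le> M" for z k M t
        unfolding V_def using that by (intro sum.cong) (auto simp: blk_len_Suc)
      have zrep: "\<exists>m. z k = replicate m (x k)" if "z \<in> PiE {..<n} (Z M)" "k < n" for z k M
        using that by (auto simp: Z_def dest!: PiE_mem)
      have nthx: "(x k # z k) ! i = x k" if "z \<in> PiE {..<n} (Z M)" "k < n" "i \<le> length (z k)" for z k i M
        using zrep[OF that(1,2)] that(3) by (cases i) auto
      have lt: "loc_time (word x z) t (blk_len z n) = loc_time x (\<lambda>k\<in>{..<n}. V z k t) n" if z: "z \<in> PiE {..<n} (Z M)" for z t M
      proof
        fix v
        have "loc_time (word x z) t (blk_len z n) v = loc_time x (\<lambda>k. \<Sum>i<Suc (length (z k)). 1 * t (blk_len z k + i)) n v"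
          by (rule loc_time_word) (use nthx[OF z] in auto)
        also have "\<dots> = loc_time x (\<lambda>k\<in>{..<n}. V z k t) n v"
          by (intro fun_cong[OF loc_time_cong]) (auto simp: V_def)
        finally show "loc_time (word x z) t (blk_len z n) v = loc_time x (\<lambda>k\<in>{..<n}. V z k t) n v" .
      qed
      have bound: "(\<integral>\<^sup>+s. h s * (\<Prod>k<n. indicator {0<..} (s k) * ennreal (c M k (s k))) \<partial>LB n) \<le> emeasure ?P ?E" for M
      proof -
        have "(\<integral>\<^sup>+s. h s * (\<Prod>k<n. indicator {0<..} (s k) * ennreal (c M k (s k))) \<partial>LB n)
           = (\<integral>\<^sup>+s. h s * (\<Prod>k<n. \<Sum>y\<in>Z M k. a k y * \<kappa> k y (s k)) \<partial>LB n)"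
        proof (intro nn_integral_cong arg_cong2[where f = "(*)"] refl prod.cong)
          fix s :: "nat \<Rightarrow> real" and k
          show "indicator {0<..} (s k) * ennreal (c M k (s k)) = (\<Sum>y\<in>Z M k. a k y * \<kappa> k y (s k))"
          proof (cases "s k > 0")
            case True
            have inj: "inj_on (\<lambda>m. replicate m (x k)) {..M}" by (auto simp: inj_on_def)
            have "(\<Sum>y\<in>Z M k. a k y * \<kappa> k y (s k)) = (\<Sum>m\<le>M. ennreal ((W (x k) (x k) / 2) ^ m * (W (x k) (x (Suc k)) / 2)) * ennreal (s k ^ m / fact m))"
              unfolding Z_def sum.reindex[OF inj] using True by (simp add: a_def \<kappa>_def path_weight_replicate)
            also have "\<dots> = (\<Sum>m\<le>M. ennreal (W (x k) (x (Suc k)) / 2 * ((W (x k) (x k) * s k / 2) ^ m / fact m)))"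
              using True nn by (intro sum.cong refl) (simp add: ennreal_mult[symmetric] power_mult_distrib power_divide mult_ac)
            also have "\<dots> = ennreal (c M k (s k))"
              using True nn unfolding c_def sum_distrib_left by (subst sum_ennreal) auto
            finally show ?thesis using True by simp
          qed (simp add: \<kappa>_def)
        qed
        also have "\<dots> = (\<Sum>z\<in>PiE {..<n} (Z M). \<integral>\<^sup>+t. (\<Prod>k<n. a k (z k)) * h (\<lambda>k\<in>{..<n}. V z k t) * (\<Prod>l<blk_len z n. ?q z l (t l)) \<partial>LB (blk_len z n))"
        proof (rule sum_words_integral[symmetric])
          show "\<kappa> k y \<in> borel_measurable borel" for k y unfolding \<kappa>_def by measurable
          show "block_integral (blk_len z k) (Suc (length (z k))) (?q z) (V z k) (\<kappa> k (z k))" for z k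
          proof -
            have "V z k = (\<lambda>t. \<Sum>i<Suc (length (z k)). t (blk_len z k + i))"
              "\<kappa> k (z k) = (\<lambda>s. indicator {0<..} s * ennreal (s ^ length (z k) / fact (length (z k))))"
              by (simp_all add: fun_eq_iff V_def \<kappa>_def)
            then show ?thesis using block_integral_sum[of "blk_len z k" "length (z k)"] by (simp only:)
          qed
          show "V z k \<in> borel_measurable (LB M)" if "blk_len z (Suc k) \<le> M" for z k M by (rule Vm[OF that])
          show "V z k (restrict t {..<M}) = V z k t" if "blk_len z (Suc k) \<le> M" for z k M t by (rule Vr[OF that])
        qed (simp_all add: h Z_def)
        also have "\<dots> = (\<Sum>z\<in>PiE {..<n} (Z M). \<integral>\<^sup>+t. indicator B (\<lambda>k\<in>{..<n}. V z k t) * ennreal (vrjp_fdd_density L W \<rho> (blk_len z n) (word x z) t) \<partial>LB (blk_len z n))"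
        proof (intro sum.cong refl nn_integral_cong)
          fix z t assume z: "z \<in> PiE {..<n} (Z M)"
          have wL: "word x z l \<in> L" if "l \<le> blk_len z n" for l
          proof (cases "l = blk_len z n")
            case False
            then have "l < blk_len z n" using that by simp
            then obtain k i where "k < n" "i \<le> length (z k)" "l = blk_len z k + i" by (rule block_cases)
            then show ?thesis using nthx[OF z] xL by (simp add: word_block)
          qed (use xL in simp)
          have w0: "word x z 0 = \<rho>" using word_blk_len[of x z 0] x0 by simp
          let ?D = "sqrt (1 + loc_time x (\<lambda>k\<in>{..<n}. V z k t) n (x n)) * vrjp_weight W L (loc_time x (\<lambda>k\<in>{..<n}. V z k t) n)"
          have fdd: "vrjp_fdd_density L W \<rho> (blk_len z n) (word x z) t = (if \<forall>l<blk_len z n. t l > 0 then (\<Prod>k<n. path_weight W (x k) (z k) (x (Suc k))) * ?D else 0)"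
            unfolding vrjp_fdd_density_eq[OF fin sym] prod_word_weights lt[OF z] using w0 wL
            by (cases "\<forall>l<blk_len z n. t l > 0") (simp_all only: simp_thms if_True if_False word_blk_len, auto)
          have "ennreal ((\<Prod>k<n. path_weight W (x k) (z k) (x (Suc k))) * ?D) = (\<Prod>k<n. a k (z k)) * ennreal ?D"
          proof -
            have pn: "0 \<le> path_weight W b y d" for b y d by (rule path_weight_nonneg[where W = W]) (rule nn)
            show ?thesis unfolding a_def by (subst prod_ennreal) (auto simp: pn intro!: ennreal_mult' prod_nonneg)
          qed
          note e = this
          show "(\<Prod>k<n. a k (z k)) * h (\<lambda>k\<in>{..<n}. V z k t) * (\<Prod>l<blk_len z n. ?q z l (t l))
             = indicator B (\<lambda>k\<in>{..<n}. V z k t) * ennreal (vrjp_fdd_density L W \<rho> (blk_len z n) (word x z) t)"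
          proof (cases "\<forall>l<blk_len z n. t l > 0")
            case T: True
            show ?thesis unfolding fdd prod_indicator_pos h_def if_P[OF T] e by (simp only: mult_1_left mult_1_right mult_ac)
          next
            case F: False
            show ?thesis unfolding fdd prod_indicator_pos if_not_P[OF F] by simp
          qed
        qed
        also have "\<dots> \<le> emeasure ?P ?E"
        proof (rule cut_lower_bound[OF P, where Q = "\<lambda>a b. b \<noteq> a"])
          show "\<not> c \<noteq> x k" if "y \<in> Z M k" "c \<in> set y" for k y c using that by (auto simp: Z_def)
          show "x (Suc k) \<noteq> x k" if "k < n" for k using xne[OF that] by simp
          show "finite (Z M k)" for k by (simp add: Z_def)
          fix z \<omega> assume z: "z \<in> PiE {..<n} (Z M)" and w: "\<omega> \<in> space (seq_space L)" and wd: "\<And>l. l \<le> blk_len z n \<Longrightarrow> fst (\<omega> l) = word x z l"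
            and VB: "(\<lambda>k\<in>{..<n}. V z k (\<lambda>l. snd (\<omega> l))) \<in> B"
          have ci: "loop_idx \<omega> k = blk_len z k" if "k \<le> n" for k
            unfolding loop_idx_eq
          proof (rule cut_idx_word[where n = n and x = x])
            show "\<not> c \<noteq> x k" if "k < n" "c \<in> set (z k)" for k c using zrep[OF z that(1)] that(2) by auto
            show "x (Suc k) \<noteq> x k" if "k < n" for k using xne[OF that] by simp
          qed (use wd that in auto)
          have X: "fst (remove_loops \<omega> k) = x k" if "k \<le> n" for k
            using wd[of "blk_len z k"] blk_len_mono[OF that, of z] by (simp add: remove_loops_def ci[OF that])
          have T: "snd (remove_loops \<omega> k) = V z k (\<lambda>l. snd (\<omega> l))" if "k < n" for k
          proof -
            have "(\<Sum>l\<in>{m..<m + p}. f l) = (\<Sum>i<p. f (m + i))" for m p and f :: "nat \<Rightarrow> real"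
              by (induction p) (auto simp: add.assoc)
            then show ?thesis using that ci[of k] ci[of "Suc k"]
              by (simp add: remove_loops_def blk_len_Suc V_def del: loop_idx.simps)
          qed
          show "\<omega> \<in> ?E"
            using X T VB w by (auto cong: restrict_cong)
        next
          show "V z k \<in> borel_measurable (LB M)" if "blk_len z (Suc k) \<le> M" for z k M by (rule Vm[OF that])
          show "V z k (restrict t {..<M}) = V z k t" if "blk_len z (Suc k) \<le> M" for z k M t by (rule Vr[OF that])
        qed (rule B' E)+
        finally show ?thesis .
      qed
      have "emeasure ?R (cylinder L n x B) = (\<integral>\<^sup>+s. h s * (\<Prod>k<n. indicator {0<..} (s k) * ennreal (W (x k) (x (Suc k)) / 2 * exp (W (x k) (x k) * s k / 2))) \<partial>LB n)"
        unfolding Rc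
      proof (rule nn_integral_cong)
        fix s :: "nat \<Rightarrow> real"
        show "indicator B s * ennreal (vrjp_fdd_density L Wn \<rho> n x s)
           = h s * (\<Prod>k<n. indicator {0<..} (s k) * ennreal (W (x k) (x (Suc k)) / 2 * exp (W (x k) (x k) * s k / 2)))"
        proof (cases "\<forall>k<n. s k > 0")
          case True
          let ?l = "loc_time x s n"
          have l: "?l v \<ge> 0" for v using True by (intro loc_time_nonneg) (auto simp: less_imp_le)
          have "(\<Sum>i\<in>L. W i i * (sqrt (1 + ?l i) * sqrt (1 + ?l i) - 1)) = (\<Sum>i\<in>L. W i i * ?l i)"
            using l by (intro sum.cong) (auto simp: add_nonneg_nonneg)
          \<comment> \<open>Regrouping by visits instead of vertices turns the exponential into a
            product with one factor per block.\<close>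
          also have "\<dots> = (\<Sum>k<n. W (x k) (x k) * s k)"
            by (rule sum_loc_time[OF fin]) (use xL in auto)
          finally have vw: "vrjp_weight Wn L ?l = vrjp_weight W L ?l * exp ((\<Sum>k<n. W (x k) (x k) * s k) / 2)"
            unfolding Wn_def vrjp_weight_offdiag[OF fin] by simp
          have e: "exp ((\<Sum>k<n. W (x k) (x k) * s k) / 2) = (\<Prod>k<n. exp (W (x k) (x k) * s k / 2))"
            by (simp add: exp_sum[symmetric] sum_divide_distrib)
          have Wp: "(\<Prod>k<n. Wn (x k) (x (Suc k)) / 2) = (\<Prod>k<n. W (x k) (x (Suc k)) / 2)"
            using xne by (intro prod.cong) (auto simp: Wn_def)
          have "vrjp_fdd_density L Wn \<rho> n x s = (\<Prod>k<n. Wn (x k) (x (Suc k)) / 2) * (sqrt (1 + ?l (x n)) * vrjp_weight Wn L ?l)"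
            using True x0 xL by (simp add: vrjp_fdd_density_eq[OF fin symn])
          also have "\<dots> = (sqrt (1 + ?l (x n)) * vrjp_weight W L ?l) * (\<Prod>k<n. W (x k) (x (Suc k)) / 2 * exp (W (x k) (x k) * s k / 2))"
            unfolding vw e Wp prod.distrib by (simp only: mult_ac)
          finally have d: "vrjp_fdd_density L Wn \<rho> n x s = \<dots>" .
          have p: "0 \<le> (\<Prod>k<n. W (x k) (x (Suc k)) / 2 * exp (W (x k) (x k) * s k / 2))"
            using nn by (intro prod_nonneg) auto
          have "(\<Prod>k<n. indicator {0<..} (s k) * ennreal (W (x k) (x (Suc k)) / 2 * exp (W (x k) (x k) * s k / 2)))
             = (\<Prod>k<n. ennreal (W (x k) (x (Suc k)) / 2 * exp (W (x k) (x k) * s k / 2)))"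
            using True by (intro prod.cong) auto
          also have "\<dots> = ennreal (\<Prod>k<n. W (x k) (x (Suc k)) / 2 * exp (W (x k) (x k) * s k / 2))"
            using nn by (intro prod_ennreal) auto
          finally show ?thesis unfolding d h_def ennreal_mult''[OF p] by (simp only: mult.assoc)
        next
          case False
          then obtain k where "k < n" "\<not> s k > 0" by auto
          then have "(\<Prod>k<n. indicator {0<..} (s k) * ennreal (W (x k) (x (Suc k)) / 2 * exp (W (x k) (x k) * s k / 2))) = 0"
            by (intro prod_zero bexI[of _ k]) auto
          moreover have "vrjp_fdd_density L Wn \<rho> n x s = 0" using False by (auto simp: vrjp_fdd_density_def)
          ultimately show ?thesis by simp
        qed
      qed
      also have "\<dots> \<le> emeasure ?P ?E"
      proof (rule nn_integral_limit_le[OF _ _ bound])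
        fix M
        show "(\<lambda>s. h s * (\<Prod>k<n. indicator {0<..} (s k) * ennreal (c M k (s k)))) \<in> borel_measurable (LB n)"
        proof (intro borel_measurable_times_ennreal h borel_measurable_prod_ennreal)
          fix k assume "k \<in> {..<n}"
          then have [measurable]: "(\<lambda>s. s k) \<in> borel_measurable (LB n)" by (intro measurable_LB_component) simp
          show "(\<lambda>s. indicator {0<..} (s k)) \<in> borel_measurable (LB n)" by measurable
          show "(\<lambda>s. ennreal (c M k (s k))) \<in> borel_measurable (LB n)" unfolding c_def by measurable
        qed
      next
        fix s :: "nat \<Rightarrow> real"
        \<comment> \<open>In \<open>ennreal\<close>, multiplication by a constant passes to limits
          when the constant is finite, and \<open>h s\<close> comes from a real number.\<close>
        have fh: "h s < Orderings.top" unfolding h_def by (auto simp: indicator_def)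
        show "(\<lambda>M. h s * (\<Prod>k<n. indicator {0<..} (s k) * ennreal (c M k (s k))))
           \<longlonglongrightarrow> h s * (\<Prod>k<n. indicator {0<..} (s k) * ennreal (W (x k) (x (Suc k)) / 2 * exp (W (x k) (x k) * s k / 2)))"
        proof (rule ennreal_tendsto_cmult[OF fh])
          show "(\<lambda>M. \<Prod>k<n. indicator {0<..} (s k) * ennreal (c M k (s k)))
             \<longlonglongrightarrow> (\<Prod>k<n. indicator {0<..} (s k) * ennreal (W (x k) (x (Suc k)) / 2 * exp (W (x k) (x k) * s k / 2)))"
          proof (cases "\<forall>k<n. s k > 0")
            case True
            have ex: "(\<lambda>M. c M k (s k)) \<longlonglongrightarrow> W (x k) (x (Suc k)) / 2 * exp (W (x k) (x k) * s k / 2)" for k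
            proof -
              have "(\<lambda>m. y ^ m / fact m) sums exp y" for y :: real
                using exp_converges[of y] by (simp add: divide_inverse mult.commute)
              then show ?thesis unfolding c_def sums_def_le by (rule tendsto_mult_left)
            qed
            have cn: "c M k (s k) \<ge> 0" if "k < n" for M k
              unfolding c_def using nn True that by (intro mult_nonneg_nonneg sum_nonneg) (auto simp: less_imp_le)
            have "(\<lambda>M. ennreal (\<Prod>k<n. c M k (s k))) \<longlonglongrightarrow> ennreal (\<Prod>k<n. W (x k) (x (Suc k)) / 2 * exp (W (x k) (x k) * s k / 2))"
              by (intro tendsto_ennrealI tendsto_prod ex)
            moreover have "(\<Prod>k<n. indicator {0<..} (s k) * ennreal (c M k (s k))) = ennreal (\<Prod>k<n. c M k (s k))" for M
              using True cn by (subst prod_ennreal[symmetric]) (auto intro!: prod.cong)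
            moreover have "(\<Prod>k<n. indicator {0<..} (s k) * ennreal (W (x k) (x (Suc k)) / 2 * exp (W (x k) (x k) * s k / 2)))
               = ennreal (\<Prod>k<n. W (x k) (x (Suc k)) / 2 * exp (W (x k) (x k) * s k / 2))"
              using True nn by (subst prod_ennreal[symmetric]) (auto intro!: prod.cong)
            ultimately show ?thesis by simp
          next
            case False
            then obtain k where "k < n" "\<not> s k > 0" by auto
            then have "(\<Prod>k<n. indicator {0<..} (s k) * f k) = (0 :: ennreal)" for f by (intro prod_zero bexI[of _ k]) auto
            then show ?thesis by (simp only: tendsto_const)
          qed
        qed
      qed
      finally show ?thesis .
    qed
  qed
qed

section \<open>Restriction to a subset of the vertices\<close>

lemma nn_integral_exp_half_line:
  assumes "b > 0"
  shows "(\<integral>\<^sup>+u. indicator {0<..} u * ennreal (exp (- (b * u))) \<partial>lborel) = ennreal (1 / b)"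
proof -
  have "(\<integral>\<^sup>+u. indicator {0<..} u * ennreal (exp (- (b * u))) \<partial>lborel) = (\<integral>\<^sup>+u. ennreal (exp (- (b * u))) * indicator {0..} u \<partial>lborel)"
  proof (rule nn_integral_cong_AE)
    show "AE u in lborel. indicator {0<..} u * ennreal (exp (- (b * u))) = ennreal (exp (- (b * u))) * indicator {0..} u"
      using AE_lborel_singleton[of "0::real"] by eventually_elim (auto simp: indicator_def)
  qed
  also have "\<dots> = ennreal (0 - (- exp (- (b * 0)) / b))"
  proof (rule nn_integral_FTC_atLeast)
    show "((\<lambda>u. - exp (- (b * u)) / b) has_real_derivative exp (- (b * x))) (at x)" for x
      using assms by (auto intro!: derivative_eq_intros)
    show "((\<lambda>u. - exp (- (b * u)) / b) \<longlongrightarrow> 0) at_top"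
      using assms by real_asymp
  qed auto
  finally show ?thesis by simp
qed

definition short_words :: "'v set \<Rightarrow> nat \<Rightarrow> 'v list set" where
  "short_words I M = {y. set y \<subseteq> I \<and> length y \<le> M}"

lemma finite_short_words: "finite I \<Longrightarrow> finite (short_words I M)"
  unfolding short_words_def by (rule finite_lists_length_le)

text \<open>Splitting off the first letter of a word reproduces the recursion of
  \<open>exc\<close>.\<close>

lemma sum_short_words:
  assumes fin: "finite I"
  shows "(\<Sum>y\<in>short_words I M. path_weight W a y b * (\<Prod>i<length y. 1 / \<beta> (y ! i))) = exc W I \<beta> b M a"
proof (induction M arbitrary: a)
  case 0
  have "short_words I 0 = {[]}" by (auto simp: short_words_def)
  then show ?case by simp
next
  case (Suc M)
  have s: "short_words I (Suc M) = insert [] ((\<lambda>(c, y). c # y) ` (I \<times> short_words I M))"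
  proof (intro equalityI subsetI)
    fix y assume "y \<in> short_words I (Suc M)"
    then show "y \<in> insert [] ((\<lambda>(c, y). c # y) ` (I \<times> short_words I M))"
      by (cases y) (auto simp: short_words_def)
  qed (auto simp: short_words_def)
  have inj: "inj_on (\<lambda>(c, y). c # y) (I \<times> short_words I M)" by (auto simp: inj_on_def)
  let ?f = "\<lambda>a y. path_weight W a y b * (\<Prod>i<length y. 1 / \<beta> (y ! i))"
  have "(\<Sum>y\<in>short_words I (Suc M). ?f a y) = ?f a [] + (\<Sum>y\<in>(\<lambda>(c, y). c # y) ` (I \<times> short_words I M). ?f a y)"
    unfolding s using fin finite_short_words[OF fin] by (subst sum.insert) auto
  also have "(\<Sum>y\<in>(\<lambda>(c, y). c # y) ` (I \<times> short_words I M). ?f a y) = (\<Sum>(c, y)\<in>I \<times> short_words I M. ?f a (c # y))"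
    by (subst sum.reindex[OF inj]) (simp add: case_prod_beta)
  also have "\<dots> = (\<Sum>c\<in>I. \<Sum>y\<in>short_words I M. ?f a (c # y))"
    by (rule sum.cartesian_product[symmetric])
  also have "\<dots> = (\<Sum>c\<in>I. W a c / 2 * (exc W I \<beta> b M c / \<beta> c))"
  proof (rule sum.cong[OF refl])
    fix c
    have "?f a (c # y) = W a c / 2 / \<beta> c * ?f c y" for y
      by (simp add: prod.lessThan_Suc_shift del: prod.lessThan_Suc)
    then show "(\<Sum>y\<in>short_words I M. ?f a (c # y)) = W a c / 2 * (exc W I \<beta> b M c / \<beta> c)"
      by (simp only: sum_distrib_left[symmetric] Suc) simp
  qed
  finally show ?case by simp
qed

lemma measurable_exc_superset:
  assumes "I \<subseteq> K"
  shows "(\<lambda>\<beta>. exc W I \<beta> j M k) \<in> borel_measurable (PiM K (\<lambda>_. borel))"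
proof (induction M arbitrary: k)
  case (Suc M)
  have "(\<lambda>\<beta>. \<beta> m) \<in> borel_measurable (PiM K (\<lambda>_. borel))" if "m \<in> I" for m
    by (rule measurable_component_singleton) (use that assms in auto)
  then show ?case unfolding exc.simps
    by (intro borel_measurable_add borel_measurable_const borel_measurable_sum borel_measurable_times borel_measurable_divide Suc)
qed simp

section \<open>The mixture over \<beta> of the laws on \<open>J\<close>\<close>

locale vrjp_restriction =
  fixes L I J :: "'v set" and W :: "'v \<Rightarrow> 'v \<Rightarrow> real" and \<rho> :: 'v
  assumes conn: "connected_weights L W" and L: "L = I \<union> J" "I \<inter> J = {}" and J2: "card J \<ge> 2" and \<rho>: "\<rho> \<in> J"
begin

lemma fin: "finite L" "finite I" "finite J" and sym: "\<And>i j. W i j = W j i" and nn: "\<And>i j. W i j \<ge> 0"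
  using conn L by (auto simp: connected_weights_def)

lemma other_vertex: "\<exists>j\<in>J. j \<noteq> i"
proof (rule ccontr)
  assume "\<not> ?thesis"
  then have "J \<subseteq> {i}" by auto
  then have "card J \<le> card {i}" by (intro card_mono) auto
  then show False using J2 by simp
qed

lemma vrjp_data_L: "vrjp_data L W \<rho>"
proof
  show "finite L" "\<rho> \<in> L" "\<And>i j. W i j \<ge> 0" using fin \<rho> L nn by auto
  fix i assume i: "i \<in> L"
  obtain j where j: "j \<in> J" "j \<noteq> i" using other_vertex by blast
  have "(i, j) \<in> {(a, b). a \<in> L \<and> b \<in> L \<and> W a b > 0}\<^sup>*"
    using conn i j L by (auto simp: connected_weights_def)
  then show "\<exists>j\<in>L. W i j > 0" using j(2) by (cases rule: converse_rtranclE) auto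
qed

text \<open>\<open>WJ_row_positive\<close> passes connectedness on to \<open>J\<close>; a second
  vertex of \<open>J\<close> serves as its target, so the positive entry is found off the diagonal
  for both kinds of weights.\<close>

lemma vrjp_data_WJ:
  assumes pd: "pos_def_on I (Hmat W \<beta>)"
  shows "vrjp_data J (WJ W I J \<beta>) \<rho>" "vrjp_data J (WJne W I J \<beta>) \<rho>"
proof -
  have n: "WJ W I J \<beta> i j \<ge> 0" for i j by (rule WJ_nonneg[OF fin(2) sym nn pd])
  have r: "\<exists>j\<in>J. j \<noteq> i \<and> WJ W I J \<beta> i j > 0" if "i \<in> J" for i
  proof -
    obtain j where j: "j \<in> J" "j \<noteq> i" using other_vertex by blast
    show ?thesis by (rule WJ_row_positive[OF conn L that j pd])
  qed
  show "vrjp_data J (WJ W I J \<beta>) \<rho>" by unfold_locales (use fin n r \<rho> in blast)+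
  show "vrjp_data J (WJne W I J \<beta>) \<rho>"
  proof
    show "\<exists>j\<in>J. WJne W I J \<beta> i j > 0" if "i \<in> J" for i using r[OF that] unfolding WJne_def by (metis (full_types))
    show "WJne W I J \<beta> i j \<ge> 0" for i j using n[of i j] by (simp add: WJne_def)
  qed (use fin \<rho> in auto)
qed

lemma AE_pos_def: "AE \<beta> in nu_meas W L. pos_def_on I (Hmat W \<beta>)"
  unfolding L(1) by (rule AE_nu_meas_pos_def[OF fin(2,3) L(2) sym])

abbreviation "NU \<equiv> nu_meas W L"

lemma sets_NU: "sets NU = sets (PiM L (\<lambda>_. borel))" by (rule sets_nu_meas)

lemma prob_NU: "prob_space NU" by (rule prob_space_nu_meas[OF fin(1) sym nn])

lemma measurable_NU_component: "v \<in> L \<Longrightarrow> (\<lambda>\<beta>. \<beta> v) \<in> borel_measurable NU"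
  by (subst measurable_cong_sets[OF sets_NU refl]) (rule measurable_component_singleton)

lemma measurable_NU_restrict: "(\<lambda>\<beta>. restrict \<beta> I) \<in> measurable NU (PiM I (\<lambda>_. lborel))"
proof -
  have "(\<lambda>\<beta>. restrict \<beta> I) \<in> measurable (PiM L (\<lambda>_. borel)) (PiM I (\<lambda>_. borel :: real measure))"
    using L by (intro measurable_restrict_subset) auto
  then show ?thesis by (simp only: measurable_cong_sets[OF sets_NU PiM_lborel_borel])
qed

lemma pos_def_restrict: "pos_def_on I (Hmat W (restrict \<beta> I)) = pos_def_on I (Hmat W \<beta>)"
  by (rule pos_def_on_cong) (simp add: Hmat_def)

lemma WJ_restrict: "WJ W I J (restrict \<beta> I) = WJ W I J \<beta>"
  by (rule WJ_cong) simp

lemma pred_pos_def_I: "Measurable.pred (PiM I (\<lambda>_. lborel)) (\<lambda>x. pos_def_on I (Hmat W x))"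
  by (rule pred_pos_def_Hmat[OF fin(2)]) (rule sym)

text \<open>The parameters for which the effective weights, and with them the laws on
  \<open>J\<close>, are under control; elsewhere the descriptions behind \<open>inv_on\<close> and
  \<open>vrjp_law\<close> are not known to be met.\<close>

definition pd_set where "pd_set = {x \<in> space (PiM I (\<lambda>_. lborel)). pos_def_on I (Hmat W x)}"

lemma pd_set: "pd_set \<in> sets (PiM I (\<lambda>_. lborel))"
  unfolding pd_set_def using pred_pos_def_I by measurable

lemma restrict_in_pd_set: "pos_def_on I (Hmat W \<beta>) \<Longrightarrow> restrict \<beta> I \<in> pd_set"
  by (auto simp: pd_set_def pos_def_restrict space_PiM)

lemma kernel_measurable:
  assumes V: "\<And>i j. (\<lambda>x. V x i j) \<in> borel_measurable (PiM I (\<lambda>_. lborel))"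
    and K: "\<And>x. x \<in> pd_set \<Longrightarrow> is_vrjp_law J (V x) \<rho> (K x)"
  shows "K \<in> measurable (restrict_space (PiM I (\<lambda>_. lborel)) pd_set) (prob_algebra (seq_space J))"
proof (rule measurable_vrjp_law[OF fin(3)])
  show "(\<lambda>x. V x i j) \<in> borel_measurable (restrict_space (PiM I (\<lambda>_. lborel)) pd_set)" for i j
    by (rule measurable_restrict_space1[OF V])
  show "is_vrjp_law J (V x) \<rho> (K x)" if "x \<in> space (restrict_space (PiM I (\<lambda>_. lborel)) pd_set)" for x
    using that by (intro K) (simp add: space_restrict_space)
qed

lemma is_vrjp_law_WJlim:
  assumes "x \<in> pd_set"
  shows "is_vrjp_law J (WJlim W I J x) \<rho> (vrjp_law J (WJ W I J x) \<rho>)"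
proof -
  have pd: "pos_def_on I (Hmat W x)" using assms by (simp add: pd_set_def)
  show ?thesis
    unfolding WJlim_eq[OF fin(2) sym nn pd] by (rule vrjp_data.is_vrjp_law[OF vrjp_data_WJ(1)[OF pd]])
qed

text \<open>Built as a genuine measure so that \<open>law_eqI_cut\<close> can be applied to it. The
  parameters are restricted to \<open>pd_set\<close> because the kernel is shown to be measurable
  there.\<close>

definition mixture :: "(nat \<Rightarrow> 'v \<times> real) measure" where
  "mixture = restrict_space (distr NU (PiM I (\<lambda>_. lborel)) (\<lambda>\<beta>. restrict \<beta> I)) pd_set \<bind> (\<lambda>x. vrjp_law J (WJ W I J x) \<rho>)"

lemma nn_integral_marginal:
  assumes "(\<lambda>x. f x * indicator pd_set x) \<in> borel_measurable (PiM I (\<lambda>_. lborel))"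
  shows "(\<integral>\<^sup>+x. f x * indicator pd_set x \<partial>distr NU (PiM I (\<lambda>_. lborel)) (\<lambda>\<beta>. restrict \<beta> I)) = (\<integral>\<^sup>+\<beta>. f (restrict \<beta> I) \<partial>NU)"
proof -
  have "(\<integral>\<^sup>+x. f x * indicator pd_set x \<partial>distr NU (PiM I (\<lambda>_. lborel)) (\<lambda>\<beta>. restrict \<beta> I))
     = (\<integral>\<^sup>+\<beta>. f (restrict \<beta> I) * indicator pd_set (restrict \<beta> I) \<partial>NU)"
    by (rule nn_integral_distr[OF measurable_NU_restrict]) (simp add: assms)
  also have "\<dots> = (\<integral>\<^sup>+\<beta>. f (restrict \<beta> I) \<partial>NU)"
    by (rule nn_integral_cong_AE) (use AE_pos_def in \<open>auto simp: restrict_in_pd_set elim!: eventually_mono\<close>)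
  finally show ?thesis .
qed

lemma kernel_measurable': "(\<lambda>x. vrjp_law J (WJ W I J x) \<rho>) \<in> measurable (restrict_space (PiM I (\<lambda>_. lborel)) pd_set) (prob_algebra (seq_space J))"
  by (rule kernel_measurable[OF measurable_WJlim is_vrjp_law_WJlim])

lemma measurable_kernel_emeasure:
  assumes K: "K \<in> measurable (restrict_space (PiM I (\<lambda>_. lborel)) pd_set) (prob_algebra (seq_space J))" and A: "A \<in> sets (seq_space J)"
  shows "(\<lambda>x. emeasure (K x) A * indicator pd_set x) \<in> borel_measurable (PiM I (\<lambda>_. lborel))"
proof -
  have "(\<lambda>x. emeasure (K x) A) \<in> borel_measurable (restrict_space (PiM I (\<lambda>_. lborel)) pd_set)"
    by (rule measurable_compose[OF measurable_prob_algebraD[OF K] measurable_emeasure_subprob_algebra[OF A]])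
  then show ?thesis using pd_set by (subst (asm) borel_measurable_restrict_space_iff_ennreal) auto
qed

lemma mixture:
  shows prob_mixture: "prob_space mixture" and sets_mixture: "sets mixture = sets (seq_space J)"
    and emeasure_mixture: "A \<in> sets (seq_space J) \<Longrightarrow> emeasure mixture A = (\<integral>\<^sup>+\<beta>. emeasure (vrjp_law J (WJ W I J \<beta>) \<rho>) A \<partial>NU)"
proof -
  let ?D = "distr NU (PiM I (\<lambda>_. lborel)) (\<lambda>\<beta>. restrict \<beta> I)"
  let ?M = "restrict_space ?D pd_set"
  let ?K = "\<lambda>x. vrjp_law J (WJ W I J x) \<rho>"
  have sD: "sets ?M = sets (restrict_space (PiM I (\<lambda>_. lborel)) pd_set)" by (intro sets_restrict_space_cong) simp
  have K: "?K \<in> measurable ?M (prob_algebra (seq_space J))"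
    using kernel_measurable' by (simp cong: measurable_cong_sets add: sD)
  have Ks: "?K \<in> measurable ?M (subprob_algebra (seq_space J))" by (rule measurable_prob_algebraD[OF K])
  have GD: "pd_set \<inter> space ?D \<in> sets ?D" using pd_set by auto
  have GIs: "pd_set \<subseteq> space (PiM I (\<lambda>_. lborel))" by (auto simp: pd_set_def)
  have "emeasure ?M (space ?M) = (\<integral>\<^sup>+x. 1 * indicator pd_set x \<partial>?D)"
    using pd_set GIs by (simp add: space_restrict_space emeasure_restrict_space Int_absorb2)
  also have "\<dots> = (\<integral>\<^sup>+\<beta>. 1 \<partial>NU)"
    by (rule nn_integral_marginal) (use pd_set in simp)
  also have "\<dots> = 1" using prob_space.emeasure_space_1[OF prob_NU] by simp
  finally have pM: "prob_space ?M" by (rule prob_spaceI)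
  interpret M: prob_space ?M by (rule pM)
  have sp: "space ?M \<noteq> {}" by (rule M.not_empty)
  show "sets mixture = sets (seq_space J)" unfolding mixture_def by (rule sets_bind[OF _ sp]) (use measurable_space[OF Ks] in \<open>simp add: space_subprob_algebra\<close>)
  show "prob_space mixture"
    unfolding mixture_def
    by (rule M.prob_space_bind[OF AE_I2 Ks]) (use measurable_space[OF K] in \<open>simp add: space_prob_algebra\<close>)
  show "emeasure mixture A = (\<integral>\<^sup>+\<beta>. emeasure (vrjp_law J (WJ W I J \<beta>) \<rho>) A \<partial>NU)" if A: "A \<in> sets (seq_space J)"
  proof -
    have "emeasure mixture A = (\<integral>\<^sup>+x. emeasure (?K x) A \<partial>?M)"
      unfolding mixture_def by (rule emeasure_bind[OF sp Ks A])
    also have "\<dots> = (\<integral>\<^sup>+x. emeasure (?K x) A * indicator pd_set x \<partial>?D)"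
      by (rule nn_integral_restrict_space[OF GD])
    also have "\<dots> = (\<integral>\<^sup>+\<beta>. emeasure (?K (restrict \<beta> I)) A \<partial>NU)"
      by (rule nn_integral_marginal[OF measurable_kernel_emeasure[OF kernel_measurable' A]])
    finally show ?thesis unfolding WJ_restrict .
  qed
qed

text \<open>Measurability of the kernel is controlled on \<open>pd_set\<close> only, so the
  indicator of \<open>pd_set\<close> is inserted before the marginals are compared. It is 1 almost
  surely under both measures, since \<open>What\<close> and \<open>W\<close> agree on
  \<open>I\<close>.\<close>

lemma nn_integral_What:
  assumes K: "K \<in> measurable (restrict_space (PiM I (\<lambda>_. lborel)) pd_set) (prob_algebra (seq_space J))" and A: "A \<in> sets (seq_space J)"
  shows "(\<integral>\<^sup>+\<beta>. emeasure (K (restrict \<beta> I)) A \<partial>nu_meas (What W I J \<rho>) (insert \<rho> I)) = (\<integral>\<^sup>+\<beta>. emeasure (K (restrict \<beta> I)) A \<partial>NU)"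
proof -
  let ?g = "\<lambda>x. emeasure (K x) A * indicator pd_set x"
  let ?V = "What W I J \<rho>"
  have rI: "\<rho> \<notin> I" using L(2) \<rho> by auto
  have VI: "?V i j = W i j" if "i \<in> I" "j \<in> I" for i j using that by (simp add: What_def)
  have symV: "?V i j = ?V j i" for i j
    using rI by (cases "i \<in> I"; cases "j \<in> I") (auto simp: What_def sym[of i j])
  have pdV: "pos_def_on I (Hmat ?V \<beta>) = pos_def_on I (Hmat W \<beta>)" for \<beta> by (rule pos_def_on_cong) (simp add: Hmat_def VI)
  have "AE \<beta> in nu_meas ?V (I \<union> {\<rho>}). pos_def_on I (Hmat ?V \<beta>)"
    by (rule AE_nu_meas_pos_def[OF fin(2) _ _ symV]) (use rI in auto)
  moreover have "I \<union> {\<rho>} = insert \<rho> I" by auto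
  ultimately have "AE \<beta> in nu_meas ?V (insert \<rho> I). pos_def_on I (Hmat W \<beta>)" by (simp only: pdV)
  then have "AE \<beta> in nu_meas ?V (insert \<rho> I). restrict \<beta> I \<in> pd_set"
    by (rule eventually_mono) (rule restrict_in_pd_set)
  then have "(\<integral>\<^sup>+\<beta>. emeasure (K (restrict \<beta> I)) A \<partial>nu_meas ?V (insert \<rho> I)) = (\<integral>\<^sup>+\<beta>. ?g (restrict \<beta> I) \<partial>nu_meas ?V (insert \<rho> I))"
    by (intro nn_integral_cong_AE) (auto elim!: eventually_mono)
  also have "\<dots> = (\<integral>\<^sup>+\<beta>. ?g (restrict \<beta> I) \<partial>nu_meas W (I \<union> J))"
    by (rule nn_integral_nu_meas_What[OF fin(2,3) L(2) sym nn measurable_kernel_emeasure[OF K A] \<rho>])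
  also have "\<dots> = (\<integral>\<^sup>+\<beta>. emeasure (K (restrict \<beta> I)) A \<partial>NU)"
    unfolding L(1)[symmetric] by (intro nn_integral_cong_AE) (use AE_pos_def in \<open>auto simp: restrict_in_pd_set elim!: eventually_mono\<close>)
  finally show ?thesis .
qed

lemma mixture_cylinder:
  assumes B: "B \<in> sets (PiM {..<n} (\<lambda>_. borel))"
  shows "emeasure mixture (cylinder J n x B)
    = (\<integral>\<^sup>+\<beta>. (\<integral>\<^sup>+s. indicator B s * ennreal (vrjp_fdd_density J (WJlim W I J (restrict \<beta> I)) \<rho> n x s) \<partial>LB n) \<partial>NU)"
  unfolding emeasure_mixture[OF sets_cylinder[OF B]]
proof (rule nn_integral_cong_AE)
  show "AE \<beta> in NU. emeasure (vrjp_law J (WJ W I J \<beta>) \<rho>) (cylinder J n x B)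
     = (\<integral>\<^sup>+s. indicator B s * ennreal (vrjp_fdd_density J (WJlim W I J (restrict \<beta> I)) \<rho> n x s) \<partial>LB n)"
    using AE_pos_def
  proof eventually_elim
    case (elim \<beta>)
    from is_vrjp_law_WJlim[OF restrict_in_pd_set[OF elim]]
    have "is_vrjp_law J (WJlim W I J (restrict \<beta> I)) \<rho> (vrjp_law J (WJ W I J \<beta>) \<rho>)" by (simp only: WJ_restrict)
    then show ?case using B unfolding is_vrjp_law_cylinder by blast
  qed
qed

lemma sigma_finite_LB: "sigma_finite_measure (LB n)"
  by (rule lborel_prod.sigma_finite) simp

lemma Fubini_NU:
  assumes "(\<lambda>p. f (fst p) (snd p)) \<in> borel_measurable (NU \<Otimes>\<^sub>M LB n)"
  shows "(\<integral>\<^sup>+t. (\<integral>\<^sup>+\<beta>. f \<beta> t \<partial>NU) \<partial>LB n) = (\<integral>\<^sup>+\<beta>. (\<integral>\<^sup>+t. f \<beta> t \<partial>LB n) \<partial>NU)"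
proof -
  interpret NU: prob_space NU by (rule prob_NU)
  interpret pair_sigma_finite NU "LB n"
    by (intro pair_sigma_finite.intro sigma_finite_LB) unfold_locales
  show ?thesis using assms by (intro Fubini') (simp add: case_prod_beta)
qed

lemma measurable_NU_integral:
  assumes "(\<lambda>p. f (fst p) (snd p)) \<in> borel_measurable (NU \<Otimes>\<^sub>M LB n)"
  shows "(\<lambda>\<beta>. \<integral>\<^sup>+t. f \<beta> t \<partial>LB n) \<in> borel_measurable NU"
  by (rule sigma_finite_measure.borel_measurable_nn_integral[OF sigma_finite_LB]) (use assms in \<open>simp add: case_prod_beta\<close>)

section \<open>Comparison of both laws on a fixed cylinder over \<open>J\<close>\<close>

context
  fixes n :: nat and x :: "nat \<Rightarrow> 'v" and B :: "(nat \<Rightarrow> real) set"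
  assumes B: "B \<in> sets (PiM {..<n} (\<lambda>_. borel))" and x0: "x 0 = \<rho>" and xJ: "\<And>k. k \<le> n \<Longrightarrow> x k \<in> J"
begin

definition "endpoint_weight s = indicator B s * ennreal (sqrt (1 + loc_time x s n (x n)))" for s

definition "exp_weight b u = indicator {0<..} u * ennreal (exp (- (b * u)))" for b u :: real

text \<open>Given \<beta>, the waiting times at \<open>J\<close> are weighted like independent
  exponential variables of rates \<open>\<beta> (x k)\<close>, up to normalisation. Grouped by
  vertex this is the exponential of minus \<beta> paired with the local times, whose mean is a
  \<open>vrjp_weight\<close>.\<close>

definition "times_weight \<beta> s = (\<Prod>k<n. exp_weight (\<beta> (x k)) (s k))" for \<beta> :: "'v \<Rightarrow> real" and s :: "nat \<Rightarrow> real"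

lemma B_LB: "B \<in> sets (LB n)"
  using B by (simp add: PiM_lborel_borel)

lemma loc_time_LB: "(\<lambda>s. loc_time x s n v) \<in> borel_measurable (LB n)"
  by (intro measurable_loc_time measurable_LB_component)

lemma endpoint_weight: "endpoint_weight \<in> borel_measurable (LB n)"
proof -
  note [measurable] = loc_time_LB B_LB
  show ?thesis unfolding endpoint_weight_def by measurable
qed

lemma measurable_exp_weight:
  assumes [measurable]: "b \<in> borel_measurable N" "u \<in> borel_measurable N"
  shows "(\<lambda>y. exp_weight (b y) (u y)) \<in> borel_measurable N"
  unfolding exp_weight_def by measurable

lemma measurable_times_weight: "(\<lambda>p. times_weight (fst p) (snd p)) \<in> borel_measurable (NU \<Otimes>\<^sub>M LB n)"
  unfolding times_weight_def
proof (intro borel_measurable_prod_ennreal measurable_exp_weight)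
  fix k assume "k \<in> {..<n}"
  then show "(\<lambda>p. fst p (x k)) \<in> borel_measurable (NU \<Otimes>\<^sub>M LB n)" "(\<lambda>p. snd p k) \<in> borel_measurable (NU \<Otimes>\<^sub>M LB n)"
    using xJ[of k] L(1)
    by (auto intro!: measurable_compose[OF measurable_fst measurable_NU_component] measurable_compose[OF measurable_snd measurable_LB_component])
qed

lemma measurable_endpoint_times_weight: "(\<lambda>p. endpoint_weight (snd p) * times_weight (fst p) (snd p)) \<in> borel_measurable (NU \<Otimes>\<^sub>M LB n)"
  by (intro borel_measurable_times_ennreal measurable_times_weight measurable_compose[OF measurable_snd endpoint_weight])

lemma times_weight_eq:
  "times_weight \<beta> s = (if \<forall>k<n. s k > 0 then ennreal (exp (- (\<Sum>v\<in>J. \<beta> v * loc_time x s n v))) else 0)"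
proof (cases "\<forall>k<n. s k > 0")
  case True
  have "times_weight \<beta> s = (\<Prod>k<n. ennreal (exp (- (\<beta> (x k) * s k))))"
    unfolding times_weight_def exp_weight_def using True by (intro prod.cong) auto
  also have "\<dots> = ennreal (exp (\<Sum>k<n. - (\<beta> (x k) * s k)))"
    by (subst prod_ennreal) (auto simp: exp_sum)
  also have "(\<Sum>k<n. - (\<beta> (x k) * s k)) = - (\<Sum>v\<in>J. \<beta> v * loc_time x s n v)"
    using xJ by (subst sum_loc_time[OF fin(3)]) (auto simp: sum_negf)
  finally show ?thesis using True by simp
next
  case False
  then obtain k where "k < n" "\<not> s k > 0" by auto
  then have "times_weight \<beta> s = 0" unfolding times_weight_def exp_weight_def by (intro prod_zero bexI[of _ k]) auto
  then show ?thesis unfolding if_not_P[OF False] .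
qed

definition "time_integral \<beta> = (\<integral>\<^sup>+s. endpoint_weight s * times_weight \<beta> s \<partial>LB n)" for \<beta>

lemma time_integral: "time_integral \<in> borel_measurable NU"
  unfolding time_integral_def by (rule measurable_NU_integral[OF measurable_endpoint_times_weight])

text \<open>At fixed times, \<open>nn_integral_nu_meas_tilt\<close> replaces the
  \<open>vrjp_weight\<close> of the random weights by the exponential of minus \<beta> paired with
  the local times on \<open>J\<close>. This happens between two exchanges of integrals; afterwards
  the waiting times at \<open>J\<close> see the coordinates of \<beta> on \<open>J\<close> and the
  excursion weights see those on \<open>I\<close>.\<close>

lemma mixture_cylinder_eq:
  "emeasure mixture (cylinder J n x B) = (\<integral>\<^sup>+\<beta>. ennreal (\<Prod>k<n. WJlim W I J (restrict \<beta> I) (x k) (x (Suc k)) / 2) * time_integral \<beta> \<partial>NU)"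
proof -
  define g where "g y = ennreal (\<Prod>k<n. WJlim W I J y (x k) (x (Suc k)) / 2)" for y
  have g: "g \<in> borel_measurable (PiM I (\<lambda>_. lborel))"
    unfolding g_def by (intro measurable_compose[OF _ measurable_ennreal] borel_measurable_prod borel_measurable_divide measurable_WJlim) simp
  have gN: "(\<lambda>\<beta>. g (restrict \<beta> I)) \<in> borel_measurable NU" by (rule measurable_compose[OF measurable_NU_restrict g])
  have gp: "(\<lambda>p. g (restrict (fst p) I)) \<in> borel_measurable (NU \<Otimes>\<^sub>M LB n)" by (rule measurable_compose[OF measurable_fst gN])
  define vw where "vw \<beta> s = (if \<forall>k<n. s k > 0 then ennreal (vrjp_weight (WJlim W I J (restrict \<beta> I)) J (loc_time x s n)) else 0)" for \<beta> s
  have vwm: "(\<lambda>p. vw (fst p) (snd p)) \<in> borel_measurable (NU \<Otimes>\<^sub>M LB n)"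
  proof -
    have [measurable]: "(\<lambda>p. vrjp_weight (WJlim W I J (restrict (fst p) I)) J (loc_time x (snd p) n)) \<in> borel_measurable (NU \<Otimes>\<^sub>M LB n)"
      by (intro measurable_vrjp_weight measurable_compose[OF measurable_fst measurable_compose[OF measurable_NU_restrict measurable_WJlim]]
          measurable_compose[OF measurable_snd loc_time_LB])
    have "Measurable.pred (NU \<Otimes>\<^sub>M LB n) (\<lambda>p. \<forall>k\<in>{..<n}. snd p k > 0)"
    proof (rule pred_intros_finite)
      fix k assume "k \<in> {..<n}"
      then have [measurable]: "(\<lambda>p. snd p k) \<in> borel_measurable (NU \<Otimes>\<^sub>M LB n)"
        by (intro measurable_compose[OF measurable_snd measurable_LB_component]) simp
      show "Measurable.pred (NU \<Otimes>\<^sub>M LB n) (\<lambda>p. snd p k > 0)" by measurable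
    qed simp
    then have "(\<lambda>p. if \<forall>k\<in>{..<n}. snd p k > 0 then ennreal (vrjp_weight (WJlim W I J (restrict (fst p) I)) J (loc_time x (snd p) n)) else 0)
       \<in> borel_measurable (NU \<Otimes>\<^sub>M LB n)" by measurable
    then show ?thesis unfolding vw_def by simp
  qed
  have "emeasure mixture (cylinder J n x B) = (\<integral>\<^sup>+\<beta>. (\<integral>\<^sup>+s. endpoint_weight s * (g (restrict \<beta> I) * vw \<beta> s) \<partial>LB n) \<partial>NU)"
    unfolding mixture_cylinder[OF B]
  proof (rule nn_integral_cong_AE, use AE_pos_def in eventually_elim)
    case (elim \<beta>)
    have pd: "pos_def_on I (Hmat W (restrict \<beta> I))" using elim by (simp only: pos_def_restrict)
    let ?V = "WJlim W I J (restrict \<beta> I)"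
    have V: "?V = WJ W I J (restrict \<beta> I)" by (rule WJlim_eq[OF fin(2) sym nn pd])
    have symV: "?V i j = ?V j i" for i j unfolding V by (rule WJ_sym[OF fin(2) sym L(2) pd])
    have nnV: "?V i j \<ge> 0" for i j unfolding V by (rule WJ_nonneg[OF fin(2) sym nn pd])
    show ?case
    proof (rule nn_integral_cong)
      fix s :: "nat \<Rightarrow> real"
      show "indicator B s * ennreal (vrjp_fdd_density J ?V \<rho> n x s) = endpoint_weight s * (g (restrict \<beta> I) * vw \<beta> s)"
      proof (cases "\<forall>k<n. s k > 0")
        case True
        let ?l = "loc_time x s n"
        have l: "?l v \<ge> 0" for v using True by (intro loc_time_nonneg) (auto simp: less_imp_le)
        have d: "vrjp_fdd_density J ?V \<rho> n x s = (\<Prod>k<n. ?V (x k) (x (Suc k)) / 2) * (sqrt (1 + ?l (x n)) * vrjp_weight ?V J ?l)"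
          using True x0 xJ by (simp add: vrjp_fdd_density_eq[OF fin(3) symV])
        have p: "0 \<le> (\<Prod>k<n. ?V (x k) (x (Suc k)) / 2)" using nnV by (intro prod_nonneg) auto
        have q: "0 \<le> sqrt (1 + ?l (x n))" using l[of "x n"] by simp
        show ?thesis
          unfolding d endpoint_weight_def g_def vw_def if_P[OF True] ennreal_mult'[OF p] ennreal_mult'[OF q] by (simp only: mult_ac)
      next
        case False
        then have "vrjp_fdd_density J ?V \<rho> n x s = 0" by (auto simp: vrjp_fdd_density_def)
        then show ?thesis unfolding vw_def if_not_P[OF False] by simp
      qed
    qed
  qed
  also have "\<dots> = (\<integral>\<^sup>+s. (\<integral>\<^sup>+\<beta>. endpoint_weight s * (g (restrict \<beta> I) * vw \<beta> s) \<partial>NU) \<partial>LB n)"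
    by (rule Fubini_NU[symmetric]) (intro borel_measurable_times_ennreal gp vwm measurable_compose[OF measurable_snd endpoint_weight])
  also have "\<dots> = (\<integral>\<^sup>+s. (\<integral>\<^sup>+\<beta>. endpoint_weight s * (g (restrict \<beta> I) * times_weight \<beta> s) \<partial>NU) \<partial>LB n)"
  proof (rule nn_integral_cong)
    fix s assume s: "s \<in> space (LB n)"
    have tm: "(\<lambda>\<beta>. times_weight \<beta> s) \<in> borel_measurable NU"
      using measurable_compose[OF measurable_Pair2'[OF s] measurable_times_weight] by simp
    have vm: "(\<lambda>\<beta>. vw \<beta> s) \<in> borel_measurable NU"
      using measurable_compose[OF measurable_Pair2'[OF s] vwm] by simp
    have "(\<integral>\<^sup>+\<beta>. g (restrict \<beta> I) * vw \<beta> s \<partial>NU) = (\<integral>\<^sup>+\<beta>. g (restrict \<beta> I) * times_weight \<beta> s \<partial>NU)"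
    proof (cases "\<forall>k<n. s k > 0")
      case True
      have l: "loc_time x s n v \<ge> 0" for v using True by (intro loc_time_nonneg) (auto simp: less_imp_le)
      show ?thesis
        unfolding vw_def times_weight_eq if_P[OF True] L(1)
        by (rule nn_integral_nu_meas_tilt[OF fin(2,3) L(2) sym nn g l, symmetric])
    next
      case False
      show ?thesis unfolding vw_def times_weight_eq if_not_P[OF False] ..
    qed
    then show "(\<integral>\<^sup>+\<beta>. endpoint_weight s * (g (restrict \<beta> I) * vw \<beta> s) \<partial>NU) = (\<integral>\<^sup>+\<beta>. endpoint_weight s * (g (restrict \<beta> I) * times_weight \<beta> s) \<partial>NU)"
      by (subst (1 2) nn_integral_cmult) (auto intro!: borel_measurable_times_ennreal gN tm vm)
  qed
  also have "\<dots> = (\<integral>\<^sup>+\<beta>. (\<integral>\<^sup>+s. endpoint_weight s * (g (restrict \<beta> I) * times_weight \<beta> s) \<partial>LB n) \<partial>NU)"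
    by (rule Fubini_NU) (intro borel_measurable_times_ennreal gp measurable_times_weight measurable_compose[OF measurable_snd endpoint_weight])
  also have "\<dots> = (\<integral>\<^sup>+\<beta>. g (restrict \<beta> I) * time_integral \<beta> \<partial>NU)"
  proof (rule nn_integral_cong)
    fix \<beta> assume b: "\<beta> \<in> space NU"
    have "(\<lambda>s. endpoint_weight s * times_weight \<beta> s) \<in> borel_measurable (LB n)"
      using measurable_compose[OF measurable_Pair1'[OF b] measurable_endpoint_times_weight] by simp
    from nn_integral_cmult[OF this, of "g (restrict \<beta> I)"]
    show "(\<integral>\<^sup>+s. endpoint_weight s * (g (restrict \<beta> I) * times_weight \<beta> s) \<partial>LB n) = g (restrict \<beta> I) * time_integral \<beta>"
      unfolding time_integral_def by (simp only: mult_ac)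
  qed
  finally show ?thesis unfolding g_def .
qed

definition "cut_event = {\<omega> \<in> space (seq_space L). (\<forall>k\<le>n. fst (restr_J J \<omega> k) = x k) \<and> (\<lambda>k\<in>{..<n}. snd (restr_J J \<omega> k)) \<in> B}"

text \<open>For fixed \<beta> the product of truncated excursion weights expands into a sum over
  words, with each \<open>1 / \<beta> i\<close> written back as an integral over a waiting time in
  \<open>I\<close>. Integrating \<beta> first, at fixed times, gives the Laplace transform on all of
  \<open>L\<close>; so each word contributes its path density, and \<open>cut_lower_bound\<close>
  applies.\<close>

lemma restr_bound:
  "(\<integral>\<^sup>+\<beta>. ennreal (\<Prod>k<n. exc W I \<beta> (x (Suc k)) M (x k)) * time_integral \<beta> \<partial>NU) \<le> emeasure (vrjp_law L W \<rho>) cut_event"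
proof -
  let ?P = "vrjp_law L W \<rho>"
  have P: "is_vrjp_law L W \<rho> ?P" by (rule vrjp_data.is_vrjp_law[OF vrjp_data_L])
  define Z where "Z k = short_words I M" for k :: nat
  define V where "V z k t = t (blk_len z k)" for z :: "nat \<Rightarrow> 'v list" and k :: nat and t :: "nat \<Rightarrow> real"
  \<comment> \<open>Each letter of the word, in \<open>J\<close> or in \<open>I\<close>, carries an
    exponential factor in its waiting time. For a letter \<open>i\<close> of \<open>I\<close> it
    integrates to \<open>iv (\<beta> i)\<close>, that is \<open>1 / \<beta> i\<close>, the factor
    per visit in \<open>exc\<close>.\<close>
  define q where "q \<beta> z l = exp_weight (\<beta> (word x z l))" for \<beta> :: "'v \<Rightarrow> real" and z and l :: nat
  define iv where "iv b = (\<integral>\<^sup>+u. exp_weight b u \<partial>lborel)" for b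
  define \<kappa> where "\<kappa> \<beta> k y s = exp_weight (\<beta> (x k)) s * (\<Prod>i<length y. iv (\<beta> (y ! i)))" for \<beta> :: "'v \<Rightarrow> real" and k :: nat and y :: "'v list" and s :: real
  define a where "a k y = ennreal (path_weight W (x k) y (x (Suc k)))" for k y
  have finZ: "finite (Z k)" for k unfolding Z_def by (rule finite_short_words[OF fin(2)])
  have Vm: "V z k \<in> borel_measurable (LB M')" if "blk_len z (Suc k) \<le> M'" for z k M'
    unfolding V_def by (rule measurable_LB_component) (use that in \<open>simp add: blk_len_Suc\<close>)
  have Vr: "V z k (restrict t {..<M'}) = V z k t" if "blk_len z (Suc k) \<le> M'" for z k M' t
    unfolding V_def using that by (simp add: blk_len_Suc)
  have zI: "set (z k) \<subseteq> I" if "z \<in> PiE {..<n} Z" "k < n" for z k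
    using PiE_mem[OF that(1), of k] that(2) by (simp add: Z_def short_words_def)
  have nthI: "z k ! i \<in> I" if "z \<in> PiE {..<n} Z" "k < n" "i < length (z k)" for z k i
    using zI[OF that(1,2)] that(3) by auto
  have wL: "word x z l \<in> L" if z: "z \<in> PiE {..<n} Z" and l: "l \<le> blk_len z n" for z l
  proof (cases "l = blk_len z n")
    case False
    then have "l < blk_len z n" using l by simp
    then obtain k i where ki: "k < n" "i \<le> length (z k)" "l = blk_len z k + i" by (rule block_cases)
    then show ?thesis using nthI[OF z] xJ[of k] L(1) by (cases i) (auto simp: word_block nth_Cons simp flip: add_Suc_right)
  qed (use xJ L in simp)
  have lt: "loc_time (word x z) t (blk_len z n) v = loc_time x (\<lambda>k\<in>{..<n}. V z k t) n v"
    if z: "z \<in> PiE {..<n} Z" and v: "v \<in> J" for z t v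
  proof -
    \<comment> \<open>A block is in \<open>J\<close> only at its first letter, so only its first
      waiting time counts towards the local times on \<open>J\<close>.\<close>
    let ?c = "\<lambda>(k :: nat) (i :: nat). if i = 0 then 1 else 0 :: real"
    have nv: "z k ! i \<noteq> v" if "k < n" "i < length (z k)" for k i using nthI[OF z that] v L(2) by auto
    have "loc_time (word x z) t (blk_len z n) v = loc_time x (\<lambda>k. \<Sum>i<Suc (length (z k)). ?c k i * t (blk_len z k + i)) n v"
    proof (rule loc_time_word)
      fix k i assume "k < n" "i \<le> length (z k)" "(x k # z k) ! i = v"
      then show "x k = v \<and> ?c k i = 1" using nv[of k "i - 1"] by (cases i) auto
    next
      fix k i assume "k < n" "i \<le> length (z k)" "x k = v" "(x k # z k) ! i \<noteq> v"
      then show "?c k i = 0" by (cases i) auto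
    qed
    also have "(\<lambda>k. \<Sum>i<Suc (length (z k)). ?c k i * t (blk_len z k + i)) = (\<lambda>k. V z k t)"
      unfolding sum.lessThan_Suc_shift by (simp add: V_def)
    also have "loc_time x (\<lambda>k. V z k t) n = loc_time x (\<lambda>k\<in>{..<n}. V z k t) n"
      by (rule loc_time_cong) simp_all
    finally show ?thesis .
  qed
  have expw_m: "exp_weight b \<in> borel_measurable borel" for b
    unfolding exp_weight_def by measurable
  define f where "f z \<beta> t = (\<Prod>k<n. a k (z k)) * endpoint_weight (\<lambda>k\<in>{..<n}. V z k t) * (\<Prod>l<blk_len z n. q \<beta> z l (t l))" for z \<beta> t
  have fm: "(\<lambda>p. f z (fst p) (snd p)) \<in> borel_measurable (NU \<Otimes>\<^sub>M LB (blk_len z n))" if z: "z \<in> PiE {..<n} Z" for z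
  proof -
    have le: "blk_len z (Suc k) \<le> blk_len z n" if "k < n" for k using that by (intro blk_len_mono) simp
    have "(\<lambda>t. \<lambda>k\<in>{..<n}. V z k t) \<in> measurable (LB (blk_len z n)) (LB n)"
    proof (rule measurable_restrict)
      fix k assume "k \<in> {..<n}"
      then show "V z k \<in> measurable (LB (blk_len z n)) lborel" using Vm[OF le[of k]] by simp
    qed
    then have "(\<lambda>p. endpoint_weight (\<lambda>k\<in>{..<n}. V z k (snd p))) \<in> borel_measurable (NU \<Otimes>\<^sub>M LB (blk_len z n))"
      by (intro measurable_compose[OF measurable_snd measurable_compose[OF _ endpoint_weight]])
    moreover have "(\<lambda>p. \<Prod>l<blk_len z n. q (fst p) z l (snd p l)) \<in> borel_measurable (NU \<Otimes>\<^sub>M LB (blk_len z n))"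
      unfolding q_def
    proof (intro borel_measurable_prod_ennreal measurable_exp_weight)
      fix l assume "l \<in> {..<blk_len z n}"
      then show "(\<lambda>p. fst p (word x z l)) \<in> borel_measurable (NU \<Otimes>\<^sub>M LB (blk_len z n))"
        "(\<lambda>p. snd p l) \<in> borel_measurable (NU \<Otimes>\<^sub>M LB (blk_len z n))"
        using wL[OF z, of l]
        by (auto intro!: measurable_compose[OF measurable_fst measurable_NU_component] measurable_compose[OF measurable_snd measurable_LB_component])
    qed
    ultimately show ?thesis unfolding f_def by (intro borel_measurable_times_ennreal borel_measurable_const)
  qed
  have "(\<integral>\<^sup>+\<beta>. ennreal (\<Prod>k<n. exc W I \<beta> (x (Suc k)) M (x k)) * time_integral \<beta> \<partial>NU)
     = (\<integral>\<^sup>+\<beta>. (\<integral>\<^sup>+s. endpoint_weight s * (\<Prod>k<n. \<Sum>y\<in>Z k. a k y * \<kappa> \<beta> k y (s k)) \<partial>LB n) \<partial>NU)"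
  proof (rule nn_integral_cong_AE, use AE_pos_def AE_space in eventually_elim)
    case (elim \<beta>)
    have bp: "\<beta> i > 0" if "i \<in> I" for i by (rule pos_def_Hmat_diag[OF fin(2) elim(1) nn that])
    have iv: "iv (\<beta> i) = ennreal (1 / \<beta> i)" if "i \<in> I" for i
      unfolding iv_def exp_weight_def by (rule nn_integral_exp_half_line[OF bp[OF that]])
    have pn: "0 \<le> path_weight W b y d" for b y d by (rule path_weight_nonneg[where W = W]) (rule nn)
    have en: "exc W I \<beta> j M k \<ge> 0" for j k by (rule exc_nonneg[where W = W, OF nn bp])
    have s: "(\<Sum>y\<in>Z k. a k y * \<kappa> \<beta> k y u) = exp_weight (\<beta> (x k)) u * ennreal (exc W I \<beta> (x (Suc k)) M (x k))" for k u
    proof -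
      have ay: "a k y * \<kappa> \<beta> k y u = exp_weight (\<beta> (x k)) u * ennreal (path_weight W (x k) y (x (Suc k)) * (\<Prod>i<length y. 1 / \<beta> (y ! i)))"
        if y: "y \<in> Z k" for y
      proof -
        have yi: "y ! i \<in> I" if "i < length y" for i using y that by (auto simp: Z_def short_words_def)
        have "(\<Prod>i<length y. iv (\<beta> (y ! i))) = (\<Prod>i<length y. ennreal (1 / \<beta> (y ! i)))"
          using yi iv by (intro prod.cong) auto
        also have "\<dots> = ennreal (\<Prod>i<length y. 1 / \<beta> (y ! i))"
          using bp[OF yi] by (intro prod_ennreal) (auto simp: less_imp_le)
        finally have e: "(\<Prod>i<length y. iv (\<beta> (y ! i))) = ennreal (\<Prod>i<length y. 1 / \<beta> (y ! i))" .
        show ?thesis unfolding a_def \<kappa>_def e ennreal_mult'[OF pn] by (simp only: mult_ac)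
      qed
      have "(\<Sum>y\<in>Z k. a k y * \<kappa> \<beta> k y u) = exp_weight (\<beta> (x k)) u * (\<Sum>y\<in>Z k. ennreal (path_weight W (x k) y (x (Suc k)) * (\<Prod>i<length y. 1 / \<beta> (y ! i))))"
        unfolding sum_distrib_left by (intro sum.cong refl ay)
      also have "(\<Sum>y\<in>Z k. ennreal (path_weight W (x k) y (x (Suc k)) * (\<Prod>i<length y. 1 / \<beta> (y ! i))))
         = ennreal (\<Sum>y\<in>Z k. path_weight W (x k) y (x (Suc k)) * (\<Prod>i<length y. 1 / \<beta> (y ! i)))"
      proof (rule sum_ennreal)
        fix y assume "y \<in> Z k"
        then have "\<beta> (y ! i) > 0" if "i < length y" for i using that by (intro bp) (auto simp: Z_def short_words_def)
        then show "0 \<le> path_weight W (x k) y (x (Suc k)) * (\<Prod>i<length y. 1 / \<beta> (y ! i))"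
          by (intro mult_nonneg_nonneg pn prod_nonneg) (auto simp: less_imp_le)
      qed
      also have "(\<Sum>y\<in>Z k. path_weight W (x k) y (x (Suc k)) * (\<Prod>i<length y. 1 / \<beta> (y ! i))) = exc W I \<beta> (x (Suc k)) M (x k)"
        unfolding Z_def by (rule sum_short_words[OF fin(2)])
      finally show ?thesis .
    qed
    have "(\<lambda>s. endpoint_weight s * times_weight \<beta> s) \<in> borel_measurable (LB n)"
      using measurable_compose[OF measurable_Pair1'[OF elim(2)] measurable_endpoint_times_weight] by simp
    from nn_integral_cmult[OF this, of "ennreal (\<Prod>k<n. exc W I \<beta> (x (Suc k)) M (x k))"]
    have "ennreal (\<Prod>k<n. exc W I \<beta> (x (Suc k)) M (x k)) * time_integral \<beta>
       = (\<integral>\<^sup>+s. ennreal (\<Prod>k<n. exc W I \<beta> (x (Suc k)) M (x k)) * (endpoint_weight s * times_weight \<beta> s) \<partial>LB n)"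
      unfolding time_integral_def by simp
    also have "\<dots> = (\<integral>\<^sup>+s. endpoint_weight s * (\<Prod>k<n. \<Sum>y\<in>Z k. a k y * \<kappa> \<beta> k y (s k)) \<partial>LB n)"
    proof (rule nn_integral_cong)
      fix u :: "nat \<Rightarrow> real"
      have "(\<Prod>k<n. \<Sum>y\<in>Z k. a k y * \<kappa> \<beta> k y (u k)) = times_weight \<beta> u * ennreal (\<Prod>k<n. exc W I \<beta> (x (Suc k)) M (x k))"
        unfolding s prod.distrib times_weight_def using en by (subst prod_ennreal) auto
      then show "ennreal (\<Prod>k<n. exc W I \<beta> (x (Suc k)) M (x k)) * (endpoint_weight u * times_weight \<beta> u) = endpoint_weight u * (\<Prod>k<n. \<Sum>y\<in>Z k. a k y * \<kappa> \<beta> k y (u k))"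
        by (simp only: mult_ac)
    qed
    finally show ?case .
  qed
  also have "\<dots> = (\<integral>\<^sup>+\<beta>. (\<Sum>z\<in>PiE {..<n} Z. \<integral>\<^sup>+t. f z \<beta> t \<partial>LB (blk_len z n)) \<partial>NU)"
    unfolding f_def
  proof (intro nn_integral_cong sum_words_integral[symmetric])
    fix \<beta> :: "'v \<Rightarrow> real"
    show "q \<beta> z l \<in> borel_measurable borel" for z l unfolding q_def by (rule expw_m)
    show "\<kappa> \<beta> k y \<in> borel_measurable borel" for k y
      using expw_m unfolding \<kappa>_def by (intro borel_measurable_times_ennreal borel_measurable_const) auto
    show "block_integral (blk_len z k) (Suc (length (z k))) (q \<beta> z) (V z k) (\<kappa> \<beta> k (z k))" for z k
    proof -
      have "V z k = (\<lambda>t. t (blk_len z k))" by (simp add: fun_eq_iff V_def)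
      moreover have "\<kappa> \<beta> k (z k) = (\<lambda>s. q \<beta> z (blk_len z k) s * (\<Prod>i<length (z k). \<integral>\<^sup>+u. q \<beta> z (blk_len z k + Suc i) u \<partial>lborel))"
      proof
        fix s
        have "iv (\<beta> (z k ! i)) = (\<integral>\<^sup>+u. q \<beta> z (blk_len z k + Suc i) u \<partial>lborel)" if "i < length (z k)" for i
          using that word_block[of "Suc i" z k x] by (simp add: q_def iv_def)
        then show "\<kappa> \<beta> k (z k) s = q \<beta> z (blk_len z k) s * (\<Prod>i<length (z k). \<integral>\<^sup>+u. q \<beta> z (blk_len z k + Suc i) u \<partial>lborel)"
          unfolding \<kappa>_def by (simp add: q_def)
      qed
      ultimately show ?thesis using block_integral_first[of "q \<beta> z" "blk_len z k" "length (z k)"] expw_m by (simp only: q_def)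
    qed
    show "V z k \<in> borel_measurable (LB M)" if "blk_len z (Suc k) \<le> M" for z k M by (rule Vm[OF that])
    show "V z k (restrict t {..<M}) = V z k t" if "blk_len z (Suc k) \<le> M" for z k M t by (rule Vr[OF that])
  qed (simp_all add: finZ endpoint_weight)
  also have "\<dots> = (\<Sum>z\<in>PiE {..<n} Z. \<integral>\<^sup>+\<beta>. (\<integral>\<^sup>+t. f z \<beta> t \<partial>LB (blk_len z n)) \<partial>NU)"
    by (rule nn_integral_sum) (rule measurable_NU_integral[OF fm])
  also have "\<dots> = (\<Sum>z\<in>PiE {..<n} Z. \<integral>\<^sup>+t. (\<integral>\<^sup>+\<beta>. f z \<beta> t \<partial>NU) \<partial>LB (blk_len z n))"
    by (intro sum.cong refl Fubini_NU[symmetric] fm)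
  also have "\<dots> = (\<Sum>z\<in>PiE {..<n} Z. \<integral>\<^sup>+t. indicator B (\<lambda>k\<in>{..<n}. V z k t) * ennreal (vrjp_fdd_density L W \<rho> (blk_len z n) (word x z) t) \<partial>LB (blk_len z n))"
  proof (intro sum.cong refl nn_integral_cong)
    fix z t assume z: "z \<in> PiE {..<n} Z" and t: "t \<in> space (LB (blk_len z n))"
    let ?N = "blk_len z n"
    let ?s = "\<lambda>k\<in>{..<n}. V z k t"
    let ?l = "loc_time (word x z) t ?N"
    have pn: "0 \<le> path_weight W b y d" for b y d by (rule path_weight_nonneg[where W = W]) (rule nn)
    have pa: "(\<Prod>k<n. a k (z k)) = ennreal (\<Prod>k<n. path_weight W (x k) (z k) (x (Suc k)))"
      unfolding a_def by (rule prod_ennreal) (rule pn)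
    have w0: "word x z 0 = \<rho>" using word_blk_len[of x z 0] x0 by simp
    \<comment> \<open>The end point lies in \<open>J\<close>, so its local time is that of the
      restricted path, while the Laplace transform keeps the local times on all of
      \<open>L\<close>.\<close>
    have fdd: "vrjp_fdd_density L W \<rho> ?N (word x z) t = (if \<forall>l<?N. t l > 0 then
        (\<Prod>k<n. path_weight W (x k) (z k) (x (Suc k))) * (sqrt (1 + loc_time x ?s n (x n)) * vrjp_weight W L ?l) else 0)"
      unfolding vrjp_fdd_density_eq[OF fin(1) sym] prod_word_weights word_blk_len lt[OF z xJ[OF order_refl]] using w0 wL[OF z]
      by (cases "\<forall>l<?N. t l > 0") (simp_all only: simp_thms if_True if_False, auto)
    show "(\<integral>\<^sup>+\<beta>. f z \<beta> t \<partial>NU) = indicator B ?s * ennreal (vrjp_fdd_density L W \<rho> ?N (word x z) t)"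
    proof (cases "\<forall>l<?N. t l > 0")
      case True
      have l: "?l v \<ge> 0" for v using True by (intro loc_time_nonneg) (auto simp: less_imp_le)
      have "(\<Prod>l<?N. q \<beta> z l (t l)) = ennreal (exp (- (\<Sum>v\<in>L. \<beta> v * ?l v)))" for \<beta>
      proof -
        have "(\<Prod>l<?N. q \<beta> z l (t l)) = (\<Prod>l<?N. ennreal (exp (- (\<beta> (word x z l) * t l))))"
          unfolding q_def exp_weight_def using True by (intro prod.cong) auto
        also have "\<dots> = ennreal (exp (\<Sum>l<?N. - (\<beta> (word x z l) * t l)))"
          by (subst prod_ennreal) (auto simp: exp_sum)
        also have "(\<Sum>l<?N. - (\<beta> (word x z l) * t l)) = - (\<Sum>v\<in>L. \<beta> v * ?l v)"
          using wL[OF z] by (subst sum_loc_time[OF fin(1)]) (auto simp: sum_negf)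
        finally show ?thesis .
      qed
      then have "(\<integral>\<^sup>+\<beta>. f z \<beta> t \<partial>NU) = (\<integral>\<^sup>+\<beta>. (\<Prod>k<n. a k (z k)) * endpoint_weight ?s * ennreal (exp (- (\<Sum>v\<in>L. \<beta> v * ?l v))) \<partial>NU)"
        unfolding f_def by simp
      also have "\<dots> = (\<Prod>k<n. a k (z k)) * endpoint_weight ?s * (\<integral>\<^sup>+\<beta>. ennreal (exp (- (\<Sum>v\<in>L. \<beta> v * ?l v))) \<partial>NU)"
        by (rule nn_integral_cmult)
           (intro measurable_compose[OF _ measurable_ennreal] measurable_compose[OF _ borel_measurable_exp] borel_measurable_uminus
             borel_measurable_sum borel_measurable_times borel_measurable_const measurable_NU_component)
      also have "(\<integral>\<^sup>+\<beta>. ennreal (exp (- (\<Sum>v\<in>L. \<beta> v * ?l v))) \<partial>NU) = ennreal (vrjp_weight W L ?l)"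
        by (rule nn_integral_nu_meas_laplace[OF fin(1) sym nn l])
      also have "(\<Prod>k<n. a k (z k)) * endpoint_weight ?s * ennreal (vrjp_weight W L ?l)
         = indicator B ?s * ennreal ((\<Prod>k<n. path_weight W (x k) (z k) (x (Suc k))) * (sqrt (1 + loc_time x ?s n (x n)) * vrjp_weight W L ?l))"
      proof -
        have p: "0 \<le> (\<Prod>k<n. path_weight W (x k) (z k) (x (Suc k)))" by (intro prod_nonneg) (simp add: pn)
        have s: "0 \<le> sqrt (1 + loc_time x ?s n (x n))"
          using l[of "x n"] lt[OF z xJ[OF order_refl], of t] by simp
        show ?thesis unfolding pa endpoint_weight_def ennreal_mult'[OF p] ennreal_mult'[OF s] by (simp only: mult_ac)
      qed
      finally show ?thesis unfolding fdd if_P[OF True] .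
    next
      case False
      then obtain l where "l < ?N" "\<not> t l > 0" by auto
      then have "(\<Prod>l<?N. q \<beta> z l (t l)) = 0" for \<beta> unfolding q_def exp_weight_def by (intro prod_zero bexI[of _ l]) auto
      then show ?thesis unfolding fdd if_not_P[OF False] f_def by (simp only: mult_zero_right nn_integral_const mult_zero_left ennreal_0)
    qed
  qed
  also have "\<dots> \<le> emeasure ?P cut_event"
  proof (rule cut_lower_bound[OF P, where Q = "\<lambda>a b. b \<in> J"])
    show "\<not> c \<in> J" if "y \<in> Z k" "c \<in> set y" for k y c using that L(2) by (auto simp: Z_def short_words_def)
    show "x (Suc k) \<in> J" if "k < n" for k using xJ[of "Suc k"] that by simp
    show "finite (Z k)" for k by (rule finZ)
    show "cut_event \<in> sets (seq_space L)" unfolding cut_event_def by (rule sets_cut_event[OF measurable_restr_J[OF fin(1)] B])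
    fix z \<omega> assume z: "z \<in> PiE {..<n} Z" and w: "\<omega> \<in> space (seq_space L)" and wd: "\<And>l. l \<le> blk_len z n \<Longrightarrow> fst (\<omega> l) = word x z l"
      and VB: "(\<lambda>k\<in>{..<n}. V z k (\<lambda>l. snd (\<omega> l))) \<in> B"
    have ci: "restr_idx J \<omega> k = blk_len z k" if "k \<le> n" for k
      unfolding restr_idx_eq
    proof (rule cut_idx_word[where n = n and x = x])
      show "\<not> c \<in> J" if "k < n" "c \<in> set (z k)" for k c using zI[OF z that(1)] that(2) L(2) by auto
      show "x (Suc k) \<in> J" if "k < n" for k using xJ[of "Suc k"] that by simp
    qed (use wd that in auto)
    have X: "fst (restr_J J \<omega> k) = x k" if "k \<le> n" for k
      using wd[of "blk_len z k"] blk_len_mono[OF that, of z] by (simp add: restr_J_def ci[OF that])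
    have T: "snd (restr_J J \<omega> k) = V z k (\<lambda>l. snd (\<omega> l))" if "k < n" for k
      using that by (simp add: restr_J_def ci V_def)
    show "\<omega> \<in> cut_event"
      unfolding cut_event_def using X T VB w by (auto cong: restrict_cong)
  next
    show "V z k \<in> borel_measurable (LB M)" if "blk_len z (Suc k) \<le> M" for z k M by (rule Vm[OF that])
    show "V z k (restrict t {..<M}) = V z k t" if "blk_len z (Suc k) \<le> M" for z k M t by (rule Vr[OF that])
  qed (rule B_LB)
  finally show ?thesis .
qed

text \<open>As \<open>M\<close> grows, the truncated excursion weights increase to
  \<open>WJ / 2\<close>, which turns the bounds for each \<open>M\<close> into one for the
  mixture.\<close>

lemma mixture_cylinder_le: "emeasure mixture (cylinder J n x B) \<le> emeasure (vrjp_law L W \<rho>) cut_event"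
proof -
  have G[measurable]: "Measurable.pred NU (\<lambda>\<beta>. pos_def_on I (Hmat W \<beta>))"
    using measurable_compose[OF measurable_NU_restrict pred_pos_def_I] by (simp add: pos_def_restrict)
  define e where "e M \<beta> = (\<Prod>k<n. exc W I \<beta> (x (Suc k)) M (x k))" for M \<beta>
  define u where "u M \<beta> = (if pos_def_on I (Hmat W \<beta>) then ennreal (e M \<beta>) * time_integral \<beta> else 0)" for M \<beta>
  define u' where "u' \<beta> = (if pos_def_on I (Hmat W \<beta>) then ennreal (\<Prod>k<n. WJ W I J \<beta> (x k) (x (Suc k)) / 2) * time_integral \<beta> else 0)" for \<beta>
  have "emeasure mixture (cylinder J n x B) = (\<integral>\<^sup>+\<beta>. u' \<beta> \<partial>NU)"
    unfolding mixture_cylinder_eq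
  proof (rule nn_integral_cong_AE, use AE_pos_def in eventually_elim)
    case (elim \<beta>)
    have "WJlim W I J (restrict \<beta> I) = WJ W I J \<beta>"
      using WJlim_eq[OF fin(2) sym nn, where \<beta> = "restrict \<beta> I" and J = J] elim by (simp only: pos_def_restrict WJ_restrict)
    then show ?case using elim by (simp only: u'_def if_True)
  qed
  also have "\<dots> \<le> emeasure (vrjp_law L W \<rho>) cut_event"
  proof (rule nn_integral_limit_le)
    fix M
    have em: "(\<lambda>\<beta>. ennreal (e M \<beta>)) \<in> borel_measurable NU"
      unfolding e_def measurable_cong_sets[OF sets_NU refl]
      using L by (intro measurable_compose[OF _ measurable_ennreal] borel_measurable_prod measurable_exc_superset) auto
    note [measurable] = em time_integral
    show "u M \<in> borel_measurable NU" unfolding u_def by measurable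
    have "(\<integral>\<^sup>+\<beta>. u M \<beta> \<partial>NU) = (\<integral>\<^sup>+\<beta>. ennreal (e M \<beta>) * time_integral \<beta> \<partial>NU)"
      by (rule nn_integral_cong_AE) (use AE_pos_def in \<open>auto simp: u_def elim!: eventually_mono\<close>)
    also have "\<dots> \<le> emeasure (vrjp_law L W \<rho>) cut_event" unfolding e_def by (rule restr_bound)
    finally show "(\<integral>\<^sup>+\<beta>. u M \<beta> \<partial>NU) \<le> emeasure (vrjp_law L W \<rho>) cut_event" .
  next
    fix \<beta> assume "\<beta> \<in> space NU"
    show "(\<lambda>M. u M \<beta>) \<longlonglongrightarrow> u' \<beta>"
    proof (cases "pos_def_on I (Hmat W \<beta>)")
      case pd: True
      have bp: "\<beta> i > 0" if "i \<in> I" for i by (rule pos_def_Hmat_diag[OF fin(2) pd nn that])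
      have en: "exc W I \<beta> j M k \<ge> 0" for j M k by (rule exc_nonneg[where W = W, OF nn bp])
      have em: "exc W I \<beta> j M k \<le> exc W I \<beta> j (Suc M) k" for j M k by (rule exc_mono[where W = W, OF nn bp])
      \<comment> \<open>\<open>time_integral \<beta>\<close> is not known to be finite, so
        multiplication by it need not be continuous; convergence of the product is obtained from
        monotonicity instead.\<close>
      have inc: "incseq (\<lambda>M. ennreal (e M \<beta>))"
        unfolding e_def by (intro incseq_SucI ennreal_leI prod_mono) (auto intro: en em simp del: exc.simps)
      have lim: "(\<lambda>M. ennreal (e M \<beta>)) \<longlonglongrightarrow> ennreal (\<Prod>k<n. WJ W I J \<beta> (x k) (x (Suc k)) / 2)"
        unfolding e_def by (intro tendsto_ennrealI tendsto_prod exc_limit_WJ[OF fin(2) sym nn pd]) (auto intro: xJ)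
      have sup: "(SUP M. ennreal (e M \<beta>)) = ennreal (\<Prod>k<n. WJ W I J \<beta> (x k) (x (Suc k)) / 2)"
        by (rule LIMSEQ_unique[OF LIMSEQ_SUP[OF inc] lim])
      have "incseq (\<lambda>M. ennreal (e M \<beta>) * time_integral \<beta>)" using inc by (auto simp: incseq_def intro: mult_right_mono)
      from LIMSEQ_SUP[OF this] show ?thesis
        unfolding u_def u'_def if_P[OF pd] SUP_mult_right_ennreal[symmetric] sup .
    qed (simp add: u_def u'_def)
  qed
  finally show ?thesis .
qed

end

text \<open>\<open>law_eqI_cut\<close> reduces the claim to the lower bound just proved; words that
  leave \<open>J\<close> or do not start at \<rho> have mass 0 under the mixture.\<close>

theorem restr_law:
  assumes A: "A \<in> sets (seq_space J)"
  shows "emeasure (vrjp_law L W \<rho>) (restr_J J -` A \<inter> space (seq_space L)) = (\<integral>\<^sup>+\<beta>. emeasure (vrjp_law J (WJ W I J \<beta>) \<rho>) A \<partial>NU)"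
  unfolding emeasure_mixture[OF A, symmetric]
proof (rule law_eqI_cut[OF fin(1) _ _ _ prob_mixture sets_mixture measurable_restr_J[OF fin(1)] _ A])
  have P: "is_vrjp_law L W \<rho> (vrjp_law L W \<rho>)" by (rule vrjp_data.is_vrjp_law[OF vrjp_data_L])
  then show "prob_space (vrjp_law L W \<rho>)" "sets (vrjp_law L W \<rho>) = sets (seq_space L)" by (auto simp: is_vrjp_law_def)
  show "J \<subseteq> L" using L by simp
  fix n :: nat and x :: "nat \<Rightarrow> 'v" and B :: "(nat \<Rightarrow> real) set" assume B: "B \<in> sets (PiM {..<n} (\<lambda>_. borel))"
  show "emeasure mixture (cylinder J n x B) \<le> emeasure (vrjp_law L W \<rho>)
     {\<omega> \<in> space (seq_space L). (\<forall>k\<le>n. fst (restr_J J \<omega> k) = x k) \<and> (\<lambda>k\<in>{..<n}. snd (restr_J J \<omega> k)) \<in> B}"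
  proof (cases "x 0 = \<rho> \<and> (\<forall>k\<le>n. x k \<in> J)")
    case True
    then have x: "x 0 = \<rho>" "\<And>k. k \<le> n \<Longrightarrow> x k \<in> J" by auto
    note ax = B x(1) x(2)
    have "emeasure mixture (cylinder J n x B) \<le> emeasure (vrjp_law L W \<rho>) (cut_event n x B)"
      by (rule mixture_cylinder_le) (use ax in blast)+
    moreover have "cut_event n x B = {\<omega> \<in> space (seq_space L). (\<forall>k\<le>n. fst (restr_J J \<omega> k) = x k) \<and> (\<lambda>k\<in>{..<n}. snd (restr_J J \<omega> k)) \<in> B}"
      by (rule cut_event_def) (use ax in blast)+
    ultimately show ?thesis by simp
  next
    case False
    then have "vrjp_fdd_density J V \<rho> n x s = 0" for V s by (auto simp: vrjp_fdd_density_def)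
    then show ?thesis unfolding mixture_cylinder[OF B] by simp
  qed
qed

text \<open>Self-loops are removed after the restriction and separately for each \<beta>:
  \<open>restr_law\<close> is applied to the preimage of the event under
  \<open>remove_loops\<close>, and \<open>remove_loops_law\<close> then to almost every law in the
  mixture.\<close>

theorem restr_remove_loops_law:
  assumes A: "A \<in> sets (seq_space J)"
  shows "emeasure (vrjp_law L W \<rho>) ((remove_loops \<circ> restr_J J) -` A \<inter> space (seq_space L))
    = (\<integral>\<^sup>+\<beta>. emeasure (vrjp_law J (WJne W I J \<beta>) \<rho>) A \<partial>NU)"
proof -
  let ?P = "vrjp_law L W \<rho>"
  have P: "is_vrjp_law L W \<rho> ?P" by (rule vrjp_data.is_vrjp_law[OF vrjp_data_L])
  interpret P: prob_space ?P using P by (simp add: is_vrjp_law_def)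
  have sP: "sets ?P = sets (seq_space L)" using P by (simp add: is_vrjp_law_def)
  have JL: "J \<subseteq> L" using L by simp
  \<comment> \<open>The preimage is cut down to \<open>seq_space J\<close>, since
    \<open>restr_law\<close> takes events of that space; the restricted path lies in it almost
    surely.\<close>
  let ?A' = "remove_loops -` A \<inter> space (seq_space J)"
  have A': "?A' \<in> sets (seq_space J)"
    by (rule measurable_sets[OF measurable_remove_loops[OF fin(3)] sets_seq_space_ext[OF fin(3) order_refl A]])
  have rm: "restr_J J -` D \<inter> space (seq_space L) \<in> sets ?P" if "D \<in> sets (seq_space J)" for D
    unfolding sP by (rule measurable_sets[OF measurable_restr_J[OF fin(1)] sets_seq_space_ext[OF fin(3) JL that]])
  have "emeasure ?P (restr_J J -` space (seq_space J) \<inter> space (seq_space L)) = emeasure mixture (space (seq_space J))"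
    by (simp add: restr_law emeasure_mixture)
  also have "\<dots> = 1"
    using prob_space.emeasure_space_1[OF prob_mixture] sets_eq_imp_space_eq[OF sets_mixture] by simp
  finally have "P.prob (restr_J J -` space (seq_space J) \<inter> space (seq_space L)) = 1"
    by (simp add: P.emeasure_eq_measure)
  then have AEJ: "AE \<omega> in ?P. restr_J J \<omega> \<in> space (seq_space J)"
    by (subst (asm) P.prob_eq_1) (auto intro: rm elim!: eventually_mono)
  have "emeasure ?P ((remove_loops \<circ> restr_J J) -` A \<inter> space (seq_space L)) = emeasure ?P (restr_J J -` ?A' \<inter> space (seq_space L))"
  proof (rule emeasure_eq_AE)
    show "AE \<omega> in ?P. (\<omega> \<in> (remove_loops \<circ> restr_J J) -` A \<inter> space (seq_space L)) = (\<omega> \<in> restr_J J -` ?A' \<inter> space (seq_space L))"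
      using AEJ by eventually_elim auto
    show "(remove_loops \<circ> restr_J J) -` A \<inter> space (seq_space L) \<in> sets ?P"
      unfolding sP by (rule measurable_sets[OF measurable_remove_loops_restr_J[OF fin(1)] sets_seq_space_ext[OF fin(3) JL A]])
    show "restr_J J -` ?A' \<inter> space (seq_space L) \<in> sets ?P" by (rule rm[OF A'])
  qed
  also have "\<dots> = (\<integral>\<^sup>+\<beta>. emeasure (vrjp_law J (WJ W I J \<beta>) \<rho>) ?A' \<partial>NU)" by (rule restr_law[OF A'])
  also have "\<dots> = (\<integral>\<^sup>+\<beta>. emeasure (vrjp_law J (WJne W I J \<beta>) \<rho>) A \<partial>NU)"
  proof (rule nn_integral_cong_AE, use AE_pos_def in eventually_elim)
    case (elim \<beta>)
    have ne: "(\<lambda>i j. if i \<noteq> j then WJ W I J \<beta> i j else 0) = WJne W I J \<beta>" by (simp add: WJne_def fun_eq_iff)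
    show ?case
      using remove_loops_law[OF vrjp_data_WJ(1)[OF elim] WJ_sym[OF fin(2) sym L(2) elim] _ A] vrjp_data_WJ(2)[OF elim]
      unfolding ne by simp
  qed
  finally show ?thesis .
qed

lemma What_WJ:
  assumes A: "A \<in> sets (seq_space J)"
  shows "(\<integral>\<^sup>+\<beta>. emeasure (vrjp_law J (WJ W I J \<beta>) \<rho>) A \<partial>nu_meas (What W I J \<rho>) (insert \<rho> I))
    = (\<integral>\<^sup>+\<beta>. emeasure (vrjp_law J (WJ W I J \<beta>) \<rho>) A \<partial>NU)"
  using nn_integral_What[OF kernel_measurable' A] unfolding WJ_restrict .

lemma What_WJne:
  assumes A: "A \<in> sets (seq_space J)"
  shows "(\<integral>\<^sup>+\<beta>. emeasure (vrjp_law J (WJne W I J \<beta>) \<rho>) A \<partial>nu_meas (What W I J \<rho>) (insert \<rho> I))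
    = (\<integral>\<^sup>+\<beta>. emeasure (vrjp_law J (WJne W I J \<beta>) \<rho>) A \<partial>NU)"
proof -
  have r: "WJne W I J (restrict \<beta> I) = WJne W I J \<beta>" for \<beta> by (simp only: WJne_def[abs_def] WJ_restrict)
  have "(\<lambda>x. vrjp_law J (WJne W I J x) \<rho>) \<in> measurable (restrict_space (PiM I (\<lambda>_. lborel)) pd_set) (prob_algebra (seq_space J))"
  proof (rule kernel_measurable)
    show "(\<lambda>x. if i \<noteq> j then WJlim W I J x i j else 0) \<in> borel_measurable (PiM I (\<lambda>_. lborel))" for i j
      using measurable_WJlim by (cases "i = j") auto
    fix x assume "x \<in> pd_set"
    then have pd: "pos_def_on I (Hmat W x)" by (simp add: pd_set_def)
    have "(\<lambda>i j. if i \<noteq> j then WJlim W I J x i j else 0) = WJne W I J x"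
      unfolding WJlim_eq[OF fin(2) sym nn pd] by (simp add: WJne_def fun_eq_iff)
    then show "is_vrjp_law J (\<lambda>i j. if i \<noteq> j then WJlim W I J x i j else 0) \<rho> (vrjp_law J (WJne W I J x) \<rho>)"
      using vrjp_data.is_vrjp_law[OF vrjp_data_WJ(2)[OF pd]] by simp
  qed
  from nn_integral_What[OF this A] show ?thesis unfolding r .
qed

end

theorem theorem1p2:
  fixes L I J :: "'v set" and W :: "'v \<Rightarrow> 'v \<Rightarrow> real" and \<rho> :: 'v
    and A :: "(nat \<Rightarrow> 'v \<times> real) set"
  assumes "connected_weights L W"
    and "L = I \<union> J" and "I \<inter> J = {}" and "card J \<ge> 2" and "\<rho> \<in> J"
    and "A \<in> sets (seq_space J)"
  shows "emeasure (vrjp_law L W \<rho>) ((remove_loops \<circ> restr_J J) -` A \<inter> space (seq_space L))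
           = (\<integral>\<^sup>+ \<beta>. emeasure (vrjp_law J (WJne W I J \<beta>) \<rho>) A \<partial>nu_meas (What W I J \<rho>) (insert \<rho> I))
       \<and> emeasure (vrjp_law L W \<rho>) ((remove_loops \<circ> restr_J J) -` A \<inter> space (seq_space L))
           = (\<integral>\<^sup>+ \<beta>. emeasure (vrjp_law J (WJne W I J \<beta>) \<rho>) A \<partial>nu_meas W L)
       \<and> emeasure (vrjp_law L W \<rho>) (restr_J J -` A \<inter> space (seq_space L))
           = (\<integral>\<^sup>+ \<beta>. emeasure (vrjp_law J (WJ W I J \<beta>) \<rho>) A \<partial>nu_meas (What W I J \<rho>) (insert \<rho> I))
       \<and> emeasure (vrjp_law L W \<rho>) (restr_J J -` A \<inter> space (seq_space L))
           = (\<integral>\<^sup>+ \<beta>. emeasure (vrjp_law J (WJ W I J \<beta>) \<rho>) A \<partial>nu_meas W L)"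
proof -
  interpret vrjp_restriction L I J W \<rho> by unfold_locales (use assms in auto)
  show ?thesis
    using restr_law restr_remove_loops_law What_WJ What_WJne assms(6) by simp
qed

end
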